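(* Let $\theta>0$, let $m,N\in\mathbb{N}$ with $1\le m\le N-1$, let $\nu\in\mathbb{GT}_N$ be any signature, and let $x_1,\dots,x_m,x$ be real numbers with $$1>x>x_m>\dots>x_2>x_1>0,\qquad x>\max_{i=1,\dots,m-1}(x_i/x_{i+1})$$ (the second condition being empty for $m=1$). Let $\mathcal{U}_x\subset\mathbb{R}^m$ be the compact set of $(w_1,\dots,w_m)$ with $1\ge w_1,\dots,w_m\ge0$ and $w_1\cdots w_m\ge x$. Put $w_{m+1}:=x/(w_1\cdots w_m)$, $x_{m+1}:=1$, and define $$G=(w_1^mw_2^{m-1}\cdots w_m)^{-\theta}\prod_{1\le i<j\le m}(1-x_ix_j^{-1}w_i)^{\theta-1}\prod_{1\le i<j\le m+1}(1-x_iw_ix_j^{-1}w_j^{-1})(1-x_ix_j^{-1}w_j^{-1})^{\theta-1}\prod_{1\le i<j\le m}(1-x_ix_j^{-1})^{1-2\theta},$$ $$F=(1-x)^{-1}\prod_{j=1}^m(1-x_j)^{-1}\prod_{i=1}^{m+1}(1-x_iw_i).$$ Then $$J_\nu(x_1,\dots,x_m;N,\theta)\,J_\nu(x;N,\theta)=\frac{\Gamma(N\theta)\,x^{m\theta}}{\Gamma((N-m)\theta)\,\Gamma(\theta)^m(1-x)^{m\theta}\prod_{i=1}^m(1-x_i)^\theta}\int\!\cdots\!\int_{\mathcal{U}_x}G\;F^{\,\theta(N-m)-1}\prod_{i=1}^m(1-w_i)^{\theta-1}\;J_\nu\!\left(x_1w_1,\dots,x_mw_m,\frac{x}{w_1\cdots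 w_m};N,\theta\right)\frac{dw_1}{w_1}\cdots\frac{dw_m}{w_m}.$$
   Context: $\mathbb{N}=\{1,2,\dots\}$. $\mathbb{GT}_N$ is the set of signatures of length $N$, i.e. integer sequences $\lambda=(\lambda_1\ge\dots\ge\lambda_N)$; $\mathbb{GT}^+_N$ is the subset with $\lambda_N\ge 0$; $|\lambda|=\sum_i\lambda_i$. Jack polynomials: for $\theta>0$ and $\lambda\in\mathbb{GT}_N^+$, $J_\lambda(x_1,\dots,x_N;\theta)$ is the Jack symmetric polynomial with Jack parameter $\alpha=1/\theta$, normalized so that the coefficient of $x_1^{\lambda_1}\cdots x_N^{\lambda_N}$ is $1$ (the limit $q\to1$, $t=q^\theta$, of Macdonald polynomials $P_\lambda(\cdot;q,t)$). Explicitly it is determined by $J_{(\lambda_1)}(x_1;\theta)=x_1^{\lambda_1}$ and the branching rule $J_\lambda(x_1,\dots,x_{N+1};\theta)=\sum_{\mu\prec\lambda}\psi_{\lambda/\mu}(\theta)\,x_{N+1}^{|\lambda|-|\mu|}J_\mu(x_1,\dots,x_N;\theta)$ for $\lambda\in\mathbb{GT}^+_{N+1}$, where the sum is over $\mu\in\mathbb{GT}^+_N$ with $\lambda_{N+1}\le\mu_N\le\lambda_N\le\dots\le\mu_1\le\lambda_1$, and, with $(a)_n=a(a+1)\cdots(a+n-1)$, $$\psi_{\lambda/\mu}(\theta)=\prod_{1\le i\le j\le N}\frac{(\mu_i-\mu_j+\theta(j-i)+\theta)_{\mu_j-\lambda_{j+1}}}{(\mu_i-\mu_j+\theta(j-i)+1)_{\mu_j-\lambda_{j+1}}}\cdot\frac{(\lambda_i-\mu_j+\theta(j-i)+1)_{\mu_j-\lambda_{j+1}}}{(\lambda_i-\mu_j+\theta(j-i)+\theta)_{\mu_j-\lambda_{j+1}}}.$$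 For general $\lambda\in\mathbb{GT}_N$, $J_\lambda(x_1,\dots,x_N;\theta)=(x_1\cdots x_N)^{-K}J_{(\lambda_1+K,\dots,\lambda_N+K)}(x_1,\dots,x_N;\theta)$ for any integer $K\ge0$ with $\lambda_N+K\ge0$ (independent of $K$). Jack characters: for $1\le m\le N$ and $\lambda\in\mathbb{GT}_N$, $J_\lambda(x_1,\dots,x_m;N,\theta)=J_\lambda(x_1,\dots,x_m,1^{N-m};\theta)/J_\lambda(1^N;\theta)$, where $1^k$ is a string of $k$ ones (the denominator is nonzero). *)

theory Defs
  imports "HOL-Analysis.Analysis"
begin

text \<open>
  Vectors and signatures of length \<open>n\<close> are functions on \<open>nat\<close> of which only the values at
  the indices \<open>1, \<dots>, n\<close> matter.
\<close>

definition signatures :: "nat \<Rightarrow> (nat \<Rightarrow> int) set" where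
  "signatures N = {\<nu>. antimono_on {1..N} \<nu>}"

definition sig_size :: "nat \<Rightarrow> (nat \<Rightarrow> int) \<Rightarrow> int" where
  "sig_size N \<nu> = (\<Sum>i = 1..N. \<nu> i)"

text \<open>
  The finite set of all \<open>\<mu>\<close> of length \<open>N\<close> interlacing with \<open>\<nu>\<close> of length \<open>N + 1\<close>, i.e.
  \<open>\<nu> (i + 1) \<le> \<mu> i \<le> \<nu> i\<close> for \<open>1 \<le> i \<le> N\<close>; extensionality makes each \<open>\<mu>\<close> occur only once.
\<close>

definition interlacing :: "nat \<Rightarrow> (nat \<Rightarrow> int) \<Rightarrow> (nat \<Rightarrow> int) set" where
  "interlacing N \<nu> = (\<Pi>\<^sub>E i\<in>{1..N}. {\<nu> (Suc i)..\<nu> i})"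

lemma finite_interlacing: "finite (interlacing N \<nu>)"
  unfolding interlacing_def by (intro finite_PiE) auto

definition jack_psi :: "real \<Rightarrow> nat \<Rightarrow> (nat \<Rightarrow> int) \<Rightarrow> (nat \<Rightarrow> int) \<Rightarrow> real" where
  "jack_psi \<theta> N \<nu> \<mu> =
    (\<Prod>i\<in>{1..N}. \<Prod>j\<in>{i..N}.
      pochhammer (of_int (\<mu> i - \<mu> j) + \<theta> * (real j - real i) + \<theta>) (nat (\<mu> j - \<nu> (Suc j))) /
      pochhammer (of_int (\<mu> i - \<mu> j) + \<theta> * (real j - real i) + 1) (nat (\<mu> j - \<nu> (Suc j))) *
      (pochhammer (of_int (\<nu> i - \<mu> j) + \<theta> * (real j - real i) + 1) (nat (\<mu> j - \<nu> (Suc j))) /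
       pochhammer (of_int (\<nu> i - \<mu> j) + \<theta> * (real j - real i) + \<theta>) (nat (\<mu> j - \<nu> (Suc j)))))"

text \<open>
  The value at \<open>(x 1, \<dots>, x N)\<close> of the Jack polynomial of a signature with nonnegative entries, in
  the normalisation with leading coefficient 1, given by the branching rule. The recursion starts
  from the empty signature; \<open>jack_nonneg_one\<close> below is the usual starting point.
\<close>

primrec jack_nonneg :: "real \<Rightarrow> nat \<Rightarrow> (nat \<Rightarrow> int) \<Rightarrow> (nat \<Rightarrow> real) \<Rightarrow> real" where
  "jack_nonneg \<theta> 0 \<nu> x = 1"
| "jack_nonneg \<theta> (Suc N) \<nu> x =
    (\<Sum>\<mu>\<in>interlacing N \<nu>.
      jack_psi \<theta> N \<nu> \<mu> * x (Suc N) ^ nat (sig_size (Suc N) \<nu> - sig_size N \<mu>) * jack_nonneg \<theta> N \<mu> x)"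

lemma jack_nonneg_one: "jack_nonneg \<theta> 1 \<nu> x = x 1 ^ nat (\<nu> 1)"
  by (simp add: interlacing_def jack_psi_def sig_size_def)

text \<open>
  For a general signature the entries are shifted by \<open>K\<close>, taken to be the least \<open>K \<ge> 0\<close> with
  \<open>\<nu> N + K \<ge> 0\<close>; every other admissible shift gives the same value if all \<open>x i\<close> are nonzero.
\<close>

definition jack :: "real \<Rightarrow> nat \<Rightarrow> (nat \<Rightarrow> int) \<Rightarrow> (nat \<Rightarrow> real) \<Rightarrow> real" where
  "jack \<theta> N \<nu> x =
    (let K = max 0 (- \<nu> N)
     in (\<Prod>i = 1..N. x i) powi (- K) * jack_nonneg \<theta> N (\<lambda>i. \<nu> i + K) x)"

definition jack_char :: "real \<Rightarrow> nat \<Rightarrow> (nat \<Rightarrow> int) \<Rightarrow> nat \<Rightarrow> (nat \<Rightarrow> real) \<Rightarrow> real" where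
  "jack_char \<theta> N \<nu> m x =
    jack \<theta> N \<nu> (\<lambda>i. if i \<le> m then x i else 1) / jack \<theta> N \<nu> (\<lambda>_. 1)"

text \<open>
  The domain of integration, as a set of points of the product measure space
  \<open>\<Pi>\<^sub>M i\<in>{1..m}. lborel\<close>, whose points are extensional functions on \<open>{1..m}\<close>.
\<close>

definition U_dom :: "nat \<Rightarrow> real \<Rightarrow> (nat \<Rightarrow> real) set" where
  "U_dom m x = {w \<in> {1..m} \<rightarrow>\<^sub>E {0..1}. (\<Prod>i = 1..m. w i) \<ge> x}"

definition w_ext :: "nat \<Rightarrow> real \<Rightarrow> (nat \<Rightarrow> real) \<Rightarrow> nat \<Rightarrow> real" where
  "w_ext m x w = w(Suc m := x / (\<Prod>i = 1..m. w i))"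

definition x_ext :: "nat \<Rightarrow> (nat \<Rightarrow> real) \<Rightarrow> nat \<Rightarrow> real" where
  "x_ext m xs = xs(Suc m := 1)"

text \<open>
  The real powers below have positive bases on \<open>U_dom m x\<close>, up to the null set where some
  \<open>w_ext m x w i\<close> equals 1; so the convention \<open>0 powr a = 0\<close> does not affect the integral.
\<close>

definition G_fun :: "real \<Rightarrow> nat \<Rightarrow> (nat \<Rightarrow> real) \<Rightarrow> real \<Rightarrow> (nat \<Rightarrow> real) \<Rightarrow> real" where
  "G_fun \<theta> m xs x w =
    (let X = x_ext m xs; W = w_ext m x w in
      (\<Prod>i = 1..m. W i ^ (Suc m - i)) powr (- \<theta>) *
      (\<Prod>i\<in>{1..m}. \<Prod>j\<in>{i<..m}. (1 - X i / X j * W i) powr (\<theta> - 1)) *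
      (\<Prod>i\<in>{1..Suc m}. \<Prod>j\<in>{i<..Suc m}.
        (1 - X i * W i / (X j * W j)) * (1 - X i / (X j * W j)) powr (\<theta> - 1)) *
      (\<Prod>i\<in>{1..m}. \<Prod>j\<in>{i<..m}. (1 - X i / X j) powr (1 - 2 * \<theta>)))"

definition F_fun :: "nat \<Rightarrow> (nat \<Rightarrow> real) \<Rightarrow> real \<Rightarrow> (nat \<Rightarrow> real) \<Rightarrow> real" where
  "F_fun m xs x w =
    inverse (1 - x) * (\<Prod>j = 1..m. inverse (1 - xs j)) *
    (\<Prod>i = 1..Suc m. 1 - x_ext m xs i * w_ext m x w i)"

end

theory Submission
  imports Defs "HOL-Computational_Algebra.Formal_Power_Series"
begin

text \<open>
  Read as an integral operator \<open>T\<close> acting on functions of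
  \<open>(x\<^sub>1 w\<^sub>1, \<dots>, x\<^sub>m w\<^sub>m, x / (w\<^sub>1 \<cdots> w\<^sub>m), 1, \<dots>, 1)\<close>, the formula says that the Jack
  polynomials are eigenfunctions of \<open>T\<close>. A change of variables turns its kernel into the Dirichlet density
  of the simplex coordinates \<open>p\<close> determined by
  \<open>\<Prod>\<^sub>j (z - x\<^sub>j w\<^sub>j) / (z - x\<^sub>j) = \<Sum>\<^sub>i p\<^sub>i (z - x x\<^sub>i) / (z - x\<^sub>i)\<close>.
  Hence \<open>T\<close> maps the Cauchy product \<open>\<Prod> (1 - t u\<^sub>i y\<^sub>j) powr -\<theta>\<close> with \<open>N - 1\<close> variables \<open>u\<close> to an
  integral of powers of linear forms. Writing these powers as Gamma integrals exchanges the roles of the two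
  sets of variables and exhibits the result as a mixture over \<open>x' \<in> (x, 1)\<close> of the operators of
  size \<open>N - 1\<close>, with nodes \<open>u\<close> and parameter \<open>x'\<close>, applied to the Cauchy product in \<open>u\<close>. By induction on \<open>N\<close>
  and the Cauchy identity, the coefficients of \<open>t\<close> give \<open>T J\<^sub>\<nu> = C\<^sub>\<nu> J\<^sub>\<nu>\<close> if \<open>\<nu> N = 0\<close>, with \<open>C\<^sub>\<nu>\<close> independent of
  \<open>m\<close>; the trivial case \<open>m = 0\<close> yields \<open>C\<^sub>\<nu>\<close>. A factor \<open>(x\<^sub>1 \<cdots> x\<^sub>N)\<^sup>k\<close> reduces every signature to this case.

  The Cauchy identity itself follows from formulas for the action of \<open>\<Sum> d/dx\<^sub>i\<close> and of \<open>\<Sum> x\<^sub>i\<^sup>2 d/dx\<^sub>i\<close> on Jack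
  polynomials: they are obtained from the branching rule by partial fractions, and they show that the difference of
  both sides is invariant under translation of \<open>u\<close>.
\<close>

section \<open>Partial fractions\<close>

text \<open>Taking exactly N - 1 variables u is what makes the exchange of variables possible. In
  the coordinates \<open>p i / p (m + 1)\<close> the Cauchy product with M variables leaves behind a
  power of one plus their sum, with exponent (M - N) \<theta>. For M = N - 1 this is one more linear
  form to the power -\<theta>, and all forms carry the same exponent, as the Gamma integrals
  require. The price is that only partitions with fewer than N nonzero rows occur.

  After the exchange the nodes enter only through the N numbers
  \<open>x\<^sub>1, ..., x\<^sub>m, 1, ..., 1\<close>, the node 1 being counted N - m times. So one
  formula serves every m, and for m = 0 the operator is the evaluation at (x, 1, ..., 1), which
  gives the eigenvalue without computing an integral.

  Kernel, Cauchy products and Jack polynomials are nonnegative at the points concerned, so the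
  integrals live in \<open>ennreal\<close>, and sums and integrals may be exchanged freely.
  Coefficients are compared for the nodes u only, hence the linear independence of Jack polynomials
  on an open cone.\<close>

lemma partial_fractions:
  fixes z s :: "'a => real"
  assumes "finite S" "inj_on z S" "w \<notin> z ` S"
  shows "(\<Prod>c\<in>S. 1 + e * s c / (w - z c)) =
    1 + e * (\<Sum>c\<in>S. s c / (w - z c) * (\<Prod>c'\<in>S - {c}. 1 + e * s c' / (z c - z c')))"
  using assms
proof (induction S arbitrary: w rule: finite_induct)
  case empty
  then show ?case by simp
next
  case (insert d S)
  define P where "P c = (\<Prod>c'\<in>S - {c}. 1 + e * s c' / (z c - z c'))" for c
  have inj: "inj_on z S" and wS: "w \<notin> z ` S" and wd: "w \<noteq> z d" and dS: "z d \<notin> z ` S"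
    using insert.prems insert.hyps by auto
  have Pd: "(\<Prod>c'\<in>insert d S - {c}. 1 + e * s c' / (z c - z c')) = P c * (1 + e * s d / (z c - z d))"
    if "c \<in> S" for c
  proof -
    have "insert d S - {c} = insert d (S - {c})" using that insert.hyps by auto
    then show ?thesis using insert.hyps by (simp add: P_def mult.commute)
  qed
  \<comment> \<open>The induction hypothesis at \<open>w = z d\<close> expands the product that
    appears as residue at the new pole.\<close>
  have PdS: "(\<Prod>c'\<in>S. 1 + e * s c' / (z d - z c')) = 1 + e * (\<Sum>c\<in>S. s c / (z d - z c) * P c)"
    using insert.IH[OF inj dS] insert.hyps by (simp add: P_def)
  have key: "s c / (w - z c) * P c * (1 + e * s d / (w - z d)) =
      s c / (w - z c) * (P c * (1 + e * s d / (z c - z d))) + s d / (w - z d) * (e * (s c / (z d - z c) * P c))"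
    if "c \<in> S" for c
  proof -
    have "w - z c \<noteq> 0" "w - z d \<noteq> 0" "z c - z d \<noteq> 0" "z d - z c \<noteq> 0"
      using that wS wd dS by (metis imageI right_minus_eq)+
    then have "1 / ((w - z c) * (w - z d)) = 1 / ((w - z c) * (z c - z d)) + 1 / ((w - z d) * (z d - z c))"
      by (simp add: divide_simps) (simp add: algebra_simps)
    then have "s c * P c * e * s d * (1 / ((w - z c) * (w - z d)))
       = s c * P c * e * s d * (1 / ((w - z c) * (z c - z d)) + 1 / ((w - z d) * (z d - z c)))"
      by (simp only:)
    then show ?thesis by (simp add: algebra_simps add_divide_distrib)
  qed
  have "(\<Prod>c\<in>insert d S. 1 + e * s c / (w - z c)) =
      (1 + e * (\<Sum>c\<in>S. s c / (w - z c) * P c)) * (1 + e * s d / (w - z d))"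
    using insert.IH[OF inj wS] insert.hyps by (simp add: P_def mult.commute)
  also have "\<dots> = 1 + e * s d / (w - z d) + e * (\<Sum>c\<in>S. s c / (w - z c) * P c * (1 + e * s d / (w - z d)))"
    by (simp only: sum_distrib_right[symmetric]) (simp add: algebra_simps)
  also have "\<dots> = 1 + e * s d / (w - z d) + e * (\<Sum>c\<in>S. s c / (w - z c) * (P c * (1 + e * s d / (z c - z d)))
      + s d / (w - z d) * (e * (s c / (z d - z c) * P c)))"
    by (simp only: key cong: sum.cong)
  also have "\<dots> = 1 + e * ((\<Sum>c\<in>S. s c / (w - z c) * (P c * (1 + e * s d / (z c - z d))))
      + s d / (w - z d) * (1 + e * (\<Sum>c\<in>S. s c / (z d - z c) * P c)))"
    by (simp only: sum.distrib sum_distrib_left[symmetric]) (simp add: algebra_simps)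
  also have "\<dots> = 1 + e * (\<Sum>c\<in>insert d S. s c / (w - z c) * (\<Prod>c'\<in>insert d S - {c}. 1 + e * s c' / (z c - z c')))"
    using insert.hyps by (simp add: PdS Pd cong: sum.cong)
  finally show ?case .
qed

text \<open>These are the coefficients of 1/w and 1/w^2 in the expansion of
  \<open>partial_fractions\<close> at infinity, divided by \<open>e\<close>. They are applied with
  \<open>e = th - 1\<close>, which vanishes for \<open>th = 1\<close>; the induction never divides
  by \<open>e\<close> and so includes this case.\<close>

lemma residue_sums:
  fixes z s :: "'a => real"
  assumes "finite S" "inj_on z S"
  shows "(\<Sum>c\<in>S. s c * (\<Prod>c'\<in>S - {c}. 1 + e * s c' / (z c - z c'))) = (\<Sum>c\<in>S. s c)"
    and "(\<Sum>c\<in>S. s c * z c * (\<Prod>c'\<in>S - {c}. 1 + e * s c' / (z c - z c'))) =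
      (\<Sum>c\<in>S. s c * z c) + e * ((\<Sum>c\<in>S. s c)\<^sup>2 - (\<Sum>c\<in>S. (s c)\<^sup>2)) / 2"
  using assms
proof (induction S rule: finite_induct)
  case empty
  { case 1 show ?case by simp next case 2 show ?case by simp }
next
  case (insert d S)
  define P where "P c = (\<Prod>c'\<in>S - {c}. 1 + e * s c' / (z c - z c'))" for c
  have Pd: "(\<Prod>c'\<in>insert d S - {c}. 1 + e * s c' / (z c - z c')) = P c * (1 + e * s d / (z c - z d))"
    if "c \<in> S" for c
  proof -
    have "insert d S - {c} = insert d (S - {c})" using that insert.hyps by auto
    then show ?thesis using insert.hyps by (simp add: P_def mult.commute)
  qed
  have *: "inj_on z S \<and> z d \<notin> z ` S" if "inj_on z (insert d S)"
    using that insert.hyps by auto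
  have PdS: "(\<Prod>c'\<in>S. 1 + e * s c' / (z d - z c')) = 1 + e * (\<Sum>c\<in>S. s c / (z d - z c) * P c)"
    if "inj_on z (insert d S)"
    using partial_fractions[of S z "z d" e s] * that insert.hyps by (simp add: P_def)
  { case 1
    have neg: "s c * (P c * (1 + e * s d / (z c - z d))) = s c * P c - s d * (e * (s c / (z d - z c) * P c))" for c
      by (simp add: divide_simps) (simp add: algebra_simps)
    have "(\<Sum>c\<in>insert d S. s c * (\<Prod>c'\<in>insert d S - {c}. 1 + e * s c' / (z c - z c')))
       = s d * (1 + e * (\<Sum>c\<in>S. s c / (z d - z c) * P c)) + (\<Sum>c\<in>S. s c * (P c * (1 + e * s d / (z c - z d))))"
      using insert.hyps by (simp add: PdS[OF 1] Pd cong: sum.cong)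
    also have "\<dots> = s d + (\<Sum>c\<in>S. s c * P c)"
      unfolding neg by (simp only: sum_subtractf sum_distrib_left[symmetric]) (simp add: algebra_simps)
    also have "(\<Sum>c\<in>S. s c * P c) = sum s S"
      using insert.IH(1) * 1 by (simp add: P_def)
    finally show ?case using insert.hyps by simp
  next
    case 2
    have T0: "(\<Sum>c\<in>S. s c * P c) = sum s S"
      using insert.IH(1) * 2 by (simp add: P_def)
    have T1: "(\<Sum>c\<in>S. s c * z c * P c) = (\<Sum>c\<in>S. s c * z c) + e * ((\<Sum>c\<in>S. s c)\<^sup>2 - (\<Sum>c\<in>S. (s c)\<^sup>2)) / 2"
      using insert.IH(2) * 2 by (simp add: P_def)
    have neg: "s c * z c * (P c * (1 + e * s d / (z c - z d))) =
       s c * z c * P c + e * s d * (s c * P c) - s d * z d * (e * (s c / (z d - z c) * P c))" if "c \<in> S" for c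
    proof -
      have "z c \<noteq> z d" using * 2 that by (metis imageI)
      then have "z c / (z c - z d) = 1 + z d / (z c - z d)" by (simp add: divide_simps)
      then have "e * s d * s c * P c * (z c / (z c - z d)) = e * s d * s c * P c * (1 + z d / (z c - z d))" by simp
      moreover have "s c / (z d - z c) = - (s c / (z c - z d))" by (metis minus_diff_eq divide_minus_right)
      ultimately show ?thesis by (simp add: algebra_simps)
    qed
    have "(\<Sum>c\<in>insert d S. s c * z c * (\<Prod>c'\<in>insert d S - {c}. 1 + e * s c' / (z c - z c')))
       = s d * z d * (1 + e * (\<Sum>c\<in>S. s c / (z d - z c) * P c)) + (\<Sum>c\<in>S. s c * z c * (P c * (1 + e * s d / (z c - z d))))"
      using insert.hyps by (simp add: PdS[OF 2] Pd cong: sum.cong)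
    also have "(\<Sum>c\<in>S. s c * z c * (P c * (1 + e * s d / (z c - z d)))) =
       (\<Sum>c\<in>S. s c * z c * P c + e * s d * (s c * P c) - s d * z d * (e * (s c / (z d - z c) * P c)))"
      by (rule sum.cong[OF refl neg])
    also have "s d * z d * (1 + e * (\<Sum>c\<in>S. s c / (z d - z c) * P c)) + \<dots> =
       s d * z d + (\<Sum>c\<in>S. s c * z c * P c) + e * s d * (\<Sum>c\<in>S. s c * P c)"
      by (simp only: sum_subtractf sum.distrib sum_distrib_left[symmetric]) (simp add: algebra_simps)
    finally show ?case using insert.hyps unfolding T0 T1
      by (simp add: power2_eq_square algebra_simps diff_divide_distrib add_divide_distrib)
  }
qed

section \<open>The branching coefficients in terms of Gamma functions\<close>

text \<open>Quotients of Pochhammer symbols become quotients of two values of this function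
  (\<open>pochhammer_gratio\<close>), so the branching coefficient turns into a product over pairs
  of rows.\<close>

definition gratio :: "real => real => real" where
  "gratio th z = Gamma (z + th) / Gamma (z + 1)"

lemma gratio_pos: "th > 0 ==> z \<ge> 0 ==> gratio th z > 0"
  by (simp add: gratio_def Gamma_real_pos)

lemma gratio_step:
  assumes "th > 0" "z \<ge> 0"
  shows "gratio th (z + 1) = gratio th z * ((z + th) / (z + 1))"
proof -
  have "Gamma (z + 1 + 1) = (z + 1) * Gamma (z + 1)"
    using assms by (intro Gamma_plus1) (auto elim!: nonpos_Ints_cases)
  moreover have "Gamma (z + th + 1) = (z + th) * Gamma (z + th)"
    using assms by (intro Gamma_plus1) (auto elim!: nonpos_Ints_cases)
  ultimately show ?thesis by (simp add: gratio_def algebra_simps)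
qed

lemma pochhammer_gratio:
  assumes "th > 0" "z \<ge> 0"
  shows "pochhammer (z + th) n / pochhammer (z + 1) n = gratio th (z + real n) / gratio th z"
proof -
  have "z + th \<notin> \<int>\<^sub>\<le>\<^sub>0" "z + 1 \<notin> \<int>\<^sub>\<le>\<^sub>0" using assms by (auto elim!: nonpos_Ints_cases)
  then have "pochhammer (z + th) n = Gamma (z + th + real n) / Gamma (z + th)"
    "pochhammer (z + 1) n = Gamma (z + 1 + real n) / Gamma (z + 1)"
    by (simp_all add: pochhammer_Gamma)
  then show ?thesis by (simp add: gratio_def add_ac)
qed

text \<open>In these coordinates a change of one row by one multiplies every weight below by a
  rational function of differences. For a weakly decreasing \<open>nu\<close>, different rows are at
  least \<open>th\<close> apart (\<open>shifted_gap\<close>), so no denominator of the form L i - L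
  b vanishes.\<close>

definition shifted :: "real => (nat => int) => nat => real" where
  "shifted th nu i = of_int (nu i) - th * real i"

text \<open>\<open>cweight\<close>, \<open>bweight\<close> and \<open>aweight\<close> separate the
  branching coefficient into a part for \<open>nu\<close>, a part for \<open>mu\<close> and a mixed
  part. The arguments in \<open>cweight\<close> are those of \<open>bweight\<close> diminished by
  \<open>th\<close>.\<close>

definition cweight :: "real => nat => (nat => int) => real" where
  "cweight th n nu = (\<Prod>i\<in>{1..n}. \<Prod>b\<in>{i<..n}. gratio th (of_int (nu i - nu b) + th * (real b - 1 - real i)))"

definition bweight :: "real => nat => (nat => int) => real" where
  "bweight th n nu = (\<Prod>i\<in>{1..n}. \<Prod>b\<in>{i<..n}. gratio th (of_int (nu i - nu b) + th * (real b - real i)))"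

text \<open>For interlacing sequences \<open>n = mu j - nu a\<close> is at most 0 if
  \<open>a \<le> j\<close> and at least 0 otherwise, so in both branches the argument of
  \<open>gratio\<close> is nonnegative. The branches are matched such that a unit step of
  \<open>n\<close> produces the same rational factor in either one
  (\<open>cross_step\<close>).\<close>

definition cross :: "real => nat => nat => int => real" where
  "cross th a j n = (if a \<le> j then gratio th (- of_int n + th * (real j - real a))
     else gratio th (of_int n + th * (real a - 1 - real j)))"

definition aweight :: "real => nat => (nat => int) => (nat => int) => real" where
  "aweight th N nu mu = (\<Prod>j\<in>{1..N}. \<Prod>a\<in>{1..Suc N}. cross th a j (mu j - nu a))"

lemma prod_triangle_swap:
  fixes f :: "nat => nat => real"
  shows "(\<Prod>j\<in>{1..N}. \<Prod>a\<in>{1..j}. f a j) = (\<Prod>a\<in>{1..N}. \<Prod>j\<in>{a..N}. f a j)"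
proof -
  have "(\<Prod>j\<in>{1..N}. \<Prod>a\<in>{1..j}. f a j) = (\<Prod>j\<in>{1..N}. \<Prod>a\<in>{a \<in> {1..N}. a \<le> j}. f a j)"
    by (intro prod.cong) auto
  also have "\<dots> = (\<Prod>a\<in>{1..N}. \<Prod>j\<in>{j \<in> {1..N}. a \<le> j}. f a j)"
    by (rule prod.swap_restrict) auto
  also have "\<dots> = (\<Prod>a\<in>{1..N}. \<Prod>j\<in>{a..N}. f a j)"
    by (intro prod.cong) auto
  finally show ?thesis .
qed

lemma antimono_onD2: "antimono_on {1..n} (nu :: nat => int) ==> 1 \<le> i ==> i \<le> j ==> j \<le> n ==> nu j \<le> nu i"
  by (auto simp: monotone_on_def)

lemma interlacing_bounds:
  assumes "mu \<in> interlacing N nu" "1 \<le> j" "j \<le> N"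
  shows "nu (Suc j) \<le> mu j" "mu j \<le> nu j"
  using assms by (auto simp: interlacing_def PiE_iff)

lemma interlacing_antimono:
  assumes "mu \<in> interlacing N nu" "antimono_on {1..Suc N} nu"
  shows "antimono_on {1..N} mu"
proof (rule monotone_onI)
  fix i j assume ij: "i \<in> {1..N}" "j \<in> {1..N}" "i \<le> j"
  show "mu j \<le> mu i"
  proof (cases "i = j")
    case False
    have "mu j \<le> nu j" using interlacing_bounds[OF assms(1)] ij by auto
    also have "nu j \<le> nu (Suc i)" using antimono_onD2[OF assms(2), of "Suc i" j] ij False by auto
    also have "\<dots> \<le> mu i" using interlacing_bounds[OF assms(1)] ij by auto
    finally show ?thesis .
  qed simp
qed

text \<open>Each of the two Pochhammer quotients is a quotient of two values of
  \<open>gratio\<close>, which leaves four products over the triangle i \<le> j. The two mixed ones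
  combine to \<open>aweight\<close>, and the diagonal of the one in \<open>mu\<close> alone gives
  \<open>gratio th 0 ^ N\<close>.\<close>

lemma jack_psi_gratio:
  assumes "th > 0" and sig: "antimono_on {1..Suc N} nu" and int: "mu \<in> interlacing N nu"
  shows "jack_psi th N nu mu = aweight th N nu mu / (gratio th 0 ^ N * bweight th N mu * cweight th (Suc N) nu)"
proof -
  define g where "g i j z = gratio th (of_int z + th * (real j - real i))" for i j z
  have am: "antimono_on {1..N} mu" by (rule interlacing_antimono[OF int sig])
  have "jack_psi th N nu mu = (\<Prod>i\<in>{1..N}. \<Prod>j\<in>{i..N}.
      g i j (mu i - nu (Suc j)) * g i j (nu i - mu j) / (g i j (mu i - mu j) * g i j (nu i - nu (Suc j))))"
    unfolding jack_psi_def
  proof (intro prod.cong refl)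
    fix i j assume ij: "i \<in> {1..N}" "j \<in> {i..N}"
    define n where "n = nat (mu j - nu (Suc j))"
    have n: "of_int (mu j - nu (Suc j)) = real n" using interlacing_bounds[OF int, of j] ij by (simp add: n_def)
    define z1 where "z1 = of_int (mu i - mu j) + th * (real j - real i)"
    define z2 where "z2 = of_int (nu i - mu j) + th * (real j - real i)"
    have "mu j \<le> mu i" using antimono_onD2[OF am, of i j] ij by auto
    moreover have "mu i \<le> nu i" using interlacing_bounds[OF int, of i] ij by auto
    ultimately have z: "z1 \<ge> 0" "z2 \<ge> 0" using ij assms(1) by (auto simp: z1_def z2_def)
    have e: "of_int (mu i - nu (Suc j)) + th * (real j - real i) = z1 + real n"
      "of_int (nu i - nu (Suc j)) + th * (real j - real i) = z2 + real n"
      using n by (simp_all add: z1_def z2_def)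
    have "pochhammer (z2 + 1) n / pochhammer (z2 + th) n = gratio th z2 / gratio th (z2 + real n)"
      using pochhammer_gratio[OF assms(1) z(2), of n] by (metis inverse_divide)
    then show "pochhammer (of_int (mu i - mu j) + th * (real j - real i) + th) (nat (mu j - nu (Suc j))) /
      pochhammer (of_int (mu i - mu j) + th * (real j - real i) + 1) (nat (mu j - nu (Suc j))) *
      (pochhammer (of_int (nu i - mu j) + th * (real j - real i) + 1) (nat (mu j - nu (Suc j))) /
       pochhammer (of_int (nu i - mu j) + th * (real j - real i) + th) (nat (mu j - nu (Suc j)))) =
      g i j (mu i - nu (Suc j)) * g i j (nu i - mu j) / (g i j (mu i - mu j) * g i j (nu i - nu (Suc j)))"
      using pochhammer_gratio[OF assms(1) z(1), of n]
      by (simp only: g_def e n_def[symmetric] z1_def[symmetric] z2_def[symmetric] times_divide_times_eq)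
  qed
  also have "\<dots> = (\<Prod>i\<in>{1..N}. \<Prod>j\<in>{i..N}. g i j (mu i - nu (Suc j))) * (\<Prod>i\<in>{1..N}. \<Prod>j\<in>{i..N}. g i j (nu i - mu j)) /
      ((\<Prod>i\<in>{1..N}. \<Prod>j\<in>{i..N}. g i j (mu i - mu j)) * (\<Prod>i\<in>{1..N}. \<Prod>j\<in>{i..N}. g i j (nu i - nu (Suc j))))"
    by (simp only: prod.distrib prod_dividef)
  also have "(\<Prod>i\<in>{1..N}. \<Prod>j\<in>{i..N}. g i j (mu i - mu j)) = gratio th 0 ^ N * bweight th N mu"
  proof -
    have "(\<Prod>j\<in>{i..N}. g i j (mu i - mu j)) = gratio th 0 * (\<Prod>j\<in>{i<..N}. g i j (mu i - mu j))"
      if "i \<in> {1..N}" for i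
    proof -
      have "{i..N} = insert i {i<..N}" using that by auto
      then show ?thesis by (simp add: g_def)
    qed
    then show ?thesis by (simp add: prod.distrib bweight_def g_def)
  qed
  \<comment> \<open>Off by one: with b = j + 1 running over the rows of \<open>nu\<close> below i,
    the difference j - i is b - 1 - i, as in \<open>cweight\<close>.\<close>
  also have "(\<Prod>i\<in>{1..N}. \<Prod>j\<in>{i..N}. g i j (nu i - nu (Suc j))) = cweight th (Suc N) nu"
  proof -
    have "(\<Prod>j\<in>{i..N}. g i j (nu i - nu (Suc j))) =
       (\<Prod>b\<in>{i<..Suc N}. gratio th (of_int (nu i - nu b) + th * (real b - 1 - real i)))" for i
      by (rule prod.reindex_bij_witness[of _ "\<lambda>b. b - 1" Suc]) (auto simp: g_def of_nat_diff)
    then show ?thesis by (simp add: cweight_def)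
  qed
  also have "(\<Prod>i\<in>{1..N}. \<Prod>j\<in>{i..N}. g i j (mu i - nu (Suc j))) * (\<Prod>i\<in>{1..N}. \<Prod>j\<in>{i..N}. g i j (nu i - mu j))
     = aweight th N nu mu"
  proof -
    have "(\<Prod>a\<in>{1..Suc N}. cross th a j (mu j - nu a)) =
       (\<Prod>a\<in>{1..j}. g a j (nu a - mu j)) * (\<Prod>b\<in>{j..N}. g j b (mu j - nu (Suc b)))" if "j \<in> {1..N}" for j
    proof -
      have "{1..Suc N} = {1..j} \<union> {j<..Suc N}" using that by auto
      then have "(\<Prod>a\<in>{1..Suc N}. cross th a j (mu j - nu a)) =
         (\<Prod>a\<in>{1..j}. cross th a j (mu j - nu a)) * (\<Prod>a\<in>{j<..Suc N}. cross th a j (mu j - nu a))"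
        by (simp only:) (rule prod.union_disjoint, auto)
      moreover have "(\<Prod>a\<in>{j<..Suc N}. cross th a j (mu j - nu a)) = (\<Prod>b\<in>{j..N}. g j b (mu j - nu (Suc b)))"
        by (rule prod.reindex_bij_witness[of _ Suc "\<lambda>b. b - 1"]) (auto simp: g_def cross_def of_nat_diff)
      moreover have "(\<Prod>a\<in>{1..j}. cross th a j (mu j - nu a)) = (\<Prod>a\<in>{1..j}. g a j (nu a - mu j))"
        by (rule prod.cong) (auto simp: g_def cross_def)
      ultimately show ?thesis by simp
    qed
    then have "aweight th N nu mu = (\<Prod>j\<in>{1..N}. (\<Prod>a\<in>{1..j}. g a j (nu a - mu j)) * (\<Prod>b\<in>{j..N}. g j b (mu j - nu (Suc b))))"
      unfolding aweight_def by (intro prod.cong) auto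
    also have "\<dots> = (\<Prod>j\<in>{1..N}. \<Prod>a\<in>{1..j}. g a j (nu a - mu j)) * (\<Prod>j\<in>{1..N}. \<Prod>b\<in>{j..N}. g j b (mu j - nu (Suc b)))"
      by (simp only: prod.distrib)
    finally show ?thesis by (simp only: prod_triangle_swap mult.commute)
  qed
  finally show ?thesis .
qed

section \<open>Change of the weights when one row changes by one\<close>

lemma prod_change_one:
  fixes f g :: "'a => real"
  assumes "finite A" "a \<in> A" "\<And>x. x \<in> A ==> x \<noteq> a ==> g x = f x" "g a = f a * r"
  shows "prod g A = prod f A * r"
proof -
  have "prod g (A - {a}) = prod f (A - {a})" using assms(3) by (intro prod.cong) auto
  then show ?thesis using assms by (simp add: prod.remove[of A a])
qed

text \<open>When row \<open>k\<close> changes, only the pairs that contain \<open>k\<close> are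
  affected. The factor is \<open>r\<close> of the partner whether the partner lies above or below
  \<open>k\<close>, so the total change is a single product over the other rows.\<close>

lemma pair_prod_change:
  fixes F G :: "nat => nat => real"
  assumes "k \<in> {1..n}"
    and "\<And>i b. 1 \<le> i ==> i < b ==> b \<le> n ==> G i b = F i b * (if i = k then r b else if b = k then r i else 1)"
  shows "(\<Prod>i\<in>{1..n}. \<Prod>b\<in>{i<..n}. G i b) = (\<Prod>i\<in>{1..n}. \<Prod>b\<in>{i<..n}. F i b) * (\<Prod>b\<in>{1..n} - {k}. r b)"
proof -
  have "(\<Prod>i\<in>{1..n}. \<Prod>b\<in>{i<..n}. G i b) =
      (\<Prod>i\<in>{1..n}. \<Prod>b\<in>{i<..n}. F i b * (if i = k then r b else if b = k then r i else 1))"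
    by (intro prod.cong refl assms(2)) auto
  also have "\<dots> = (\<Prod>i\<in>{1..n}. \<Prod>b\<in>{i<..n}. F i b) *
      (\<Prod>i\<in>{1..n}. \<Prod>b\<in>{i<..n}. if i = k then r b else if b = k then r i else 1)"
    by (simp only: prod.distrib)
  also have "(\<Prod>i\<in>{1..n}. \<Prod>b\<in>{i<..n}. if i = k then r b else if b = k then r i else 1) =
      (\<Prod>i\<in>{1..n}. if i = k then (\<Prod>b\<in>{k<..n}. r b) else if i < k then r i else 1)"
  proof (intro prod.cong refl)
    fix i assume "i \<in> {1..n}"
    show "(\<Prod>b\<in>{i<..n}. if i = k then r b else if b = k then r i else 1) =
        (if i = k then (\<Prod>b\<in>{k<..n}. r b) else if i < k then r i else 1)"
    proof (cases "i = k")
      case False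
      then show ?thesis using assms(1) by (simp add: prod.delta)
    qed simp
  qed
  also have "\<dots> = (\<Prod>b\<in>{k<..n}. r b) * (\<Prod>i\<in>{1..n} - {k}. if i < k then r i else 1)"
    using assms(1) by (subst prod.remove[of _ k]) (auto intro!: prod.cong)
  also have "(\<Prod>i\<in>{1..n} - {k}. if i < k then r i else 1) = (\<Prod>i\<in>{1..<k}. r i)"
    using assms(1) by (intro prod.mono_neutral_cong_right) auto
  also have "(\<Prod>b\<in>{k<..n}. r b) * (\<Prod>i\<in>{1..<k}. r i) = (\<Prod>b\<in>{k<..n} \<union> {1..<k}. r b)"
    by (rule prod.union_disjoint[symmetric]) auto
  also have "{k<..n} \<union> {1..<k} = {1..n} - {k}" using assms(1) by auto
  finally show ?thesis .
qed

lemma cross_pos: "th > 0 ==> (a \<le> j \<and> n \<le> 0) \<or> (j < a \<and> 0 \<le> n) ==> cross th a j n > 0"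
proof (cases "a \<le> j")
  case True
  assume *: "th > 0" "(a \<le> j \<and> n \<le> 0) \<or> (j < a \<and> 0 \<le> n)"
  then have "th * (real j - real a) \<ge> 0" "real_of_int n \<le> 0" using True by auto
  then have "0 \<le> - real_of_int n + th * (real j - real a)" by linarith
  then show ?thesis using True gratio_pos[OF *(1)] by (simp only: cross_def if_True)
next
  case False
  assume *: "th > 0" "(a \<le> j \<and> n \<le> 0) \<or> (j < a \<and> 0 \<le> n)"
  then show ?thesis using False by (auto simp: cross_def intro!: gratio_pos add_nonneg_nonneg)
qed

text \<open>For \<open>a \<le> j\<close> the argument of \<open>gratio\<close> decreases as
  \<open>n\<close> grows, so \<open>gratio_step\<close> is inverted; changing the signs of numerator
  and denominator then gives the form of the other branch. With \<open>n = mu j - nu a\<close> the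
  factor depends on \<open>shifted th mu j - shifted th nu a\<close> only.\<close>

lemma cross_step:
  assumes "th > 0" "(a \<le> j \<and> n < 0) \<or> (j < a \<and> 0 \<le> n)"
  shows "cross th a j (n + 1) = cross th a j n *
    ((of_int n + th * (real a - real j)) / (of_int n + th * (real a - real j) - th + 1))"
proof (cases "a \<le> j")
  case True
  define y where "y = - of_int (n + 1) + th * (real j - real a)"
  have n: "real_of_int n \<le> -1" using assms True by linarith
  have y: "y \<ge> 0" using n True assms(1) by (simp add: y_def)
  have "gratio th (y + 1) = gratio th y * ((y + th) / (y + 1))" by (rule gratio_step[OF assms(1) y])
  then have "gratio th y = gratio th (y + 1) * ((y + 1) / (y + th))"
    using y assms(1) by (simp add: field_simps)
  moreover have "(y + 1) / (y + th) = (- (y + 1)) / (- (y + th))" by (simp only: minus_divide_divide)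
  moreover have "- (y + 1) = of_int n + th * (real a - real j)" "- (y + th) = of_int n + th * (real a - real j) - th + 1"
    by (simp_all add: y_def algebra_simps)
  moreover have "cross th a j (n + 1) = gratio th y" "cross th a j n = gratio th (y + 1)"
    using True by (simp_all add: cross_def y_def)
  ultimately show ?thesis by metis
next
  case False
  then have z: "of_int n + th * (real a - 1 - real j) \<ge> 0" using assms by auto
  show ?thesis using gratio_step[OF assms(1) z] False
    by (simp add: cross_def algebra_simps)
qed

lemma cross_denom_nz:
  assumes "th > 0" "(a \<le> j \<and> n < 0) \<or> (j < a \<and> 0 \<le> n)"
  shows "of_int n + th * (real a - real j) - th + 1 \<noteq> 0"
proof (cases "a \<le> j")
  case True
  then have n: "real_of_int n \<le> -1" using assms by linarith
  have "th * (real a - real j) \<le> 0" using True assms by (simp add: mult_nonneg_nonpos)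
  then show ?thesis using n assms(1) by linarith
next
  case False
  then have "th * (real a - real j) \<ge> th * 1" using assms by (intro mult_left_mono) auto
  moreover have "real_of_int n \<ge> 0" using False assms by auto
  ultimately show ?thesis by linarith
qed

definition is_partition :: "nat => (nat => int) => bool" where
  "is_partition n nu \<longleftrightarrow> antimono_on {1..n} nu \<and> (\<forall>i\<in>{1..n}. 0 \<le> nu i)"

definition removable :: "nat => (nat => int) => nat set" where
  "removable n nu = {i \<in> {1..n}. is_partition n (nu(i := nu i - 1))}"

text \<open>The coefficient with which J of \<open>nu\<close> minus a box in row \<open>i\<close>
  occurs in the sum of all partial derivatives of J of \<open>nu\<close>, see
  \<open>jack_lowering\<close>. The first factor equals nu i + th (n - i); it vanishes for an empty
  last row, where no box can be removed.\<close>

definition lower_coeff :: "real => nat => (nat => int) => nat => real" where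
  "lower_coeff th n nu i = (shifted th nu i + th * real n) *
    (\<Prod>b\<in>{1..n} - {i}. (shifted th nu i - shifted th nu b + th - 1) / (shifted th nu i - shifted th nu b)) *
    (cweight th n (nu(i := nu i - 1)) / cweight th n nu)"

lemma aweight_pos:
  assumes "th > 0" "antimono_on {1..Suc N} nu" "mu \<in> interlacing N nu"
  shows "aweight th N nu mu > 0"
  unfolding aweight_def
proof (intro prod_pos cross_pos ballI assms(1))
  fix j a assume ja: "j \<in> {1..N}" "a \<in> {1..Suc N}"
  note b = interlacing_bounds[OF assms(3), of j]
  show "(a \<le> j \<and> mu j - nu a \<le> 0) \<or> (j < a \<and> 0 \<le> mu j - nu a)"
    using antimono_onD2[OF assms(2), of a j] antimono_onD2[OF assms(2), of "Suc j" a] b ja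
    by (cases "a \<le> j") auto
qed

lemma cweight_pos: "th > 0 ==> antimono_on {1..n} nu ==> cweight th n nu > 0"
  unfolding cweight_def by (intro prod_pos ballI gratio_pos add_nonneg_nonneg mult_nonneg_nonneg)
    (use antimono_onD2[of n nu] in auto)

lemma bweight_pos: "th > 0 ==> antimono_on {1..n} nu ==> bweight th n nu > 0"
  unfolding bweight_def by (intro prod_pos ballI gratio_pos add_nonneg_nonneg mult_nonneg_nonneg)
    (use antimono_onD2[of n nu] in auto)

lemma jack_psi_pos:
  assumes "th > 0" "antimono_on {1..Suc N} nu" "mu \<in> interlacing N nu"
  shows "jack_psi th N nu mu > 0"
  using aweight_pos[OF assms] cweight_pos[OF assms(1,2)]
    bweight_pos[OF assms(1) interlacing_antimono[OF assms(3,2)]] gratio_pos[OF assms(1), of 0]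
  by (simp add: jack_psi_gratio[OF assms])

lemma shifted_diff: "shifted th nu i - shifted th mu j = of_int (nu i - mu j) + th * (real j - real i)"
  by (simp add: shifted_def algebra_simps)

lemma aweight_up:
  assumes "th > 0" "antimono_on {1..Suc N} nu" "mu \<in> interlacing N nu" "j \<in> {1..N}" "mu j < nu j"
  shows "aweight th N nu (mu(j := mu j + 1)) = aweight th N nu mu *
    (\<Prod>a\<in>{1..Suc N}. (shifted th mu j - shifted th nu a) / (shifted th mu j - shifted th nu a - th + 1))"
  unfolding aweight_def
proof (rule prod_change_one[where a = j])
  have "cross th a j (mu j + 1 - nu a) = cross th a j (mu j - nu a) *
     ((shifted th mu j - shifted th nu a) / (shifted th mu j - shifted th nu a - th + 1))" if a: "a \<in> {1..Suc N}" for a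
  proof -
    have "(a \<le> j \<and> mu j - nu a < 0) \<or> (j < a \<and> 0 \<le> mu j - nu a)"
      using antimono_onD2[OF assms(2), of a j] antimono_onD2[OF assms(2), of "Suc j" a]
        interlacing_bounds[OF assms(3), of j] a assms(4,5) by (cases "a \<le> j") auto
    from cross_step[OF assms(1) this] show ?thesis by (simp add: shifted_diff algebra_simps)
  qed
  then show "(\<Prod>a\<in>{1..Suc N}. cross th a j ((mu(j := mu j + 1)) j - nu a)) = (\<Prod>a\<in>{1..Suc N}. cross th a j (mu j - nu a)) *
    (\<Prod>a\<in>{1..Suc N}. (shifted th mu j - shifted th nu a) / (shifted th mu j - shifted th nu a - th + 1))"
    by (simp only: prod.distrib[symmetric] fun_upd_same cong: prod.cong)
qed (use assms in auto)

lemma aweight_down: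
  assumes "th > 0" "antimono_on {1..Suc N} nu" "mu \<in> interlacing N nu" "i \<in> {1..Suc N}" "i \<le> N ==> mu i < nu i"
  shows "aweight th N (nu(i := nu i - 1)) mu = aweight th N nu mu *
    (\<Prod>b\<in>{1..N}. (shifted th mu b - shifted th nu i) / (shifted th mu b - shifted th nu i - th + 1))"
  unfolding aweight_def prod.distrib[symmetric]
proof (rule prod.cong[OF refl])
  fix j assume j: "j \<in> {1..N}"
  show "(\<Prod>a\<in>{1..Suc N}. cross th a j (mu j - (nu(i := nu i - 1)) a)) =
    (\<Prod>a\<in>{1..Suc N}. cross th a j (mu j - nu a)) *
    ((shifted th mu j - shifted th nu i) / (shifted th mu j - shifted th nu i - th + 1))"
  proof (rule prod_change_one[where a = i])
    have "mu j < nu i" if "i \<le> j"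
    proof -
      have "mu j \<le> mu i" using antimono_onD2[OF interlacing_antimono[OF assms(3,2)], of i j] that assms(4) j by auto
      then show ?thesis using assms(5) that j by auto
    qed
    then have "(i \<le> j \<and> mu j - nu i < 0) \<or> (j < i \<and> 0 \<le> mu j - nu i)"
      using antimono_onD2[OF assms(2), of "Suc j" i]
        interlacing_bounds[OF assms(3), of j] j assms(4) by (cases "i \<le> j") auto
    from cross_step[OF assms(1) this]
    show "cross th i j (mu j - (nu(i := nu i - 1)) i) = cross th i j (mu j - nu i) *
      ((shifted th mu j - shifted th nu i) / (shifted th mu j - shifted th nu i - th + 1))"
      by (simp add: shifted_diff algebra_simps)
  qed (use assms in auto)
qed

lemma bcweight_up:
  assumes "th > 0" "antimono_on {1..n} mu" "antimono_on {1..n} (mu(j := mu j + 1))" "j \<in> {1..n}"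
  defines "D \<equiv> \<lambda>b. shifted th mu j - shifted th mu b"
  shows "bweight th n (mu(j := mu j + 1)) * cweight th n (mu(j := mu j + 1)) = bweight th n mu * cweight th n mu *
    (\<Prod>b\<in>{1..n} - {j}. (D b * (D b + th)) / ((D b + 1 - th) * (D b + 1)))"
  unfolding bweight_def cweight_def prod.distrib[symmetric]
proof (rule pair_prod_change[OF assms(4)])
  fix i b assume ib: "1 \<le> i" "i < b" "b \<le> n"
  define mu' where "mu' = mu(j := mu j + 1)"
  define z where "z = of_int (mu i - mu b) + th * (real b - real i)"
  have zt: "of_int (mu i - mu b) + th * (real b - 1 - real i) = z - th" by (simp add: z_def algebra_simps)
  have "th * (real b - real i) \<ge> th * 1" using ib assms(1) by (intro mult_left_mono) auto
  moreover have mono: "mu b \<le> mu i" "mu' b \<le> mu' i" using antimono_onD2[OF assms(2), of i b] antimono_onD2[OF assms(3), of i b] ib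
    by (auto simp: mu'_def)
  ultimately have z: "z - th \<ge> 0" by (simp add: z_def)
  consider "i = j" | "b = j" | "i \<noteq> j" "b \<noteq> j" by auto
  then show "gratio th (of_int ((mu(j := mu j + 1)) i - (mu(j := mu j + 1)) b) + th * (real b - real i)) *
       gratio th (of_int ((mu(j := mu j + 1)) i - (mu(j := mu j + 1)) b) + th * (real b - 1 - real i)) =
       gratio th (of_int (mu i - mu b) + th * (real b - real i)) *
       gratio th (of_int (mu i - mu b) + th * (real b - 1 - real i)) *
       (if i = j then D b * (D b + th) / ((D b + 1 - th) * (D b + 1))
        else if b = j then D i * (D i + th) / ((D i + 1 - th) * (D i + 1)) else 1)"
  proof cases
    case 1
    have D: "D b = z" by (simp add: D_def shifted_diff z_def 1)
    have e: "of_int ((mu(j := mu j + 1)) i - (mu(j := mu j + 1)) b) + th * (real b - real i) = z + 1"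
      "of_int ((mu(j := mu j + 1)) i - (mu(j := mu j + 1)) b) + th * (real b - 1 - real i) = z - th + 1"
      using ib 1 by (simp_all add: z_def algebra_simps)
    have "gratio th (z + 1) = gratio th z * ((z + th) / (z + 1))" "gratio th (z - th + 1) = gratio th (z - th) * ((z - th + th) / (z - th + 1))"
      using gratio_step[OF assms(1), of z] gratio_step[OF assms(1) z] z assms(1) by auto
    then show ?thesis unfolding e zt z_def[symmetric] D using 1 by (simp add: mult_ac add_ac)
  next
    case 2
    then have ij: "i \<noteq> j" using ib by auto
    \<comment> \<open>Row j is the lower row of the pair here, so raising it decreases the
      difference of the two rows. The step formula is therefore applied at the smaller argument
      \<open>y\<close> and inverted.\<close>
    define y where "y = z - 1"
    have "mu i - mu b \<ge> 1" using mono(2) 2 ij by (auto simp: mu'_def)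
    then have "real_of_int (mu i - mu b) \<ge> 1" by linarith
    with \<open>th * (real b - real i) \<ge> th * 1\<close> have y: "y - th \<ge> 0" by (simp add: y_def z_def)
    have D: "D i = - (y + 1)" by (simp add: D_def shifted_diff z_def y_def 2 algebra_simps)
    have e: "of_int ((mu(j := mu j + 1)) i - (mu(j := mu j + 1)) b) + th * (real b - real i) = y"
      "of_int ((mu(j := mu j + 1)) i - (mu(j := mu j + 1)) b) + th * (real b - 1 - real i) = y - th"
      using ib 2 ij by (simp_all add: z_def y_def algebra_simps)
    have z': "z = y + 1" "z - th = y - th + 1" by (simp_all add: y_def)
    have g: "gratio th (y + 1) = gratio th y * ((y + th) / (y + 1))" "gratio th (y - th + 1) = gratio th (y - th) * ((y - th + th) / (y - th + 1))"
      using gratio_step[OF assms(1), of y] gratio_step[OF assms(1) y] y assms(1) by auto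
    have yp: "y > 0" "y + th > 0" "y + 1 > 0" "y - th + 1 > 0" using y assms(1) by auto
    have r: "((y + th) / (y + 1)) * ((y - th + th) / (y - th + 1)) * (D i * (D i + th) / ((D i + 1 - th) * (D i + 1))) = 1"
    proof -
      have "D i * (D i + th) = (y + 1) * (y - th + 1)" "(D i + 1 - th) * (D i + 1) = (y + th) * y"
        by (simp_all add: D algebra_simps)
      then show ?thesis using yp by simp
    qed
    have "gratio th y * gratio th (y - th) = gratio th y * gratio th (y - th) *
      (((y + th) / (y + 1)) * ((y - th + th) / (y - th + 1)) * (D i * (D i + th) / ((D i + 1 - th) * (D i + 1))))"
      by (simp only: r mult_1_right)
    also have "\<dots> = gratio th (y + 1) * gratio th (y - th + 1) * (D i * (D i + th) / ((D i + 1 - th) * (D i + 1)))"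
      unfolding g by (simp only: mult_ac)
    finally show ?thesis unfolding e zt z_def[symmetric] unfolding z'(2) unfolding z'(1) using 2 ij
      by (simp only: if_False if_True simp_thms)
  next
    case 3
    then show ?thesis by simp
  qed
qed

section \<open>The residue identity behind the lowering operator\<close>

lemma shifted_gap:
  assumes "th > 0" "antimono_on {1..n} nu" "1 \<le> i" "i < b" "b \<le> n"
  shows "shifted th nu i - shifted th nu b \<ge> th"
proof -
  have "th * (real b - real i) \<ge> th * 1" using assms by (intro mult_left_mono) auto
  moreover have "nu b \<le> nu i" using antimono_onD2[OF assms(2), of i b] assms by auto
  ultimately show ?thesis by (simp add: shifted_diff)
qed

lemma shifted_inj:
  assumes "th > 0" "antimono_on {1..n} nu" "i \<in> {1..n}" "b \<in> {1..n}" "i \<noteq> b"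
  shows "shifted th nu i \<noteq> shifted th nu b"
  using shifted_gap[OF assms(1,2), of i b] shifted_gap[OF assms(1,2), of b i] assms by (cases "i < b") auto

text \<open>A residue computation with \<open>e = th - 1\<close>, weight 1 at the points
  \<open>L i\<close> and weight -1 at the points \<open>M j + 1 - th\<close>. After multiplication
  by \<open>jack_psi th N nu mu\<close>, the terms with \<open>i\<close> describe the removal of a
  box from \<open>nu\<close> and those with \<open>j\<close> the addition of a box to
  \<open>mu\<close>. Rows with \<open>mu j = nu j\<close> admit neither and have no pole.\<close>

lemma branching_identity:
  assumes th: "th > 0" and sig: "antimono_on {1..Suc N} nu" and int: "mu \<in> interlacing N nu"
  defines "S \<equiv> {j \<in> {1..N}. mu j < nu j}" and "L \<equiv> shifted th nu" and "M \<equiv> shifted th mu"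
  shows "(\<Sum>i\<in>insert (Suc N) S. (L i + th * real (Suc N)) * (\<Prod>a\<in>{1..Suc N} - {i}. (L i - L a + th - 1) / (L i - L a)) *
      (\<Prod>b\<in>{1..N}. (M b - L i) / (M b - L i - th + 1))) =
    of_int (sig_size (Suc N) nu - sig_size N mu) +
    (\<Sum>j\<in>S. (M j + 1 + th * real N) * (\<Prod>b\<in>{1..N} - {j}. (M j - M b + 1 - th) / (M j - M b)) *
      (\<Prod>a\<in>{1..Suc N}. (M j - L a) / (M j - L a - th + 1)))"
proof -
  have am: "antimono_on {1..N} mu" by (rule interlacing_antimono[OF int sig])
  define S' where "S' = insert (Suc N) S"
  have S: "finite S" "S \<subseteq> {1..N}" "Suc N \<notin> S" by (auto simp: S_def)
  define T where "T = Inl ` S \<union> Inr ` S'"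
  define z where "z c = (case c of Inl j => M j + 1 - th | Inr i => L i)" for c
  define s where "s c = (case c of Inl j => -1 | Inr i => (1::real))" for c :: "nat + nat"
  define P where "P c = (\<Prod>c'\<in>T - {c}. 1 + (th - 1) * s c' / (z c - z c'))" for c
  have finT: "finite T" by (simp add: T_def S'_def S)
  have Linj: "L a \<noteq> L b" if "a \<in> {1..Suc N}" "b \<in> {1..Suc N}" "a \<noteq> b" for a b
    using shifted_inj[OF th sig that] by (simp add: L_def)
  have Minj: "M a \<noteq> M b" if "a \<in> {1..N}" "b \<in> {1..N}" "a \<noteq> b" for a b
    using shifted_inj[OF th am that] by (simp add: M_def)
  have LM: "M j - L a - th + 1 \<noteq> 0" if j: "j \<in> S" and a: "a \<in> {1..Suc N}" for j a
  proof -
    have "(a \<le> j \<and> mu j - nu a < 0) \<or> (j < a \<and> 0 \<le> mu j - nu a)"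
      using antimono_onD2[OF sig, of a j] antimono_onD2[OF sig, of "Suc j" a]
        interlacing_bounds[OF int, of j] a j by (cases "a \<le> j") (auto simp: S_def)
    from cross_denom_nz[OF th this] show ?thesis by (simp add: M_def L_def shifted_diff)
  qed
  have LM': "M b - L i - th + 1 \<noteq> 0" if b: "b \<in> {1..N}" and i: "i \<in> S'" for b i
  proof -
    have "mu b < nu i" if "i \<le> b"
      using antimono_onD2[OF am, of i b] that b i by (auto simp: S_def S'_def)
    then have "(i \<le> b \<and> mu b - nu i < 0) \<or> (b < i \<and> 0 \<le> mu b - nu i)"
      using antimono_onD2[OF sig, of "Suc b" i]
        interlacing_bounds[OF int, of b] b i by (cases "i \<le> b") (auto simp: S_def S'_def)
    from cross_denom_nz[OF th this] show ?thesis by (simp add: M_def L_def shifted_diff)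
  qed
  have S': "S' \<subseteq> {1..Suc N}" using S by (auto simp: S'_def)
  have injz: "inj_on z T"
  proof (rule inj_onI)
    fix c d assume cd: "c \<in> T" "d \<in> T" "z c = z d"
    show "c = d"
    proof (cases c; cases d)
      fix i j assume "c = Inl i" "d = Inl j"
      then show ?thesis using cd Minj[of i j] S by (auto simp: T_def z_def subset_eq)
    next
      fix i j assume "c = Inr i" "d = Inr j"
      then show ?thesis using cd Linj[of i j] S' by (auto simp: T_def z_def subset_eq)
    next
      fix i j assume *: "c = Inl i" "d = Inr j"
      then have "i \<in> S" "j \<in> {1..Suc N}" using cd S' by (auto simp: T_def)
      from LM[OF this] * cd(3) show ?thesis by (simp add: z_def)
    next
      fix i j assume *: "c = Inr i" "d = Inl j"
      then have "j \<in> S" "i \<in> {1..Suc N}" using cd S' by (auto simp: T_def)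
      from LM[OF this] * cd(3) show ?thesis by (simp add: z_def)
    qed
  qed
  have outside: "M a = L a" if "a \<in> {1..N} - S" for a
    using that interlacing_bounds[OF int, of a] by (auto simp: S_def M_def L_def shifted_def)
  have split: "(\<Prod>c\<in>T - {d}. f c) = (\<Prod>b\<in>S - {b. d = Inl b}. f (Inl b)) * (\<Prod>a\<in>S' - {a. d = Inr a}. f (Inr a))"
    for f :: "nat + nat => real" and d
  proof -
    have "T - {d} = Inl ` (S - {b. d = Inl b}) \<union> Inr ` (S' - {a. d = Inr a})" by (auto simp: T_def)
    then have "(\<Prod>c\<in>T - {d}. f c) = (\<Prod>c\<in>Inl ` (S - {b. d = Inl b}). f c) * (\<Prod>c\<in>Inr ` (S' - {a. d = Inr a}). f c)"
      using S by (simp only:) (rule prod.union_disjoint, auto simp: S'_def)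
    then show ?thesis by (simp add: prod.reindex)
  qed
  have PR: "P (Inr i) = (\<Prod>a\<in>{1..Suc N} - {i}. (L i - L a + th - 1) / (L i - L a)) * (\<Prod>b\<in>{1..N}. (M b - L i) / (M b - L i - th + 1))"
    if i: "i \<in> S'" for i
  proof -
    define f g where "f a = (L i - L a + th - 1) / (L i - L a)" and "g b = (M b - L i) / (M b - L i - th + 1)" for a b
    have i': "i \<in> {1..Suc N}" using i S' by auto
    have "P (Inr i) = (\<Prod>b\<in>S. 1 + (th - 1) * s (Inl b) / (z (Inr i) - z (Inl b))) *
       (\<Prod>a\<in>S' - {i}. 1 + (th - 1) * s (Inr a) / (z (Inr i) - z (Inr a)))"
      unfolding P_def split by (intro arg_cong2[of _ _ _ _ "(*)"] prod.cong) auto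
    also have "(\<Prod>b\<in>S. 1 + (th - 1) * s (Inl b) / (z (Inr i) - z (Inl b))) = (\<Prod>b\<in>S. g b)"
    proof (rule prod.cong[OF refl])
      fix b assume b: "b \<in> S"
      have "M b - L i - th + 1 \<noteq> 0" using LM[OF b i'] .
      then show "1 + (th - 1) * s (Inl b) / (z (Inr i) - z (Inl b)) = g b"
        by (simp add: s_def z_def g_def divide_simps) (simp add: algebra_simps)?
    qed
    also have "(\<Prod>a\<in>S' - {i}. 1 + (th - 1) * s (Inr a) / (z (Inr i) - z (Inr a))) = (\<Prod>a\<in>S' - {i}. f a)"
    proof (rule prod.cong[OF refl])
      fix a assume a: "a \<in> S' - {i}"
      have "L i \<noteq> L a" using Linj[OF i', of a] a S' by auto
      then show "1 + (th - 1) * s (Inr a) / (z (Inr i) - z (Inr a)) = f a"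
        by (simp add: s_def z_def f_def divide_simps)
    qed
    \<comment> \<open>A row outside \<open>S\<close> satisfies \<open>M a = L a\<close>, so its
      factors \<open>f a\<close> and \<open>g a\<close> are inverse to each other. They are inserted
      to complete both products to full index ranges.\<close>
    also have "(\<Prod>b\<in>S. g b) * (\<Prod>a\<in>S' - {i}. f a) =
      (\<Prod>b\<in>S. g b) * (\<Prod>a\<in>S' - {i}. f a) * (\<Prod>a\<in>{1..N} - S. f a * g a)"
    proof -
      have "f a * g a = 1" if a: "a \<in> {1..N} - S" for a
      proof -
        have "a \<noteq> i" using a i by (auto simp: S'_def)
        then have "L i - L a \<noteq> 0" using Linj[OF i', of a] a by auto
        moreover have "L a - L i - th + 1 \<noteq> 0" using LM'[of a i] a i outside[OF a] by auto
        ultimately show ?thesis by (simp add: f_def g_def outside[OF a] divide_simps) (simp add: algebra_simps)?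
      qed
      then show ?thesis by simp
    qed
    also have "\<dots> = ((\<Prod>a\<in>S' - {i}. f a) * (\<Prod>a\<in>{1..N} - S. f a)) * ((\<Prod>b\<in>S. g b) * (\<Prod>b\<in>{1..N} - S. g b))"
      by (simp add: prod.distrib mult_ac)
    also have "(\<Prod>b\<in>S. g b) * (\<Prod>b\<in>{1..N} - S. g b) = (\<Prod>b\<in>{1..N}. g b)"
      using S by (subst prod.union_disjoint[symmetric]) (auto intro!: prod.cong)
    also have "(\<Prod>a\<in>S' - {i}. f a) * (\<Prod>a\<in>{1..N} - S. f a) = (\<Prod>a\<in>{1..Suc N} - {i}. f a)"
      using S i by (subst prod.union_disjoint[symmetric]) (auto intro!: prod.cong simp: S'_def)
    finally show ?thesis by (simp add: f_def g_def)
  qed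
  have PL: "P (Inl j) = (\<Prod>b\<in>{1..N} - {j}. (M j - M b + 1 - th) / (M j - M b)) * (\<Prod>a\<in>{1..Suc N}. (M j - L a) / (M j - L a - th + 1))"
    if j: "j \<in> S" for j
  proof -
    define f g where "f b = (M j - M b + 1 - th) / (M j - M b)" and "g a = (M j - L a) / (M j - L a - th + 1)" for a b
    have j': "j \<in> {1..N}" using j S by auto
    have "P (Inl j) = (\<Prod>b\<in>S - {j}. 1 + (th - 1) * s (Inl b) / (z (Inl j) - z (Inl b))) *
       (\<Prod>a\<in>S'. 1 + (th - 1) * s (Inr a) / (z (Inl j) - z (Inr a)))"
      unfolding P_def split by (intro arg_cong2[of _ _ _ _ "(*)"] prod.cong) auto
    also have "(\<Prod>b\<in>S - {j}. 1 + (th - 1) * s (Inl b) / (z (Inl j) - z (Inl b))) = (\<Prod>b\<in>S - {j}. f b)"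
    proof (rule prod.cong[OF refl])
      fix b assume b: "b \<in> S - {j}"
      have "M j \<noteq> M b" using Minj[OF j', of b] b S by auto
      then show "1 + (th - 1) * s (Inl b) / (z (Inl j) - z (Inl b)) = f b"
        by (simp add: s_def z_def f_def divide_simps)
    qed
    also have "(\<Prod>a\<in>S'. 1 + (th - 1) * s (Inr a) / (z (Inl j) - z (Inr a))) = (\<Prod>a\<in>S'. g a)"
    proof (rule prod.cong[OF refl])
      fix a assume a: "a \<in> S'"
      have "M j - L a - th + 1 \<noteq> 0" using LM[OF j, of a] a S' by auto
      then show "1 + (th - 1) * s (Inr a) / (z (Inl j) - z (Inr a)) = g a"
        by (simp add: s_def z_def g_def divide_simps) (simp add: algebra_simps)?
    qed
    also have "(\<Prod>b\<in>S - {j}. f b) * (\<Prod>a\<in>S'. g a) =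
      (\<Prod>b\<in>S - {j}. f b) * (\<Prod>a\<in>S'. g a) * (\<Prod>a\<in>{1..N} - S. f a * g a)"
    proof -
      have "f a * g a = 1" if a: "a \<in> {1..N} - S" for a
      proof -
        have "a \<noteq> j" using a j by auto
        then have "M j - M a \<noteq> 0" using Minj[OF j', of a] a by auto
        moreover have "M j - L a - th + 1 \<noteq> 0" using LM[of j a] a j by auto
        ultimately show ?thesis by (simp add: f_def g_def outside[OF a, symmetric] divide_simps) (simp add: algebra_simps)?
      qed
      then show ?thesis by simp
    qed
    also have "\<dots> = ((\<Prod>a\<in>S - {j}. f a) * (\<Prod>a\<in>{1..N} - S. f a)) * ((\<Prod>b\<in>S'. g b) * (\<Prod>b\<in>{1..N} - S. g b))"
      by (simp add: prod.distrib mult_ac)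
    also have "(\<Prod>b\<in>S'. g b) * (\<Prod>b\<in>{1..N} - S. g b) = (\<Prod>b\<in>{1..Suc N}. g b)"
      using S by (subst prod.union_disjoint[symmetric]) (auto intro!: prod.cong simp: S'_def)
    also have "(\<Prod>a\<in>S - {j}. f a) * (\<Prod>a\<in>{1..N} - S. f a) = (\<Prod>a\<in>{1..N} - {j}. f a)"
      using S j by (subst prod.union_disjoint[symmetric]) (auto intro!: prod.cong)
    finally show ?thesis by (simp add: f_def g_def)
  qed
  have sumT: "(\<Sum>c\<in>T. f c) = (\<Sum>j\<in>S. f (Inl j)) + (\<Sum>i\<in>S'. f (Inr i))" for f :: "nat + nat => real"
  proof -
    have "finite S'" using S by (simp add: S'_def)
    then show ?thesis unfolding T_def using S by (subst sum.union_disjoint) (auto simp: sum.reindex)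
  qed
  have cardS': "real (card S') = real (card S) + 1" using S by (simp add: S'_def)
  have t0: "(\<Sum>c\<in>T. s c) = 1" "(\<Sum>c\<in>T. (s c)\<^sup>2) = 2 * real (card S) + 1"
    unfolding sumT by (simp_all add: s_def cardS')
  have t1: "(\<Sum>c\<in>T. s c * z c) = (\<Sum>i\<in>S. L i - M i) + L (Suc N) + real (card S) * (th - 1)"
    unfolding sumT using S by (simp add: s_def z_def S'_def sum.distrib sum_subtractf sum_negf algebra_simps)
  have LMsum: "(\<Sum>i\<in>S. L i - M i) = (\<Sum>i\<in>{1..N}. of_int (nu i - mu i))"
  proof (rule sum.mono_neutral_cong_left)
    show "\<forall>i\<in>{1..N} - S. real_of_int (nu i - mu i) = 0"
      using outside by (auto simp: L_def M_def shifted_def)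
  qed (use S in \<open>auto simp: L_def M_def shifted_def\<close>)
  have "(\<Sum>c\<in>T. s c * (z c + th * real (Suc N)) * P c) = (\<Sum>c\<in>T. s c * z c * P c) + th * real (Suc N) * (\<Sum>c\<in>T. s c * P c)"
    by (simp add: sum.distrib[symmetric] sum_distrib_left algebra_simps del: of_nat_Suc)
  \<comment> \<open>The shifts th - 1 of the poles at \<open>M j + 1 - th\<close> contribute card S
    * (th - 1). This cancels against the quadratic term of \<open>residue_sums\<close>, because (1 -
    (2 * card S + 1)) / 2 = - card S.\<close>
  also have "\<dots> = (\<Sum>i\<in>S. L i - M i) + L (Suc N) + th * real (Suc N)"
    using residue_sums[OF finT injz, of s "th - 1"]
    unfolding P_def[symmetric] t0 t1 by (simp add: field_simps)
  also have "\<dots> = of_int (sig_size (Suc N) nu - sig_size N mu)"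
    unfolding LMsum by (simp add: sig_size_def L_def shifted_def sum_subtractf)
  finally have fin: "(\<Sum>c\<in>T. s c * (z c + th * real (Suc N)) * P c) = of_int (sig_size (Suc N) nu - sig_size N mu)" .
  have e1: "(\<Sum>i\<in>S'. (L i + th * real (Suc N)) * (\<Prod>a\<in>{1..Suc N} - {i}. (L i - L a + th - 1) / (L i - L a)) *
      (\<Prod>b\<in>{1..N}. (M b - L i) / (M b - L i - th + 1))) = (\<Sum>i\<in>S'. (L i + th * real (Suc N)) * P (Inr i))"
    by (rule sum.cong[OF refl]) (simp only: PR mult.assoc)
  have e2: "(\<Sum>j\<in>S. (M j + 1 + th * real N) * (\<Prod>b\<in>{1..N} - {j}. (M j - M b + 1 - th) / (M j - M b)) *
      (\<Prod>a\<in>{1..Suc N}. (M j - L a) / (M j - L a - th + 1))) = (\<Sum>j\<in>S. (M j + 1 + th * real N) * P (Inl j))"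
    by (rule sum.cong[OF refl]) (simp only: PL mult.assoc)
  have e3: "(\<Sum>j\<in>S. s (Inl j) * (z (Inl j) + th * real (Suc N)) * P (Inl j)) =
      - (\<Sum>j\<in>S. (M j + 1 + th * real N) * P (Inl j))"
    unfolding sum_negf[symmetric] by (rule sum.cong[OF refl]) (simp add: s_def z_def algebra_simps)
  have e4: "(\<Sum>i\<in>S'. s (Inr i) * (z (Inr i) + th * real (Suc N)) * P (Inr i)) =
      (\<Sum>i\<in>S'. (L i + th * real (Suc N)) * P (Inr i))"
    by (simp add: s_def z_def)
  show ?thesis
    unfolding S'_def[symmetric] e1 e2 fin[symmetric] sumT e3 e4 by simp
qed

section \<open>The lowering operator\<close>

text \<open>The quotient of \<open>cweight\<close> values in \<open>lower_coeff\<close> replaces the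
  weight of the smaller signature in \<open>jack_psi\<close> by that of \<open>nu\<close>; what
  remains is the summand of \<open>branching_identity\<close> for row \<open>i\<close>.\<close>

lemma lower_coeff_psi_down:
  assumes th: "th > 0" and sig: "antimono_on {1..Suc N} nu" and sig': "antimono_on {1..Suc N} (nu(i := nu i - 1))"
    and int: "mu \<in> interlacing N nu" and i: "i \<in> {1..Suc N}" "i \<le> N ==> mu i < nu i"
  defines "L \<equiv> shifted th nu" and "M \<equiv> shifted th mu"
  shows "lower_coeff th (Suc N) nu i * jack_psi th N (nu(i := nu i - 1)) mu = jack_psi th N nu mu *
    ((L i + th * real (Suc N)) * (\<Prod>a\<in>{1..Suc N} - {i}. (L i - L a + th - 1) / (L i - L a)) *
      (\<Prod>b\<in>{1..N}. (M b - L i) / (M b - L i - th + 1)))"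
proof -
  define nu' where "nu' = nu(i := nu i - 1)"
  have int': "mu \<in> interlacing N nu'"
  proof -
    have "mu j \<le> nu' j \<and> nu' (Suc j) \<le> mu j" if "1 \<le> j" "j \<le> N" for j
      using interlacing_bounds[OF int that] i that by (auto simp: nu'_def)
    then show ?thesis using int by (auto simp: interlacing_def PiE_iff)
  qed
  have C: "cweight th (Suc N) nu' > 0" "cweight th (Suc N) nu > 0"
    using cweight_pos[OF th sig] cweight_pos[OF th sig'] by (simp_all add: nu'_def)
  have p: "jack_psi th N nu' mu = aweight th N nu' mu / (gratio th 0 ^ N * bweight th N mu * cweight th (Suc N) nu')"
    using jack_psi_gratio[OF th sig'[folded nu'_def] int'] .
  have a: "aweight th N nu' mu = aweight th N nu mu * (\<Prod>b\<in>{1..N}. (M b - L i) / (M b - L i - th + 1))"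
    unfolding nu'_def L_def M_def by (rule aweight_down[OF th sig int i])
  have gen: "v * w * (c' / c) * (A * q / (h * c')) = A / (h * c) * (v * w * q)" if "c' > 0" for v w c c' A q h :: real
    using that by (simp add: mult_ac)
  show ?thesis
    unfolding lower_coeff_def jack_psi_gratio[OF th sig int] L_def[symmetric] M_def[symmetric] nu'_def[symmetric] p a
    by (rule gen[OF C(1)])
qed

lemma bcweight_quotient:
  assumes th: "th > 0" and am: "antimono_on {1..n} mu" and am': "antimono_on {1..n} (mu(j := mu j + 1))" and j: "j \<in> {1..n}"
  defines "D \<equiv> \<lambda>b. shifted th mu j - shifted th mu b" and "mu' \<equiv> mu(j := mu j + 1)"
  shows "(\<Prod>b\<in>{1..n} - {j}. (D b + th) / (D b + 1)) / (bweight th n mu' * cweight th n mu') * cweight th n mu =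
     (\<Prod>b\<in>{1..n} - {j}. (D b + 1 - th) / D b) / bweight th n mu"
proof -
  have nz: "D b + 1 \<noteq> 0" "D b + th \<noteq> 0" "D b + 1 - th \<noteq> 0" "D b \<noteq> 0" if b: "b \<in> {1..n} - {j}" for b
  proof -
    have "D b + 1 \<noteq> 0 \<and> D b + th \<noteq> 0 \<and> D b + 1 - th \<noteq> 0 \<and> D b \<noteq> 0"
    proof (cases "b < j")
      case True
      have "mu' j \<le> mu' b" unfolding mu'_def by (rule antimono_onD2[OF am']) (use True b j in auto)
      then have "real_of_int (mu j - mu b) \<le> -1" using True by (auto simp: mu'_def)
      moreover have "th * (real j - real b) \<ge> th * 1" using True th by (intro mult_left_mono) auto
      moreover have "D b = of_int (mu j - mu b) - th * (real j - real b)" by (simp add: D_def shifted_def algebra_simps)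
      ultimately show ?thesis using th by linarith
    next
      case False
      then have "D b \<ge> th" using shifted_gap[OF th am, of j b] b j by (auto simp: D_def)
      then show ?thesis using th by linarith
    qed
    then show "D b + 1 \<noteq> 0" "D b + th \<noteq> 0" "D b + 1 - th \<noteq> 0" "D b \<noteq> 0" by auto
  qed
  have C: "bweight th n mu > 0" "cweight th n mu > 0" using bweight_pos[OF th am] cweight_pos[OF th am] by auto
  define G where "G = (\<Prod>b\<in>{1..n} - {j}. (D b * (D b + th)) / ((D b + 1 - th) * (D b + 1)))"
  have G: "G \<noteq> 0" unfolding G_def using nz by (simp add: prod_zero_iff)
  have up: "bweight th n mu' * cweight th n mu' = bweight th n mu * cweight th n mu * G"
    unfolding mu'_def G_def D_def by (rule bcweight_up[OF th am am' j])
  have "(\<Prod>b\<in>{1..n} - {j}. (D b + th) / (D b + 1)) = G * (\<Prod>b\<in>{1..n} - {j}. (D b + 1 - th) / D b)"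
    unfolding G_def prod.distrib[symmetric] using nz by (intro prod.cong refl) (simp add: divide_simps)
  then show ?thesis unfolding up using C G by (simp add: field_simps)
qed

text \<open>The division by \<open>bweight\<close> anticipates the denominator of
  \<open>jack_psi\<close>. The changes of \<open>bweight\<close> and \<open>cweight\<close> under
  the added box combine, by \<open>bcweight_up\<close>, to a product that leaves only data of
  \<open>mu\<close>.\<close>

lemma lower_coeff_up:
  assumes th: "th > 0" and am: "antimono_on {1..N} mu" and am': "antimono_on {1..N} (mu(j := mu j + 1))" and j: "j \<in> {1..N}"
  defines "M \<equiv> shifted th mu" and "mu' \<equiv> mu(j := mu j + 1)"
  shows "lower_coeff th N mu' j / bweight th N mu' = (M j + 1 + th * real N) * (\<Prod>b\<in>{1..N} - {j}. (M j - M b + 1 - th) / (M j - M b)) / bweight th N mu"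
proof -
  have Mj: "shifted th mu' j = M j + 1" by (simp add: mu'_def M_def shifted_def)
  have Mb: "shifted th mu' b = M b" if "b \<noteq> j" for b using that by (simp add: mu'_def M_def shifted_def)
  have bk: "mu'(j := mu' j - 1) = mu" by (simp add: mu'_def)
  have pr: "(\<Prod>b\<in>{1..N} - {j}. (shifted th mu' j - shifted th mu' b + th - 1) / (shifted th mu' j - shifted th mu' b)) =
     (\<Prod>b\<in>{1..N} - {j}. (M j - M b + th) / (M j - M b + 1))"
    by (intro prod.cong refl) (simp add: Mj Mb algebra_simps)
  have "lower_coeff th N mu' j / bweight th N mu' = (M j + 1 + th * real N) *
     ((\<Prod>b\<in>{1..N} - {j}. (M j - M b + th) / (M j - M b + 1)) / (bweight th N mu' * cweight th N mu') * cweight th N mu)"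
    unfolding lower_coeff_def pr bk unfolding Mj by (simp add: mult_ac)
  also have "\<dots> = (M j + 1 + th * real N) * ((\<Prod>b\<in>{1..N} - {j}. (M j - M b + 1 - th) / (M j - M b)) / bweight th N mu)"
    unfolding M_def mu'_def by (subst bcweight_quotient[OF th am am' j]) simp
  finally show ?thesis by simp
qed

text \<open>The counterpart of \<open>lower_coeff_psi_down\<close>: adding a box to row
  \<open>j\<close> of \<open>mu\<close> and removing it again by the lowering operator yields the
  summand of \<open>branching_identity\<close> for \<open>j\<close>.\<close>

lemma lower_coeff_psi_up:
  assumes th: "th > 0" and sig: "antimono_on {1..Suc N} nu" and int: "mu \<in> interlacing N nu"
    and j: "j \<in> {1..N}" "mu j < nu j"
  defines "L \<equiv> shifted th nu" and "M \<equiv> shifted th mu"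
  shows "jack_psi th N nu (mu(j := mu j + 1)) * lower_coeff th N (mu(j := mu j + 1)) j = jack_psi th N nu mu *
    ((M j + 1 + th * real N) * (\<Prod>b\<in>{1..N} - {j}. (M j - M b + 1 - th) / (M j - M b)) *
      (\<Prod>a\<in>{1..Suc N}. (M j - L a) / (M j - L a - th + 1)))"
proof -
  define mu' where "mu' = mu(j := mu j + 1)"
  have int': "mu' \<in> interlacing N nu"
  proof -
    have "mu' b \<le> nu b \<and> nu (Suc b) \<le> mu' b" if "1 \<le> b" "b \<le> N" for b
      using interlacing_bounds[OF int that] j that by (auto simp: mu'_def)
    then show ?thesis using int j by (auto simp: interlacing_def PiE_iff mu'_def extensional_def)
  qed
  have am: "antimono_on {1..N} mu" by (rule interlacing_antimono[OF int sig])
  have am': "antimono_on {1..N} mu'" by (rule interlacing_antimono[OF int' sig])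
  have a: "aweight th N nu mu' = aweight th N nu mu * (\<Prod>a\<in>{1..Suc N}. (M j - L a) / (M j - L a - th + 1))"
    unfolding mu'_def L_def M_def by (rule aweight_up[OF th sig int j])
  have "jack_psi th N nu mu' * lower_coeff th N mu' j = aweight th N nu mu' / (gratio th 0 ^ N * cweight th (Suc N) nu) * (lower_coeff th N mu' j / bweight th N mu')"
    unfolding jack_psi_gratio[OF th sig int'] by (simp add: mult_ac)
  also have "lower_coeff th N mu' j / bweight th N mu' = (M j + 1 + th * real N) * (\<Prod>b\<in>{1..N} - {j}. (M j - M b + 1 - th) / (M j - M b)) / bweight th N mu"
    unfolding M_def mu'_def by (rule lower_coeff_up[OF th am am'[unfolded mu'_def] j(1)])
  finally show ?thesis
    unfolding a jack_psi_gratio[OF th sig int] mu'_def[symmetric] by (simp add: mult_ac)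
qed

text \<open>Row \<open>j\<close> of \<open>mu'\<close> and row j + 1 of \<open>nu\<close> are equal
  and lose a box together, so the factor belonging to this pair is unchanged. Every other pair
  containing one of the two rows moves by exactly one step of \<open>cross\<close>.\<close>

lemma aweight_both:
  assumes th: "th > 0" and sig: "antimono_on {1..Suc N} nu" and int: "mu' \<in> interlacing N nu"
    and j: "j \<in> {1..N}" and tie: "mu' j = nu (Suc j)"
    and sig': "antimono_on {1..Suc N} (nu(Suc j := nu (Suc j) - 1))"
    and int': "mu'(j := mu' j - 1) \<in> interlacing N (nu(Suc j := nu (Suc j) - 1))"
  defines "L \<equiv> shifted th nu" and "M \<equiv> shifted th (mu'(j := mu' j - 1))"
  shows "aweight th N (nu(Suc j := nu (Suc j) - 1)) (mu'(j := mu' j - 1)) *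
      (\<Prod>a\<in>{1..Suc N} - {Suc j}. (M j - L a) / (M j - L a - th + 1)) =
    aweight th N nu mu' * (\<Prod>b\<in>{1..N} - {j}. (M b - L (Suc j)) / (M b - L (Suc j) - th + 1))"
proof -
  define nu' where "nu' = nu(Suc j := nu (Suc j) - 1)"
  define mu where "mu = mu'(j := mu' j - 1)"
  have am: "antimono_on {1..N} mu"
    using interlacing_antimono[OF int' sig'] by (simp add: mu_def)
  have col: "(\<Prod>a\<in>{1..Suc N}. cross th a j (mu j - nu' a)) * (\<Prod>a\<in>{1..Suc N} - {Suc j}. (M j - L a) / (M j - L a - th + 1)) =
    (\<Prod>a\<in>{1..Suc N}. cross th a j (mu' j - nu a))"
  proof -
    have c: "cross th a j (mu j - nu' a) * ((M j - L a) / (M j - L a - th + 1)) = cross th a j (mu' j - nu a)"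
      if a: "a \<in> {1..Suc N} - {Suc j}" for a
    proof -
      have "(a \<le> j \<and> mu j - nu a < 0) \<or> (j < a \<and> 0 \<le> mu j - nu a)"
      proof (cases "a \<le> j")
        case True
        have "nu (Suc j) \<le> nu a" by (rule antimono_onD2[OF sig]) (use True a j in auto)
        then show ?thesis using True tie by (auto simp: mu_def)
      next
        case False
        have "nu' a \<le> nu' (Suc j)" unfolding nu'_def by (rule antimono_onD2[OF sig']) (use False a j in auto)
        then show ?thesis using False tie a by (auto simp: mu_def nu'_def)
      qed
      from cross_step[OF th this] have "cross th a j (mu j - nu a + 1) = cross th a j (mu j - nu a) * ((M j - L a) / (M j - L a - th + 1))"
        by (simp only: L_def M_def shifted_diff mu_def)
      then show ?thesis using a by (simp add: mu_def nu'_def)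
    qed
    have "(\<Prod>a\<in>{1..Suc N}. cross th a j (mu j - nu' a)) * (\<Prod>a\<in>{1..Suc N} - {Suc j}. (M j - L a) / (M j - L a - th + 1)) =
       cross th (Suc j) j (mu j - nu' (Suc j)) * (\<Prod>a\<in>{1..Suc N} - {Suc j}. cross th a j (mu j - nu' a) * ((M j - L a) / (M j - L a - th + 1)))"
      using j by (subst prod.remove[of _ "Suc j"]) (simp_all only: prod.distrib mult.assoc finite_atLeastAtMost, auto)
    also have "\<dots> = cross th (Suc j) j (mu' j - nu (Suc j)) * (\<Prod>a\<in>{1..Suc N} - {Suc j}. cross th a j (mu' j - nu a))"
      using c by (intro arg_cong2[of _ _ _ _ "(*)"] prod.cong) (auto simp: mu_def nu'_def)
    also have "\<dots> = (\<Prod>a\<in>{1..Suc N}. cross th a j (mu' j - nu a))"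
      using j by (subst prod.remove[of "{1..Suc N}" "Suc j"]) auto
    finally show ?thesis .
  qed
  have row: "(\<Prod>a\<in>{1..Suc N}. cross th a b (mu b - nu' a)) =
      (\<Prod>a\<in>{1..Suc N}. cross th a b (mu' b - nu a)) * ((M b - L (Suc j)) / (M b - L (Suc j) - th + 1))"
    if b: "b \<in> {1..N} - {j}" for b
  proof (rule prod_change_one[where a = "Suc j"])
    have "(Suc j \<le> b \<and> mu b - nu (Suc j) < 0) \<or> (b < Suc j \<and> 0 \<le> mu b - nu (Suc j))"
    proof (cases "Suc j \<le> b")
      case True
      have "mu b \<le> mu (Suc j)" by (rule antimono_onD2[OF am]) (use True b j in auto)
      moreover have "mu (Suc j) \<le> nu' (Suc j)" using interlacing_bounds(2)[OF int', of "Suc j"] True b j by (auto simp: mu_def nu'_def)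
      ultimately show ?thesis using True by (auto simp: nu'_def)
    next
      case False
      have "nu (Suc j) \<le> nu (Suc b)" by (rule antimono_onD2[OF sig]) (use False b j in auto)
      moreover have "nu (Suc b) \<le> mu' b" using interlacing_bounds(1)[OF int, of b] b by auto
      ultimately show ?thesis using False b by (auto simp: mu_def)
    qed
    from cross_step[OF th this]
    show "cross th (Suc j) b (mu b - nu' (Suc j)) = cross th (Suc j) b (mu' b - nu (Suc j)) * ((M b - L (Suc j)) / (M b - L (Suc j) - th + 1))"
      using b by (simp add: L_def M_def shifted_diff mu_def nu'_def algebra_simps)
  qed (use b j in \<open>auto simp: mu_def nu'_def\<close>)
  have "aweight th N nu' mu = (\<Prod>a\<in>{1..Suc N}. cross th a j (mu j - nu' a)) * (\<Prod>b\<in>{1..N} - {j}. \<Prod>a\<in>{1..Suc N}. cross th a b (mu b - nu' a))"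
    unfolding aweight_def using j by (intro prod.remove) auto
  moreover have "aweight th N nu mu' = (\<Prod>a\<in>{1..Suc N}. cross th a j (mu' j - nu a)) * (\<Prod>b\<in>{1..N} - {j}. \<Prod>a\<in>{1..Suc N}. cross th a b (mu' b - nu a))"
    unfolding aweight_def using j by (intro prod.remove) auto
  moreover have "(\<Prod>b\<in>{1..N} - {j}. \<Prod>a\<in>{1..Suc N}. cross th a b (mu b - nu' a)) =
    (\<Prod>b\<in>{1..N} - {j}. \<Prod>a\<in>{1..Suc N}. cross th a b (mu' b - nu a)) * (\<Prod>b\<in>{1..N} - {j}. (M b - L (Suc j)) / (M b - L (Suc j) - th + 1))"
    unfolding prod.distrib[symmetric] by (intro prod.cong refl row)
  ultimately show ?thesis unfolding nu'_def[symmetric] mu_def[symmetric] col[symmetric]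
    by (simp only: mult_ac)
qed

text \<open>If rows \<open>mu' j\<close> and \<open>nu (Suc j)\<close> are equal, the smaller
  sequence \<open>mu' - e_j\<close> does not interlace with \<open>nu\<close>. It arises by lowering
  \<open>mu'\<close> after branching or by branching after lowering \<open>nu\<close> in row j + 1.
  The two coefficients agree because the tie gives M j = L (j + 1) + th - 1, which turns the
  products of one side into those of the other.\<close>

lemma lower_coeff_psi_tie:
  assumes th: "th > 0" and sig: "antimono_on {1..Suc N} nu" and int: "mu' \<in> interlacing N nu"
    and j: "j \<in> {1..N}" and tie: "mu' j = nu (Suc j)"
    and sig': "antimono_on {1..Suc N} (nu(Suc j := nu (Suc j) - 1))"
    and int': "mu'(j := mu' j - 1) \<in> interlacing N (nu(Suc j := nu (Suc j) - 1))"
  shows "jack_psi th N nu mu' * lower_coeff th N mu' j =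
    lower_coeff th (Suc N) nu (Suc j) * jack_psi th N (nu(Suc j := nu (Suc j) - 1)) (mu'(j := mu' j - 1))"
proof -
  define nu' where "nu' = nu(Suc j := nu (Suc j) - 1)"
  define mu where "mu = mu'(j := mu' j - 1)"
  define L where "L = shifted th nu"
  define M where "M = shifted th mu"
  have mu': "mu' = mu(j := mu j + 1)" by (simp add: mu_def)
  have am: "antimono_on {1..N} mu"
    using interlacing_antimono[OF int' sig'] by (simp add: mu_def)
  have am': "antimono_on {1..N} mu'" by (rule interlacing_antimono[OF int sig])
  have MjL: "M j = L (Suc j) + th - 1" by (simp add: M_def L_def shifted_def mu_def tie algebra_simps)
  define h where "h = gratio th 0 ^ N"
  define Q where "Q = (\<Prod>b\<in>{1..N} - {j}. (M b - L (Suc j)) / (M b - L (Suc j) - th + 1))"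
  define R where "R = (\<Prod>a\<in>{1..Suc N} - {Suc j}. (M j - L a) / (M j - L a - th + 1))"
  have both: "aweight th N nu' mu * R = aweight th N nu mu' * Q"
    unfolding nu'_def mu_def L_def M_def Q_def R_def by (rule aweight_both[OF th sig int j tie sig' int'])
  have C: "cweight th (Suc N) nu' > 0" using cweight_pos[OF th sig'] by (simp add: nu'_def)
  have lo: "lower_coeff th N mu' j / bweight th N mu' = (M j + 1 + th * real N) * (\<Prod>b\<in>{1..N} - {j}. (M j - M b + 1 - th) / (M j - M b)) / bweight th N mu"
    unfolding M_def mu' by (rule lower_coeff_up[OF th am am'[unfolded mu'] j(1)])
  have q: "(\<Prod>b\<in>{1..N} - {j}. (M j - M b + 1 - th) / (M j - M b)) = Q"
    unfolding Q_def
  proof (intro prod.cong refl)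
    fix b
    have "(M j - M b + 1 - th) = - (M b - L (Suc j))" "M j - M b = - (M b - L (Suc j) - th + 1)" by (simp_all add: MjL)
    then show "(M j - M b + 1 - th) / (M j - M b) = (M b - L (Suc j)) / (M b - L (Suc j) - th + 1)"
      by (simp only: minus_divide_divide)
  qed
  have r: "(\<Prod>b\<in>{1..Suc N} - {Suc j}. (L (Suc j) - L b + th - 1) / (L (Suc j) - L b)) = R"
    unfolding R_def by (intro prod.cong refl) (simp add: MjL algebra_simps)
  have "jack_psi th N nu mu' * lower_coeff th N mu' j = aweight th N nu mu' / (h * cweight th (Suc N) nu) * (lower_coeff th N mu' j / bweight th N mu')"
    unfolding jack_psi_gratio[OF th sig int] h_def by (simp add: mult_ac)
  also have "\<dots> = (aweight th N nu mu' * Q) / (h * cweight th (Suc N) nu * bweight th N mu) * (M j + 1 + th * real N)"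
    unfolding lo q by (simp add: mult_ac)
  also have "M j + 1 + th * real N = L (Suc j) + th * real (Suc N)" by (simp add: MjL algebra_simps)
  also have "(aweight th N nu mu' * Q) / (h * cweight th (Suc N) nu * bweight th N mu) * (L (Suc j) + th * real (Suc N)) =
     (aweight th N nu' mu * R) / (h * cweight th (Suc N) nu * bweight th N mu) * (L (Suc j) + th * real (Suc N))"
    by (simp only: both)
  also have "\<dots> = (L (Suc j) + th * real (Suc N)) * R * (cweight th (Suc N) nu' / cweight th (Suc N) nu) *
     (aweight th N nu' mu / (h * bweight th N mu * cweight th (Suc N) nu'))"
    using C by (simp add: mult_ac)
  also have "\<dots> = lower_coeff th (Suc N) nu (Suc j) * jack_psi th N nu' mu"
    unfolding lower_coeff_def L_def[symmetric] r nu'_def[symmetric]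
    using jack_psi_gratio[OF th sig' int'] by (simp add: nu'_def mu_def h_def)
  finally show ?thesis by (simp add: nu'_def mu_def)
qed

section \<open>The lowering operator on Jack polynomials\<close>

definition psi0 :: "real => nat => (nat => int) => (nat => int) => real" where
  "psi0 th N nu mu = (if mu \<in> interlacing N nu then jack_psi th N nu mu else 0)"

text \<open>Both coefficients are extended by zero so that the sums below can run over a common box
  of sequences, whether or not a changed sequence still interlaces or is a partition.\<close>

definition lower0 :: "real => nat => (nat => int) => nat => real" where
  "lower0 th n nu i = (if i \<in> removable n nu then lower_coeff th n nu i else 0)"

lemma partitionD: "is_partition n nu ==> antimono_on {1..n} nu" "is_partition n nu ==> 1 \<le> i ==> i \<le> n ==> 0 \<le> nu i"
  "is_partition n nu ==> 1 \<le> i ==> i \<le> j ==> j \<le> n ==> nu j \<le> nu i"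
  by (auto simp: is_partition_def monotone_on_def)

lemma partitionI:
  assumes "\<And>i. 1 \<le> i ==> i < n ==> nu (Suc i) \<le> nu i" "n \<ge> 1 ==> 0 \<le> nu n"
  shows "is_partition n nu"
proof -
  have am: "nu j \<le> nu i" if "i \<ge> 1" "i \<le> j" "j \<le> n" for i j
    using that(2,3)
  proof (induction j rule: dec_induct)
    case (step k)
    then show ?case using assms(1)[of k] that(1) by simp
  qed simp
  have "0 \<le> nu i" if "1 \<le> i" "i \<le> n" for i using am[of i n] assms(2) that by force
  then show ?thesis using am by (auto simp: is_partition_def monotone_on_def)
qed

lemma interlacing_partition:
  assumes "is_partition (Suc N) nu" "mu \<in> interlacing N nu"
  shows "is_partition N mu"
proof (rule partitionI)
  fix i assume i: "1 \<le> i" "i < N"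
  show "mu (Suc i) \<le> mu i"
    using antimono_onD2[OF interlacing_antimono[OF assms(2) partitionD(1)[OF assms(1)]], of i "Suc i"] i by auto
next
  assume "N \<ge> 1"
  then show "0 \<le> mu N" using interlacing_bounds(1)[OF assms(2), of N] partitionD(2)[OF assms(1), of "Suc N"] by auto
qed

text \<open>Both sides are the coefficient of J of \<open>mu\<close> times a power of the last
  variable: on the left after differentiating the branching rule, on the right after branching the
  claimed derivative. If \<open>mu\<close> interlaces with \<open>nu\<close>, this is
  \<open>branching_identity\<close>. Otherwise at most one term on each side is nonzero, and
  \<open>lower_coeff_psi_tie\<close> compares them.\<close>

lemma lowering_coefficients:
  assumes th: "th > 0" and part: "is_partition (Suc N) nu" and mu: "mu \<in> (\<Pi>\<^sub>E j\<in>{1..N}. {nu (Suc j) - 1..nu j})"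
  shows "of_int (sig_size (Suc N) nu - sig_size N mu) * psi0 th N nu mu +
     (\<Sum>j\<in>{1..N}. psi0 th N nu (mu(j := mu j + 1)) * lower0 th N (mu(j := mu j + 1)) j) =
     (\<Sum>i\<in>{1..Suc N}. lower0 th (Suc N) nu i * psi0 th N (nu(i := nu i - 1)) mu)"
proof (cases "mu \<in> interlacing N nu")
  case True
  define S where "S = {j \<in> {1..N}. mu j < nu j}"
  define L where "L = shifted th nu"
  define M where "M = shifted th mu"
  note sig = partitionD(1)[OF part]
  have partmu: "is_partition N mu" by (rule interlacing_partition[OF part True])
  have up: "(\<Sum>j\<in>{1..N}. psi0 th N nu (mu(j := mu j + 1)) * lower0 th N (mu(j := mu j + 1)) j) =
     (\<Sum>j\<in>S. jack_psi th N nu mu * ((M j + 1 + th * real N) * (\<Prod>b\<in>{1..N} - {j}. (M j - M b + 1 - th) / (M j - M b)) *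
      (\<Prod>a\<in>{1..Suc N}. (M j - L a) / (M j - L a - th + 1))))"
  proof (rule sum.mono_neutral_cong_right)
    show "\<forall>j\<in>{1..N} - S. psi0 th N nu (mu(j := mu j + 1)) * lower0 th N (mu(j := mu j + 1)) j = 0"
    proof
      fix j assume j: "j \<in> {1..N} - S"
      then have "mu(j := mu j + 1) \<notin> interlacing N nu"
        using interlacing_bounds(2)[of "mu(j := mu j + 1)" N nu j] by (auto simp: S_def)
      then show "psi0 th N nu (mu(j := mu j + 1)) * lower0 th N (mu(j := mu j + 1)) j = 0" by (simp add: psi0_def)
    qed
  next
    fix j assume j: "j \<in> S"
    then have j': "j \<in> {1..N}" "mu j < nu j" by (auto simp: S_def)
    have "mu(j := mu j + 1) \<in> interlacing N nu"
    proof -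
      have "(mu(j := mu j + 1)) b \<le> nu b \<and> nu (Suc b) \<le> (mu(j := mu j + 1)) b" if "1 \<le> b" "b \<le> N" for b
        using interlacing_bounds[OF True that] j' that by auto
      then show ?thesis using True j' by (auto simp: interlacing_def PiE_iff extensional_def)
    qed
    moreover have "j \<in> removable N (mu(j := mu j + 1))"
      using j' partmu by (simp add: removable_def)
    ultimately show "psi0 th N nu (mu(j := mu j + 1)) * lower0 th N (mu(j := mu j + 1)) j =
      jack_psi th N nu mu * ((M j + 1 + th * real N) * (\<Prod>b\<in>{1..N} - {j}. (M j - M b + 1 - th) / (M j - M b)) *
      (\<Prod>a\<in>{1..Suc N}. (M j - L a) / (M j - L a - th + 1)))"
      unfolding psi0_def lower0_def M_def L_def
      by (simp only: if_True lower_coeff_psi_up[OF th sig True j'])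
  qed (auto simp: S_def)
  have down: "(\<Sum>i\<in>{1..Suc N}. lower0 th (Suc N) nu i * psi0 th N (nu(i := nu i - 1)) mu) =
     (\<Sum>i\<in>insert (Suc N) S. jack_psi th N nu mu * ((L i + th * real (Suc N)) * (\<Prod>a\<in>{1..Suc N} - {i}. (L i - L a + th - 1) / (L i - L a)) *
      (\<Prod>b\<in>{1..N}. (M b - L i) / (M b - L i - th + 1))))"
  proof (rule sum.mono_neutral_cong_right)
    show "\<forall>i\<in>{1..Suc N} - insert (Suc N) S. lower0 th (Suc N) nu i * psi0 th N (nu(i := nu i - 1)) mu = 0"
    proof
      fix i assume i: "i \<in> {1..Suc N} - insert (Suc N) S"
      then have "mu \<notin> interlacing N (nu(i := nu i - 1))"
        using interlacing_bounds(2)[of mu N "nu(i := nu i - 1)" i] by (auto simp: S_def)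
      then show "lower0 th (Suc N) nu i * psi0 th N (nu(i := nu i - 1)) mu = 0" by (simp add: psi0_def)
    qed
  next
    fix i assume i: "i \<in> insert (Suc N) S"
    then have i': "i \<in> {1..Suc N}" "i \<le> N ==> mu i < nu i" by (auto simp: S_def)
    show "lower0 th (Suc N) nu i * psi0 th N (nu(i := nu i - 1)) mu =
      jack_psi th N nu mu * ((L i + th * real (Suc N)) * (\<Prod>a\<in>{1..Suc N} - {i}. (L i - L a + th - 1) / (L i - L a)) *
      (\<Prod>b\<in>{1..N}. (M b - L i) / (M b - L i - th + 1)))"
    \<comment> \<open>An empty last row cannot lose a box, so it is missing on the left. The
      corresponding summand of \<open>branching_identity\<close> vanishes as well, since L (N + 1) +
      th (N + 1) is the length of this row.\<close>
    proof (cases "i = Suc N \<and> nu (Suc N) = 0")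
      case z: True
      then have "i \<notin> removable (Suc N) nu" by (auto simp: removable_def is_partition_def)
      moreover have "L i + th * real (Suc N) = 0" using z by (simp add: L_def shifted_def algebra_simps)
      ultimately show ?thesis by (simp add: lower0_def)
    next
      case False
      have part': "is_partition (Suc N) (nu(i := nu i - 1))"
      proof (rule partitionI)
        fix k assume k: "1 \<le> k" "k < Suc N"
        show "(nu(i := nu i - 1)) (Suc k) \<le> (nu(i := nu i - 1)) k"
          using partitionD(3)[OF part, of k "Suc k"] interlacing_bounds[OF True, of k] i' k by auto
      next
        show "0 \<le> (nu(i := nu i - 1)) (Suc N)"
          using partitionD(2)[OF part, of "Suc N"] False by auto
      qed
      have "mu \<in> interlacing N (nu(i := nu i - 1))"
      proof -
        have "mu k \<le> (nu(i := nu i - 1)) k \<and> (nu(i := nu i - 1)) (Suc k) \<le> mu k" if "1 \<le> k" "k \<le> N" for k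
          using interlacing_bounds[OF True that] i' that by auto
        then show ?thesis using True by (auto simp: interlacing_def PiE_iff)
      qed
      moreover have "i \<in> removable (Suc N) nu" using i' part' by (simp add: removable_def)
      ultimately show ?thesis
        unfolding psi0_def lower0_def M_def L_def
        by (simp only: if_True lower_coeff_psi_down[OF th sig partitionD(1)[OF part'] True i'])
    qed
  qed (auto simp: S_def)
  show ?thesis
    unfolding up down sum_distrib_left[symmetric]
    unfolding L_def M_def S_def branching_identity[OF th sig True]
    by (simp only: psi0_def True if_True) (simp add: algebra_simps)
next
  case False
  note sig = partitionD(1)[OF part]
  have ext: "mu \<in> extensional {1..N}" using mu by (simp add: PiE_def)
  have b: "nu (Suc j) - 1 \<le> mu j" "mu j \<le> nu j" if "1 \<le> j" "j \<le> N" for j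
    using mu that by (auto simp: PiE_iff)
  \<comment> \<open>Within the given box interlacing can fail only at a lower bound, and there by
    exactly one.\<close>
  obtain j where j: "j \<in> {1..N}" "mu j < nu (Suc j)"
    using False b ext by (auto simp: interlacing_def PiE_iff not_le)
  then have tie: "mu j = nu (Suc j) - 1" using b[of j] by auto
  define mu' where "mu' = mu(j := mu j + 1)"
  define nu' where "nu' = nu(Suc j := nu (Suc j) - 1)"
  have bk: "mu'(j := mu' j - 1) = mu" by (simp add: mu'_def)
  have l: "(\<Sum>k\<in>{1..N}. psi0 th N nu (mu(k := mu k + 1)) * lower0 th N (mu(k := mu k + 1)) k) =
     psi0 th N nu mu' * lower0 th N mu' j"
  proof -
    have "(\<Sum>k\<in>{1..N}. psi0 th N nu (mu(k := mu k + 1)) * lower0 th N (mu(k := mu k + 1)) k) =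
      (\<Sum>k\<in>{j}. psi0 th N nu (mu(k := mu k + 1)) * lower0 th N (mu(k := mu k + 1)) k)"
    proof (rule sum.mono_neutral_right)
      show "\<forall>k\<in>{1..N} - {j}. psi0 th N nu (mu(k := mu k + 1)) * lower0 th N (mu(k := mu k + 1)) k = 0"
      proof
        fix k assume "k \<in> {1..N} - {j}"
        then have "mu(k := mu k + 1) \<notin> interlacing N nu"
          using j interlacing_bounds(1)[of "mu(k := mu k + 1)" N nu j] by auto
        then show "psi0 th N nu (mu(k := mu k + 1)) * lower0 th N (mu(k := mu k + 1)) k = 0"
          by (simp add: psi0_def)
      qed
    qed (use j in auto)
    then show ?thesis by (simp add: mu'_def)
  qed
  have r: "(\<Sum>i\<in>{1..Suc N}. lower0 th (Suc N) nu i * psi0 th N (nu(i := nu i - 1)) mu) =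
     lower0 th (Suc N) nu (Suc j) * psi0 th N nu' mu"
  proof -
    have "(\<Sum>i\<in>{1..Suc N}. lower0 th (Suc N) nu i * psi0 th N (nu(i := nu i - 1)) mu) =
       (\<Sum>i\<in>{Suc j}. lower0 th (Suc N) nu i * psi0 th N (nu(i := nu i - 1)) mu)"
    proof (rule sum.mono_neutral_right)
      show "\<forall>i\<in>{1..Suc N} - {Suc j}. lower0 th (Suc N) nu i * psi0 th N (nu(i := nu i - 1)) mu = 0"
      proof
        fix i assume "i \<in> {1..Suc N} - {Suc j}"
        then have "mu \<notin> interlacing N (nu(i := nu i - 1))"
          using j interlacing_bounds(1)[of mu N "nu(i := nu i - 1)" j] by auto
        then show "lower0 th (Suc N) nu i * psi0 th N (nu(i := nu i - 1)) mu = 0"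
          by (simp add: psi0_def)
      qed
    qed (use j in auto)
    then show ?thesis by (simp add: nu'_def)
  qed
  \<comment> \<open>Extension by zero must not destroy the comparison: the term on the left is
    present precisely when the one on the right is.\<close>
  have iff: "(mu' \<in> interlacing N nu \<and> j \<in> removable N mu') \<longleftrightarrow> (Suc j \<in> removable (Suc N) nu \<and> mu \<in> interlacing N nu')"
  proof
    assume *: "mu' \<in> interlacing N nu \<and> j \<in> removable N mu'"
    then have pm: "is_partition N mu" using bk by (simp add: removable_def)
    have lo: "nu (Suc k) \<le> mu k" if "1 \<le> k" "k \<le> N" "k \<noteq> j" for k
      using interlacing_bounds(1)[of mu' N nu k] * that by (auto simp: mu'_def)
    have "is_partition (Suc N) nu'"
    proof (rule partitionI)
      fix k assume k: "1 \<le> k" "k < Suc N"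
      show "nu' (Suc k) \<le> nu' k"
      proof (cases "k = Suc j")
        case True
        then show ?thesis using lo[of k] partitionD(3)[OF pm, of j k] k j tie by (auto simp: nu'_def)
      next
        case False
        then show ?thesis using partitionD(3)[OF part, of k "Suc k"] k by (auto simp: nu'_def)
      qed
    next
      show "0 \<le> nu' (Suc N)"
        using partitionD(2)[OF part, of "Suc N"] partitionD(2)[OF pm, of j] tie j by (auto simp: nu'_def)
    qed
    moreover have "mu \<in> interlacing N nu'"
    proof -
      have "mu k \<le> nu' k \<and> nu' (Suc k) \<le> mu k" if k: "1 \<le> k" "k \<le> N" for k
        using b[OF k] lo[OF k] partitionD(3)[OF pm, of j k] j tie k by (auto simp: nu'_def)
      then show ?thesis using ext by (auto simp: interlacing_def PiE_iff)
    qed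
    ultimately show "Suc j \<in> removable (Suc N) nu \<and> mu \<in> interlacing N nu'"
      using j by (simp add: removable_def nu'_def)
  next
    assume *: "Suc j \<in> removable (Suc N) nu \<and> mu \<in> interlacing N nu'"
    then have "is_partition (Suc N) nu'" by (simp add: removable_def nu'_def)
    then have "is_partition N mu" using interlacing_partition * by blast
    then have "j \<in> removable N mu'" using j bk by (simp add: removable_def)
    moreover have "mu' \<in> interlacing N nu"
    proof -
      have "mu' k \<le> nu k \<and> nu (Suc k) \<le> mu' k" if k: "1 \<le> k" "k \<le> N" for k
        using interlacing_bounds[of mu N nu' k] * k tie partitionD(3)[OF part, of k "Suc k"]
        by (auto simp: nu'_def mu'_def split: if_splits)
      moreover have "mu' \<in> extensional {1..N}" using ext j by (auto simp: mu'_def extensional_def)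
      ultimately show ?thesis by (auto simp: interlacing_def PiE_iff)
    qed
    ultimately show "mu' \<in> interlacing N nu \<and> j \<in> removable N mu'" by simp
  qed
  have eq: "psi0 th N nu mu' * lower0 th N mu' j = lower0 th (Suc N) nu (Suc j) * psi0 th N nu' mu"
  proof (cases "mu' \<in> interlacing N nu \<and> j \<in> removable N mu'")
    case True
    then have s: "Suc j \<in> removable (Suc N) nu" "mu \<in> interlacing N nu'" using iff by auto
    then have "antimono_on {1..Suc N} nu'" using partitionD(1)[of "Suc N" nu'] by (simp add: removable_def nu'_def)
    note tie_eq = lower_coeff_psi_tie[OF th sig _ j(1) _ this[unfolded nu'_def], of mu', unfolded bk nu'_def[symmetric]]
    have "mu' j = nu (Suc j)" by (simp add: mu'_def tie)
    then show ?thesis using tie_eq True s by (simp add: psi0_def lower0_def)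
  next
    case F: False
    then have "psi0 th N nu mu' * lower0 th N mu' j = 0" by (auto simp: psi0_def lower0_def)
    moreover have "lower0 th (Suc N) nu (Suc j) * psi0 th N nu' mu = 0" using F iff by (auto simp: psi0_def lower0_def)
    ultimately show ?thesis by (simp only:)
  qed
  show ?thesis unfolding l r eq using False by (simp add: psi0_def)
qed

lemma sig_size_Suc: "sig_size (Suc N) nu = sig_size N nu + nu (Suc N)"
  by (simp add: sig_size_def)

lemma sig_size_upd: "i \<in> {1..n} ==> sig_size n (nu(i := v)) = sig_size n nu - nu i + v"
proof -
  assume i: "i \<in> {1..n}"
  have "sum (nu(i := v)) ({1..n} - {i}) = sum nu ({1..n} - {i})" by (intro sum.cong) auto
  then have "sum (nu(i := v)) {1..n} = v + sum nu ({1..n} - {i})" using sum.remove[OF _ i, of "nu(i := v)"] by simp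
  moreover have "sum nu {1..n} = nu i + sum nu ({1..n} - {i})" using sum.remove[OF _ i, of nu] by simp
  ultimately show ?thesis by (simp add: sig_size_def)
qed

lemma sig_size_interlacing:
  assumes "mu \<in> interlacing N nu"
  shows "sig_size N mu \<le> sig_size N nu"
  unfolding sig_size_def by (intro sum_mono) (use interlacing_bounds(2)[OF assms] in auto)

lemma sig_size_interlacing':
  assumes "mu \<in> interlacing N nu" "is_partition (Suc N) nu"
  shows "sig_size N mu \<le> sig_size (Suc N) nu"
  using sig_size_interlacing[OF assms(1)] partitionD(2)[OF assms(2), of "Suc N"] by (simp add: sig_size_Suc)

text \<open>Induction on the number of variables: the product rule is applied to each term of the
  branching rule, the inner polynomials being differentiated by the induction hypothesis. Collecting
  the terms with equal inner polynomial leaves the scalar identity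
  \<open>lowering_coefficients\<close>.\<close>

lemma jack_lowering:
  assumes th: "th > 0" and part: "is_partition n nu"
  shows "((\<lambda>t. jack_nonneg th n nu (\<lambda>i. x i + t)) has_real_derivative
    (\<Sum>i\<in>removable n nu. lower_coeff th n nu i * jack_nonneg th n (nu(i := nu i - 1)) x)) (at 0)"
  using part
proof (induction n arbitrary: nu)
  case 0
  then show ?case by (simp add: removable_def)
next
  case (Suc N)
  define X where "X = x (Suc N)"
  define J where "J mu = jack_nonneg th N mu x" for mu
  define e where "e mu = X ^ nat (sig_size (Suc N) nu - 1 - sig_size N mu)" for mu
  \<comment> \<open>Lowering an interlacing sequence in one row may go below the lower bound by one.
    This box contains everything that occurs on either side.\<close>
  define B where "B = (\<Pi>\<^sub>E j\<in>{1..N}. {nu (Suc j) - 1..nu j})"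
  define k where "k mu = nat (sig_size (Suc N) nu - sig_size N mu)" for mu
  have finB: "finite B" unfolding B_def by (intro finite_PiE) auto
  have sub: "interlacing N nu \<subseteq> B" unfolding interlacing_def B_def by (intro PiE_mono) auto
  have sub': "interlacing N (nu(i := nu i - 1)) \<subseteq> B" for i
    unfolding interlacing_def B_def by (intro PiE_mono) auto
  have "((\<lambda>t. jack_nonneg th (Suc N) nu (\<lambda>i. x i + t)) has_real_derivative
     (\<Sum>mu\<in>interlacing N nu. jack_psi th N nu mu * (real (k mu) * X ^ (k mu - 1) * J mu +
       X ^ k mu * (\<Sum>j\<in>removable N mu. lower_coeff th N mu j * J (mu(j := mu j - 1)))))) (at 0)"
  proof -
    have "((\<lambda>t. jack_psi th N nu mu * (x (Suc N) + t) ^ k mu * jack_nonneg th N mu (\<lambda>i. x i + t)) has_real_derivative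
       jack_psi th N nu mu * (real (k mu) * X ^ (k mu - 1) * J mu +
       X ^ k mu * (\<Sum>j\<in>removable N mu. lower_coeff th N mu j * J (mu(j := mu j - 1))))) (at 0)"
      if "mu \<in> interlacing N nu" for mu
    proof -
      have "is_partition N mu" by (rule interlacing_partition[OF Suc.prems that])
      note D = Suc.IH[OF this]
      show ?thesis
        by (rule derivative_eq_intros D refl)+ (simp add: X_def J_def algebra_simps fun_upd_def)
    qed
    then show ?thesis unfolding jack_nonneg.simps k_def[symmetric] by (rule DERIV_sum)
  qed
  moreover have "(\<Sum>mu\<in>interlacing N nu. jack_psi th N nu mu * (real (k mu) * X ^ (k mu - 1) * J mu +
       X ^ k mu * (\<Sum>j\<in>removable N mu. lower_coeff th N mu j * J (mu(j := mu j - 1))))) =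
     (\<Sum>i\<in>removable (Suc N) nu. lower_coeff th (Suc N) nu i * jack_nonneg th (Suc N) (nu(i := nu i - 1)) x)"
  proof -
    have 1: "(\<Sum>mu\<in>interlacing N nu. jack_psi th N nu mu * (real (k mu) * X ^ (k mu - 1) * J mu)) =
       (\<Sum>mu\<in>B. of_int (sig_size (Suc N) nu - sig_size N mu) * psi0 th N nu mu * (e mu * J mu))"
    proof (rule sum.mono_neutral_cong_left[OF finB sub])
      fix mu assume m: "mu \<in> interlacing N nu"
      have "k mu - 1 = nat (sig_size (Suc N) nu - 1 - sig_size N mu)" by (simp add: k_def)
      moreover have "real (k mu) = of_int (sig_size (Suc N) nu - sig_size N mu)"
        using sig_size_interlacing'[OF m Suc.prems] by (simp add: k_def)
      ultimately show "jack_psi th N nu mu * (real (k mu) * X ^ (k mu - 1) * J mu) =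
         of_int (sig_size (Suc N) nu - sig_size N mu) * psi0 th N nu mu * (e mu * J mu)"
        using m by (simp add: psi0_def e_def)
    qed (simp add: psi0_def)
    have 2: "(\<Sum>mu\<in>interlacing N nu. jack_psi th N nu mu * (X ^ k mu * (\<Sum>j\<in>removable N mu. lower_coeff th N mu j * J (mu(j := mu j - 1))))) =
       (\<Sum>mu\<in>B. (\<Sum>j\<in>{1..N}. psi0 th N nu (mu(j := mu j + 1)) * lower0 th N (mu(j := mu j + 1)) j) * (e mu * J mu))"
    proof -
      have "(\<Sum>mu\<in>interlacing N nu. jack_psi th N nu mu * (X ^ k mu * (\<Sum>j\<in>removable N mu. lower_coeff th N mu j * J (mu(j := mu j - 1))))) =
        (\<Sum>mu\<in>interlacing N nu. \<Sum>j\<in>{1..N}. jack_psi th N nu mu * X ^ k mu * lower0 th N mu j * J (mu(j := mu j - 1)))"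
      proof (rule sum.cong[OF refl])
        fix mu
        have "(\<Sum>j\<in>removable N mu. lower_coeff th N mu j * J (mu(j := mu j - 1))) = (\<Sum>j\<in>{1..N}. lower0 th N mu j * J (mu(j := mu j - 1)))"
          by (rule sum.mono_neutral_cong_left) (auto simp: lower0_def removable_def)
        then show "jack_psi th N nu mu * (X ^ k mu * (\<Sum>j\<in>removable N mu. lower_coeff th N mu j * J (mu(j := mu j - 1)))) =
           (\<Sum>j\<in>{1..N}. jack_psi th N nu mu * X ^ k mu * lower0 th N mu j * J (mu(j := mu j - 1)))"
          by (simp only: sum_distrib_left mult.assoc)
      qed
      also have "\<dots> = (\<Sum>j\<in>{1..N}. \<Sum>mu\<in>interlacing N nu. jack_psi th N nu mu * X ^ k mu * lower0 th N mu j * J (mu(j := mu j - 1)))"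
        by (rule sum.swap)
      also have "\<dots> = (\<Sum>j\<in>{1..N}. \<Sum>mu\<in>B. psi0 th N nu (mu(j := mu j + 1)) * lower0 th N (mu(j := mu j + 1)) j * (e mu * J mu))"
      proof (rule sum.cong[OF refl])
        fix j assume j: "j \<in> {1..N}"
        have "(\<Sum>mu\<in>interlacing N nu. jack_psi th N nu mu * X ^ k mu * lower0 th N mu j * J (mu(j := mu j - 1))) =
          (\<Sum>mu\<in>{mu \<in> B. mu(j := mu j + 1) \<in> interlacing N nu}. psi0 th N nu (mu(j := mu j + 1)) * lower0 th N (mu(j := mu j + 1)) j * (e mu * J mu))"
        proof (rule sum.reindex_bij_witness[of _ "\<lambda>mu. mu(j := mu j + 1)" "\<lambda>mu. mu(j := mu j - 1)"])
          fix mu assume m: "mu \<in> interlacing N nu"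
          have "(mu(j := mu j - 1)) b \<le> nu b \<and> nu (Suc b) - 1 \<le> (mu(j := mu j - 1)) b" if "1 \<le> b" "b \<le> N" for b
            using interlacing_bounds[OF m that] by auto
          then show "mu(j := mu j - 1) \<in> {mu \<in> B. mu(j := mu j + 1) \<in> interlacing N nu}"
            using m j by (auto simp: B_def PiE_iff interlacing_def extensional_def)
          have "k mu = nat (sig_size (Suc N) nu - 1 - sig_size N (mu(j := mu j - 1)))"
            using j by (simp add: k_def sig_size_upd)
          then show "psi0 th N nu ((mu(j := mu j - 1))(j := (mu(j := mu j - 1)) j + 1)) *
            lower0 th N ((mu(j := mu j - 1))(j := (mu(j := mu j - 1)) j + 1)) j * (e (mu(j := mu j - 1)) * J (mu(j := mu j - 1))) =
            jack_psi th N nu mu * X ^ k mu * lower0 th N mu j * J (mu(j := mu j - 1))"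
            using m by (simp add: psi0_def e_def)
        qed auto
        also have "\<dots> = (\<Sum>mu\<in>B. psi0 th N nu (mu(j := mu j + 1)) * lower0 th N (mu(j := mu j + 1)) j * (e mu * J mu))"
          by (rule sum.mono_neutral_left[OF finB]) (auto simp: psi0_def)
        finally show "(\<Sum>mu\<in>interlacing N nu. jack_psi th N nu mu * X ^ k mu * lower0 th N mu j * J (mu(j := mu j - 1))) =
          (\<Sum>mu\<in>B. psi0 th N nu (mu(j := mu j + 1)) * lower0 th N (mu(j := mu j + 1)) j * (e mu * J mu))" .
      qed
      also have "\<dots> = (\<Sum>mu\<in>B. \<Sum>j\<in>{1..N}. psi0 th N nu (mu(j := mu j + 1)) * lower0 th N (mu(j := mu j + 1)) j * (e mu * J mu))"
        by (rule sum.swap)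
      finally show ?thesis by (simp only: sum_distrib_right)
    qed
    have 3: "(\<Sum>i\<in>removable (Suc N) nu. lower_coeff th (Suc N) nu i * jack_nonneg th (Suc N) (nu(i := nu i - 1)) x) =
      (\<Sum>mu\<in>B. (\<Sum>i\<in>{1..Suc N}. lower0 th (Suc N) nu i * psi0 th N (nu(i := nu i - 1)) mu) * (e mu * J mu))"
    proof -
      have "(\<Sum>i\<in>removable (Suc N) nu. lower_coeff th (Suc N) nu i * jack_nonneg th (Suc N) (nu(i := nu i - 1)) x) =
         (\<Sum>i\<in>{1..Suc N}. lower0 th (Suc N) nu i * jack_nonneg th (Suc N) (nu(i := nu i - 1)) x)"
        by (rule sum.mono_neutral_cong_left) (auto simp: lower0_def removable_def)
      also have "\<dots> = (\<Sum>i\<in>{1..Suc N}. \<Sum>mu\<in>B. lower0 th (Suc N) nu i * psi0 th N (nu(i := nu i - 1)) mu * (e mu * J mu))"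
      proof (rule sum.cong[OF refl])
        fix i assume i: "i \<in> {1..Suc N}"
        have "jack_nonneg th (Suc N) (nu(i := nu i - 1)) x = (\<Sum>mu\<in>B. psi0 th N (nu(i := nu i - 1)) mu * (e mu * J mu))"
          unfolding jack_nonneg.simps
        proof (rule sum.mono_neutral_cong_left[OF finB sub'])
          fix mu assume "mu \<in> interlacing N (nu(i := nu i - 1))"
          moreover have "sig_size (Suc N) (nu(i := nu i - 1)) - sig_size N mu = sig_size (Suc N) nu - 1 - sig_size N mu"
            using i by (simp add: sig_size_upd)
          ultimately show "jack_psi th N (nu(i := nu i - 1)) mu * x (Suc N) ^ nat (sig_size (Suc N) (nu(i := nu i - 1)) - sig_size N mu) * jack_nonneg th N mu x =
             psi0 th N (nu(i := nu i - 1)) mu * (e mu * J mu)"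
            by (simp add: psi0_def e_def J_def X_def)
        qed (auto simp: psi0_def)
        then show "lower0 th (Suc N) nu i * jack_nonneg th (Suc N) (nu(i := nu i - 1)) x =
           (\<Sum>mu\<in>B. lower0 th (Suc N) nu i * psi0 th N (nu(i := nu i - 1)) mu * (e mu * J mu))"
          by (simp only: sum_distrib_left mult.assoc)
      qed
      also have "\<dots> = (\<Sum>mu\<in>B. \<Sum>i\<in>{1..Suc N}. lower0 th (Suc N) nu i * psi0 th N (nu(i := nu i - 1)) mu * (e mu * J mu))"
        by (rule sum.swap)
      finally show ?thesis by (simp only: sum_distrib_right)
    qed
    show ?thesis
      unfolding distrib_left sum.distrib 1 2 3
      unfolding sum.distrib[symmetric] distrib_right[symmetric]
      by (intro sum.cong refl) (simp only: lowering_coefficients[OF th Suc.prems] B_def)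
  qed
  ultimately show ?case by (simp only:)
qed

section \<open>Shifts, stability, positivity and complements\<close>

lemma jack_nonneg_cong:
  "(\<And>i. 1 \<le> i ==> i \<le> n ==> nu i = nu' i) ==> (\<And>i. 1 \<le> i ==> i \<le> n ==> x i = y i) ==>
    jack_nonneg th n nu x = jack_nonneg th n nu' y"
proof (induction n arbitrary: nu nu')
  case (Suc N)
  have "interlacing N nu = interlacing N nu'"
    unfolding interlacing_def by (intro PiE_cong) (simp add: Suc.prems)
  moreover have "jack_psi th N nu mu = jack_psi th N nu' mu" for mu
    unfolding jack_psi_def by (intro prod.cong refl) (auto simp: Suc.prems(1))
  moreover have "sig_size (Suc N) nu = sig_size (Suc N) nu'"
    unfolding sig_size_def by (intro sum.cong refl) (auto intro!: Suc.prems(1))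
  moreover have "jack_nonneg th N mu x = jack_nonneg th N mu y" for mu
    by (rule Suc.IH) (auto simp: Suc.prems)
  ultimately show ?case using Suc.prems(2)[of "Suc N"] by simp
qed simp

text \<open>The branching coefficient depends only on differences of rows, so shifting all rows is a
  bijection of the summands; the exponent of the last variable grows by \<open>K\<close>.\<close>

lemma jack_nonneg_shift:
  assumes "is_partition n nu" "K \<ge> 0"
  shows "jack_nonneg th n (\<lambda>i. nu i + K) x = (\<Prod>i=1..n. x i) ^ nat K * jack_nonneg th n nu x"
  using assms(1)
proof (induction n arbitrary: nu)
  case (Suc N)
  define up where "up mu = restrict (\<lambda>i. mu i + K) {1..N}" for mu :: "nat => int"
  define dn where "dn mu = restrict (\<lambda>i. mu i - K) {1..N}" for mu :: "nat => int"
  have "jack_nonneg th (Suc N) (\<lambda>i. nu i + K) x =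
     (\<Sum>mu\<in>interlacing N nu. (\<Prod>i=1..Suc N. x i) ^ nat K *
       (jack_psi th N nu mu * x (Suc N) ^ nat (sig_size (Suc N) nu - sig_size N mu) * jack_nonneg th N mu x))"
    unfolding jack_nonneg.simps
  proof (rule sum.reindex_bij_witness[of _ up dn])
    fix mu assume m: "mu \<in> interlacing N (\<lambda>i. nu i + K)"
    have ud: "up (dn mu) = mu"
      using m by (auto simp: up_def dn_def interlacing_def PiE_iff extensional_def fun_eq_iff)
    then show "up (dn mu) = mu" .
    have mm: "dn mu \<in> interlacing N nu" using m by (force simp: dn_def interlacing_def PiE_iff)
    then show "dn mu \<in> interlacing N nu" .
    have J: "jack_nonneg th N mu x = jack_nonneg th N (\<lambda>i. dn mu i + K) x"
      by (rule jack_nonneg_cong) (auto simp: dn_def)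
    have J': "jack_nonneg th N mu x = (\<Prod>i=1..N. x i) ^ nat K * jack_nonneg th N (dn mu) x"
      unfolding J by (rule Suc.IH[OF interlacing_partition[OF Suc.prems mm]])
    have p: "jack_psi th N (\<lambda>i. nu i + K) mu = jack_psi th N nu (dn mu)"
      unfolding jack_psi_def by (intro prod.cong refl) (simp add: dn_def algebra_simps)
    have s: "sig_size (Suc N) (\<lambda>i. nu i + K) - sig_size N mu = sig_size (Suc N) nu - sig_size N (dn mu) + K"
    proof -
      have "sig_size N (dn mu) = sig_size N mu - int N * K"
        by (simp add: sig_size_def dn_def sum_subtractf)
      then show ?thesis by (simp add: sig_size_def sum.distrib algebra_simps)
    qed
    have "sig_size N (dn mu) \<le> sig_size (Suc N) nu" by (rule sig_size_interlacing'[OF mm Suc.prems])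
    then have s': "nat (sig_size (Suc N) (\<lambda>i. nu i + K) - sig_size N mu) = nat (sig_size (Suc N) nu - sig_size N (dn mu)) + nat K"
      unfolding s using assms(2) by (simp add: nat_add_distrib)
    show "(\<Prod>i=1..Suc N. x i) ^ nat K *
       (jack_psi th N nu (dn mu) * x (Suc N) ^ nat (sig_size (Suc N) nu - sig_size N (dn mu)) * jack_nonneg th N (dn mu) x) =
       jack_psi th N (\<lambda>i. nu i + K) mu * x (Suc N) ^ nat (sig_size (Suc N) (\<lambda>i. nu i + K) - sig_size N mu) * jack_nonneg th N mu x"
      unfolding J' p s' by (simp add: power_add power_mult_distrib)
  next
    fix mu assume m: "mu \<in> interlacing N nu"
    show "dn (up mu) = mu"
      using m by (auto simp: up_def dn_def interlacing_def PiE_iff extensional_def fun_eq_iff)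
    show "up mu \<in> interlacing N (\<lambda>i. nu i + K)" using m by (force simp: up_def interlacing_def PiE_iff)
  qed
  then show ?case by (simp add: sum_distrib_left)
qed simp

lemma jack_psi_restrict: "jack_psi th N nu (restrict nu {1..N}) = 1" if "th > 0" "antimono_on {1..Suc N} nu"
  unfolding jack_psi_def
proof (intro prod.neutral ballI)
  fix i j assume ij: "i \<in> {1..N}" "j \<in> {i..N}"
  define z where "z = of_int (nu i - nu j) + th * (real j - real i)"
  have "nu j \<le> nu i" using antimono_onD2[OF that(2), of i j] ij by auto
  then have "z \<ge> 0" using ij that(1) by (simp add: z_def)
  then have "pochhammer (z + th) n > 0" "pochhammer (z + 1) n > 0" for n
    using that(1) by (auto intro!: pochhammer_pos)
  then have nz: "pochhammer (z + th) n \<noteq> 0" "pochhammer (z + 1) n \<noteq> 0" for n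
    by (metis less_irrefl)+
  have r: "restrict nu {1..N} i = nu i" "restrict nu {1..N} j = nu j" using ij by auto
  show "pochhammer (of_int (restrict nu {1..N} i - restrict nu {1..N} j) + th * (real j - real i) + th) (nat (restrict nu {1..N} j - nu (Suc j))) /
      pochhammer (of_int (restrict nu {1..N} i - restrict nu {1..N} j) + th * (real j - real i) + 1) (nat (restrict nu {1..N} j - nu (Suc j))) *
      (pochhammer (of_int (nu i - restrict nu {1..N} j) + th * (real j - real i) + 1) (nat (restrict nu {1..N} j - nu (Suc j))) /
       pochhammer (of_int (nu i - restrict nu {1..N} j) + th * (real j - real i) + th) (nat (restrict nu {1..N} j - nu (Suc j)))) = 1"
    unfolding r z_def[symmetric] using nz by simp
qed

lemma restrict_interlacing: "antimono_on {1..Suc N} nu ==> restrict nu {1..N} \<in> interlacing N nu"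
  by (auto simp: interlacing_def PiE_iff antimono_onD2)

text \<open>Only the terms without the last variable survive. Their \<open>mu\<close> has the size
  of \<open>nu\<close>, which by interlacing forces \<open>nu (Suc N) = 0\<close> and
  \<open>mu\<close> to be the restriction of \<open>nu\<close>, with branching coefficient
  1.\<close>

lemma jack_nonneg_last_zero:
  assumes th: "th > 0" and part: "is_partition (Suc N) nu" and x: "x (Suc N) = 0"
  shows "jack_nonneg th (Suc N) nu x = (if nu (Suc N) = 0 then jack_nonneg th N nu x else 0)"
proof -
  define mu0 where "mu0 = restrict nu {1..N}"
  have m0: "mu0 \<in> interlacing N nu" unfolding mu0_def by (rule restrict_interlacing[OF partitionD(1)[OF part]])
  have s0: "sig_size N mu0 = sig_size N nu" by (simp add: sig_size_def mu0_def)
  have "jack_nonneg th (Suc N) nu x = (\<Sum>mu\<in>{mu0}. jack_psi th N nu mu * x (Suc N) ^ nat (sig_size (Suc N) nu - sig_size N mu) * jack_nonneg th N mu x)"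
    unfolding jack_nonneg.simps
  proof (rule sum.mono_neutral_right)
    show "\<forall>mu\<in>interlacing N nu - {mu0}. jack_psi th N nu mu * x (Suc N) ^ nat (sig_size (Suc N) nu - sig_size N mu) * jack_nonneg th N mu x = 0"
    proof
      fix mu assume m: "mu \<in> interlacing N nu - {mu0}"
      obtain i where i: "i \<in> {1..N}" "mu i \<noteq> nu i"
        using m by (auto simp: mu0_def interlacing_def PiE_iff extensional_def fun_eq_iff split: if_splits)
      have "sig_size N mu < sig_size N nu"
        unfolding sig_size_def
      proof (rule sum_strict_mono_ex1)
        show "\<forall>j\<in>{1..N}. mu j \<le> nu j" using interlacing_bounds(2)[of mu N nu] m by auto
        then show "\<exists>j\<in>{1..N}. mu j < nu j" using i by force
      qed simp
      then have "nat (sig_size (Suc N) nu - sig_size N mu) > 0"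
        using partitionD(2)[OF part, of "Suc N"] by (simp add: sig_size_Suc)
      then show "jack_psi th N nu mu * x (Suc N) ^ nat (sig_size (Suc N) nu - sig_size N mu) * jack_nonneg th N mu x = 0"
        using x by simp
    qed
  qed (use m0 finite_interlacing in auto)
  also have "\<dots> = x (Suc N) ^ nat (nu (Suc N)) * jack_nonneg th N mu0 x"
    using jack_psi_restrict[OF th partitionD(1)[OF part], folded mu0_def] by (simp add: s0 sig_size_Suc)
  also have "jack_nonneg th N mu0 x = jack_nonneg th N nu x" by (rule jack_nonneg_cong) (auto simp: mu0_def)
  finally show ?thesis using x partitionD(2)[OF part, of "Suc N"] by auto
qed

lemma jack_nonneg_pos:
  assumes th: "th > 0"
  shows "antimono_on {1..n} nu ==> (\<And>i. 1 \<le> i ==> i \<le> n ==> 0 < x i) ==> jack_nonneg th n nu x > 0"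
proof (induction n arbitrary: nu)
  case (Suc N)
  show ?case unfolding jack_nonneg.simps
  proof (rule sum_pos[OF finite_interlacing])
    show "interlacing N nu \<noteq> {}" using restrict_interlacing[OF Suc.prems(1)] by auto
    fix mu assume m: "mu \<in> interlacing N nu"
    have "jack_nonneg th N mu x > 0" using interlacing_antimono[OF m Suc.prems(1)] by (rule Suc.IH) (auto intro: Suc.prems(2))
    moreover have "x (Suc N) > 0" by (rule Suc.prems(2)) auto
    ultimately show "0 < jack_psi th N nu mu * x (Suc N) ^ nat (sig_size (Suc N) nu - sig_size N mu) * jack_nonneg th N mu x"
      using jack_psi_pos[OF th Suc.prems(1) m] by simp
  qed
qed simp

text \<open>The complement in a rectangle of n rows and K columns, turned by 180 degrees. On
  polynomials it corresponds to inverting all variables; this is how statements on removing boxes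
  become statements on adding boxes.\<close>

definition complement :: "nat => int => (nat => int) => nat => int" where
  "complement n K nu = (\<lambda>i. K - nu (Suc n - i))"

lemma pair_prod_reflect:
  fixes F :: "nat => nat => real"
  shows "(\<Prod>i\<in>{1..n}. \<Prod>b\<in>{i<..n}. F i b) = (\<Prod>i\<in>{1..n}. \<Prod>b\<in>{i<..n}. F (Suc n - b) (Suc n - i))"
proof -
  define f where "f = (\<lambda>(i, b). (Suc n - b, Suc n - i))"
  have "(\<Prod>(i, b)\<in>Sigma {1..n} (\<lambda>i. {i<..n}). F i b) =
     (\<Prod>(i, b)\<in>Sigma {1..n} (\<lambda>i. {i<..n}). F (Suc n - b) (Suc n - i))"
    by (rule prod.reindex_bij_witness[of _ f f]) (auto simp: f_def)
  then show ?thesis by (simp add: prod.Sigma)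
qed

lemma cweight_cong: "(\<And>i. 1 \<le> i ==> i \<le> n ==> nu i = nu' i) ==> cweight th n nu = cweight th n nu'"
  unfolding cweight_def by (intro prod.cong refl) auto

lemma bweight_cong: "(\<And>i. 1 \<le> i ==> i \<le> n ==> nu i = nu' i) ==> bweight th n nu = bweight th n nu'"
  unfolding bweight_def by (intro prod.cong refl) auto

lemma partition_cong: "(\<And>i. 1 \<le> i ==> i \<le> n ==> nu i = nu' i) ==> is_partition n nu = is_partition n nu'"
  by (auto simp: is_partition_def monotone_on_def)

lemma cweight_complement: "cweight th n (complement n K nu) = cweight th n nu"
  unfolding cweight_def complement_def
  by (subst (2) pair_prod_reflect) (intro prod.cong refl, auto simp: of_nat_diff algebra_simps)

lemma bweight_complement: "bweight th n (complement n K nu) = bweight th n nu"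
  unfolding bweight_def complement_def
  by (subst (2) pair_prod_reflect) (intro prod.cong refl, auto simp: of_nat_diff algebra_simps)

text \<open>The rotation sends the pair (a, j) to (N + 2 - a, N + 1 - j) and changes the sign of the
  difference of the rows. This interchanges the two branches of \<open>cross\<close> and preserves
  its value.\<close>

lemma aweight_complement:
  "aweight th N (complement (Suc N) K nu) (complement N K mu) = aweight th N nu mu"
proof -
  have c: "cross th (Suc (Suc N) - a) (Suc N - j) (- n) = cross th a j n" if "j \<in> {1..N}" "a \<in> {1..Suc N}" for a j n
    using that by (auto simp: cross_def of_nat_diff algebra_simps)
  have "aweight th N (complement (Suc N) K nu) (complement N K mu) =
     (\<Prod>j\<in>{1..N}. \<Prod>a\<in>{1..Suc N}. cross th (Suc (Suc N) - a) (Suc N - j)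
       (complement N K mu (Suc N - j) - complement (Suc N) K nu (Suc (Suc N) - a)))"
    unfolding aweight_def
    by (subst prod.atLeastAtMost_rev, subst (2) prod.atLeastAtMost_rev) simp
  also have "\<dots> = aweight th N nu mu"
    unfolding aweight_def
  proof (intro prod.cong refl)
    fix j a assume ja: "j \<in> {1..N}" "a \<in> {1..Suc N}"
    have "complement N K mu (Suc N - j) - complement (Suc N) K nu (Suc (Suc N) - a) = - (mu j - nu a)"
      using ja by (simp add: complement_def)
    then show "cross th (Suc (Suc N) - a) (Suc N - j)
       (complement N K mu (Suc N - j) - complement (Suc N) K nu (Suc (Suc N) - a)) = cross th a j (mu j - nu a)"
      by (simp only: c[OF ja])
  qed
  finally show ?thesis .
qed

lemma aweight_cong: "(\<And>i. 1 \<le> i ==> i \<le> N ==> mu i = mu' i) ==> aweight th N nu mu = aweight th N nu mu'"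
  unfolding aweight_def by (intro prod.cong refl) auto

lemma complement_antimono:
  assumes "antimono_on {1..n} nu"
  shows "antimono_on {1..n} (complement n K nu)"
proof (rule monotone_onI)
  fix i j assume ij: "i \<in> {1..n}" "j \<in> {1..n}" "i \<le> j"
  have "nu (Suc n - i) \<le> nu (Suc n - j)"
    by (rule antimono_onD2[OF assms]) (use ij in auto)
  then show "complement n K nu j \<le> complement n K nu i" by (simp add: complement_def)
qed

lemma complement_partition:
  assumes "antimono_on {1..n} nu" "\<And>i. 1 \<le> i ==> i \<le> n ==> nu i \<le> K"
  shows "is_partition n (complement n K nu)"
proof -
  have "0 \<le> complement n K nu i" if "i \<in> {1..n}" for i
    using assms(2)[of "Suc n - i"] that by (auto simp: complement_def)
  then show ?thesis using complement_antimono[OF assms(1)] by (auto simp: is_partition_def)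
qed

lemma interlacing_complement:
  assumes "mu \<in> interlacing N nu"
  shows "restrict (complement N K mu) {1..N} \<in> interlacing N (complement (Suc N) K nu)"
proof -
  have "K - nu (Suc (Suc N) - Suc i) \<le> K - mu (Suc N - i) \<and> K - mu (Suc N - i) \<le> K - nu (Suc (Suc N) - i)"
    if "1 \<le> i" "i \<le> N" for i
    using interlacing_bounds[OF assms, of "Suc N - i"] that by (auto simp: Suc_diff_le)
  then show ?thesis by (auto simp: interlacing_def complement_def PiE_iff)
qed

lemma jack_psi_complement:
  assumes "th > 0" "antimono_on {1..Suc N} nu" "mu \<in> interlacing N nu"
  shows "jack_psi th N (complement (Suc N) K nu) (restrict (complement N K mu) {1..N}) = jack_psi th N nu mu"
proof -
  have 1: "aweight th N (complement (Suc N) K nu) (restrict (complement N K mu) {1..N}) = aweight th N nu mu"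
    by (subst aweight_cong[of N _ "complement N K mu"]) (auto simp: aweight_complement)
  have 2: "bweight th N (restrict (complement N K mu) {1..N}) = bweight th N mu"
    by (subst bweight_cong[of N _ "complement N K mu"]) (auto simp: bweight_complement)
  show ?thesis
    unfolding jack_psi_gratio[OF assms]
      jack_psi_gratio[OF assms(1) complement_antimono[OF assms(2)] interlacing_complement[OF assms(3)]]
    by (simp only: 1 2 cweight_complement)
qed

lemma sig_size_complement: "sig_size n (complement n K nu) = int n * K - sig_size n nu"
proof -
  have "(\<Sum>i=1..n. nu (Suc n - i)) = (\<Sum>i=1..n. nu i)"
    by (subst (2) sum.atLeastAtMost_rev) simp
  then show ?thesis by (simp add: sig_size_def complement_def sum_subtractf)
qed

lemma complement_twice:
  "mu \<in> extensional {1..N} ==> restrict (complement N K (restrict (complement N K mu) {1..N})) {1..N} = mu"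
  by (auto simp: fun_eq_iff complement_def extensional_def)

text \<open>Complementation permutes the summands of the branching rule with equal coefficients, and
  an exponent d of the last variable becomes K - d.\<close>

lemma jack_nonneg_complement:
  assumes "th > 0" "\<And>i. 1 \<le> i ==> i \<le> n ==> x i \<noteq> 0"
  shows "is_partition n nu ==> (\<And>i. 1 \<le> i ==> i \<le> n ==> nu i \<le> K) ==>
    jack_nonneg th n nu x = (\<Prod>i=1..n. x i) ^ nat K * jack_nonneg th n (complement n K nu) (\<lambda>i. 1 / x i)"
  using assms(2)
proof (induction n arbitrary: nu)
  case (Suc N)
  note part = Suc.prems(1)
  define c where "c mu = restrict (complement N K mu) {1..N}" for mu
  have partc: "is_partition (Suc N) (complement (Suc N) K nu)"
    by (rule complement_partition[OF partitionD(1)[OF part] Suc.prems(2)])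
  have X: "x (Suc N) \<noteq> 0" by (rule Suc.prems(3)) auto
  have "(\<Sum>mu\<in>interlacing N nu. jack_psi th N nu mu * x (Suc N) ^ nat (sig_size (Suc N) nu - sig_size N mu) * jack_nonneg th N mu x) =
     (\<Sum>mu\<in>interlacing N (complement (Suc N) K nu). (\<Prod>i=1..Suc N. x i) ^ nat K *
       (jack_psi th N (complement (Suc N) K nu) mu * (1 / x (Suc N)) ^ nat (sig_size (Suc N) (complement (Suc N) K nu) - sig_size N mu) *
        jack_nonneg th N mu (\<lambda>i. 1 / x i)))"
  proof (rule sum.reindex_bij_witness[of _ c c])
    fix mu assume m: "mu \<in> interlacing N nu"
    then show "c (c mu) = mu" unfolding c_def by (intro complement_twice) (auto simp: interlacing_def PiE_def)
    show mc: "c mu \<in> interlacing N (complement (Suc N) K nu)" unfolding c_def by (rule interlacing_complement[OF m])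
    have mK: "mu i \<le> K" if "1 \<le> i" "i \<le> N" for i
      using interlacing_bounds(2)[OF m that] Suc.prems(2)[of i] that by auto
    have J: "jack_nonneg th N mu x = (\<Prod>i=1..N. x i) ^ nat K * jack_nonneg th N (complement N K mu) (\<lambda>i. 1 / x i)"
      using interlacing_partition[OF part m] mK by (rule Suc.IH) (use Suc.prems(3) in auto)
    have J': "jack_nonneg th N (complement N K mu) (\<lambda>i. 1 / x i) = jack_nonneg th N (c mu) (\<lambda>i. 1 / x i)"
      by (rule jack_nonneg_cong) (auto simp: c_def)
    have "sig_size N (c mu) = sig_size N (complement N K mu)" by (simp add: sig_size_def c_def)
    then have s: "sig_size (Suc N) (complement (Suc N) K nu) - sig_size N (c mu) = K - (sig_size (Suc N) nu - sig_size N mu)"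
      by (simp add: sig_size_complement algebra_simps)
    have le: "0 \<le> sig_size (Suc N) nu - sig_size N mu" "0 \<le> K - (sig_size (Suc N) nu - sig_size N mu)"
      using sig_size_interlacing'[OF m part] sig_size_interlacing'[OF mc partc] s by auto
    define p q where "p = nat (sig_size (Suc N) nu - sig_size N mu)" and "q = nat (K - (sig_size (Suc N) nu - sig_size N mu))"
    have "nat K = p + q" using le by (simp add: p_def q_def nat_add_distrib[symmetric])
    then have "x (Suc N) ^ nat K * (1 / x (Suc N)) ^ q = x (Suc N) ^ p"
      using X by (simp add: power_add power_divide)
    then show "(\<Prod>i=1..Suc N. x i) ^ nat K *
       (jack_psi th N (complement (Suc N) K nu) (c mu) * (1 / x (Suc N)) ^ nat (sig_size (Suc N) (complement (Suc N) K nu) - sig_size N (c mu)) *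
        jack_nonneg th N (c mu) (\<lambda>i. 1 / x i)) =
       jack_psi th N nu mu * x (Suc N) ^ nat (sig_size (Suc N) nu - sig_size N mu) * jack_nonneg th N mu x"
      unfolding J J' s p_def[symmetric] q_def[symmetric]
      unfolding c_def jack_psi_complement[OF assms(1) partitionD(1)[OF part] m]
      by (simp add: power_mult_distrib mult_ac)
  next
    fix mu assume m: "mu \<in> interlacing N (complement (Suc N) K nu)"
    then show "c (c mu) = mu" unfolding c_def by (intro complement_twice) (auto simp: interlacing_def PiE_def)
    have "c mu \<in> interlacing N (complement (Suc N) K (complement (Suc N) K nu))"
      unfolding c_def by (rule interlacing_complement[OF m])
    also have "interlacing N (complement (Suc N) K (complement (Suc N) K nu)) = interlacing N nu"
      unfolding interlacing_def by (intro PiE_cong) (auto simp: complement_def)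
    finally show "c mu \<in> interlacing N nu" .
  qed
  then show ?case by (simp add: sum_distrib_left)
qed simp

section \<open>The raising operators\<close>

definition addable :: "nat => (nat => int) => nat set" where
  "addable n nu = {k \<in> {1..n}. is_partition n (nu(k := nu k + 1))}"

text \<open>The Pieri coefficient for a box added to row \<open>k\<close>, see
  \<open>jack_pieri\<close>. It is what remains of \<open>lower_coeff\<close> of the complement when
  the linear factor K - (shifted + th) is split off (\<open>lower_coeff_complement\<close>); in
  particular it does not depend on the rectangle.\<close>

definition raise_coeff :: "real => nat => (nat => int) => nat => real" where
  "raise_coeff th n nu k =
    (\<Prod>b\<in>{1..n} - {k}. (shifted th nu b - shifted th nu k + th - 1) / (shifted th nu b - shifted th nu k)) *
    (cweight th n (nu(k := nu k + 1)) / cweight th n nu)"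

lemma complement_upd:
  assumes "k \<in> {1..n}" "1 \<le> i" "i \<le> n"
  shows "((complement n K nu)(Suc n - k := complement n K nu (Suc n - k) - 1)) i = complement n K (nu(k := nu k + 1)) i"
  using assms by (auto simp: complement_def)

lemma partition_complement_upd:
  assumes "k \<in> {1..n}"
  shows "is_partition n ((complement n K nu)(Suc n - k := complement n K nu (Suc n - k) - 1)) = is_partition n (complement n K (nu(k := nu k + 1)))"
  by (rule partition_cong) (rule complement_upd[OF assms])

lemma lower_coeff_complement:
  assumes k: "k \<in> {1..n}"
  shows "lower_coeff th n (complement n K nu) (Suc n - k) = (of_int K - (shifted th nu k + th)) * raise_coeff th n nu k"
proof -
  have s: "shifted th (complement n K nu) (Suc n - b) = of_int K - shifted th nu b - th * real (Suc n)" if "b \<in> {1..n}" for b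
    using that by (simp add: shifted_def complement_def of_nat_diff algebra_simps)
  have diff: "shifted th (complement n K nu) (Suc n - k) - shifted th (complement n K nu) a = shifted th nu (Suc n - a) - shifted th nu k"
    if "a \<in> {1..n}" for a
  proof -
    have "Suc n - a \<in> {1..n}" "Suc n - (Suc n - a) = a" using that by auto
    with s[OF k] s[of "Suc n - a"] show ?thesis by simp
  qed
  have "cweight th n ((complement n K nu)(Suc n - k := complement n K nu (Suc n - k) - 1)) = cweight th n (nu(k := nu k + 1))"
    by (subst cweight_cong[OF complement_upd[OF k]]) (auto simp: cweight_complement)
  moreover have "(\<Prod>b\<in>{1..n} - {Suc n - k}. (shifted th (complement n K nu) (Suc n - k) - shifted th (complement n K nu) b + th - 1) /
      (shifted th (complement n K nu) (Suc n - k) - shifted th (complement n K nu) b)) =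
     (\<Prod>b\<in>{1..n} - {k}. (shifted th nu b - shifted th nu k + th - 1) / (shifted th nu b - shifted th nu k))"
    by (rule prod.reindex_bij_witness[of _ "\<lambda>b. Suc n - b" "\<lambda>b. Suc n - b"])
      (use k in \<open>auto simp: diff[unfolded One_nat_def atLeastAtMost_iff]\<close>)
  moreover have "shifted th (complement n K nu) (Suc n - k) + th * real n = of_int K - (shifted th nu k + th)"
    by (simp add: s[OF k] algebra_simps)
  ultimately show ?thesis
    unfolding lower_coeff_def raise_coeff_def cweight_complement by (simp only: mult.assoc)
qed

lemma flow_prod_derivative:
  "((\<lambda>t. \<Prod>i=1..n. x i / (1 - t * x i)) has_real_derivative (\<Prod>i=1..n. x i) * (\<Sum>i=1..n. x i :: real)) (at 0)" for n :: nat
proof (induction n)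
  case (Suc n)
  have 1: "((\<lambda>t. x (Suc n) / (1 - t * x (Suc n))) has_real_derivative x (Suc n) * x (Suc n)) (at 0)"
    by (auto intro!: derivative_eq_intros)
  show ?case
    using DERIV_mult[OF Suc 1] by (simp add: algebra_simps)
qed simp

text \<open>In the variables 1 / x i the flow x i / (1 - t x i) is the translation by -t, so
  \<open>jack_lowering\<close> applies to the complement. The term with the sum of the variables is
  the derivative of the prefactor. The strict bound on the rows leaves room in the rectangle for one
  more box.\<close>

lemma jack_flow_complement:
  assumes th: "th > 0" and part: "is_partition n nu" and x: "\<And>i. 1 \<le> i ==> i \<le> n ==> 0 < x i"
    and K: "0 \<le> K" "\<And>i. 1 \<le> i ==> i \<le> n ==> nu i < K"
  shows "((\<lambda>t. jack_nonneg th n nu (\<lambda>i. x i / (1 - t * x i))) has_real_derivative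
    of_int K * ((\<Sum>i=1..n. x i) * jack_nonneg th n nu x) -
    (\<Sum>k\<in>addable n nu. (of_int K - (shifted th nu k + th)) * raise_coeff th n nu k * jack_nonneg th n (nu(k := nu k + 1)) x)) (at 0)"
proof -
  define c where "c = complement n K nu"
  define P where "P = (\<Prod>i=1..n. x i) ^ nat K"
  have xnz: "x i \<noteq> 0" if "1 \<le> i" "i \<le> n" for i using x[OF that] by simp
  have partc: "is_partition n c"
    unfolding c_def by (rule complement_partition[OF partitionD(1)[OF part]]) (use K in \<open>auto intro: less_imp_le\<close>)
  have "((\<lambda>t. jack_nonneg th n c (\<lambda>i. 1 / x i + t)) has_real_derivative
     (\<Sum>i\<in>removable n c. lower_coeff th n c i * jack_nonneg th n (c(i := c i - 1)) (\<lambda>i. 1 / x i))) (at (- 0))"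
    using jack_lowering[OF th partc] by simp
  then have "((\<lambda>t. (\<lambda>t. jack_nonneg th n c (\<lambda>i. 1 / x i + t)) (- t)) has_real_derivative
     (\<Sum>i\<in>removable n c. lower_coeff th n c i * jack_nonneg th n (c(i := c i - 1)) (\<lambda>i. 1 / x i)) * (- 1)) (at 0)"
    by (rule DERIV_chain2[where g = uminus]) (auto intro!: derivative_eq_intros)
  then have D1: "((\<lambda>t. jack_nonneg th n c (\<lambda>i. 1 / x i - t)) has_real_derivative
     - (\<Sum>i\<in>removable n c. lower_coeff th n c i * jack_nonneg th n (c(i := c i - 1)) (\<lambda>i. 1 / x i))) (at 0)"
    by simp
  have D2: "((\<lambda>t. (\<Prod>i=1..n. x i / (1 - t * x i)) ^ nat K) has_real_derivative of_int K * (\<Sum>i=1..n. x i) * P) (at 0)"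
  proof -
    have "real (nat K) * ((\<Prod>i=1..n. x i) * (\<Sum>i=1..n. x i) * (\<Prod>i=1..n. x i / (1 - 0 * x i)) ^ (nat K - Suc 0)) =
        of_int K * (\<Sum>i=1..n. x i) * P"
    proof (cases "K = 0")
      case False
      then obtain m where "nat K = Suc m" using K(1) by (metis gr0_implies_Suc nat_0_iff not_gr_zero order_antisym)
      then have "P = (\<Prod>i=1..n. x i) * (\<Prod>i=1..n. x i) ^ (nat K - Suc 0)" by (simp add: P_def)
      then show ?thesis using K(1) by (simp add: mult_ac)
    qed simp
    with DERIV_power[OF flow_prod_derivative[of x n], of "nat K"] show ?thesis by (simp only:)
  qed
  \<comment> \<open>The inversion of variables requires nonzero arguments, which the flow provides
    for small t only; this suffices for a derivative at 0.\<close>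
  have ev: "\<forall>\<^sub>F t in nhds 0. \<forall>i\<in>{1..n}. 1 - t * x i > 0"
  proof (intro eventually_ball_finite ballI)
    fix i
    have "open {t. 0 < 1 - t * x i}" by (intro open_Collect_less continuous_intros)
    from eventually_nhds_in_open[OF this, of 0] show "\<forall>\<^sub>F t in nhds 0. 1 - t * x i > 0" by simp
  qed simp
  have "\<forall>\<^sub>F t in nhds 0. jack_nonneg th n nu (\<lambda>i. x i / (1 - t * x i)) =
      (\<Prod>i=1..n. x i / (1 - t * x i)) ^ nat K * jack_nonneg th n c (\<lambda>i. 1 / x i - t)"
    using ev
  proof eventually_elim
    case (elim t)
    have nz: "x i / (1 - t * x i) \<noteq> 0" if "1 \<le> i" "i \<le> n" for i
      using xnz[OF that] elim that by (metis atLeastAtMost_iff divide_eq_0_iff less_irrefl)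
    have "jack_nonneg th n c (\<lambda>i. 1 / (x i / (1 - t * x i))) = jack_nonneg th n c (\<lambda>i. 1 / x i - t)"
      by (rule jack_nonneg_cong) (use xnz in \<open>auto simp: field_simps\<close>)
    then show ?case
      using jack_nonneg_complement[where x = "\<lambda>i. x i / (1 - t * x i)" and K = K, OF th nz part] K(2) by (simp add: c_def less_imp_le)
  qed
  moreover have "((\<lambda>t. (\<Prod>i=1..n. x i / (1 - t * x i)) ^ nat K * jack_nonneg th n c (\<lambda>i. 1 / x i - t)) has_real_derivative
     of_int K * ((\<Sum>i=1..n. x i) * (P * jack_nonneg th n c (\<lambda>i. 1 / x i))) -
     (\<Sum>i\<in>removable n c. lower_coeff th n c i * (P * jack_nonneg th n (c(i := c i - 1)) (\<lambda>i. 1 / x i)))) (at 0)"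
  proof -
    have S: "(\<Sum>i\<in>removable n c. lower_coeff th n c i * (P * jack_nonneg th n (c(i := c i - 1)) (\<lambda>i. 1 / x i))) =
       P * (\<Sum>i\<in>removable n c. lower_coeff th n c i * jack_nonneg th n (c(i := c i - 1)) (\<lambda>i. 1 / x i))"
      by (simp add: sum_distrib_left mult_ac)
    show ?thesis unfolding S by (rule DERIV_cong[OF DERIV_mult[OF D2 D1]]) (simp add: P_def mult_ac)
  qed
  ultimately have "((\<lambda>t. jack_nonneg th n nu (\<lambda>i. x i / (1 - t * x i))) has_real_derivative
     of_int K * ((\<Sum>i=1..n. x i) * (P * jack_nonneg th n c (\<lambda>i. 1 / x i))) -
     (\<Sum>i\<in>removable n c. lower_coeff th n c i * (P * jack_nonneg th n (c(i := c i - 1)) (\<lambda>i. 1 / x i)))) (at 0)"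
    by (subst DERIV_cong_ev[OF refl _ refl]) auto
  moreover have "P * jack_nonneg th n c (\<lambda>i. 1 / x i) = jack_nonneg th n nu x"
    using jack_nonneg_complement[where x = x and K = K, OF th xnz part] K(2) by (simp add: c_def P_def less_imp_le)
  moreover have "(\<Sum>i\<in>removable n c. lower_coeff th n c i * (P * jack_nonneg th n (c(i := c i - 1)) (\<lambda>i. 1 / x i))) =
    (\<Sum>k\<in>addable n nu. (of_int K - (shifted th nu k + th)) * raise_coeff th n nu k * jack_nonneg th n (nu(k := nu k + 1)) x)"
  proof (rule sum.reindex_bij_witness[of _ "\<lambda>k. Suc n - k" "\<lambda>k. Suc n - k"])
    fix i assume i: "i \<in> removable n c"
    then have i': "i \<in> {1..n}" by (simp add: removable_def)
    define k where "k = Suc n - i"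
    have k: "k \<in> {1..n}" "i = Suc n - k" using i' by (auto simp: k_def)
    show "Suc n - (Suc n - i) = i" using i' by auto
    have "is_partition n (complement n K (nu(k := nu k + 1)))"
      using i partition_complement_upd[OF k(1), of K nu] by (simp add: removable_def c_def k(2)[symmetric])
    note pc = this
    have le: "complement n K (nu(k := nu k + 1)) b \<le> K" if b: "1 \<le> b" "b \<le> n" for b
      using partitionD(2)[OF part, of "Suc n - b"] b by (auto simp: complement_def)
    have "is_partition n (complement n K (complement n K (nu(k := nu k + 1))))"
      by (rule complement_partition[OF partitionD(1)[OF pc] le])
    moreover have "is_partition n (complement n K (complement n K (nu(k := nu k + 1)))) = is_partition n (nu(k := nu k + 1))"
      by (rule partition_cong) (auto simp: complement_def)
    ultimately have pk: "is_partition n (nu(k := nu k + 1))" by simp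
    then show "Suc n - i \<in> addable n nu" unfolding k_def[symmetric] using k(1) by (simp add: addable_def)
    have "jack_nonneg th n (c(i := c i - 1)) (\<lambda>i. 1 / x i) = jack_nonneg th n (complement n K (nu(k := nu k + 1))) (\<lambda>i. 1 / x i)"
      unfolding c_def k(2) by (rule jack_nonneg_cong, rule complement_upd[OF k(1)], auto)
    moreover have "(nu(k := nu k + 1)) b \<le> K" if "1 \<le> b" "b \<le> n" for b using K(2)[OF that] by auto
    note jack_nonneg_complement[where x = x, OF th xnz pk this]
    ultimately have "P * jack_nonneg th n (c(i := c i - 1)) (\<lambda>i. 1 / x i) = jack_nonneg th n (nu(k := nu k + 1)) x"
      by (simp only: P_def)
    then show "(of_int K - (shifted th nu (Suc n - i) + th)) * raise_coeff th n nu (Suc n - i) * jack_nonneg th n (nu(Suc n - i := nu (Suc n - i) + 1)) x =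
       lower_coeff th n c i * (P * jack_nonneg th n (c(i := c i - 1)) (\<lambda>i. 1 / x i))"
      using lower_coeff_complement[OF k(1), of th K nu] by (simp add: c_def k(2)[symmetric] k_def[symmetric])
  next
    fix k assume k: "k \<in> addable n nu"
    then have k': "k \<in> {1..n}" "is_partition n (nu(k := nu k + 1))" by (simp_all add: addable_def)
    show "Suc n - (Suc n - k) = k" using k' by auto
    have "is_partition n (complement n K (nu(k := nu k + 1)))"
      by (rule complement_partition[OF partitionD(1)[OF k'(2)]]) (use K(2) in force)
    then show "Suc n - k \<in> removable n c"
      using partition_complement_upd[OF k'(1), of K nu] k' by (auto simp: removable_def c_def)
  qed
  ultimately show ?thesis by (simp only:)
qed

text \<open>The derivative computed in \<open>jack_flow_complement\<close> cannot depend on the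
  width K of the auxiliary rectangle, but the formula is affine in K. Comparing two widths shows
  that the coefficient of K vanishes, which is the Pieri rule, and what is left is the raising
  formula.\<close>

lemma
  assumes th: "th > 0" and part: "is_partition n nu" and x: "\<And>i. 1 \<le> i ==> i \<le> n ==> 0 < x i"
  shows jack_pieri: "(\<Sum>i=1..n. x i) * jack_nonneg th n nu x =
      (\<Sum>k\<in>addable n nu. raise_coeff th n nu k * jack_nonneg th n (nu(k := nu k + 1)) x)"
    and jack_raising: "((\<lambda>t. jack_nonneg th n nu (\<lambda>i. x i / (1 - t * x i))) has_real_derivative
      (\<Sum>k\<in>addable n nu. (shifted th nu k + th) * raise_coeff th n nu k * jack_nonneg th n (nu(k := nu k + 1)) x)) (at 0)"
proof -
  define A where "A = (\<Sum>i=1..n. x i) * jack_nonneg th n nu x"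
  define R where "R k = raise_coeff th n nu k * jack_nonneg th n (nu(k := nu k + 1)) x" for k
  define C where "C = (\<Sum>k\<in>addable n nu. (shifted th nu k + th) * R k)"
  define K where "K = (\<Sum>i=1..n. nu i) + 1"
  have nn: "0 \<le> nu i" if "i \<in> {1..n}" for i using partitionD(2)[OF part, of i] that by auto
  have K: "nu i < K" if "1 \<le> i" "i \<le> n" for i
  proof -
    have "nu i \<le> sum nu {1..n}" by (rule member_le_sum) (use that nn in auto)
    then show ?thesis unfolding K_def by linarith
  qed
  have "0 \<le> sum nu {1..n}" by (rule sum_nonneg) (rule nn)
  then have K0: "0 \<le> K" by (simp add: K_def)
  have e: "of_int k * A - (\<Sum>j\<in>addable n nu. (of_int k - (shifted th nu j + th)) * raise_coeff th n nu j * jack_nonneg th n (nu(j := nu j + 1)) x) =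
     of_int k * (A - sum R (addable n nu)) + C" for k
  proof -
    have "(\<Sum>j\<in>addable n nu. (of_int k - (shifted th nu j + th)) * raise_coeff th n nu j * jack_nonneg th n (nu(j := nu j + 1)) x) =
       (\<Sum>j\<in>addable n nu. of_int k * R j - (shifted th nu j + th) * R j)"
      by (intro sum.cong refl) (simp only: R_def left_diff_distrib mult.assoc)
    also have "\<dots> = of_int k * sum R (addable n nu) - C"
      by (simp only: sum_subtractf sum_distrib_left C_def)
    finally show ?thesis by (simp only: right_diff_distrib)
  qed
  have d: "((\<lambda>t. jack_nonneg th n nu (\<lambda>i. x i / (1 - t * x i))) has_real_derivative of_int k * (A - sum R (addable n nu)) + C) (at 0)"
    if "K \<le> k" for k
    using jack_flow_complement[where x = x and K = k, OF th part x, unfolded A_def[symmetric] e] K K0 that by force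
  have "of_int K * (A - sum R (addable n nu)) + C = of_int (K + 1) * (A - sum R (addable n nu)) + C"
    by (rule DERIV_unique[OF d d]) auto
  then have z: "A - sum R (addable n nu) = 0" by (simp add: algebra_simps)
  then show "(\<Sum>i=1..n. x i) * jack_nonneg th n nu x =
      (\<Sum>k\<in>addable n nu. raise_coeff th n nu k * jack_nonneg th n (nu(k := nu k + 1)) x)"
    by (simp add: A_def R_def)
  show "((\<lambda>t. jack_nonneg th n nu (\<lambda>i. x i / (1 - t * x i))) has_real_derivative
      (\<Sum>k\<in>addable n nu. (shifted th nu k + th) * raise_coeff th n nu k * jack_nonneg th n (nu(k := nu k + 1)) x)) (at 0)"
    using d[of K] unfolding z C_def R_def by (simp add: mult.assoc)
qed

section \<open>The Cauchy identity\<close>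

definition zero_ext :: "nat => (nat => int) => nat => int" where
  "zero_ext n nu = (\<lambda>i. if i \<le> n then nu i else 0)"

text \<open>Macdonald's constant b of \<open>nu\<close> for the Jack parameter 1 / th, that is, the
  reciprocal of the squared norm of J of \<open>nu\<close>. It is characterised here by
  \<open>cauchy_identity\<close> alone.\<close>

definition cauchy_coeff :: "real => nat => (nat => int) => real" where
  "cauchy_coeff th n nu = cweight th (Suc n) (zero_ext n nu) / (gratio th 0 ^ n * bweight th n nu)"

lemma cweight_Suc: "cweight th (Suc m) nu = cweight th m nu * (\<Prod>a\<in>{1..m}. gratio th (of_int (nu a - nu (Suc m)) + th * (real m - real a)))"
proof -
  have "(\<Prod>b\<in>{i<..Suc m}. gratio th (of_int (nu i - nu b) + th * (real b - 1 - real i))) =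
     (\<Prod>b\<in>{i<..m}. gratio th (of_int (nu i - nu b) + th * (real b - 1 - real i))) *
     gratio th (of_int (nu i - nu (Suc m)) + th * (real m - real i))" if "i \<in> {1..m}" for i
  proof -
    have "{i<..Suc m} = insert (Suc m) {i<..m}" using that by auto
    then show ?thesis by (simp add: mult.commute)
  qed
  then show ?thesis by (simp add: cweight_def prod.distrib)
qed

lemma bweight_Suc: "bweight th (Suc m) nu = bweight th m nu * (\<Prod>a\<in>{1..m}. gratio th (of_int (nu a - nu (Suc m)) + th * (real m + 1 - real a)))"
proof -
  have "(\<Prod>b\<in>{i<..Suc m}. gratio th (of_int (nu i - nu b) + th * (real b - real i))) =
     (\<Prod>b\<in>{i<..m}. gratio th (of_int (nu i - nu b) + th * (real b - real i))) *
     gratio th (of_int (nu i - nu (Suc m)) + th * (real m + 1 - real i))" if "i \<in> {1..m}" for i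
  proof -
    have "{i<..Suc m} = insert (Suc m) {i<..m}" using that by auto
    then show ?thesis by (simp add: mult.commute add.commute)
  qed
  then show ?thesis by (simp add: bweight_def prod.distrib)
qed

lemma zero_ext_partition: "is_partition n nu ==> is_partition m (zero_ext n nu)"
  by (rule partitionI) (auto simp: zero_ext_def partitionD(2) intro: partitionD(3))

lemma zero_ext_upd: "i \<le> n ==> zero_ext n (nu(i := v)) = (zero_ext n nu)(i := v)"
  by (auto simp: zero_ext_def fun_eq_iff)

lemma cweight_zero_ext_upd:
  assumes th: "th > 0" and part: "is_partition n nu" and i: "i \<in> {1..n}" and m: "n \<le> m"
  defines "z \<equiv> shifted th nu i + th * real m"
  shows "cweight th (Suc m) (zero_ext n (nu(i := nu i + 1))) * cweight th m (zero_ext n nu) * (z + 1) =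
    cweight th (Suc m) (zero_ext n nu) * cweight th m (zero_ext n (nu(i := nu i + 1))) * (z + th)"
proof -
  define e where "e = zero_ext n nu"
  have ei: "e i = nu i" using i by (simp add: e_def zero_ext_def)
  have em: "e (Suc m) = 0" using m by (simp add: e_def zero_ext_def)
  have z0: "z \<ge> 0"
  proof -
    have "th * real i \<le> th * real m" using i m th by (intro mult_left_mono) auto
    moreover have "0 \<le> nu i" using partitionD(2)[OF part, of i] i by auto
    ultimately show ?thesis by (simp add: z_def shifted_def)
  qed
  have "(\<Prod>a\<in>{1..m}. gratio th (of_int ((e(i := e i + 1)) a - (e(i := e i + 1)) (Suc m)) + th * (real m - real a))) =
     (\<Prod>a\<in>{1..m}. gratio th (of_int (e a - e (Suc m)) + th * (real m - real a))) * ((z + th) / (z + 1))"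
  proof (rule prod_change_one[where a = i])
    have z: "of_int (e i - e (Suc m)) + th * (real m - real i) = z"
      by (simp add: ei em z_def shifted_def algebra_simps)
    have z1: "of_int ((e(i := e i + 1)) i - (e(i := e i + 1)) (Suc m)) + th * (real m - real i) = z + 1"
      using i m em by (simp add: z[symmetric])
    show "gratio th (of_int ((e(i := e i + 1)) i - (e(i := e i + 1)) (Suc m)) + th * (real m - real i)) =
      gratio th (of_int (e i - e (Suc m)) + th * (real m - real i)) * ((z + th) / (z + 1))"
      unfolding z z1 by (rule gratio_step[OF th z0])
  qed (use i m in auto)
  then have "cweight th (Suc m) (e(i := e i + 1)) * cweight th m e * (z + 1) =
    cweight th m (e(i := e i + 1)) * ((cweight th m e * (\<Prod>a\<in>{1..m}. gratio th (of_int (e a - e (Suc m)) + th * (real m - real a)))) * ((z + th) / (z + 1)) * (z + 1))"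
    unfolding cweight_Suc by (simp only: mult_ac)
  also have "\<dots> = cweight th (Suc m) e * cweight th m (e(i := e i + 1)) * (z + th)"
    unfolding cweight_Suc[symmetric] using z0 by simp
  finally show ?thesis using i ei by (simp add: zero_ext_upd e_def)
qed

text \<open>An additional empty row contributes (z + 1) / (z + th) to the product over the rows, and
  by \<open>cweight_zero_ext_upd\<close> the inverse of this factor to the quotient of the
  weights.\<close>

lemma raise_coeff_zero_ext:
  assumes th: "th > 0" and part: "is_partition n nu" and i: "i \<in> addable n nu" and m: "n \<le> m"
  shows "raise_coeff th m (zero_ext n nu) i = raise_coeff th n nu i"
  using m
proof (induction m rule: dec_induct)
  case base
  have i': "i \<in> {1..n}" using i by (simp add: addable_def)
  have "shifted th (zero_ext n nu) b = shifted th nu b" if "b \<le> n" for b using that by (simp add: shifted_def zero_ext_def)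
  moreover have "cweight th n (zero_ext n nu) = cweight th n nu" "cweight th n ((zero_ext n nu)(i := zero_ext n nu i + 1)) = cweight th n (nu(i := nu i + 1))"
    by (rule cweight_cong; use i' in \<open>simp add: zero_ext_def\<close>)+
  ultimately show ?case unfolding raise_coeff_def using i' by (intro arg_cong2[of _ _ _ _ "(*)"] prod.cong) auto
next
  case (step m)
  define e where "e = zero_ext n nu"
  have i': "i \<in> {1..n}" "is_partition n (nu(i := nu i + 1))" using i by (auto simp: addable_def)
  have ei: "e i = nu i" using i' by (simp add: e_def zero_ext_def)
  have e': "zero_ext n (nu(i := nu i + 1)) = e(i := e i + 1)" using i' ei by (simp add: zero_ext_upd e_def)
  define z where "z = shifted th nu i + th * real m"
  have z0: "z \<ge> 0"
  proof -
    have "th * real i \<le> th * real m" using i' step th by (intro mult_left_mono) auto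
    moreover have "0 \<le> nu i" using partitionD(2)[OF part, of i] i' by auto
    ultimately show ?thesis by (simp add: z_def shifted_def)
  qed
  have pos: "cweight th k e > 0" "cweight th k (e(i := e i + 1)) > 0" for k
    unfolding e'[symmetric] unfolding e_def
    by (rule cweight_pos[OF th partitionD(1)[OF zero_ext_partition]], rule part i'(2))+
  have c: "cweight th (Suc m) (e(i := e i + 1)) * cweight th m e * (z + 1) =
    cweight th (Suc m) e * cweight th m (e(i := e i + 1)) * (z + th)"
    using cweight_zero_ext_upd[OF th part i'(1) step(1)] by (simp only: e' z_def e_def)
  then have c': "cweight th (Suc m) (e(i := e i + 1)) / cweight th (Suc m) e * ((z + 1) / (z + th)) = cweight th m (e(i := e i + 1)) / cweight th m e"
  proof -
    define a b c d where "a = cweight th (Suc m) (e(i := e i + 1))" and "b = cweight th m e"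
      and "c = cweight th (Suc m) e" and "d = cweight th m (e(i := e i + 1))"
    have nz: "b \<noteq> 0" "c * (z + th) \<noteq> 0" using pos[of m] pos[of "Suc m"] z0 th by (auto simp: b_def c_def)
    have "a * (z + 1) * b = d * (c * (z + th))" using c by (simp only: a_def b_def c_def d_def mult_ac)
    then have "(a * (z + 1)) / (c * (z + th)) = d / b" using nz by (simp add: frac_eq_eq)
    then show ?thesis by (simp add: a_def b_def c_def d_def)
  qed
  have "{1..Suc m} - {i} = insert (Suc m) ({1..m} - {i})" using i' step by auto
  then have "(\<Prod>b\<in>{1..Suc m} - {i}. (shifted th e b - shifted th e i + th - 1) / (shifted th e b - shifted th e i)) =
     ((shifted th e (Suc m) - shifted th e i + th - 1) / (shifted th e (Suc m) - shifted th e i)) *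
     (\<Prod>b\<in>{1..m} - {i}. (shifted th e b - shifted th e i + th - 1) / (shifted th e b - shifted th e i))"
    by simp
  also have "(shifted th e (Suc m) - shifted th e i + th - 1) / (shifted th e (Suc m) - shifted th e i) = (z + 1) / (z + th)"
  proof -
    have a: "shifted th e (Suc m) - shifted th e i = - (z + th)"
      using ei step by (simp add: shifted_def z_def e_def zero_ext_def algebra_simps)
    have "shifted th e (Suc m) - shifted th e i + th - 1 = - (z + 1)" by (simp add: a)
    then show ?thesis by (simp only: a minus_divide_divide)
  qed
  finally have "raise_coeff th (Suc m) e i = raise_coeff th m e i"
    unfolding raise_coeff_def c'[symmetric] by (simp only: mult_ac)
  then show ?case using step.IH by (simp add: e_def)
qed

text \<open>Lowering in the variables u is adjoint to an operator of raising type in the variables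
  y; this relation of the coefficients makes the Cauchy sum satisfy the differential equation of the
  Cauchy product. The summand \<open>th * real n\<close> is the contribution of the Pieri rule in
  \<open>raising_pairs\<close>.\<close>

lemma cauchy_coeff_raise:
  assumes th: "th > 0" and part: "is_partition n nu" and i: "i \<in> addable n nu"
  shows "cauchy_coeff th n (nu(i := nu i + 1)) * lower_coeff th n (nu(i := nu i + 1)) i =
    cauchy_coeff th n nu * ((shifted th nu i + th + th * real n) * raise_coeff th n nu i)"
proof -
  define nu' where "nu' = nu(i := nu i + 1)"
  have i': "i \<in> {1..n}" "is_partition n nu'" using i by (auto simp: addable_def nu'_def)
  define L where "L = shifted th nu"
  define z where "z = L i + th * real n"
  define Q where "Q = (\<Prod>b\<in>{1..n} - {i}. (L i - L b + 1 - th) / (L i - L b))"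
  define h where "h = gratio th 0 ^ n"
  have Q': "(\<Prod>b\<in>{1..n} - {i}. (L b - L i + th - 1) / (L b - L i)) = Q"
    unfolding Q_def
  proof (intro prod.cong refl)
    fix b
    have "L b - L i + th - 1 = - (L i - L b + 1 - th)" "L b - L i = - (L i - L b)" by simp_all
    then show "(L b - L i + th - 1) / (L b - L i) = (L i - L b + 1 - th) / (L i - L b)" by (simp only: minus_divide_divide)
  qed
  have lo: "lower_coeff th n nu' i / bweight th n nu' = (L i + 1 + th * real n) * Q / bweight th n nu"
    unfolding nu'_def L_def Q_def
    by (rule lower_coeff_up[OF th partitionD(1)[OF part] partitionD(1)[OF i'(2)[unfolded nu'_def]] i'(1)])
  have C: "cweight th n (zero_ext n nu) = cweight th n nu" "cweight th n (zero_ext n nu') = cweight th n nu'"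
    by (rule cweight_cong; simp add: zero_ext_def)+
  have pos: "cweight th n nu > 0" using cweight_pos[OF th partitionD(1)[OF part]] .
  have c: "cweight th (Suc n) (zero_ext n nu') * cweight th n nu * (z + 1) =
    cweight th (Suc n) (zero_ext n nu) * cweight th n nu' * (z + th)"
    using cweight_zero_ext_upd[OF th part i'(1) order_refl] unfolding C nu'_def[symmetric] L_def[symmetric] z_def[symmetric] .
  then have c': "cweight th (Suc n) (zero_ext n nu') * (z + 1) = cweight th (Suc n) (zero_ext n nu) * (z + th) * (cweight th n nu' / cweight th n nu)"
    using pos by (simp add: field_simps)
  have "cauchy_coeff th n nu' * lower_coeff th n nu' i = cweight th (Suc n) (zero_ext n nu') / h * (lower_coeff th n nu' i / bweight th n nu')"
    by (simp add: cauchy_coeff_def h_def)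
  also have "\<dots> = (cweight th (Suc n) (zero_ext n nu') * (z + 1)) * (Q / (h * bweight th n nu))"
    unfolding lo by (simp add: z_def add_ac mult_ac)
  also have "\<dots> = cauchy_coeff th n nu * ((z + th) * (Q * (cweight th n nu' / cweight th n nu)))"
    unfolding c' by (simp add: cauchy_coeff_def h_def mult_ac)
  finally have "cauchy_coeff th n nu' * lower_coeff th n nu' i =
      cauchy_coeff th n nu * ((z + th) * (Q * (cweight th n nu' / cweight th n nu)))" .
  moreover have "Q * (cweight th n nu' / cweight th n nu) = raise_coeff th n nu i"
    unfolding raise_coeff_def L_def[symmetric] Q' nu'_def ..
  moreover have "z + th = shifted th nu i + th + th * real n" by (simp add: z_def L_def)
  ultimately show ?thesis by (simp only: nu'_def)
qed

lemma cauchy_coeff_pos: "th > 0 ==> is_partition n nu ==> cauchy_coeff th n nu > 0"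
  unfolding cauchy_coeff_def
  using cweight_pos[OF _ partitionD(1)[OF zero_ext_partition]] bweight_pos[OF _ partitionD(1)] gratio_pos[of th 0]
  by simp

lemma cauchy_coeff_stable:
  assumes th: "th > 0" and part: "is_partition (Suc n) nu" and z: "nu (Suc n) = 0"
  shows "cauchy_coeff th (Suc n) nu = cauchy_coeff th n nu"
proof -
  have e: "zero_ext (Suc n) nu = zero_ext n nu" using z by (auto simp: zero_ext_def fun_eq_iff le_Suc_eq)
  have "(\<Prod>a\<in>{1..Suc n}. gratio th (of_int (zero_ext n nu a - zero_ext n nu (Suc (Suc n))) + th * (real (Suc n) - real a))) =
     gratio th 0 * (\<Prod>a\<in>{1..n}. gratio th (of_int (nu a - nu (Suc n)) + th * (real n + 1 - real a)))"
  proof -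
    have "(\<Prod>a\<in>{1..n}. gratio th (of_int (zero_ext n nu a - zero_ext n nu (Suc (Suc n))) + th * (real (Suc n) - real a))) =
      (\<Prod>a\<in>{1..n}. gratio th (of_int (nu a - nu (Suc n)) + th * (real n + 1 - real a)))"
      by (intro prod.cong refl) (auto simp: zero_ext_def z add_ac)
    then show ?thesis by (simp add: zero_ext_def)
  qed
  then have "cweight th (Suc (Suc n)) (zero_ext (Suc n) nu) = cweight th (Suc n) (zero_ext n nu) *
     (gratio th 0 * (\<Prod>a\<in>{1..n}. gratio th (of_int (nu a - nu (Suc n)) + th * (real n + 1 - real a))))"
    by (simp only: e cweight_Suc[of th "Suc n"])
  moreover have "(\<Prod>a\<in>{1..n}. gratio th (of_int (nu a - nu (Suc n)) + th * (real n + 1 - real a))) > 0"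
    by (intro prod_pos gratio_pos[OF th] add_nonneg_nonneg mult_nonneg_nonneg ballI)
      (use th partitionD(2)[OF part] in \<open>auto simp: z\<close>)
  moreover have "gratio th 0 > 0" by (rule gratio_pos[OF th]) simp
  moreover define P where "P = (\<Prod>a\<in>{1..n}. gratio th (of_int (nu a - nu (Suc n)) + th * (real n + 1 - real a)))"
  ultimately have "cweight th (Suc (Suc n)) (zero_ext (Suc n) nu) = cweight th (Suc n) (zero_ext n nu) * (gratio th 0 * P)"
    "P > 0" "gratio th 0 > 0" by (simp_all only:)
  then show ?thesis unfolding cauchy_coeff_def bweight_Suc P_def[symmetric] by simp
qed

section \<open>Families of formal power series and their derivatives, coefficient by
  coefficient\<close>

definition fps_has_derivative :: "(real => real fps) => real fps => bool" where
  "fps_has_derivative A A' \<longleftrightarrow> (\<forall>k. ((\<lambda>t. fps_nth (A t) k) has_real_derivative fps_nth A' k) (at 0))"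

lemma fps_has_derivative_mult:
  assumes "fps_has_derivative A A'" "fps_has_derivative B B'"
  shows "fps_has_derivative (\<lambda>t. A t * B t) (A' * B 0 + A 0 * B')"
  unfolding fps_has_derivative_def
proof
  fix k
  have "((\<lambda>t. \<Sum>i=0..k. fps_nth (A t) i * fps_nth (B t) (k - i)) has_real_derivative
     (\<Sum>i=0..k. fps_nth A' i * fps_nth (B 0) (k - i) + fps_nth (A 0) i * fps_nth B' (k - i))) (at 0)"
  proof (rule DERIV_sum)
    fix i
    have "((\<lambda>t. fps_nth (A t) i) has_real_derivative fps_nth A' i) (at 0)"
      "((\<lambda>t. fps_nth (B t) (k - i)) has_real_derivative fps_nth B' (k - i)) (at 0)"
      using assms unfolding fps_has_derivative_def by auto
    from DERIV_mult[OF this]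
    show "((\<lambda>t. fps_nth (A t) i * fps_nth (B t) (k - i)) has_real_derivative
      fps_nth A' i * fps_nth (B 0) (k - i) + fps_nth (A 0) i * fps_nth B' (k - i)) (at 0)"
      by (rule DERIV_cong) (simp only: mult.commute)
  qed
  then show "((\<lambda>t. fps_nth (A t * B t) k) has_real_derivative fps_nth (A' * B 0 + A 0 * B') k) (at 0)"
    by (simp add: fps_mult_nth sum.distrib)
qed

lemma fps_has_derivative_prod:
  assumes "finite I" "\<And>i. i \<in> I ==> fps_has_derivative (A i) (A' i)"
  shows "fps_has_derivative (\<lambda>t. \<Prod>i\<in>I. A i t) (\<Sum>i\<in>I. A' i * (\<Prod>j\<in>I - {i}. A j 0))"
  using assms
proof (induction I rule: finite_induct)
  case empty
  then show ?case by (simp add: fps_has_derivative_def)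
next
  case (insert d I)
  have e: "(\<Sum>i\<in>insert d I. A' i * (\<Prod>j\<in>insert d I - {i}. A j 0)) =
     A' d * (\<Prod>j\<in>I. A j 0) + A d 0 * (\<Sum>i\<in>I. A' i * (\<Prod>j\<in>I - {i}. A j 0))"
  proof -
    have "(\<Prod>j\<in>insert d I - {i}. A j 0) = A d 0 * (\<Prod>j\<in>I - {i}. A j 0)" if "i \<in> I" for i
    proof -
      have "insert d I - {i} = insert d (I - {i})" using that insert.hyps by auto
      then show ?thesis using insert.hyps by simp
    qed
    then have "(\<Sum>i\<in>I. A' i * (\<Prod>j\<in>insert d I - {i}. A j 0)) = A d 0 * (\<Sum>i\<in>I. A' i * (\<Prod>j\<in>I - {i}. A j 0))"
      unfolding sum_distrib_left by (intro sum.cong refl) (simp add: mult_ac)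
    then show ?thesis using insert.hyps by simp
  qed
  show ?case using fps_has_derivative_mult[OF insert.prems[of d] insert.IH[OF insert.prems]] insert.hyps
    by (simp add: e)
qed

text \<open>The formal series of (1 - a X) powr -th. The variant \<open>binomial_fps'\<close> is its
  derivative with respect to a.\<close>

definition binomial_fps :: "real => real => real fps" where
  "binomial_fps th a = Abs_fps (\<lambda>k. pochhammer th k / fact k * a ^ k)"

definition binomial_fps' :: "real => real => real fps" where
  "binomial_fps' th a = Abs_fps (\<lambda>k. pochhammer th k / fact k * (real k * a ^ (k - 1)))"

lemma binomial_fps_deriv:
  assumes "(f has_real_derivative f') (at 0)"
  shows "fps_has_derivative (\<lambda>t. binomial_fps th (f t)) (fps_const f' * binomial_fps' th (f 0))"
  unfolding fps_has_derivative_def binomial_fps_def binomial_fps'_def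
  by (auto intro!: derivative_eq_intros assms)

text \<open>For f = (1 - a X) powr -th one has df/da = th X f / (1 - a X); this is the same equation
  cleared of its denominator.\<close>

lemma binomial_fps_ode:
  "binomial_fps' th a = fps_X * (fps_const a * binomial_fps' th a + fps_const th * binomial_fps th a)"
proof (rule fps_ext)
  fix k
  show "fps_nth (binomial_fps' th a) k = fps_nth (fps_X * (fps_const a * binomial_fps' th a + fps_const th * binomial_fps th a)) k"
  proof (cases k)
    case 0
    then show ?thesis by (simp add: binomial_fps'_def)
  next
    case (Suc m)
    have p: "pochhammer th (Suc m) / fact (Suc m) * real (Suc m) = pochhammer th m / fact m * (th + real m)"
      by (simp add: pochhammer_Suc divide_simps) (simp add: algebra_simps add_divide_distrib)?
    have a: "a * (real m * a ^ (m - 1)) = real m * a ^ m" by (cases m) auto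
    have "fps_nth (binomial_fps' th a) k = (pochhammer th (Suc m) / fact (Suc m) * real (Suc m)) * a ^ m"
      unfolding Suc by (simp add: binomial_fps'_def del: pochhammer_Suc of_nat_Suc fact_Suc)
    also have "\<dots> = pochhammer th m / fact m * (a * (real m * a ^ (m - 1))) + th * (pochhammer th m / fact m * a ^ m)"
      unfolding p a by (simp add: algebra_simps add_divide_distrib)
    also have "\<dots> = fps_nth (fps_X * (fps_const a * binomial_fps' th a + fps_const th * binomial_fps th a)) k"
      unfolding Suc by (simp add: binomial_fps'_def binomial_fps_def)
    finally show ?thesis .
  qed
qed

definition cauchy_fps :: "real => nat => nat => (nat => real) => (nat => real) => real fps" where
  "cauchy_fps th n M u y = (\<Prod>(i, j)\<in>{1..n} \<times> {1..M}. binomial_fps th (u i * y j))"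

text \<open>On a factor f with a = u i * y j, translation of u gives y j * f', and the flow of y
  gives u i * (y j)^2 * f'; \<open>binomial_fps_ode\<close> relates the two. The factor
  \<open>fps_X\<close> means that the translation derivative in degree k is determined by degree k -
  1, which opens the way to an induction on the degree.\<close>

lemma cauchy_fps_derivatives:
  obtains E where
    "fps_has_derivative (\<lambda>t. cauchy_fps th n M u (\<lambda>j. y j / (1 - t * y j))) E"
    "fps_has_derivative (\<lambda>t. cauchy_fps th n M (\<lambda>i. u i + t) y)
       (fps_X * (E + fps_const (th * real n * (\<Sum>j=1..M. y j)) * cauchy_fps th n M u y))"
proof -
  define I where "I = {1..n} \<times> {1..M}"
  define g where "g = (\<lambda>(i, j). binomial_fps th (u i * y j))"
  define g' where "g' = (\<lambda>(i, j). binomial_fps' th (u i * y j))"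
  define E where "E = (\<Sum>p\<in>I. (fps_const (u (fst p) * (y (snd p) * y (snd p))) * g' p) * (\<Prod>q\<in>I - {p}. g q))"
  have fin: "finite I" by (simp add: I_def)
  have 1: "fps_has_derivative (\<lambda>t. cauchy_fps th n M u (\<lambda>j. y j / (1 - t * y j))) E"
  proof -
    have "fps_has_derivative (\<lambda>t. binomial_fps th (u (fst p) * (y (snd p) / (1 - t * y (snd p)))))
       (fps_const (u (fst p) * (y (snd p) * y (snd p))) * g' p)" for p
    proof -
      have "((\<lambda>t. u (fst p) * (y (snd p) / (1 - t * y (snd p)))) has_real_derivative u (fst p) * (y (snd p) * y (snd p))) (at 0)"
        by (auto intro!: derivative_eq_intros)
      from binomial_fps_deriv[OF this, of th] show ?thesis by (simp add: g'_def case_prod_unfold)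
    qed
    from fps_has_derivative_prod[OF fin this]
    show ?thesis by (simp add: cauchy_fps_def E_def I_def g_def case_prod_unfold)
  qed
  have "fps_has_derivative (\<lambda>t. cauchy_fps th n M (\<lambda>i. u i + t) y)
      (\<Sum>p\<in>I. (fps_const (y (snd p)) * g' p) * (\<Prod>q\<in>I - {p}. g q))"
  proof -
    have "fps_has_derivative (\<lambda>t. binomial_fps th ((u (fst p) + t) * y (snd p)))
       (fps_const (y (snd p)) * g' p)" for p
    proof -
      have "((\<lambda>t. (u (fst p) + t) * y (snd p)) has_real_derivative y (snd p)) (at 0)"
        by (auto intro!: derivative_eq_intros)
      from binomial_fps_deriv[OF this, of th] show ?thesis by (simp add: g'_def case_prod_unfold)
    qed
    from fps_has_derivative_prod[OF fin this]
    show ?thesis by (simp add: cauchy_fps_def I_def g_def case_prod_unfold)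
  qed
  also have "(\<Sum>p\<in>I. (fps_const (y (snd p)) * g' p) * (\<Prod>q\<in>I - {p}. g q)) =
    fps_X * (E + fps_const (th * real n * (\<Sum>j=1..M. y j)) * cauchy_fps th n M u y)"
  proof -
    have "(fps_const (y (snd p)) * g' p) * (\<Prod>q\<in>I - {p}. g q) =
       fps_X * ((fps_const (u (fst p) * (y (snd p) * y (snd p))) * g' p) * (\<Prod>q\<in>I - {p}. g q)) +
       fps_X * (fps_const (th * y (snd p)) * (\<Prod>q\<in>I. g q))" if "p \<in> I" for p
    proof -
      have "g' p = fps_X * (fps_const (u (fst p) * y (snd p)) * g' p + fps_const th * g p)"
        unfolding g'_def g_def case_prod_unfold by (rule binomial_fps_ode)
      then have "fps_const (y (snd p)) * g' p = fps_const (y (snd p)) * (fps_X * (fps_const (u (fst p) * y (snd p)) * g' p + fps_const th * g p))"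
        by (rule arg_cong)
      also have "\<dots> = fps_X * (fps_const (u (fst p) * (y (snd p) * y (snd p))) * g' p) + fps_X * (fps_const (th * y (snd p)) * g p)"
        by (simp only: fps_const_mult[symmetric] distrib_left mult_ac)
      finally have *: "fps_const (y (snd p)) * g' p = \<dots>" .
      have "(\<Prod>q\<in>I. g q) = g p * (\<Prod>q\<in>I - {p}. g q)" by (rule prod.remove[OF fin that])
      then show ?thesis unfolding * by (simp only: distrib_left distrib_right mult_ac)
    qed
    then have "(\<Sum>p\<in>I. (fps_const (y (snd p)) * g' p) * (\<Prod>q\<in>I - {p}. g q)) =
       fps_X * E + fps_X * ((\<Sum>p\<in>I. fps_const (th * y (snd p))) * (\<Prod>q\<in>I. g q))"
      by (simp add: sum.distrib sum_distrib_left sum_distrib_right E_def)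
    also have "(\<Sum>p\<in>I. fps_const (th * y (snd p))) = fps_const (th * real n * (\<Sum>j=1..M. y j))"
    proof -
      have "(\<Sum>p\<in>I. fps_const (th * y (snd p))) = fps_const (\<Sum>p\<in>I. th * y (snd p))"
        by (induction I rule: infinite_finite_induct) (simp_all add: fps_const_add[symmetric] del: fps_const_add)
      also have "(\<Sum>p\<in>I. th * y (snd p)) = (\<Sum>i=1..n. \<Sum>j=1..M. th * y j)"
        unfolding I_def by (simp only: sum.cartesian_product case_prod_unfold)
      also have "\<dots> = th * real n * (\<Sum>j=1..M. y j)" by (simp add: sum_distrib_left mult_ac)
      finally show ?thesis .
    qed
    also have "(\<Prod>q\<in>I. g q) = cauchy_fps th n M u y" by (simp add: cauchy_fps_def I_def g_def)
    finally show ?thesis by (simp add: distrib_left)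
  qed
  finally show ?thesis using that 1 by blast
qed

section \<open>Partitions of a given size and the sum over them\<close>

definition partitions :: "nat => nat => (nat => int) set" where
  "partitions n k = {nu \<in> {1..n} \<rightarrow>\<^sub>E {0..int k}. is_partition n nu \<and> sig_size n nu = int k}"

lemma finite_partitions: "finite (partitions n k)"
  unfolding partitions_def by (rule finite_subset[of _ "{1..n} \<rightarrow>\<^sub>E {0..int k}"]) (auto intro!: finite_PiE)

lemma partitionsI:
  assumes "nu \<in> extensional {1..n}" "is_partition n nu" "sig_size n nu = int k"
  shows "nu \<in> partitions n k"
proof -
  have "nu i \<le> int k" if "i \<in> {1..n}" for i
    using member_le_sum[of i "{1..n}" nu] that assms(2,3) by (auto simp: sig_size_def is_partition_def)
  then show ?thesis using assms by (auto simp: partitions_def PiE_iff is_partition_def)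
qed

lemma partitionsD:
  assumes "nu \<in> partitions n k"
  shows "nu \<in> extensional {1..n}" "is_partition n nu" "sig_size n nu = int k"
  using assms by (auto simp: partitions_def PiE_def)

lemma cauchy_fps_0: "fps_nth (cauchy_fps th 0 M u y) k = (if k = 0 then 1 else 0)"
  by (simp add: cauchy_fps_def)

lemma partitions_0: "partitions 0 k = (if k = 0 then {\<lambda>_. undefined} else {})"
  by (auto simp: partitions_def is_partition_def sig_size_def monotone_on_def)

lemma binomial_fps_0: "binomial_fps th 0 = 1"
  by (rule fps_ext) (simp add: binomial_fps_def)

lemma cauchy_fps_last_zero:
  assumes "u (Suc n) = 0"
  shows "cauchy_fps th (Suc n) M u y = cauchy_fps th n M u y"
  unfolding cauchy_fps_def
  by (rule prod.mono_neutral_right) (use assms in \<open>auto simp: binomial_fps_0 le_Suc_eq\<close>)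

text \<open>By the Pieri rule, the multiplication with \<open>th * real N\<close> times the sum of
  the y j adds th N to the factor of each added box. The new factor vanishes on row N + 1, the first
  empty one, so no partition with more than N nonzero rows arises.\<close>

lemma raising_pairs:
  assumes th: "th > 0" and NM: "N \<le> M" and mu: "is_partition N mu" and y: "\<And>j. 1 \<le> j ==> j \<le> M ==> 0 < y j"
  shows "(\<Sum>i\<in>addable M (zero_ext N mu). (shifted th (zero_ext N mu) i + th) * raise_coeff th M (zero_ext N mu) i *
        jack_nonneg th M ((zero_ext N mu)(i := zero_ext N mu i + 1)) y) +
      th * real N * (\<Sum>j=1..M. y j) * jack_nonneg th M (zero_ext N mu) y =
    (\<Sum>i\<in>addable N mu. (shifted th mu i + th + th * real N) * raise_coeff th N mu i * jack_nonneg th M (zero_ext N (mu(i := mu i + 1))) y)"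
proof -
  define e where "e = zero_ext N mu"
  define J where "J i = jack_nonneg th M (e(i := e i + 1)) y" for i
  have pe: "is_partition M e" unfolding e_def by (rule zero_ext_partition[OF mu])
  have pie: "(\<Sum>j=1..M. y j) * jack_nonneg th M e y = (\<Sum>k\<in>addable M e. raise_coeff th M e k * J k)"
    unfolding J_def by (rule jack_pieri[OF th pe y])
  have "(\<Sum>i\<in>addable M e. (shifted th e i + th) * raise_coeff th M e i * J i) + th * real N * (\<Sum>j=1..M. y j) * jack_nonneg th M e y =
     (\<Sum>i\<in>addable M e. (shifted th e i + th) * raise_coeff th M e i * J i) + th * real N * (\<Sum>k\<in>addable M e. raise_coeff th M e k * J k)"
    by (simp only: mult.assoc pie)
  also have "\<dots> = (\<Sum>i\<in>addable M e. (shifted th e i + th + th * real N) * raise_coeff th M e i * J i)"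
    by (simp only: sum_distrib_left sum.distrib[symmetric] distrib_right mult.assoc)
  also have "\<dots> = (\<Sum>i\<in>addable N mu. (shifted th mu i + th + th * real N) * raise_coeff th N mu i * jack_nonneg th M (zero_ext N (mu(i := mu i + 1))) y)"
  proof (rule sum.mono_neutral_cong_right)
    show "finite (addable M e)" by (simp add: addable_def)
    show "addable N mu \<subseteq> addable M e"
    proof
      fix i assume i: "i \<in> addable N mu"
      then have "i \<le> N" "i \<ge> 1" by (auto simp: addable_def)
      then have "zero_ext N (mu(i := mu i + 1)) = e(i := e i + 1)" by (auto simp: e_def zero_ext_def fun_eq_iff)
      then show "i \<in> addable M e" using i NM \<open>i \<le> N\<close> \<open>i \<ge> 1\<close> zero_ext_partition[of N "mu(i := mu i + 1)" M]
        by (simp add: addable_def)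
    qed
    show "\<forall>i\<in>addable M e - addable N mu. (shifted th e i + th + th * real N) * raise_coeff th M e i * J i = 0"
    proof
      fix i assume i: "i \<in> addable M e - addable N mu"
      then have i': "1 \<le> i" "i \<le> M" "is_partition M (e(i := e i + 1))" by (auto simp: addable_def)
      have "\<not> i \<le> N"
      proof
        assume iN: "i \<le> N"
        have "is_partition N (mu(i := mu i + 1))"
        proof (rule partitionI)
          fix k assume k: "1 \<le> k" "k < N"
          show "(mu(i := mu i + 1)) (Suc k) \<le> (mu(i := mu i + 1)) k"
            using partitionD(3)[OF i'(3), of k "Suc k"] k iN NM by (auto simp: e_def zero_ext_def split: if_splits)
        next
          assume "1 \<le> N"
          then show "0 \<le> (mu(i := mu i + 1)) N" using partitionD(2)[OF mu, of N] by auto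
        qed
        then show False using i iN i'(1) by (auto simp: addable_def)
      qed
      moreover have "\<not> i > Suc N"
      proof
        assume iN: "i > Suc N"
        then have "(e(i := e i + 1)) i \<le> (e(i := e i + 1)) (i - 1)" by (intro partitionD(3)[OF i'(3)]) (use i' in auto)
        then show False using iN by (auto simp: e_def zero_ext_def split: if_splits)
      qed
      ultimately have "i = Suc N" by simp
      then have "shifted th e i + th + th * real N = 0" by (simp add: shifted_def e_def zero_ext_def algebra_simps)
      then show "(shifted th e i + th + th * real N) * raise_coeff th M e i * J i = 0" by simp
    qed
    fix i assume i: "i \<in> addable N mu"
    then have i': "i \<le> N" "i \<ge> 1" by (auto simp: addable_def)
    then have "zero_ext N (mu(i := mu i + 1)) = e(i := e i + 1)" by (auto simp: e_def zero_ext_def fun_eq_iff)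
    moreover have "shifted th e i = shifted th mu i" using i' by (simp add: shifted_def e_def zero_ext_def)
    moreover have "raise_coeff th M e i = raise_coeff th N mu i" unfolding e_def by (rule raise_coeff_zero_ext[OF th mu i NM])
    ultimately show "(shifted th e i + th + th * real N) * raise_coeff th M e i * J i =
       (shifted th mu i + th + th * real N) * raise_coeff th N mu i * jack_nonneg th M (zero_ext N (mu(i := mu i + 1))) y"
      by (simp only: J_def)
  qed
  finally show ?thesis unfolding e_def J_def .
qed

lemma finite_removable: "finite (removable n nu)"
  by (simp add: removable_def)

lemma finite_addable: "finite (addable n nu)"
  by (simp add: addable_def)

lemma partitions_pairs:
  fixes f :: "(nat => int) => nat => real"
  shows "(\<Sum>nu\<in>partitions n (Suc k). \<Sum>i\<in>removable n nu. f nu i) = (\<Sum>mu\<in>partitions n k. \<Sum>i\<in>addable n mu. f (mu(i := mu i + 1)) i)"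
proof -
  have "(\<Sum>(nu, i)\<in>Sigma (partitions n (Suc k)) (removable n). f nu i) =
     (\<Sum>(mu, i)\<in>Sigma (partitions n k) (addable n). f (mu(i := mu i + 1)) i)"
  proof (rule sum.reindex_bij_witness[of _ "\<lambda>(mu, i). (mu(i := mu i + 1), i)" "\<lambda>(nu, i). (nu(i := nu i - 1), i)"])
    fix p assume "p \<in> Sigma (partitions n (Suc k)) (removable n)"
    then obtain nu i where p: "p = (nu, i)" "nu \<in> partitions n (Suc k)" "i \<in> removable n nu" by auto
    note d = partitionsD[OF p(2)]
    have i: "i \<in> {1..n}" "is_partition n (nu(i := nu i - 1))" using p(3) by (auto simp: removable_def)
    have "nu(i := nu i - 1) \<in> partitions n k"
      by (rule partitionsI) (use d i in \<open>auto simp: extensional_def sig_size_upd\<close>)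
    then show "(case p of (nu, i) => (nu(i := nu i - 1), i)) \<in> Sigma (partitions n k) (addable n)"
      using p i d by (simp add: addable_def)
    show "(case case p of (nu, i) => (nu(i := nu i - 1), i) of (mu, i) => (mu(i := mu i + 1), i)) = p"
      using p by simp
    show "(case case p of (nu, i) => (nu(i := nu i - 1), i) of (mu, i) => f (mu(i := mu i + 1)) i) = (case p of (nu, i) => f nu i)"
      using p by simp
  next
    fix p assume "p \<in> Sigma (partitions n k) (addable n)"
    then obtain mu i where p: "p = (mu, i)" "mu \<in> partitions n k" "i \<in> addable n mu" by auto
    note d = partitionsD[OF p(2)]
    have i: "i \<in> {1..n}" "is_partition n (mu(i := mu i + 1))" using p(3) by (auto simp: addable_def)
    have "mu(i := mu i + 1) \<in> partitions n (Suc k)"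
      by (rule partitionsI) (use d i in \<open>auto simp: extensional_def sig_size_upd\<close>)
    then show "(case p of (mu, i) => (mu(i := mu i + 1), i)) \<in> Sigma (partitions n (Suc k)) (removable n)"
      using p i d by (simp add: removable_def)
    show "(case case p of (mu, i) => (mu(i := mu i + 1), i) of (nu, i) => (nu(i := nu i - 1), i)) = p"
      using p by simp
  qed
  then show ?thesis
    by (simp add: sum.Sigma finite_partitions finite_removable finite_addable)
qed

lemma removable_partitions_0: "nu \<in> partitions n 0 ==> removable n nu = {}"
proof (rule ccontr)
  assume n: "nu \<in> partitions n 0" "removable n nu \<noteq> {}"
  then obtain i where i: "i \<in> {1..n}" "is_partition n (nu(i := nu i - 1))" by (auto simp: removable_def)
  have "0 \<le> sig_size n (nu(i := nu i - 1))"
    unfolding sig_size_def by (rule sum_nonneg) (use partitionD(2)[OF i(2)] in auto)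
  then show False using i(1) partitionsD(3)[OF n(1)] by (simp add: sig_size_upd)
qed

text \<open>Translating by - u N makes the last variable zero, where both sides lose this variable
  and the induction on \<open>n\<close> applies. The invariance under translation in degree k rests
  on the identity in degree k - 1 for all positive y, as the flow of y moves the second set of
  variables.\<close>

theorem cauchy_identity:
  assumes th: "th > 0"
  shows "n \<le> M ==> (\<And>j. 1 \<le> j ==> j \<le> M ==> 0 < y j) ==> fps_nth (cauchy_fps th n M u y) k =
    (\<Sum>nu\<in>partitions n k. cauchy_coeff th n nu * jack_nonneg th n nu u * jack_nonneg th M (zero_ext n nu) y)"
proof (induction n arbitrary: u k y)
  case 0
  have "zero_ext 0 (\<lambda>_. undefined) i = 0" if "1 \<le> i" for i using that by (simp add: zero_ext_def)
  then have "jack_nonneg th M (zero_ext 0 (\<lambda>_. undefined)) y = jack_nonneg th M (\<lambda>_. 0) y"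
    by (intro jack_nonneg_cong) auto
  moreover have "jack_nonneg th M (\<lambda>_. 0) y = 1"
  proof (induction M)
    case (Suc M)
    have a: "antimono_on {1..Suc M} (\<lambda>_. 0 :: int)" by (auto simp: monotone_on_def)
    have i: "interlacing M (\<lambda>_. 0) = {restrict (\<lambda>_. 0) {1..M}}"
      by (auto simp: interlacing_def PiE_iff extensional_def fun_eq_iff)
    have "jack_nonneg th M (restrict (\<lambda>_. 0) {1..M}) y = jack_nonneg th M (\<lambda>_. 0) y"
      by (rule jack_nonneg_cong) auto
    then show ?case using Suc jack_psi_restrict[OF th a] i by (simp add: sig_size_def)
  qed simp
  moreover have "cauchy_coeff th 0 (\<lambda>_. undefined) = 1" by (simp add: cauchy_coeff_def cweight_def bweight_def)
  ultimately show ?case by (simp add: cauchy_fps_0 partitions_0)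
next
  case (Suc n)
  define N where "N = Suc n"
  define S where "S k u y = (\<Sum>nu\<in>partitions N k. cauchy_coeff th N nu * jack_nonneg th N nu u * jack_nonneg th M (zero_ext N nu) y)" for k u y
  define C where "C k u y = fps_nth (cauchy_fps th N M u y) k" for k u y
  have NM: "N \<le> M" using Suc.prems by (simp add: N_def)
  \<comment> \<open>At \<open>u N = 0\<close> the partitions with nonzero row N drop out, and those
    with \<open>nu N = 0\<close> correspond to the partitions of length n.\<close>
  have zero: "C k u y = S k u y" if u: "u N = 0" and y: "\<And>j. 1 \<le> j ==> j \<le> M ==> 0 < y j" for k u y
  proof -
    have "C k u y = (\<Sum>nu\<in>partitions n k. cauchy_coeff th n nu * jack_nonneg th n nu u * jack_nonneg th M (zero_ext n nu) y)"
      unfolding C_def N_def using u NM cauchy_fps_last_zero[of u n th M y] Suc.IH[OF _ y] by (simp add: N_def)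
    also have "\<dots> = (\<Sum>nu\<in>{nu \<in> partitions N k. nu N = 0}. cauchy_coeff th N nu * jack_nonneg th N nu u * jack_nonneg th M (zero_ext N nu) y)"
    proof (rule sum.reindex_bij_witness[of _ "\<lambda>nu. restrict nu {1..n}" "\<lambda>nu. nu(N := 0)"])
      fix nu assume v: "nu \<in> partitions n k"
      note d = partitionsD[OF v]
      show "restrict (nu(N := 0)) {1..n} = nu" using d(1) by (auto simp: N_def extensional_def fun_eq_iff)
      have "is_partition N (nu(N := 0))"
        by (rule partitionI) (auto simp: N_def less_Suc_eq intro: partitionD[OF d(2)])
      moreover have "sig_size N (nu(N := 0)) = int k" using d(3) by (simp add: N_def sig_size_def)
      ultimately have p: "nu(N := 0) \<in> partitions N k"
        by (intro partitionsI) (use d(1) in \<open>auto simp: N_def extensional_def\<close>)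
      then show "nu(N := 0) \<in> {nu \<in> partitions N k. nu N = 0}" by simp
      note d' = partitionsD[OF p]
      have "cauchy_coeff th N (nu(N := 0)) = cauchy_coeff th n (nu(N := 0))"
        using cauchy_coeff_stable[OF th d'(2)[unfolded N_def]] by (simp add: N_def)
      also have "\<dots> = cauchy_coeff th n nu"
      proof -
        have "zero_ext n (nu(N := 0)) = zero_ext n nu" by (auto simp: zero_ext_def N_def)
        moreover have "bweight th n (nu(N := 0)) = bweight th n nu" by (rule bweight_cong) (auto simp: N_def)
        ultimately show ?thesis by (simp add: cauchy_coeff_def)
      qed
      finally have b: "cauchy_coeff th N (nu(N := 0)) = cauchy_coeff th n nu" .
      have "jack_nonneg th N (nu(N := 0)) u = jack_nonneg th n (nu(N := 0)) u"
        using jack_nonneg_last_zero[OF th d'(2)[unfolded N_def], of u] u by (simp add: N_def)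
      also have "\<dots> = jack_nonneg th n nu u" by (rule jack_nonneg_cong) (auto simp: N_def)
      finally have j: "jack_nonneg th N (nu(N := 0)) u = jack_nonneg th n nu u" .
      have e: "zero_ext N (nu(N := 0)) = zero_ext n nu" by (auto simp: zero_ext_def N_def)
      show "cauchy_coeff th N (nu(N := 0)) * jack_nonneg th N (nu(N := 0)) u * jack_nonneg th M (zero_ext N (nu(N := 0))) y =
         cauchy_coeff th n nu * jack_nonneg th n nu u * jack_nonneg th M (zero_ext n nu) y"
        by (simp only: b j e)
    next
      fix nu assume v: "nu \<in> {nu \<in> partitions N k. nu N = 0}"
      then have d: "nu \<in> extensional {1..N}" "is_partition N nu" "sig_size N nu = int k" "nu N = 0" by (auto dest: partitionsD)
      show "(restrict nu {1..n})(N := 0) = nu" using d(1,4) by (auto simp: N_def extensional_def fun_eq_iff le_Suc_eq)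
      show "restrict nu {1..n} \<in> partitions n k"
      proof (rule partitionsI)
        show "is_partition n (restrict nu {1..n})"
          by (rule partitionI) (use partitionD(2,3)[OF d(2)] in \<open>auto simp: N_def\<close>)
        show "sig_size n (restrict nu {1..n}) = int k" using d(3,4) by (simp add: sig_size_def N_def)
      qed simp
    qed
    also have "\<dots> = S k u y"
      unfolding S_def
    proof (rule sum.mono_neutral_left)
      show "\<forall>nu\<in>partitions N k - {nu \<in> partitions N k. nu N = 0}. cauchy_coeff th N nu * jack_nonneg th N nu u * jack_nonneg th M (zero_ext N nu) y = 0"
      proof
        fix nu assume v: "nu \<in> partitions N k - {nu \<in> partitions N k. nu N = 0}"
        then have "is_partition (Suc n) nu" "nu (Suc n) \<noteq> 0" by (auto dest: partitionsD(2) simp: N_def)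
        then have "jack_nonneg th (Suc n) nu u = 0"
          using jack_nonneg_last_zero[where x = u, OF th _ u[unfolded N_def]] by (simp del: jack_nonneg.simps)
        then show "cauchy_coeff th N nu * jack_nonneg th N nu u * jack_nonneg th M (zero_ext N nu) y = 0"
          by (simp add: N_def del: jack_nonneg.simps)
      qed
    qed (auto simp: finite_partitions)
    finally show ?thesis .
  qed
  have "C k u y = S k u y" if y: "\<And>j. 1 \<le> j ==> j \<le> M ==> 0 < y j" for k u y
    using y
  proof (induction k arbitrary: u y rule: nat_less_induct)
    case (1 k)
    note y = 1(2)
    have deriv: "((\<lambda>t. C k (\<lambda>i. u i + t) y - S k (\<lambda>i. u i + t) y) has_real_derivative 0) (at 0)" for u
    proof -
      obtain E where E: "fps_has_derivative (\<lambda>t. cauchy_fps th N M u (\<lambda>j. y j / (1 - t * y j))) E"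
        "fps_has_derivative (\<lambda>t. cauchy_fps th N M (\<lambda>i. u i + t) y)
           (fps_X * (E + fps_const (th * real N * (\<Sum>j=1..M. y j)) * cauchy_fps th N M u y))"
        by (rule cauchy_fps_derivatives)
      have dS: "((\<lambda>t. S k (\<lambda>i. u i + t) y) has_real_derivative
         (\<Sum>nu\<in>partitions N k. \<Sum>i\<in>removable N nu. cauchy_coeff th N nu * lower_coeff th N nu i * jack_nonneg th N (nu(i := nu i - 1)) u * jack_nonneg th M (zero_ext N nu) y)) (at 0)"
        unfolding S_def
      proof (rule DERIV_sum)
        fix nu assume "nu \<in> partitions N k"
        note D = jack_lowering[OF th partitionsD(2)[OF this], of u]
        show "((\<lambda>t. cauchy_coeff th N nu * jack_nonneg th N nu (\<lambda>i. u i + t) * jack_nonneg th M (zero_ext N nu) y) has_real_derivative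
          (\<Sum>i\<in>removable N nu. cauchy_coeff th N nu * lower_coeff th N nu i * jack_nonneg th N (nu(i := nu i - 1)) u * jack_nonneg th M (zero_ext N nu) y)) (at 0)"
          by (rule DERIV_cong[OF DERIV_cmult_right[OF DERIV_cmult[OF D]]])
            (simp only: sum_distrib_left sum_distrib_right mult.assoc)
      qed
      have dC: "((\<lambda>t. C k (\<lambda>i. u i + t) y) has_real_derivative
          fps_nth (fps_X * (E + fps_const (th * real N * (\<Sum>j=1..M. y j)) * cauchy_fps th N M u y)) k) (at 0)"
        using E(2) by (simp only: fps_has_derivative_def C_def)
      have "fps_nth (fps_X * (E + fps_const (th * real N * (\<Sum>j=1..M. y j)) * cauchy_fps th N M u y)) k =
         (\<Sum>nu\<in>partitions N k. \<Sum>i\<in>removable N nu. cauchy_coeff th N nu * lower_coeff th N nu i * jack_nonneg th N (nu(i := nu i - 1)) u * jack_nonneg th M (zero_ext N nu) y)"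
      proof (cases k)
        case 0
        then show ?thesis by (simp add: removable_partitions_0)
      next
        case (Suc l)
        have IH: "C l u y' = S l u y'" if "\<And>j. 1 \<le> j ==> j \<le> M ==> 0 < y' j" for y'
          using 1(1) Suc that by auto
        have ev: "\<forall>\<^sub>F t in nhds 0. \<forall>j\<in>{1..M}. 1 - t * y j > 0"
        proof (intro eventually_ball_finite ballI)
          fix j
          have "open {t. 0 < 1 - t * y j}" by (intro open_Collect_less continuous_intros)
          from eventually_nhds_in_open[OF this, of 0] show "\<forall>\<^sub>F t in nhds 0. 1 - t * y j > 0" by simp
        qed simp
        \<comment> \<open>The identity of degree \<open>l\<close> holds along the flow of y near t =
          0, so its two sides have the same derivative. This evaluates \<open>E\<close> in terms of
          Jack polynomials.\<close>
        then have "\<forall>\<^sub>F t in nhds 0. C l u (\<lambda>j. y j / (1 - t * y j)) = S l u (\<lambda>j. y j / (1 - t * y j))"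
          by eventually_elim (use y in \<open>auto intro!: IH\<close>)
        moreover have "((\<lambda>t. C l u (\<lambda>j. y j / (1 - t * y j))) has_real_derivative fps_nth E l) (at 0)"
          using E(1) by (simp add: fps_has_derivative_def C_def)
        ultimately have "((\<lambda>t. S l u (\<lambda>j. y j / (1 - t * y j))) has_real_derivative fps_nth E l) (at 0)"
          by (subst (asm) DERIV_cong_ev[OF refl _ refl])
        moreover have "((\<lambda>t. S l u (\<lambda>j. y j / (1 - t * y j))) has_real_derivative
           (\<Sum>mu\<in>partitions N l. cauchy_coeff th N mu * jack_nonneg th N mu u *
             (\<Sum>i\<in>addable M (zero_ext N mu). (shifted th (zero_ext N mu) i + th) * raise_coeff th M (zero_ext N mu) i *
               jack_nonneg th M ((zero_ext N mu)(i := zero_ext N mu i + 1)) y))) (at 0)"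
          unfolding S_def
        proof (intro DERIV_sum DERIV_cmult)
          fix mu assume "mu \<in> partitions N l"
          then show "((\<lambda>t. jack_nonneg th M (zero_ext N mu) (\<lambda>j. y j / (1 - t * y j))) has_real_derivative
             (\<Sum>i\<in>addable M (zero_ext N mu). (shifted th (zero_ext N mu) i + th) * raise_coeff th M (zero_ext N mu) i *
               jack_nonneg th M ((zero_ext N mu)(i := zero_ext N mu i + 1)) y)) (at 0)"
            by (intro jack_raising[OF th] zero_ext_partition y) (auto dest: partitionsD)
        qed
        ultimately have El: "fps_nth E l = (\<Sum>mu\<in>partitions N l. cauchy_coeff th N mu * jack_nonneg th N mu u *
             (\<Sum>i\<in>addable M (zero_ext N mu). (shifted th (zero_ext N mu) i + th) * raise_coeff th M (zero_ext N mu) i *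
               jack_nonneg th M ((zero_ext N mu)(i := zero_ext N mu i + 1)) y))"
          by (rule DERIV_unique)
        have "fps_nth (fps_X * (E + fps_const (th * real N * (\<Sum>j=1..M. y j)) * cauchy_fps th N M u y)) k =
           fps_nth E l + th * real N * (\<Sum>j=1..M. y j) * S l u y"
          using IH[OF y] by (simp add: Suc C_def)
        also have "\<dots> = (\<Sum>mu\<in>partitions N l. cauchy_coeff th N mu * jack_nonneg th N mu u *
             ((\<Sum>i\<in>addable M (zero_ext N mu). (shifted th (zero_ext N mu) i + th) * raise_coeff th M (zero_ext N mu) i *
               jack_nonneg th M ((zero_ext N mu)(i := zero_ext N mu i + 1)) y) +
              th * real N * (\<Sum>j=1..M. y j) * jack_nonneg th M (zero_ext N mu) y))"
          unfolding El S_def by (simp only: sum_distrib_left sum.distrib[symmetric] distrib_left mult_ac)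
        also have "\<dots> = (\<Sum>mu\<in>partitions N l. cauchy_coeff th N mu * jack_nonneg th N mu u *
             (\<Sum>i\<in>addable N mu. (shifted th mu i + th + th * real N) * raise_coeff th N mu i * jack_nonneg th M (zero_ext N (mu(i := mu i + 1))) y))"
          by (intro sum.cong refl arg_cong2[of _ _ _ _ "(*)"] raising_pairs th NM y) (auto dest: partitionsD)
        also have "\<dots> = (\<Sum>mu\<in>partitions N l. \<Sum>i\<in>addable N mu. cauchy_coeff th N (mu(i := mu i + 1)) * lower_coeff th N (mu(i := mu i + 1)) i *
            jack_nonneg th N ((mu(i := mu i + 1))(i := (mu(i := mu i + 1)) i - 1)) u * jack_nonneg th M (zero_ext N (mu(i := mu i + 1))) y)"
          unfolding sum_distrib_left
        proof (intro sum.cong refl)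
          fix mu i assume m: "mu \<in> partitions N l" "i \<in> addable N mu"
          have b: "(mu(i := mu i + 1))(i := (mu(i := mu i + 1)) i - 1) = mu" by simp
          show "cauchy_coeff th N mu * jack_nonneg th N mu u * ((shifted th mu i + th + th * real N) * raise_coeff th N mu i * jack_nonneg th M (zero_ext N (mu(i := mu i + 1))) y) =
            cauchy_coeff th N (mu(i := mu i + 1)) * lower_coeff th N (mu(i := mu i + 1)) i *
            jack_nonneg th N ((mu(i := mu i + 1))(i := (mu(i := mu i + 1)) i - 1)) u * jack_nonneg th M (zero_ext N (mu(i := mu i + 1))) y"
            unfolding b cauchy_coeff_raise[OF th partitionsD(2)[OF m(1)] m(2)] by (simp only: mult_ac)
        qed
        finally show ?thesis unfolding Suc partitions_pairs .
      qed
      with DERIV_diff[OF dC dS] show ?thesis by simp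
    qed
    define f where "f t = C k (\<lambda>i. u i + t) y - S k (\<lambda>i. u i + t) y" for t
    have fd: "(f has_real_derivative 0) (at t)" for t
    proof -
      have "((\<lambda>s. f (t + s)) has_real_derivative 0) (at 0)"
        using deriv[of "\<lambda>i. u i + t"] by (simp add: f_def add.assoc)
      then show ?thesis using DERIV_shift[of f 0 0 t] by (simp add: add.commute)
    qed
    have "f 0 = f (- u N)" by (rule DERIV_isconst_all[of f], rule allI, rule fd)
    also have "f (- u N) = 0" unfolding f_def using zero[of "\<lambda>i. u i + - u N" y k] y by simp
    finally show ?case by (simp add: f_def)
  qed
  from this[OF Suc.prems(2)] show ?case by (simp add: C_def S_def N_def)
qed

section \<open>Linear independence of the Jack polynomials\<close>

lemma jack_nonneg_homogeneous:
  "is_partition n nu ==> jack_nonneg th n nu (\<lambda>i. c * x i) = c ^ nat (sig_size n nu) * jack_nonneg th n nu x"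
proof (induction n arbitrary: nu)
  case 0
  then show ?case by (simp add: sig_size_def)
next
  case (Suc N)
  show ?case unfolding jack_nonneg.simps sum_distrib_left
  proof (intro sum.cong refl)
    fix mu assume m: "mu \<in> interlacing N nu"
    have pm: "is_partition N mu" by (rule interlacing_partition[OF Suc.prems m])
    have "0 \<le> sig_size N mu" unfolding sig_size_def by (rule sum_nonneg) (use partitionD(2)[OF pm] in auto)
    then have "nat (sig_size (Suc N) nu) = nat (sig_size (Suc N) nu - sig_size N mu) + nat (sig_size N mu)"
      using sig_size_interlacing'[OF m Suc.prems] by simp
    then show "jack_psi th N nu mu * (c * x (Suc N)) ^ nat (sig_size (Suc N) nu - sig_size N mu) * jack_nonneg th N mu (\<lambda>i. c * x i) =
       c ^ nat (sig_size (Suc N) nu) * (jack_psi th N nu mu * x (Suc N) ^ nat (sig_size (Suc N) nu - sig_size N mu) * jack_nonneg th N mu x)"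
      using Suc.IH[OF pm] by (simp add: power_add power_mult_distrib)
  qed
qed

text \<open>For 0 < x < 1, the points of \<open>cone (Suc n) x\<close> are, up to a positive factor,
  those u with \<open>nodes n 1 x u\<close>: dividing by the last coordinate makes it 1. The cone is
  the region in which Cauchy products are compared.\<close>

definition cone :: "nat => real => (nat => real) set" where
  "cone n x = {u. (\<forall>i\<in>{1..n}. 0 < u i) \<and> (\<forall>i\<in>{1..<n}. u i < x * u (Suc i))}"

text \<open>Within the cone the last variable may be arbitrarily large while the others stay fixed.
  A vanishing combination is thus a polynomial in it with infinitely many roots, and its
  coefficients are combinations of Jack polynomials in fewer variables, to which the induction
  applies. Triangularity of the branching rule then isolates one coefficient
  \<open>a nu\<close>.\<close>

lemma jack_nonneg_independent:
  assumes th: "th > 0" and x: "x > 0"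
  shows "finite S ==> (\<And>nu. nu \<in> S ==> nu \<in> extensional {1..n} \<and> is_partition n nu) ==>
    (\<And>u. u \<in> cone n x ==> (\<Sum>nu\<in>S. a nu * jack_nonneg th n nu u) = 0) ==> nu \<in> S ==> a nu = 0"
proof (induction n arbitrary: S a nu)
  case 0
  have "S \<subseteq> {\<lambda>_. undefined}" using 0(2) by (auto simp: extensional_def)
  then have "S = {\<lambda>_. undefined}" "nu = (\<lambda>_. undefined)" using 0(4) by auto
  then show ?case using 0(3)[of "\<lambda>_. 1"] by (simp add: cone_def)
next
  case (Suc n)
  define k where "k nu mu = nat (sig_size (Suc n) nu - sig_size n mu)" for nu mu
  define T where "T = (\<Union>nu\<in>S. interlacing n nu)"
  define d where "d l mu = (\<Sum>nu\<in>S. if k nu mu = l then a nu * psi0 th n nu mu else 0)" for l mu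
  have finT: "finite T" unfolding T_def using Suc.prems(1) finite_interlacing by auto
  have dz: "d l mu = 0" if mu: "mu \<in> T" for l mu
  proof (rule Suc.IH[OF finT _ _ mu])
    fix mu assume "mu \<in> T"
    then obtain nu where v: "nu \<in> S" "mu \<in> interlacing n nu" by (auto simp: T_def)
    then show "mu \<in> extensional {1..n} \<and> is_partition n mu"
      using interlacing_partition[of n nu mu] Suc.prems(2)[of nu] by (auto simp: interlacing_def PiE_def)
  next
    fix u assume u: "u \<in> cone n x"
    define L where "L = Max (insert l ((\<lambda>(nu, mu). k nu mu) ` (S \<times> T)))"
    have fin: "finite (insert l ((\<lambda>(nu, mu). k nu mu) ` (S \<times> T)))" using Suc.prems(1) finT by simp
    have kL: "k nu mu \<le> L" if "nu \<in> S" "mu \<in> T" for nu mu unfolding L_def by (rule Max_ge[OF fin]) (use that in auto)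
    have lL: "l \<le> L" unfolding L_def by (rule Max_ge[OF fin]) simp
    define q where "q l = (\<Sum>mu\<in>T. d l mu * jack_nonneg th n mu u)" for l
    have q0: "(\<Sum>l\<le>L. q l * s ^ l) = 0" if s: "s > (if n = 0 then 0 else u n / x)" "s > 0" for s
    proof -
      define v where "v = u(Suc n := s)"
      have "v \<in> cone (Suc n) x"
        using u s x by (auto simp: cone_def v_def divide_less_eq mult.commute less_Suc_eq)
      then have "0 = (\<Sum>nu\<in>S. a nu * jack_nonneg th (Suc n) nu v)" using Suc.prems(3) by simp
      also have "\<dots> = (\<Sum>nu\<in>S. \<Sum>mu\<in>T. a nu * psi0 th n nu mu * s ^ k nu mu * jack_nonneg th n mu u)"
      proof (rule sum.cong[OF refl])
        fix nu assume vS: "nu \<in> S"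
        have "jack_nonneg th (Suc n) nu v = (\<Sum>mu\<in>T. psi0 th n nu mu * s ^ k nu mu * jack_nonneg th n mu u)"
          unfolding jack_nonneg.simps
        proof (rule sum.mono_neutral_cong_left[OF finT])
          show "interlacing n nu \<subseteq> T" using vS by (auto simp: T_def)
          fix mu assume "mu \<in> interlacing n nu"
          moreover have "jack_nonneg th n mu v = jack_nonneg th n mu u" by (rule jack_nonneg_cong) (auto simp: v_def)
          ultimately show "jack_psi th n nu mu * v (Suc n) ^ nat (sig_size (Suc n) nu - sig_size n mu) * jack_nonneg th n mu v =
            psi0 th n nu mu * s ^ k nu mu * jack_nonneg th n mu u" by (simp add: psi0_def k_def v_def)
        qed (auto simp: psi0_def)
        then show "a nu * jack_nonneg th (Suc n) nu v = (\<Sum>mu\<in>T. a nu * psi0 th n nu mu * s ^ k nu mu * jack_nonneg th n mu u)"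
          by (simp only: sum_distrib_left mult.assoc)
      qed
      also have "\<dots> = (\<Sum>nu\<in>S. \<Sum>mu\<in>T. \<Sum>l\<le>L. (if k nu mu = l then a nu * psi0 th n nu mu else 0) * jack_nonneg th n mu u * s ^ l)"
      proof (intro sum.cong refl)
        fix nu mu assume "nu \<in> S" "mu \<in> T"
        then have "k nu mu \<in> {..L}" using kL by simp
        then have "(\<Sum>l\<le>L. if k nu mu = l then a nu * psi0 th n nu mu * jack_nonneg th n mu u * s ^ l else 0) = a nu * psi0 th n nu mu * jack_nonneg th n mu u * s ^ k nu mu"
          by (subst sum.delta') auto
        moreover have "(\<Sum>l\<le>L. (if k nu mu = l then a nu * psi0 th n nu mu else 0) * jack_nonneg th n mu u * s ^ l) =
          (\<Sum>l\<le>L. if k nu mu = l then a nu * psi0 th n nu mu * jack_nonneg th n mu u * s ^ l else 0)"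
          by (intro sum.cong) auto
        ultimately show "a nu * psi0 th n nu mu * s ^ k nu mu * jack_nonneg th n mu u =
          (\<Sum>l\<le>L. (if k nu mu = l then a nu * psi0 th n nu mu else 0) * jack_nonneg th n mu u * s ^ l)" by simp
      qed
      also have "\<dots> = (\<Sum>l\<le>L. \<Sum>mu\<in>T. \<Sum>nu\<in>S. (if k nu mu = l then a nu * psi0 th n nu mu else 0) * jack_nonneg th n mu u * s ^ l)"
        by (subst sum.swap, subst (2) sum.swap, subst sum.swap) (rule refl)
      also have "\<dots> = (\<Sum>l\<le>L. q l * s ^ l)"
        unfolding q_def d_def sum_distrib_right ..
      finally show ?thesis by simp
    qed
    have "\<forall>i\<le>L. q i = 0"
    proof (rule ccontr)
      assume "\<not> (\<forall>i\<le>L. q i = 0)"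
      then have "finite {s. (\<Sum>l\<le>L. q l * s ^ l) = 0}" by (subst polyfun_finite_roots) auto
      moreover have "{max 1 (1 + (if n = 0 then 0 else u n / x))<..} \<subseteq> {s. (\<Sum>l\<le>L. q l * s ^ l) = 0}" using q0 by auto
      ultimately have "finite {max 1 (1 + (if n = 0 then 0 else u n / x))<..}" by (rule finite_subset[rotated])
      then show False by (simp add: infinite_Ioi)
    qed
    then show "(\<Sum>mu\<in>T. d l mu * jack_nonneg th n mu u) = 0" using lL by (simp add: q_def)
  qed
  show ?case
  proof (rule ccontr)
    assume nz: "a nu \<noteq> 0"
    define A where "A = {nu \<in> S. a nu \<noteq> 0}"
    have A: "finite A" "A \<noteq> {}" using Suc.prems(1,4) nz by (auto simp: A_def)
    \<comment> \<open>For \<open>mu\<close> the restriction of \<kappa>, every competing nu has rows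
      at least those of \<kappa>, by interlacing for the first n rows and by this choice for the
      last one. The degree in the last variable fixes the size, so nu = \<kappa>, and a single term
      is left.\<close>
    obtain \<kappa> where ka: "\<kappa> \<in> A" "\<And>nu. nu \<in> A ==> \<kappa> (Suc n) \<le> nu (Suc n)"
      using ex_is_arg_min_if_finite[OF A, of "\<lambda>nu. nu (Suc n)"] by (force simp: is_arg_min_def not_less)
    have kS: "\<kappa> \<in> S" "a \<kappa> \<noteq> 0" using ka by (auto simp: A_def)
    have kp: "\<kappa> \<in> extensional {1..Suc n}" "is_partition (Suc n) \<kappa>" using Suc.prems(2)[OF kS(1)] by auto
    define mu where "mu = restrict \<kappa> {1..n}"
    have mi: "mu \<in> interlacing n \<kappa>" unfolding mu_def by (rule restrict_interlacing[OF partitionD(1)[OF kp(2)]])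
    define l where "l = k \<kappa> mu"
    have smu: "sig_size n mu = sig_size n \<kappa>" by (simp add: sig_size_def mu_def)
    have "d l mu = (\<Sum>nu\<in>{\<kappa>}. if k nu mu = l then a nu * psi0 th n nu mu else 0)"
      unfolding d_def
    proof (rule sum.mono_neutral_right)
      show "\<forall>nu\<in>S - {\<kappa>}. (if k nu mu = l then a nu * psi0 th n nu mu else 0) = 0"
      proof (rule ballI, rule ccontr)
        fix nu assume v: "nu \<in> S - {\<kappa>}" and "(if k nu mu = l then a nu * psi0 th n nu mu else 0) \<noteq> 0"
        then have kl: "k nu mu = l" and av: "a nu \<noteq> 0" and vi: "mu \<in> interlacing n nu"
          by (auto simp: psi0_def split: if_splits)
        have vp: "nu \<in> extensional {1..Suc n}" "is_partition (Suc n) nu" using Suc.prems(2)[of nu] v by auto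
        have "sig_size (Suc n) nu - sig_size n mu = sig_size (Suc n) \<kappa> - sig_size n mu"
          using kl sig_size_interlacing'[OF vi vp(2)] sig_size_interlacing'[OF mi kp(2)]
          unfolding l_def k_def by (subst (asm) eq_nat_nat_iff) auto
        then have s: "sig_size n nu + nu (Suc n) = sig_size n \<kappa> + \<kappa> (Suc n)" by (simp add: sig_size_Suc)
        have le: "\<kappa> i \<le> nu i" if "i \<in> {1..n}" for i
          using interlacing_bounds(2)[OF vi, of i] that by (auto simp: mu_def)
        have "\<kappa> (Suc n) \<le> nu (Suc n)" using ka(2)[of nu] v av by (simp add: A_def)
        moreover have "sig_size n \<kappa> \<le> sig_size n nu" unfolding sig_size_def by (rule sum_mono[OF le])
        ultimately have e: "nu (Suc n) = \<kappa> (Suc n)" "sig_size n \<kappa> = sig_size n nu" using s by auto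
        have "nu i = \<kappa> i" if i: "i \<in> {1..n}" for i
        proof (rule ccontr)
          assume "nu i \<noteq> \<kappa> i"
          then have "\<exists>i\<in>{1..n}. \<kappa> i < nu i" using le[OF i] i by force
          then have "sig_size n \<kappa> < sig_size n nu" unfolding sig_size_def using le by (intro sum_strict_mono_ex1) auto
          then show False using e by simp
        qed
        then have "nu = \<kappa>" using e(1) vp(1) kp(1)
          by (intro extensionalityI[OF vp(1) kp(1)]) (auto simp: le_Suc_eq)
        then show False using v by simp
      qed
    qed (use Suc.prems(1) kS in auto)
    also have "\<dots> = a \<kappa> * jack_psi th n \<kappa> mu" using mi by (simp add: l_def psi0_def)
    finally have "a \<kappa> * jack_psi th n \<kappa> mu = 0" using dz[of mu l] kS mi by (auto simp: T_def)
    then show False using kS(2) jack_psi_pos[OF th partitionD(1)[OF kp(2)] mi] by simp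
  qed
qed

section \<open>Substitution lemmas for nonnegative integrals\<close>

text \<open>As \<open>g\<close> may be singular at the endpoints, the interval is exhausted by the
  compact intervals from \<open>A n\<close> to \<open>B n\<close>, and the results are joined by
  continuity of measures from below. On each of them the reflection y = -x turns the decreasing map
  into an increasing one.\<close>

lemma nn_integral_substitution_decreasing:
  fixes f :: "real => ennreal" and g g' :: "real => real"
  assumes [measurable]: "f \<in> borel_measurable borel" "g \<in> borel_measurable borel" "g' \<in> borel_measurable borel"
    and ab: "a < b"
    and deriv: "\<And>x. a < x ==> x < b ==> (g has_real_derivative g' x) (at x)"
    and cont: "continuous_on {a<..<b} g'"
    and neg: "\<And>x. a < x ==> x < b ==> g' x < 0"
    and pos: "\<And>x. a < x ==> x < b ==> 0 < g x"
    and onto: "\<And>t. 0 < t ==> \<exists>x. a < x \<and> x < b \<and> g x = t"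
  shows "(\<integral>\<^sup>+t. f t * indicator {0<..} t \<partial>lborel) = (\<integral>\<^sup>+x. f (g x) * ennreal (- g' x) * indicator {a<..<b} x \<partial>lborel)"
proof -
  define A B where "A n = a + (b - a) / (real n + 3)" and "B n = b - (b - a) / (real n + 3)" for n :: nat
  have AB: "a < A n" "A n < B n" "B n < b" for n
  proof -
    define q where "q = (b - a) / (real n + 3)"
    have "q > 0" using ab by (simp add: q_def)
    moreover have "q \<le> (b - a) / 3" unfolding q_def by (rule divide_left_mono) (use ab in auto)
    ultimately show "a < A n" "A n < B n" "B n < b"
      using ab unfolding A_def B_def q_def[symmetric] by auto
  qed
  have mono: "A (Suc n) \<le> A n" "B n \<le> B (Suc n)" for n
    using ab by (auto simp: A_def B_def intro!: divide_left_mono)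
  have lim: "A \<longlonglongrightarrow> a" "B \<longlonglongrightarrow> b"
  proof -
    have "(\<lambda>n. (b - a) / (real n + 3)) \<longlonglongrightarrow> 0"
      by (rule real_tendsto_divide_at_top[OF tendsto_const])
        (rule filterlim_at_top_mono[OF filterlim_real_sequentially], simp)
    note tendsto_add[OF tendsto_const this, of a] tendsto_diff[OF tendsto_const this, of b]
    then show "A \<longlonglongrightarrow> a" "B \<longlonglongrightarrow> b" unfolding A_def[abs_def] B_def[abs_def] by simp_all
  qed
  have dec: "g y \<le> g x" if "a < x" "x \<le> y" "y < b" for x y
  proof (rule DERIV_nonpos_imp_nonincreasing[OF that(2)])
    fix z assume "x \<le> z" "z \<le> y"
    then have "a < z" "z < b" using that by auto
    then show "\<exists>d. (g has_real_derivative d) (at z) \<and> d \<le> 0" using deriv neg by (metis less_imp_le)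
  qed
  have ex: "\<exists>n. A n \<le> x \<and> x \<le> B n" if "a < x" "x < b" for x
  proof -
    have "\<forall>\<^sub>F n in sequentially. A n < x" "\<forall>\<^sub>F n in sequentially. x < B n"
      using order_tendstoD(2)[OF lim(1) that(1)] order_tendstoD(1)[OF lim(2) that(2)] by auto
    then have "\<forall>\<^sub>F n in sequentially. A n < x \<and> x < B n" by eventually_elim auto
    from eventually_happens[OF this] show ?thesis by (auto intro: less_imp_le)
  qed
  have step: "(\<integral>\<^sup>+t. f t * indicator {g (B n)..g (A n)} t \<partial>lborel) =
     (\<integral>\<^sup>+x. (f (g x) * ennreal (- g' x) * indicator {a<..<b} x) * indicator {A n..B n} x \<partial>lborel)" for n
  proof -
    have "(\<integral>\<^sup>+t. f t * indicator {(\<lambda>y. g (- y)) (- B n)..(\<lambda>y. g (- y)) (- A n)} t \<partial>lborel) =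
       (\<integral>\<^sup>+y. f (g (- y)) * (- g' (- y)) * indicator {- B n..- A n} y \<partial>lborel)"
    proof (rule nn_integral_substitution_aux)
      show "- B n < - A n" using AB(2)[of n] by simp
      fix y assume y: "y \<in> {- B n..- A n}"
      then have y': "a < - y" "- y < b" using AB[of n] by auto
      show "((\<lambda>y. g (- y)) has_real_derivative - g' (- y)) (at y)"
        by (rule DERIV_cong[OF DERIV_chain2[where g = uminus, OF deriv[OF y']]]) (auto intro!: derivative_eq_intros)
      show "- g' (- y) \<ge> 0" using neg[OF y'] by simp
    next
      show "continuous_on {- B n..- A n} (\<lambda>y. - g' (- y))"
        by (intro continuous_on_minus continuous_on_compose2[OF cont] continuous_intros) (use AB[of n] in auto)
    qed auto
    also have "\<dots> = (\<integral>\<^sup>+x. f (g x) * ennreal (- g' x) * indicator {A n..B n} x \<partial>lborel)"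
      by (subst nn_integral_real_affine[where c = "-1" and t = 0]) (auto intro!: nn_integral_cong simp: indicator_def)
    also have "\<dots> = (\<integral>\<^sup>+x. (f (g x) * ennreal (- g' x) * indicator {a<..<b} x) * indicator {A n..B n} x \<partial>lborel)"
      using AB[of n] by (intro nn_integral_cong) (auto simp: indicator_def)
    finally show ?thesis by simp
  qed
  have union: "(\<integral>\<^sup>+x. F x * indicator (\<Union>n. S n) x \<partial>lborel) = (SUP n. \<integral>\<^sup>+x. F x * indicator (S n) x \<partial>lborel)"
    if [measurable]: "F \<in> borel_measurable borel" "\<And>n. S n \<in> sets borel" and S: "incseq S" for F :: "real => ennreal" and S :: "nat => real set"
  proof -
    have "emeasure (density lborel F) (\<Union>n. S n) = (SUP n. emeasure (density lborel F) (S n))"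
      by (rule SUP_emeasure_incseq[symmetric]) (use S in auto)
    then show ?thesis by (simp add: emeasure_density)
  qed
  have U1: "(\<Union>n. {g (B n)..g (A n)}) = {0<..}"
  proof safe
    fix n t assume "t \<in> {g (B n)..g (A n)}"
    then show "0 < t" using pos[of "B n"] AB[of n] by force
  next
    fix t :: real assume "0 < t"
    then obtain x where x: "a < x" "x < b" "g x = t" using onto by blast
    then obtain n where "A n \<le> x" "x \<le> B n" using ex by blast
    then show "t \<in> (\<Union>n. {g (B n)..g (A n)})" using x dec[of "A n" x] dec[of x "B n"] AB[of n] by auto
  qed
  have U2: "(\<Union>n. {A n..B n}) = {a<..<b}"
  proof safe
    fix n x assume "x \<in> {A n..B n}"
    then show "x \<in> {a<..<b}" using AB[of n] by auto
  next
    fix x assume "x \<in> {a<..<b}"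
    then show "x \<in> (\<Union>n. {A n..B n})" using ex[of x] by auto
  qed
  have "(\<integral>\<^sup>+t. f t * indicator {0<..} t \<partial>lborel) = (SUP n. \<integral>\<^sup>+t. f t * indicator {g (B n)..g (A n)} t \<partial>lborel)"
    unfolding U1[symmetric]
  proof (rule union)
    show "incseq (\<lambda>n. {g (B n)..g (A n)})"
    proof (rule incseq_SucI)
      fix n
      have "g (B (Suc n)) \<le> g (B n)" "g (A n) \<le> g (A (Suc n))"
        by (rule dec; use AB[of n] AB[of "Suc n"] mono[of n] in linarith)+
      then show "{g (B n)..g (A n)} \<subseteq> {g (B (Suc n))..g (A (Suc n))}" by auto
    qed
  qed auto
  also have "\<dots> = (SUP n. \<integral>\<^sup>+x. (f (g x) * ennreal (- g' x) * indicator {a<..<b} x) * indicator {A n..B n} x \<partial>lborel)"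
    by (simp only: step)
  also have "\<dots> = (\<integral>\<^sup>+x. (f (g x) * ennreal (- g' x) * indicator {a<..<b} x) * indicator {a<..<b} x \<partial>lborel)"
    unfolding U2[symmetric]
  proof (rule union[symmetric])
    show "incseq (\<lambda>n. {A n..B n})" using mono by (intro incseq_SucI) (auto intro: order_trans)
  qed auto
  also have "\<dots> = (\<integral>\<^sup>+x. f (g x) * ennreal (- g' x) * indicator {a<..<b} x \<partial>lborel)"
    by (intro nn_integral_cong) (auto simp: indicator_def)
  finally show ?thesis .
qed

section \<open>Product Lebesgue measure and rescaling of coordinates\<close>

abbreviation lborel_prod :: "nat set => (nat => real) measure" where
  "lborel_prod I \<equiv> Pi\<^sub>M I (\<lambda>_. lborel)"

lemma product_sigma_finite_lborel: "product_sigma_finite (\<lambda>_ :: nat. lborel :: real measure)"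
  by standard

lemmas lborel_prod_insert = product_sigma_finite.product_nn_integral_insert[OF product_sigma_finite_lborel]
lemmas lborel_prod_insert_rev = product_sigma_finite.product_nn_integral_insert_rev[OF product_sigma_finite_lborel]

lemma nn_integral_lborel_prod_scale:
  assumes "finite I" "\<And>i. i \<in> I ==> 0 < c i" "f \<in> borel_measurable (lborel_prod I)"
  shows "(\<integral>\<^sup>+s. f s \<partial>lborel_prod I) = ennreal (\<Prod>i\<in>I. c i) * (\<integral>\<^sup>+s. f (\<lambda>i\<in>I. c i * s i) \<partial>lborel_prod I)"
  using assms
proof (induction I arbitrary: f rule: finite_induct)
  case empty
  have "(\<integral>\<^sup>+s. f (\<lambda>i\<in>{}. c i * s i) \<partial>lborel_prod {}) = (\<integral>\<^sup>+s. f s \<partial>lborel_prod {})"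
    by (rule nn_integral_cong) (auto simp: space_PiM restrict_def)
  then show ?case by (simp only: prod.empty ennreal_1 mult_1)
next
  case (insert d I)
  note [measurable] = insert.prems(2)
  have cd: "c d > 0" using insert.prems by auto
  have "(\<integral>\<^sup>+s. f s \<partial>lborel_prod (insert d I)) = (\<integral>\<^sup>+s. (\<integral>\<^sup>+y. f (s(d := y)) \<partial>lborel) \<partial>lborel_prod I)"
    by (rule lborel_prod_insert) (use insert in auto)
  also have "\<dots> = (\<integral>\<^sup>+s. ennreal (c d) * (\<integral>\<^sup>+y. f (s(d := c d * y)) \<partial>lborel) \<partial>lborel_prod I)"
  proof (rule nn_integral_cong)
    fix s assume "s \<in> space (lborel_prod I)"
    then have "(\<lambda>y. f (s(d := y))) \<in> borel_measurable borel"
      using measurable_comp[OF measurable_component_update insert.prems(2)] insert.hyps by (simp add: comp_def)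
    from nn_integral_real_affine[OF this, of "c d" 0] show "(\<integral>\<^sup>+y. f (s(d := y)) \<partial>lborel) = ennreal (c d) * (\<integral>\<^sup>+y. f (s(d := c d * y)) \<partial>lborel)"
      using cd by simp
  qed
  also have "\<dots> = ennreal (c d) * (\<integral>\<^sup>+s. (\<integral>\<^sup>+y. f (s(d := c d * y)) \<partial>lborel) \<partial>lborel_prod I)"
    by (rule nn_integral_cmult) measurable
  also have "(\<integral>\<^sup>+s. (\<integral>\<^sup>+y. f (s(d := c d * y)) \<partial>lborel) \<partial>lborel_prod I) =
     ennreal (\<Prod>i\<in>I. c i) * (\<integral>\<^sup>+s. (\<integral>\<^sup>+y. f ((\<lambda>i\<in>I. c i * s i)(d := c d * y)) \<partial>lborel) \<partial>lborel_prod I)"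
  proof (rule insert.IH)
    show "(\<lambda>s. \<integral>\<^sup>+y. f (s(d := c d * y)) \<partial>lborel) \<in> borel_measurable (lborel_prod I)" by measurable
  qed (use insert.prems in auto)
  also have "(\<integral>\<^sup>+s. (\<integral>\<^sup>+y. f ((\<lambda>i\<in>I. c i * s i)(d := c d * y)) \<partial>lborel) \<partial>lborel_prod I) =
     (\<integral>\<^sup>+s. (\<integral>\<^sup>+y. f (\<lambda>i\<in>insert d I. c i * (s(d := y)) i) \<partial>lborel) \<partial>lborel_prod I)"
  proof (intro nn_integral_cong arg_cong[where f = f])
    fix s y
    show "(\<lambda>i\<in>I. c i * s i)(d := c d * y) = (\<lambda>i\<in>insert d I. c i * (s(d := y)) i)"
      using insert.hyps by (auto simp: restrict_def fun_eq_iff)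
  qed
  also have "\<dots> = (\<integral>\<^sup>+s. f (\<lambda>i\<in>insert d I. c i * s i) \<partial>lborel_prod (insert d I))"
  proof (rule lborel_prod_insert[symmetric])
    show "(\<lambda>s. f (\<lambda>i\<in>insert d I. c i * s i)) \<in> borel_measurable (lborel_prod (insert d I))" by measurable
  qed (use insert.hyps in auto)
  moreover have "ennreal (\<Prod>i\<in>insert d I. c i) = ennreal (c d) * ennreal (\<Prod>i\<in>I. c i)"
    using insert.hyps insert.prems(1) by (simp add: ennreal_mult prod_nonneg less_imp_le)
  ultimately show ?case by (simp only: mult.assoc)
qed

section \<open>The change of variables\<close>

text \<open>
  The nodes \<open>X k < \<dots> < X m < X (m + 1) = 1\<close> and the points \<open>y j = X j * W j\<close> interlace, and
  \<open>\<Prod>j. (z - y j) / (z - X j) = \<Sum>i. p i * (z - x * X i) / (z - X i)\<close> defines a point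
  \<open>p\<close> of the open simplex. The lower bound \<open>k\<close> of the index range varies for the
  sake of the induction, which removes \<open>w k\<close>.
\<close>

definition nodes :: "nat => nat => real => (nat => real) => bool" where
  "nodes m k x X \<longleftrightarrow> 0 < x \<and> x < 1 \<and> X (Suc m) = 1 \<and> (\<forall>i\<in>{k..m}. 0 < X i \<and> X i < x * X (Suc i))"

definition wfull :: "nat => nat => real => (nat => real) => nat => real" where
  "wfull m k x w j = (if j = Suc m then x / (\<Prod>i\<in>{k..m}. w i) else w j)"

definition simplex_coord :: "nat => nat => real => (nat => real) => (nat => real) => nat => real" where
  "simplex_coord m k x X w i = (\<Prod>j\<in>{k..Suc m}. X i - X j * wfull m k x w j) /
     ((1 - x) * X i * (\<Prod>j\<in>{k..Suc m} - {i}. X i - X j))"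

text \<open>Division by the last coordinate maps the open simplex to the open orthant, where the
  integral can be taken over one half-line at a time.\<close>

definition affine_coord :: "nat => nat => real => (nat => real) => (nat => real) => nat => real" where
  "affine_coord m k x X w i = simplex_coord m k x X w i / simplex_coord m k x X w (Suc m)"

text \<open>The absolute Jacobian determinant of the first m + 1 - k simplex coordinates with
  respect to w; the double product is a quotient of two Vandermonde products, of the points y and of
  the nodes. The passage to \<open>affine_coord\<close> divides it by the power m + 2 - k of the
  last simplex coordinate.\<close>

definition coord_jacobian :: "nat => nat => real => (nat => real) => (nat => real) => real" where
  "coord_jacobian m k x X w = (\<Prod>i\<in>{k..m}. 1 / w i *
     (\<Prod>j\<in>{i<..Suc m}. (X j * wfull m k x w j - X i * wfull m k x w i) / (X j - X i))) / (1 - x) ^ (Suc m - k)"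

definition open_domain :: "nat => nat => real => (nat => real) set" where
  "open_domain m k x = {w. (\<forall>i\<in>{k..m}. 0 < w i \<and> w i < 1) \<and> x < (\<Prod>i\<in>{k..m}. w i)}"

lemma nodesD:
  assumes "nodes m k x X"
  shows "0 < x" "x < 1" "X (Suc m) = 1"
    and "k \<le> i ==> i \<le> Suc m ==> 0 < X i"
    and "k \<le> i ==> i < j ==> j \<le> Suc m ==> X i < x * X j"
    and "k \<le> i ==> i < j ==> j \<le> Suc m ==> X i < X j"
    and "k \<le> i ==> i \<le> m ==> X i < 1"
proof -
  show x: "0 < x" "x < 1" "X (Suc m) = 1" using assms by (auto simp: nodes_def)
  have st: "0 < X i" "X i < x * X (Suc i)" if "k \<le> i" "i \<le> m" for i using assms that by (auto simp: nodes_def)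
  show p: "0 < X i" if "k \<le> i" "i \<le> Suc m" for i using st(1)[of i] x(3) that by (cases "i = Suc m") auto
  have st': "X i < X (Suc i)" if "k \<le> i" "i \<le> m" for i
    using st(2)[OF that] p[of "Suc i"] x that by (smt (verit) mult_le_cancel_right1 le_SucI Suc_le_mono)
  have *: "X i < x * X j \<and> X i < X j" if i: "k \<le> i" and j: "i < j" "j \<le> Suc m" for i j
  proof -
    have "Suc i \<le> j" using j by simp
    then show ?thesis using j(2)
    proof (induction j rule: dec_induct)
      case base
      then show ?case using st(2)[of i] st'[of i] i by auto
    next
      case (step n)
      then have "X i < x * X n" "X n < X (Suc n)" using st'[of n] i by auto
      moreover have "x * X n < x * X (Suc n)" using \<open>X n < X (Suc n)\<close> x by simp
      ultimately show ?case using step i by auto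
    qed
  qed
  show "k \<le> i ==> i < j ==> j \<le> Suc m ==> X i < x * X j" "k \<le> i ==> i < j ==> j \<le> Suc m ==> X i < X j" for i j
    using * by auto
  show "k \<le> i ==> i \<le> m ==> X i < 1" using *[of i "Suc m"] x by auto
qed

text \<open>All W j are at most 1 and multiply to x, so each of them is at least x. Together with X
  i < x X (i + 1) this keeps the point y j = X j W j above X (j - 1) and, for k \<le> m, below X j:
  the points interlace with the nodes.\<close>

lemma domain_facts:
  assumes n: "nodes m k x X" and k: "k \<le> Suc m" and w: "w \<in> open_domain m k x"
  shows "(\<Prod>i\<in>{k..m}. w i) > 0"
    and "(\<Prod>j\<in>{k..Suc m}. wfull m k x w j) = x"
    and "k \<le> j ==> j \<le> Suc m ==> x \<le> wfull m k x w j"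
    and "k \<le> j ==> j \<le> m ==> x < w j"
    and "k \<le> j ==> j \<le> Suc m ==> k \<le> m ==> wfull m k x w j < 1"
    and "k \<le> i ==> i \<le> j ==> j \<le> Suc m ==> k \<le> m ==> X i * wfull m k x w i < X j"
    and "k \<le> i ==> i < j ==> j \<le> Suc m ==> X i < X j * wfull m k x w j"
    and "k \<le> i ==> i < j ==> j \<le> Suc m ==> k \<le> m ==> X i * wfull m k x w i < X j * wfull m k x w j"
proof -
  note nd = nodesD[OF n]
  have w01: "0 < w i" "w i < 1" if "k \<le> i" "i \<le> m" for i using w that by (auto simp: open_domain_def)
  have xp: "x < (\<Prod>i\<in>{k..m}. w i)" using w by (simp add: open_domain_def)
  show pp: "(\<Prod>i\<in>{k..m}. w i) > 0" using xp nd(1) by linarith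
  have last: "{k..Suc m} = insert (Suc m) {k..m}" using k by auto
  show "(\<Prod>j\<in>{k..Suc m}. wfull m k x w j) = x"
  proof -
    define P where "P = (\<Prod>i\<in>{k..m}. w i)"
    have "(\<Prod>j\<in>{k..m}. wfull m k x w j) = P" unfolding P_def by (intro prod.cong) (auto simp: wfull_def)
    moreover have "wfull m k x w (Suc m) = x / P" by (simp add: wfull_def P_def)
    moreover have "P \<noteq> 0" unfolding P_def using pp by linarith
    ultimately show ?thesis unfolding last by simp
  qed
  show xw: "x < w j" if "k \<le> j" "j \<le> m" for j
  proof -
    have "(\<Prod>i\<in>{k..m}. w i) = w j * (\<Prod>i\<in>{k..m} - {j}. w i)" using that by (intro prod.remove) auto
    also have "\<dots> \<le> w j * 1" using w01 that by (intro mult_left_mono prod_le_1) (auto intro: less_imp_le)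
    finally show ?thesis using xp by simp
  qed
  have "(\<Prod>i\<in>{k..m}. w i) \<le> 1" using w01 by (intro prod_le_1) (auto intro: less_imp_le)
  then have "x \<le> x / (\<Prod>i\<in>{k..m}. w i)" using pp nd(1) by (simp add: field_simps)
  then show xW: "x \<le> wfull m k x w j" if "k \<le> j" "j \<le> Suc m" for j
    using xw[of j] that by (cases "j = Suc m") (auto simp: wfull_def)
  have "x / (\<Prod>i\<in>{k..m}. w i) < 1" using xp pp by simp
  then show W1: "wfull m k x w j < 1" if "k \<le> j" "j \<le> Suc m" "k \<le> m" for j
    using w01[of j] that by (cases "j = Suc m") (auto simp: wfull_def)
  show a: "X i * wfull m k x w i < X j" if "k \<le> i" "i \<le> j" "j \<le> Suc m" "k \<le> m" for i j
  proof -
    have "X i * wfull m k x w i < X i * 1" using W1[of i] nd(4)[of i] that by (intro mult_strict_left_mono) auto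
    also have "\<dots> \<le> X j" using nd(6)[of i j] that by (cases "i = j") auto
    finally show ?thesis .
  qed
  show b: "X i < X j * wfull m k x w j" if "k \<le> i" "i < j" "j \<le> Suc m" for i j
  proof -
    have "X i < X j * x" using nd(5)[of i j] that by (simp add: mult.commute)
    also have "\<dots> \<le> X j * wfull m k x w j" using xW[of j] nd(4)[of j] that by (intro mult_left_mono) auto
    finally show ?thesis .
  qed
  show "X i * wfull m k x w i < X j * wfull m k x w j" if "k \<le> i" "i < j" "j \<le> Suc m" "k \<le> m" for i j
    using a[of i i] b[of i j] that by auto
qed

text \<open>An instance of \<open>partial_fractions\<close> with \<open>e = 1\<close> and s j = X j
  - y j, the residues being (1 - x) X i p i. At z = 0 the product is the product of the W j, that is
  x, and this forces the total mass 1.\<close>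

lemma simplex_coord_sum:
  assumes n: "nodes m k x X" and k: "k \<le> Suc m" and w: "w \<in> open_domain m k x"
  shows "(\<Sum>i\<in>{k..Suc m}. simplex_coord m k x X w i) = 1"
    and "z \<notin> X ` {k..Suc m} ==>
      (\<Sum>i\<in>{k..Suc m}. simplex_coord m k x X w i * ((z - x * X i) / (z - X i))) =
      (\<Prod>j\<in>{k..Suc m}. (z - X j * wfull m k x w j) / (z - X j))"
proof -
  define p where "p = simplex_coord m k x X w"
  define y where "y j = X j * wfull m k x w j" for j
  note nd = nodesD[OF n]
  have Xne: "X i \<noteq> X j" if "i \<in> {k..Suc m}" "j \<in> {k..Suc m}" "i \<noteq> j" for i j
    using nd(6)[of i j] nd(6)[of j i] that by (cases "i < j") auto
  have inj: "inj_on X {k..Suc m}" using Xne by (meson inj_onI)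
  have res: "(X c - y c) * (\<Prod>c'\<in>{k..Suc m} - {c}. 1 + 1 * (X c' - y c') / (X c - X c')) = (1 - x) * X c * p c"
    if c: "c \<in> {k..Suc m}" for c
  proof -
    have "(\<Prod>c'\<in>{k..Suc m} - {c}. 1 + 1 * (X c' - y c') / (X c - X c')) = (\<Prod>c'\<in>{k..Suc m} - {c}. (X c - y c') / (X c - X c'))"
    proof (intro prod.cong refl)
      fix c' assume "c' \<in> {k..Suc m} - {c}"
      then have "X c - X c' \<noteq> 0" using Xne[of c c'] c by auto
      then show "1 + 1 * (X c' - y c') / (X c - X c') = (X c - y c') / (X c - X c')" by (simp add: divide_simps)
    qed
    then have "(X c - y c) * (\<Prod>c'\<in>{k..Suc m} - {c}. 1 + 1 * (X c' - y c') / (X c - X c')) =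
       ((X c - y c) * (\<Prod>c'\<in>{k..Suc m} - {c}. X c - y c')) / (\<Prod>c'\<in>{k..Suc m} - {c}. X c - X c')"
      by (simp add: prod_dividef)
    also have "(X c - y c) * (\<Prod>c'\<in>{k..Suc m} - {c}. X c - y c') = (\<Prod>c'\<in>{k..Suc m}. X c - y c')"
      by (rule prod.remove[symmetric]) (use c in auto)
    finally show ?thesis using nd(2) nd(4)[of c] c
      by (simp add: p_def simplex_coord_def y_def)
  qed
  have pf: "(\<Prod>j\<in>{k..Suc m}. (z - y j) / (z - X j)) = 1 + (\<Sum>i\<in>{k..Suc m}. (1 - x) * X i * p i / (z - X i))"
    if z: "z \<notin> X ` {k..Suc m}" for z
  proof -
    have zne: "z - X j \<noteq> 0" if "j \<in> {k..Suc m}" for j using z that by auto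
    have "(\<Prod>j\<in>{k..Suc m}. (z - y j) / (z - X j)) = (\<Prod>j\<in>{k..Suc m}. 1 + 1 * (X j - y j) / (z - X j))"
      by (intro prod.cong refl) (use zne in \<open>simp add: divide_simps\<close>)
    also have "\<dots> = 1 + 1 * (\<Sum>c\<in>{k..Suc m}. (X c - y c) / (z - X c) * (\<Prod>c'\<in>{k..Suc m} - {c}. 1 + 1 * (X c' - y c') / (X c - X c')))"
      by (rule partial_fractions[OF _ inj z]) simp
    also have "(\<Sum>c\<in>{k..Suc m}. (X c - y c) / (z - X c) * (\<Prod>c'\<in>{k..Suc m} - {c}. 1 + 1 * (X c' - y c') / (X c - X c'))) =
       (\<Sum>i\<in>{k..Suc m}. (1 - x) * X i * p i / (z - X i))"
    proof (intro sum.cong refl)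
      fix c assume c: "c \<in> {k..Suc m}"
      show "(X c - y c) / (z - X c) * (\<Prod>c'\<in>{k..Suc m} - {c}. 1 + 1 * (X c' - y c') / (X c - X c')) = (1 - x) * X c * p c / (z - X c)"
        unfolding res[OF c, symmetric] by simp
    qed
    finally show ?thesis by simp
  qed
  have "0 \<notin> X ` {k..Suc m}" using nd(4) by force
  from pf[OF this] have "(\<Prod>j\<in>{k..Suc m}. y j / X j) = 1 + (\<Sum>i\<in>{k..Suc m}. (1 - x) * X i * p i / (- X i))" by simp
  also have "(\<Sum>i\<in>{k..Suc m}. (1 - x) * X i * p i / (- X i)) = (\<Sum>i\<in>{k..Suc m}. - ((1 - x) * p i))"
  proof (intro sum.cong refl)
    fix i assume "i \<in> {k..Suc m}"
    then have "X i \<noteq> 0" using nd(4)[of i] by auto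
    then show "(1 - x) * X i * p i / (- X i) = - ((1 - x) * p i)" by simp
  qed
  also have "\<dots> = - ((1 - x) * (\<Sum>i\<in>{k..Suc m}. p i))" by (simp only: sum_negf sum_distrib_left)
  also have "(\<Prod>j\<in>{k..Suc m}. y j / X j) = (\<Prod>j\<in>{k..Suc m}. wfull m k x w j)"
  proof (intro prod.cong refl)
    fix j assume "j \<in> {k..Suc m}"
    then have "X j \<noteq> 0" using nd(4)[of j] by auto
    then show "y j / X j = wfull m k x w j" by (simp add: y_def)
  qed
  also have "\<dots> = x" by (rule domain_facts(2)[OF n k w])
  finally have "x = 1 + - ((1 - x) * (\<Sum>i\<in>{k..Suc m}. p i))" .
  moreover have "\<sigma> = 1" if "x = 1 + - ((1 - x) * \<sigma>)" for \<sigma>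
  proof -
    have "(1 - x) * \<sigma> = (1 - x) * 1" using that by (simp add: algebra_simps)
    then show ?thesis using nd(2) by simp
  qed
  ultimately show s1: "(\<Sum>i\<in>{k..Suc m}. simplex_coord m k x X w i) = 1" unfolding p_def by blast
  assume z: "z \<notin> X ` {k..Suc m}"
  have zne: "z - X j \<noteq> 0" if "j \<in> {k..Suc m}" for j using z that by auto
  have "(\<Sum>i\<in>{k..Suc m}. p i * ((z - x * X i) / (z - X i))) = (\<Sum>i\<in>{k..Suc m}. p i + (1 - x) * X i * p i / (z - X i))"
  proof (intro sum.cong refl)
    fix i assume "i \<in> {k..Suc m}"
    from zne[OF this] have "(z - x * X i) / (z - X i) = 1 + (1 - x) * X i / (z - X i)" by (simp add: divide_simps) (simp add: algebra_simps)
    then show "p i * ((z - x * X i) / (z - X i)) = p i + (1 - x) * X i * p i / (z - X i)" by (simp add: algebra_simps)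
  qed
  also have "\<dots> = (\<Prod>j\<in>{k..Suc m}. (z - y j) / (z - X j))"
    unfolding pf[OF z] sum.distrib using s1 by (simp add: p_def)
  finally show "(\<Sum>i\<in>{k..Suc m}. simplex_coord m k x X w i * ((z - x * X i) / (z - X i))) =
      (\<Prod>j\<in>{k..Suc m}. (z - X j * wfull m k x w j) / (z - X j))"
    by (simp only: p_def y_def)
qed

text \<open>By the interlacing, X i - y j and X i - X j have the same sign for every j different
  from i.\<close>

lemma simplex_coord_pos:
  assumes n: "nodes m k x X" and k: "k \<le> m" and w: "w \<in> open_domain m k x" and i: "k \<le> i" "i \<le> Suc m"
  shows "simplex_coord m k x X w i > 0"
proof -
  note nd = nodesD[OF n]
  have k': "k \<le> Suc m" using k by simp
  note df = domain_facts[OF n k' w]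
  define y where "y j = X j * wfull m k x w j" for j
  have "(\<Prod>j\<in>{k..Suc m}. X i - y j) = (X i - y i) * (\<Prod>j\<in>{k..Suc m} - {i}. X i - y j)"
    by (rule prod.remove) (use i in auto)
  then have "simplex_coord m k x X w i = (X i - y i) / ((1 - x) * X i) * (\<Prod>j\<in>{k..Suc m} - {i}. (X i - y j) / (X i - X j))"
    by (simp add: simplex_coord_def y_def prod_dividef)
  moreover have "X i - y i > 0" using df(6)[of i i] i k by (simp add: y_def)
  moreover have "(1 - x) * X i > 0" using nd i by simp
  moreover have "(\<Prod>j\<in>{k..Suc m} - {i}. (X i - y j) / (X i - X j)) > 0"
  proof (rule prod_pos)
    fix j assume j: "j \<in> {k..Suc m} - {i}"
    show "(X i - y j) / (X i - X j) > 0"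
    proof (cases "j < i")
      case True
      then show ?thesis using df(6)[of j i] nd(6)[of j i] i j k by (simp add: y_def)
    next
      case False
      then have "X i - y j < 0" "X i - X j < 0" using df(7)[of i j] nd(6)[of i j] i j by (auto simp: y_def)
      then show ?thesis by (rule divide_neg_neg)
    qed
  qed
  ultimately show ?thesis by simp
qed

section \<open>Removing the first variable\<close>

lemma wfull_Suc:
  assumes "k \<le> m" "j > k" "w k \<noteq> 0"
  shows "wfull m (Suc k) (x / w k) w j = wfull m k x w j"
proof -
  have "{k..m} = insert k {Suc k..m}" using assms by auto
  then show ?thesis using assms by (simp add: wfull_def)
qed

text \<open>After the removal of \<open>w k\<close> the other W j are unchanged and multiply to x /
  w k. So the system from k + 1 on is of the same kind with x / w k in place of x, and the two
  systems differ by the factors of index k and by the normalisation 1 - x.\<close>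

lemma simplex_coord_Suc:
  assumes n: "nodes m k x X" and k: "k \<le> m" and w: "w \<in> open_domain m k x" and i: "k < i" "i \<le> Suc m"
  shows "simplex_coord m k x X w i = simplex_coord m (Suc k) (x / w k) X w i *
    ((1 - x / w k) / (1 - x)) * ((X i - X k * w k) / (X i - X k))"
proof -
  note nd = nodesD[OF n]
  have k': "k \<le> Suc m" using k by simp
  note df = domain_facts[OF n k' w]
  have wk: "w k > 0" "x < w k" using df(4)[of k] nd(1) k by auto
  have 1: "{k..Suc m} = insert k {Suc k..Suc m}" using k by auto
  have 2: "{k..Suc m} - {i} = insert k ({Suc k..Suc m} - {i})" using k i by auto
  define P where "P = (\<Prod>j\<in>{Suc k..Suc m}. X i - X j * wfull m (Suc k) (x / w k) w j)"
  define D where "D = (\<Prod>j\<in>{Suc k..Suc m} - {i}. X i - X j)"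
  have "(\<Prod>j\<in>{Suc k..Suc m}. X i - X j * wfull m k x w j) = P"
    unfolding P_def using k wk by (intro prod.cong refl) (simp add: wfull_Suc)
  moreover have "wfull m k x w k = w k" using k by (simp add: wfull_def)
  ultimately have P: "(\<Prod>j\<in>{k..Suc m}. X i - X j * wfull m k x w j) = (X i - X k * w k) * P"
    unfolding 1 by (subst prod.insert) auto
  have D: "(\<Prod>j\<in>{k..Suc m} - {i}. X i - X j) = (X i - X k) * D"
    unfolding 2 D_def by (subst prod.insert) auto
  have gen: "(a * P) / (d * b * (e * D)) = P / (c * b * D) * (c / d) * (a / e)" if "c \<noteq> 0" for a b c d e :: real
    using that by (simp add: mult_ac)
  have "x / w k < 1" using wk by simp
  then have "1 - x / w k \<noteq> 0" by linarith
  from gen[OF this] show ?thesis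
    unfolding simplex_coord_def P D P_def[symmetric] D_def[symmetric] .
qed

lemma open_domain_Suc:
  assumes n: "nodes m k x X" and k: "k \<le> m"
  shows "w \<in> open_domain m k x \<longleftrightarrow> x < w k \<and> w k < 1 \<and> w \<in> open_domain m (Suc k) (x / w k)"
proof -
  note nd = nodesD[OF n]
  have 1: "{k..m} = insert k {Suc k..m}" using k by auto
  show ?thesis
  proof
    assume w: "w \<in> open_domain m k x"
    have k': "k \<le> Suc m" using k by simp
    have "x < w k" using domain_facts(4)[OF n k' w] k by auto
    then show "x < w k \<and> w k < 1 \<and> w \<in> open_domain m (Suc k) (x / w k)"
      using w nd(1) by (simp add: open_domain_def 1 field_simps)
  next
    assume *: "x < w k \<and> w k < 1 \<and> w \<in> open_domain m (Suc k) (x / w k)"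
    then have wk: "w k > 0" using nd(1) by linarith
    have "x / w k < (\<Prod>i\<in>{Suc k..m}. w i)" using * by (simp add: open_domain_def)
    then have "x < w k * (\<Prod>i\<in>{Suc k..m}. w i)" using wk by (simp add: pos_divide_less_eq mult.commute)
    then show "w \<in> open_domain m k x" using * wk by (simp add: open_domain_def 1)
  qed
qed

lemma nodes_Suc:
  assumes n: "nodes m k x X" and w: "x < w" "w < 1"
  shows "nodes m (Suc k) (x / w) X"
proof -
  note nd = nodesD[OF n]
  have "x \<le> x / w" using w nd(1) by (simp add: field_simps)
  have "X i < x / w * X (Suc i)" if "i \<in> {Suc k..m}" for i
  proof -
    have "X i < x * X (Suc i)" using nd(5)[of i "Suc i"] that by auto
    also have "\<dots> \<le> x / w * X (Suc i)" using \<open>x \<le> x / w\<close> nd(4)[of "Suc i"] that by (intro mult_right_mono) auto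
    finally show ?thesis .
  qed
  then show ?thesis using nd w by (auto simp: nodes_def)
qed

text \<open>
  The first affine coordinate as a function of \<open>w k\<close>, the other ones being fixed, and its derivative.
\<close>

definition first_coord :: "nat => nat => real => (nat => real) => (nat => real) => real => real" where
  "first_coord m k x X s v = (1 - v) / (v - x) *
     (\<Sum>j\<in>{Suc k..Suc m}. (if j = Suc m then 1 else s j) * ((x * X j - X k * v) / (X j - X k * v)))"

definition first_coord' :: "nat => nat => real => (nat => real) => (nat => real) => real => real" where
  "first_coord' m k x X s v = - ((1 - x) / (v - x)\<^sup>2 *
     (\<Sum>j\<in>{Suc k..Suc m}. (if j = Suc m then 1 else s j) *
       ((X j - X k) * (x * X j - X k * v\<^sup>2) / (X j - X k * v)\<^sup>2)))"

lemma first_coord_deriv: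
  assumes n: "nodes m k x X" and k: "k \<le> m" and v: "x < v" "v < 1"
  shows "(first_coord m k x X s has_real_derivative first_coord' m k x X s v) (at v)"
proof -
  note nd = nodesD[OF n]
  have summand: "((\<lambda>v. (1 - v) / (v - x) * ((if j = Suc m then 1 else s j) * ((x * X j - X k * v) / (X j - X k * v)))) has_real_derivative
     - ((1 - x) / (v - x)\<^sup>2 * ((if j = Suc m then 1 else s j) * ((X j - X k) * (x * X j - X k * v\<^sup>2) / (X j - X k * v)\<^sup>2)))) (at v)"
    if j: "j \<in> {Suc k..Suc m}" for j
  proof -
    define S where "S = (if j = Suc m then 1 else s j)"
    have "X k * v < X k * 1" using v nd(4)[of k] k by (intro mult_strict_left_mono) auto
    also have "\<dots> < X j" using nd(6)[of k j] j by auto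
    finally have d: "X j - X k * v \<noteq> 0" by simp
    have e: "v - x \<noteq> 0" using v by simp
    have "((\<lambda>v. (1 - v) / (v - x) * (S * ((x * X j - X k * v) / (X j - X k * v)))) has_real_derivative
       ((- 1 * (v - x) - (1 - v) * 1) / ((v - x) * (v - x))) * (S * ((x * X j - X k * v) / (X j - X k * v))) +
       S * ((- X k * (X j - X k * v) - (x * X j - X k * v) * - X k) / ((X j - X k * v) * (X j - X k * v))) * ((1 - v) / (v - x))) (at v)"
    proof (rule DERIV_mult)
      show "((\<lambda>v. (1 - v) / (v - x)) has_real_derivative (- 1 * (v - x) - (1 - v) * 1) / ((v - x) * (v - x))) (at v)"
        using e by (auto intro!: derivative_eq_intros)
      show "((\<lambda>v. S * ((x * X j - X k * v) / (X j - X k * v))) has_real_derivative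
        S * ((- X k * (X j - X k * v) - (x * X j - X k * v) * - X k) / ((X j - X k * v) * (X j - X k * v)))) (at v)"
        using d by (auto intro!: derivative_eq_intros simp: right_diff_distrib mult_ac)
    qed
    also have "((- 1 * (v - x) - (1 - v) * 1) / ((v - x) * (v - x))) * (S * ((x * X j - X k * v) / (X j - X k * v))) +
       S * ((- X k * (X j - X k * v) - (x * X j - X k * v) * - X k) / ((X j - X k * v) * (X j - X k * v))) * ((1 - v) / (v - x)) =
       - ((1 - x) / (v - x)\<^sup>2 * (S * ((X j - X k) * (x * X j - X k * v\<^sup>2) / (X j - X k * v)\<^sup>2)))"
    proof -
      define a b where "a = v - x" and "b = X j - X k * v"
      have ab: "a \<noteq> 0" "b \<noteq> 0" using d e by (simp_all add: a_def b_def)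
      have "((- 1 * (v - x) - (1 - v) * 1) / (a * a)) * (S * ((x * X j - X k * v) / b)) +
        S * ((- X k * b - (x * X j - X k * v) * - X k) / (b * b)) * ((1 - v) / a) =
        S * ((- 1 * (v - x) - (1 - v) * 1) * (x * X j - X k * v) * b + (- X k * b - (x * X j - X k * v) * - X k) * (1 - v) * a) / (a\<^sup>2 * b\<^sup>2)"
        using ab by (simp add: field_simps power2_eq_square)
      also have "(- 1 * (v - x) - (1 - v) * 1) * (x * X j - X k * v) * b + (- X k * b - (x * X j - X k * v) * - X k) * (1 - v) * a =
        - ((1 - x) * ((X j - X k) * (x * X j - X k * v\<^sup>2)))"
        unfolding a_def b_def by algebra
      also have "S * - ((1 - x) * ((X j - X k) * (x * X j - X k * v\<^sup>2))) / (a\<^sup>2 * b\<^sup>2) =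
        - ((1 - x) / a\<^sup>2 * (S * ((X j - X k) * (x * X j - X k * v\<^sup>2) / b\<^sup>2)))"
        by (simp add: mult_ac)
      finally show ?thesis by (simp only: a_def b_def)
    qed
    finally show ?thesis by (simp only: S_def)
  qed
  have "((\<lambda>v. \<Sum>j\<in>{Suc k..Suc m}. (1 - v) / (v - x) * ((if j = Suc m then 1 else s j) * ((x * X j - X k * v) / (X j - X k * v)))) has_real_derivative
     (\<Sum>j\<in>{Suc k..Suc m}. - ((1 - x) / (v - x)\<^sup>2 * ((if j = Suc m then 1 else s j) * ((X j - X k) * (x * X j - X k * v\<^sup>2) / (X j - X k * v)\<^sup>2))))) (at v)"
    by (intro DERIV_sum summand)
  then show ?thesis unfolding first_coord_def[abs_def] first_coord'_def by (simp only: sum_distrib_left sum_negf)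
qed

lemma first_coord_measurable:
  "k \<le> m ==> first_coord m k x X s \<in> borel_measurable borel" "k \<le> m ==> first_coord' m k x X s \<in> borel_measurable borel"
  unfolding first_coord_def[abs_def] first_coord'_def[abs_def] by measurable

text \<open>The factor (1 - v) / (v - x) decreases from infinity to 0 on the interval from x to 1,
  while the sum stays between the positive constants \<open>A1\<close> and \<open>A0\<close>. So the
  first coordinate attains every positive value, and its derivative is negative because X k v^2 < X
  k < x X j.\<close>

lemma nn_integral_first_coord:
  assumes n: "nodes m k x X" and k: "k \<le> m" and s: "\<And>i. i \<in> {Suc k..m} ==> 0 < s i"
    and f: "f \<in> borel_measurable borel"
  shows "(\<integral>\<^sup>+t. f t * indicator {0<..} t \<partial>lborel) =
    (\<integral>\<^sup>+v. f (first_coord m k x X s v) * ennreal (- first_coord' m k x X s v) * indicator {x<..<1} v \<partial>lborel)"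
proof (rule nn_integral_substitution_decreasing)
  note nd = nodesD[OF n]
  define S where "S j = (if j = Suc m then 1 else s j)" for j
  have S: "S j > 0" if "j \<in> {Suc k..Suc m}" for j using s[of j] that by (auto simp: S_def)
  have xX: "X k < x * X j" "X k < X j" "0 < X j" if "j \<in> {Suc k..Suc m}" for j
    using nd(5)[of k j] nd(6)[of k j] nd(4)[of j] that by auto
  have Xk: "X k > 0" using nd(4)[of k] k by auto
  have Xv: "X k * v < X k" if "v < 1" for v using mult_strict_left_mono[OF that Xk] by simp
  have dn: "X j - X k * v > 0" "x * X j - X k * v > 0" if "j \<in> {Suc k..Suc m}" "v < 1" for j v
    using xX[OF that(1)] Xv[OF that(2)] by auto
  define A where "A v = (\<Sum>j\<in>{Suc k..Suc m}. S j * ((x * X j - X k * v) / (X j - X k * v)))" for v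
  have fc: "first_coord m k x X s v = (1 - v) / (v - x) * A v" for v by (simp only: first_coord_def A_def S_def)
  have ne: "{Suc k..Suc m} \<noteq> {}" using k by auto
  define A0 where "A0 = (\<Sum>j\<in>{Suc k..Suc m}. S j)"
  define A1 where "A1 = (\<Sum>j\<in>{Suc k..Suc m}. S j * ((x * X j - X k) / (X j - X k)))"
  have A0: "A0 > 0" unfolding A0_def by (intro sum_pos S ne) auto
  have A1: "A1 > 0" unfolding A1_def using xX by (intro sum_pos mult_pos_pos S divide_pos_pos ne) auto
  have Ale: "A v \<le> A0" if "v < 1" for v
    unfolding A_def A0_def
  proof (rule sum_mono)
    fix j assume j: "j \<in> {Suc k..Suc m}"
    have "x * X j \<le> X j" using xX(3)[OF j] nd(2) by simp
    then have "(x * X j - X k * v) / (X j - X k * v) \<le> 1" using dn[OF j that] by simp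
    then have "S j * ((x * X j - X k * v) / (X j - X k * v)) \<le> S j * 1" using S[OF j] by (intro mult_left_mono) auto
    then show "S j * ((x * X j - X k * v) / (X j - X k * v)) \<le> S j" by simp
  qed
  have Age: "A1 \<le> A v" if "0 < v" "v < 1" for v
    unfolding A_def A1_def
  proof (intro sum_mono mult_left_mono)
    fix j assume j: "j \<in> {Suc k..Suc m}"
    have e: "(x * X j - c) / (X j - c) = 1 - (1 - x) * X j / (X j - c)" if "X j - c > 0" for c
      using that by (simp add: divide_simps) (simp add: algebra_simps)
    have "(1 - x) * X j / (X j - X k * v) \<le> (1 - x) * X j / (X j - X k)"
      using xX[OF j] Xv[OF that(2)] nd(2) by (intro divide_left_mono mult_nonneg_nonneg mult_pos_pos) auto
    then show "(x * X j - X k) / (X j - X k) \<le> (x * X j - X k * v) / (X j - X k * v)"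
      using e[of "X k"] e[of "X k * v"] xX[OF j] dn[OF j that(2)] by simp
  qed (use S in \<open>auto intro: less_imp_le\<close>)
  show "x < 1" by (rule nd(2))
  show "f \<in> borel_measurable borel" by (rule f)
  show "first_coord m k x X s \<in> borel_measurable borel" "first_coord' m k x X s \<in> borel_measurable borel"
    by (rule first_coord_measurable[OF k])+
  show "(first_coord m k x X s has_real_derivative first_coord' m k x X s v) (at v)" if "x < v" "v < 1" for v
    by (rule first_coord_deriv[OF n k that])
  show "continuous_on {x<..<1} (first_coord' m k x X s)"
    unfolding first_coord'_def[abs_def]
    by (intro continuous_intros) (use dn(1) in force)+
  show "first_coord' m k x X s v < 0" if v: "x < v" "v < 1" for v
  proof -
    have "(\<Sum>j\<in>{Suc k..Suc m}. S j * ((X j - X k) * (x * X j - X k * v\<^sup>2) / (X j - X k * v)\<^sup>2)) > 0"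
    proof (intro sum_pos mult_pos_pos divide_pos_pos S ne)
      fix j assume j: "j \<in> {Suc k..Suc m}"
      show "X j - X k > 0" using xX[OF j] by simp
      have "v\<^sup>2 < 1" using v nd(1) by (simp add: power_less_one_iff)
      from Xv[OF this] show "x * X j - X k * v\<^sup>2 > 0" using xX[OF j] by simp
      show "(X j - X k * v)\<^sup>2 > 0" using dn[OF j v(2)] by simp
    qed auto
    moreover have "(1 - x) / (v - x)\<^sup>2 > 0" using v nd(2) by simp
    ultimately show ?thesis unfolding first_coord'_def S_def[symmetric] neg_less_0_iff_less by (rule mult_pos_pos[rotated])
  qed
  have fpos: "0 < first_coord m k x X s v" if v: "x < v" "v < 1" for v
    using Age[of v] A1 v nd(1) unfolding fc by (intro mult_pos_pos divide_pos_pos) auto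
  then show "\<And>v. x < v ==> v < 1 ==> 0 < first_coord m k x X s v" by blast
  show "\<exists>v. x < v \<and> v < 1 \<and> first_coord m k x X s v = t" if t: "0 < t" for t
  proof -
    \<comment> \<open>The solution v of (1 - v) / (v - x) = r. For r = t / A1 the first coordinate
      is at least t, for r = t / A0 it is at most t, and the intermediate value theorem applies
      between these points.\<close>
    define V where "V r = (1 + r * x) / (1 + r)" for r
    have V: "x < V r" "V r < 1" "(1 - V r) / (V r - x) = r" if r: "r > 0" for r
    proof -
      show "x < V r" "V r < 1" using r nd(1,2) by (simp_all add: V_def field_simps)
      have "1 - V r = r * ((1 - x) / (1 + r))" "V r - x = (1 - x) / (1 + r)" using r by (simp_all add: V_def divide_simps) (simp_all add: algebra_simps)
      moreover have "(1 - x) / (1 + r) \<noteq> 0" using r nd by simp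
      ultimately show "(1 - V r) / (V r - x) = r" by simp
    qed
    have r: "t / A0 > 0" "t / A1 > 0" using t A0 A1 by auto
    define a b where "a = V (t / A1)" and "b = V (t / A0)"
    have a: "x < a" "a < 1" "0 < a" "t \<le> first_coord m k x X s a"
    proof -
      show a: "x < a" "a < 1" "0 < a" using V[OF r(2)] nd(1) by (auto simp: a_def)
      have "t = t / A1 * A1" using A1 by simp
      also have "\<dots> \<le> t / A1 * A a" using Age[OF a(3,2)] r(2) by (intro mult_left_mono) auto
      finally show "t \<le> first_coord m k x X s a" unfolding fc using V(3)[OF r(2)] by (simp add: a_def)
    qed
    have b: "x < b" "b < 1" "first_coord m k x X s b \<le> t"
    proof -
      show b: "x < b" "b < 1" using V[OF r(1)] by (auto simp: b_def)
      have "t / A0 * A b \<le> t / A0 * A0" using Ale[OF b(2)] r(1) by (intro mult_left_mono) auto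
      also have "\<dots> = t" using A0 by simp
      finally show "first_coord m k x X s b \<le> t" unfolding fc using V(3)[OF r(1)] by (simp add: b_def)
    qed
    have cont: "isCont (first_coord m k x X s) v" if "x < v" "v < 1" for v
      using first_coord_deriv[OF n k that] by (rule DERIV_isCont)
    consider "a \<le> b" | "b \<le> a" by linarith
    then show ?thesis
    proof cases
      case 1
      then obtain v where "a \<le> v" "v \<le> b" "first_coord m k x X s v = t"
        using IVT2[of "first_coord m k x X s" b t a] a b cont by force
      then show ?thesis using a b by (intro exI[of _ v]) auto
    next
      case 2
      then obtain v where "b \<le> v" "v \<le> a" "first_coord m k x X s v = t"
        using IVT[of "first_coord m k x X s" b t a] a b cont by force
      then show ?thesis using a b by (intro exI[of _ v]) auto
    qed
  qed
qed

lemma wfull_cong: "(\<And>i. k \<le> i ==> i \<le> m ==> w i = w' i) ==> k \<le> j ==> j \<le> Suc m ==> wfull m k x w j = wfull m k x w' j"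
  by (auto simp: wfull_def intro!: arg_cong2[of _ _ _ _ "(/)"] prod.cong)

lemma simplex_coord_cong:
  assumes "\<And>i. k \<le> i ==> i \<le> m ==> w i = w' i"
  shows "simplex_coord m k x X w i = simplex_coord m k x X w' i"
proof -
  have "(\<Prod>j\<in>{k..Suc m}. X i - X j * wfull m k x w j) = (\<Prod>j\<in>{k..Suc m}. X i - X j * wfull m k x w' j)"
  proof (intro prod.cong refl)
    fix j assume "j \<in> {k..Suc m}"
    then show "X i - X j * wfull m k x w j = X i - X j * wfull m k x w' j"
      using wfull_cong[of k m w w' j x] assms by auto
  qed
  then show ?thesis by (simp only: simplex_coord_def)
qed

lemma coord_jacobian_cong:
  assumes "\<And>i. k \<le> i ==> i \<le> m ==> w i = w' i"
  shows "coord_jacobian m k x X w = coord_jacobian m k x X w'"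
proof -
  have "wfull m k x w j = wfull m k x w' j" if "k \<le> j" "j \<le> Suc m" for j
    using wfull_cong[of k m w w' j x] assms that by auto
  then have "(\<Prod>i\<in>{k..m}. 1 / w i * (\<Prod>j\<in>{i<..Suc m}. (X j * wfull m k x w j - X i * wfull m k x w i) / (X j - X i))) =
     (\<Prod>i\<in>{k..m}. 1 / w' i * (\<Prod>j\<in>{i<..Suc m}. (X j * wfull m k x w' j - X i * wfull m k x w' i) / (X j - X i)))"
    using assms by (intro prod.cong refl arg_cong2[of _ _ _ _ "(*)"]) auto
  then show ?thesis by (simp only: coord_jacobian_def)
qed

lemma open_domain_cong:
  assumes "\<And>i. k \<le> i ==> i \<le> m ==> w i = w' i"
  shows "w \<in> open_domain m k x \<longleftrightarrow> w' \<in> open_domain m k x"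
proof -
  have "(\<Prod>i\<in>{k..m}. w i) = (\<Prod>i\<in>{k..m}. w' i)" using assms by (intro prod.cong) auto
  then show ?thesis using assms by (auto simp: open_domain_def)
qed

lemma first_coord_cong:
  assumes "\<And>i. Suc k \<le> i ==> i \<le> m ==> s i = s' i"
  shows "first_coord m k x X s v = first_coord m k x X s' v" "first_coord' m k x X s v = first_coord' m k x X s' v"
proof -
  have "(\<Sum>j\<in>{Suc k..Suc m}. (if j = Suc m then 1 else s j) * F j) = (\<Sum>j\<in>{Suc k..Suc m}. (if j = Suc m then 1 else s' j) * F j)" for F :: "nat => real"
  proof (intro sum.cong refl)
    fix j assume "j \<in> {Suc k..Suc m}"
    then show "(if j = Suc m then 1 else s j) * F j = (if j = Suc m then 1 else s' j) * F j"
      using assms[of j] by (cases "j = Suc m") auto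
  qed
  then show "first_coord m k x X s v = first_coord m k x X s' v" "first_coord' m k x X s v = first_coord' m k x X s' v"
    by (simp_all only: first_coord_def first_coord'_def)
qed

text \<open>The factor between the affine coordinates of the systems starting at k and at k + 1. It
  depends on \<open>v = w k\<close> only, so for fixed v the remaining coordinates are merely
  rescaled by constants.\<close>

definition rescale :: "nat => (nat => real) => real => nat => real" where
  "rescale k X v i = (X i - X k * v) / (X i - X k) * ((1 - X k) / (1 - X k * v))"

text \<open>The identity of \<open>simplex_coord_sum\<close> is evaluated at z = X k w k in two
  ways. In the system from k this is a zero of the product, and solving the resulting linear
  relation for p k gives \<open>first_coord\<close>. In the system from k + 1 the same point gives
  the product \<open>R\<close>, which is the value of the sum in
  \<open>first_coord'\<close>.\<close>

lemma
  assumes n: "nodes m k x X" and k: "k \<le> m" and w: "w \<in> open_domain m k x"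
  shows affine_coord_Suc: "\<And>i. i \<in> {Suc k..m} ==> affine_coord m k x X w i = rescale k X (w k) i * affine_coord m (Suc k) (x / w k) X w i"
    and affine_coord_first: "first_coord m k x X (affine_coord m k x X w) (w k) = affine_coord m k x X w k"
    and coord_jacobian_step: "(\<Prod>i\<in>{Suc k..m}. rescale k X (w k) i) * (- first_coord' m k x X (affine_coord m k x X w) (w k)) *
      (coord_jacobian m (Suc k) (x / w k) X w / simplex_coord m (Suc k) (x / w k) X w (Suc m) ^ (Suc m - k)) =
      coord_jacobian m k x X w / simplex_coord m k x X w (Suc m) ^ (Suc (Suc m) - k)"
proof -
  define v where "v = w k"
  define z where "z = X k * v"
  define x' where "x' = x / v"
  define y where "y j = X j * wfull m k x w j" for j
  define p where "p = simplex_coord m k x X w"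
  define q where "q = simplex_coord m (Suc k) x' X w"
  have k': "k \<le> Suc m" using k by simp
  note nd = nodesD[OF n]
  note df = domain_facts[OF n k' w]
  have v: "x < v" "v < 1" "0 < v" using open_domain_Suc[OF n k] w nd(1) by (auto simp: v_def)
  have n': "nodes m (Suc k) x' X" unfolding x'_def by (rule nodes_Suc[OF n v(1,2)])
  have w': "w \<in> open_domain m (Suc k) x'" using open_domain_Suc[OF n k] w by (auto simp: x'_def v_def)
  have x': "x' < 1" "x' > 0" using v nd(1) by (auto simp: x'_def)
  have Xk: "0 < X k" "X k < 1" using nd(4)[of k] nd(7)[of k] k by auto
  have zk: "z < X k" using v Xk by (simp add: z_def)
  have zj: "z < X j" if "k \<le> j" "j \<le> Suc m" for j using nd(6)[of k j] zk that by (cases "j = k") auto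
  have znot: "z \<notin> X ` {k..Suc m}" using zj by force
  have znot': "z \<notin> X ` {Suc k..Suc m}" using znot by auto
  have p: "p j > 0" if "k \<le> j" "j \<le> Suc m" for j unfolding p_def by (rule simplex_coord_pos[OF n k w that])
  have wk: "wfull m k x w k = v" using k by (simp add: wfull_def v_def)
  have wS: "wfull m (Suc k) x' w j = wfull m k x w j" if "k < j" for j
    unfolding x'_def v_def by (rule wfull_Suc[OF k that]) (use v in \<open>simp add: v_def\<close>)
  define d where "d = (1 - x') / (1 - x)"
  define e where "e = (1 - X k) / (1 - z)"
  have z1: "z < 1" using zk Xk by simp
  have d: "d > 0" using x' nd(2) by (simp add: d_def)
  have e: "e > 0" using z1 Xk by (simp add: e_def)
  have pq: "p i = q i * d * ((X i - z) / (X i - X k))" if "k < i" "i \<le> Suc m" for i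
    unfolding p_def q_def d_def x'_def z_def v_def by (rule simplex_coord_Suc[OF n k w that])
  have pm: "p (Suc m) = q (Suc m) * d / e"
    using pq[of "Suc m"] k nd(3) by (simp add: e_def)
  have q: "q (Suc m) \<noteq> 0" using pm p[of "Suc m"] k by auto
  have split: "{k..Suc m} = insert k {Suc k..Suc m}" using k by auto
  show "\<And>i. i \<in> {Suc k..m} ==> affine_coord m k x X w i = rescale k X (w k) i * affine_coord m (Suc k) (x / w k) X w i"
  proof -
    fix i assume i: "i \<in> {Suc k..m}"
    have "p i / p (Suc m) = ((X i - z) / (X i - X k) * e) * (q i / q (Suc m))"
      unfolding pm using pq[of i] i d e q by simp
    then show "affine_coord m k x X w i = rescale k X (w k) i * affine_coord m (Suc k) (x / w k) X w i"
      unfolding affine_coord_def rescale_def v_def[symmetric] z_def[symmetric] x'_def[symmetric] p_def[symmetric] q_def[symmetric] e_def[symmetric] .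
  qed
  have S: "(if j = Suc m then 1 else affine_coord m k x X w j) = p j / p (Suc m)" if "j \<in> {Suc k..Suc m}" for j
    using p[of "Suc m"] k by (auto simp: affine_coord_def p_def)
  have flip: "(z - a) / (z - X j) = (a - z) / (X j - z)" for a j
    by (metis minus_diff_eq minus_divide_divide)
  have "(\<Prod>j\<in>{k..Suc m}. (z - y j) / (z - X j)) = 0"
    by (rule prod_zero) (use k wk in \<open>auto simp: y_def z_def intro!: bexI[of _ k]\<close>)
  then have "(\<Sum>i\<in>{k..Suc m}. p i * ((z - x * X i) / (z - X i))) = 0"
    using simplex_coord_sum(2)[OF n k' w znot] by (simp only: p_def y_def)
  then have "p k * ((z - x * X k) / (z - X k)) + (\<Sum>i\<in>{Suc k..Suc m}. p i * ((z - x * X i) / (z - X i))) = 0"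
    unfolding split by (subst (asm) sum.insert) auto
  moreover have "p k * ((z - x * X k) / (z - X k)) = - (p k * ((v - x) / (1 - v)))"
  proof -
    have "z - x * X k = X k * (v - x)" "z - X k = - (X k * (1 - v))" by (simp_all add: z_def algebra_simps)
    then show ?thesis using Xk by simp
  qed
  ultimately have sum1: "(\<Sum>i\<in>{Suc k..Suc m}. p i * ((x * X i - z) / (X i - z))) = p k * ((v - x) / (1 - v))"
    by (simp only: flip)
  have "first_coord m k x X (affine_coord m k x X w) v = (1 - v) / (v - x) * (\<Sum>j\<in>{Suc k..Suc m}. p j / p (Suc m) * ((x * X j - z) / (X j - z)))"
    unfolding first_coord_def z_def[symmetric] by (intro arg_cong2[of _ _ _ _ "(*)"] sum.cong refl) (simp only: S)
  also have "(\<Sum>j\<in>{Suc k..Suc m}. p j / p (Suc m) * ((x * X j - z) / (X j - z))) = (\<Sum>j\<in>{Suc k..Suc m}. p j * ((x * X j - z) / (X j - z))) / p (Suc m)"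
    by (simp only: sum_divide_distrib times_divide_eq_left)
  also have "(1 - v) / (v - x) * (\<dots>) = p k / p (Suc m)"
  proof -
    have "v - x \<noteq> 0" "1 - v \<noteq> 0" using v by auto
    then show ?thesis unfolding sum1 by simp
  qed
  finally show "first_coord m k x X (affine_coord m k x X w) (w k) = affine_coord m k x X w k"
    by (simp only: v_def affine_coord_def[of m k x X w k] p_def)
  define R where "R = (\<Prod>j\<in>{Suc k..Suc m}. (y j - z) / (X j - z))"
  have sumR: "(\<Sum>i\<in>{Suc k..Suc m}. q i * ((x' * X i - z) / (X i - z))) = R"
  proof -
    have "(\<Sum>i\<in>{Suc k..Suc m}. q i * ((z - x' * X i) / (z - X i))) = (\<Prod>j\<in>{Suc k..Suc m}. (z - X j * wfull m (Suc k) x' w j) / (z - X j))"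
      unfolding q_def by (rule simplex_coord_sum(2)[OF n' _ w' znot']) (use k in simp)
    also have "\<dots> = (\<Prod>j\<in>{Suc k..Suc m}. (z - y j) / (z - X j))"
      by (intro prod.cong refl) (simp add: wS y_def)
    finally show ?thesis unfolding flip R_def .
  qed
  have fc': "- first_coord' m k x X (affine_coord m k x X w) v = R / (v * (1 - x') * p (Suc m))"
  proof -
    have "(\<Sum>j\<in>{Suc k..Suc m}. (if j = Suc m then 1 else affine_coord m k x X w j) * ((X j - X k) * (x * X j - X k * v\<^sup>2) / (X j - X k * v)\<^sup>2)) =
      (\<Sum>j\<in>{Suc k..Suc m}. d * v / p (Suc m) * (q j * ((x' * X j - z) / (X j - z))))"
    proof (intro sum.cong refl)
      fix j assume j: "j \<in> {Suc k..Suc m}"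
      have a: "X j - X k \<noteq> 0" "X j - z \<noteq> 0" using nd(6)[of k j] zj[of j] j by auto
      \<comment> \<open>The square of v in the derivative is what reduces its terms to those of the
        smaller system, whose parameter is x / v.\<close>
      have b: "x * X j - X k * v\<^sup>2 = v * (x' * X j - z)" using v by (simp add: x'_def z_def power2_eq_square algebra_simps)
      have pj: "p j = q j * d * ((X j - z) / (X j - X k))" using pq[of j] j by auto
      define A B where "A = X j - X k" and "B = X j - z"
      have "q j * d * (B / A) / p (Suc m) * (A * (v * (x' * X j - z)) / B\<^sup>2) = d * v / p (Suc m) * (q j * ((x' * X j - z) / B))"
        using a unfolding A_def[symmetric] B_def[symmetric] by (simp add: power2_eq_square mult_ac)
      then show "(if j = Suc m then 1 else affine_coord m k x X w j) * ((X j - X k) * (x * X j - X k * v\<^sup>2) / (X j - X k * v)\<^sup>2) =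
        d * v / p (Suc m) * (q j * ((x' * X j - z) / (X j - z)))"
        unfolding S[OF j] b pj z_def[symmetric] A_def B_def .
    qed
    also have "\<dots> = d * v / p (Suc m) * R" by (simp only: sum_distrib_left[symmetric] sumR)
    finally have "- first_coord' m k x X (affine_coord m k x X w) v = (1 - x) / (v - x)\<^sup>2 * (d * v / p (Suc m) * R)"
      unfolding first_coord'_def by (simp only: minus_minus)
    also have "v - x = v * (1 - x')" using v by (simp add: x'_def algebra_simps)
    also have "(1 - x) / (v * (1 - x'))\<^sup>2 * (d * v / p (Suc m) * R) = R / (v * (1 - x') * p (Suc m))"
    proof -
      define a b where "a = 1 - x'" and "b = 1 - x"
      have "a \<noteq> 0" "b \<noteq> 0" using x' nd(2) by (auto simp: a_def b_def)
      then show ?thesis unfolding d_def a_def[symmetric] b_def[symmetric] using v by (simp add: power2_eq_square)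
    qed
    finally show ?thesis .
  qed
  define r where "r = m - k"
  have mk: "Suc m - k = Suc r" "Suc (Suc m) - k = Suc (Suc r)" using k by (auto simp: r_def)
  define G where "G = (\<Prod>i\<in>{Suc k..m}. (X i - z) / (X i - X k))"
  have rs: "(\<Prod>i\<in>{Suc k..m}. rescale k X (w k) i) = G * e ^ r"
    unfolding rescale_def v_def[symmetric] z_def[symmetric] e_def[symmetric] G_def prod.distrib prod_constant by (simp add: r_def)
  define T where "T = (\<Prod>j\<in>{Suc k..Suc m}. (y j - z) / (X j - X k))"
  have T: "T = R * G / e"
  proof -
    have "T = (\<Prod>j\<in>{Suc k..Suc m}. (y j - z) / (X j - z) * ((X j - z) / (X j - X k)))"
      unfolding T_def
    proof (intro prod.cong refl)
      fix j assume "j \<in> {Suc k..Suc m}"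
      then have "X j - z \<noteq> 0" using zj[of j] by auto
      then show "(y j - z) / (X j - X k) = (y j - z) / (X j - z) * ((X j - z) / (X j - X k))" by simp
    qed
    also have "\<dots> = R * (\<Prod>j\<in>{Suc k..Suc m}. (X j - z) / (X j - X k))" by (simp only: prod.distrib R_def)
    also have "(\<Prod>j\<in>{Suc k..Suc m}. (X j - z) / (X j - X k)) = G * (1 / e)"
    proof -
      have "{Suc k..Suc m} = insert (Suc m) {Suc k..m}" using k by auto
      then show ?thesis using nd(3) by (simp add: G_def e_def mult.commute)
    qed
    finally show ?thesis by simp
  qed
  \<comment> \<open>The factor \<open>i = k\<close> of the Vandermonde quotient is \<open>T\<close>;
    the rest is the Jacobian of the smaller system except for its power of 1 - x'.\<close>
  have jac: "coord_jacobian m k x X w = 1 / v * T * (coord_jacobian m (Suc k) x' X w * (1 - x') ^ r) / (1 - x) ^ Suc r"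
  proof -
    define J where "J i = 1 / w i * (\<Prod>j\<in>{i<..Suc m}. (y j - y i) / (X j - X i))" for i
    have "{k..m} = insert k {Suc k..m}" using k by auto
    then have "(\<Prod>i\<in>{k..m}. J i) = J k * (\<Prod>i\<in>{Suc k..m}. J i)" by simp
    moreover have "J k = 1 / v * T"
    proof -
      have "{k<..Suc m} = {Suc k..Suc m}" by auto
      moreover have "y k = z" by (simp add: y_def wk z_def)
      ultimately show ?thesis by (simp only: J_def T_def v_def)
    qed
    moreover have "coord_jacobian m k x X w = (\<Prod>i\<in>{k..m}. J i) / (1 - x) ^ Suc r"
      unfolding coord_jacobian_def mk J_def y_def ..
    moreover have "coord_jacobian m (Suc k) x' X w = (\<Prod>i\<in>{Suc k..m}. J i) / (1 - x') ^ r"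
    proof -
      have "(\<Prod>i\<in>{Suc k..m}. 1 / w i * (\<Prod>j\<in>{i<..Suc m}. (X j * wfull m (Suc k) x' w j - X i * wfull m (Suc k) x' w i) / (X j - X i))) = (\<Prod>i\<in>{Suc k..m}. J i)"
        unfolding J_def y_def by (intro prod.cong refl arg_cong2[of _ _ _ _ "(*)"]) (auto simp: wS)
      then show ?thesis by (simp add: coord_jacobian_def r_def)
    qed
    ultimately show ?thesis using x' by simp
  qed
  have pq': "q (Suc m) = p (Suc m) * e / d" using pm d e by simp
  have "G * e ^ r * (R / (v * (1 - x') * p (Suc m))) * (coord_jacobian m (Suc k) x' X w / (p (Suc m) * e / d) ^ Suc r) =
     1 / v * (R * G / e) * (coord_jacobian m (Suc k) x' X w * (1 - x') ^ r) / (1 - x) ^ Suc r / p (Suc m) ^ Suc (Suc r)"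
  proof -
    define a b where "a = 1 - x'" and "b = 1 - x"
    have "a \<noteq> 0" "b \<noteq> 0" using x' nd(2) by (auto simp: a_def b_def)
    moreover have "p (Suc m) \<noteq> 0" using p[of "Suc m"] k by auto
    ultimately show ?thesis unfolding d_def a_def[symmetric] b_def[symmetric] using v e
      by (simp add: field_simps power_mult_distrib)
  qed
  then show "(\<Prod>i\<in>{Suc k..m}. rescale k X (w k) i) * (- first_coord' m k x X (affine_coord m k x X w) (w k)) *
      (coord_jacobian m (Suc k) (x / w k) X w / simplex_coord m (Suc k) (x / w k) X w (Suc m) ^ (Suc m - k)) =
      coord_jacobian m k x X w / simplex_coord m k x X w (Suc m) ^ (Suc (Suc m) - k)"
    unfolding rs unfolding v_def[symmetric] unfolding fc' x'_def[symmetric] q_def[symmetric] p_def[symmetric] mk jac T pq' .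
qed

section \<open>The change of variables as an iterated integral\<close>

lemma lborel_product_component [measurable]: "i \<in> I ==> (\<lambda>w. w i) \<in> borel_measurable (lborel_prod I)"
  using measurable_component_singleton[of i I "\<lambda>_. lborel :: real measure"] by simp

lemma wfull_measurable:
  "k \<le> j ==> j \<le> Suc m ==> (\<lambda>w. wfull m k x w j) \<in> borel_measurable (lborel_prod {k..m})"
  unfolding wfull_def by (cases "j = Suc m") (auto intro!: borel_measurable_divide borel_measurable_prod)

lemma simplex_coord_measurable [measurable]:
  "(\<lambda>w. simplex_coord m k x X w i) \<in> borel_measurable (lborel_prod {k..m})"
  unfolding simplex_coord_def
  by (intro borel_measurable_divide borel_measurable_prod borel_measurable_diff borel_measurable_times borel_measurable_const wfull_measurable) auto

lemma affine_coord_measurable [measurable]: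
  "(\<lambda>w. affine_coord m k x X w i) \<in> borel_measurable (lborel_prod {k..m})"
  unfolding affine_coord_def by measurable

lemma coord_jacobian_measurable [measurable]:
  "coord_jacobian m k x X \<in> borel_measurable (lborel_prod {k..m})"
  unfolding coord_jacobian_def[abs_def]
  by (intro borel_measurable_divide borel_measurable_prod borel_measurable_diff borel_measurable_times borel_measurable_const wfull_measurable lborel_product_component) auto

lemma open_domain_measurable [measurable]:
  "(indicator (open_domain m k x) :: _ => ennreal) \<in> borel_measurable (lborel_prod {k..m})"
proof -
  have "(\<lambda>w. (\<Prod>i\<in>{k..m}. indicator {0<..<1} (w i)) * indicator {x<..} (\<Prod>i\<in>{k..m}. w i) :: ennreal)
    \<in> borel_measurable (lborel_prod {k..m})" by measurable
  moreover have "(indicator (open_domain m k x) :: _ => ennreal) = (\<lambda>w. (\<Prod>i\<in>{k..m}. indicator {0<..<1} (w i)) * indicator {x<..} (\<Prod>i\<in>{k..m}. w i) :: ennreal)"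
  proof
    fix w
    show "indicator (open_domain m k x) w = (\<Prod>i\<in>{k..m}. indicator {0<..<1} (w i)) * (indicator {x<..} (\<Prod>i\<in>{k..m}. w i) :: ennreal)"
    proof (cases "\<forall>i\<in>{k..m}. 0 < w i \<and> w i < 1")
      case True
      then have "(\<Prod>i\<in>{k..m}. indicator {0<..<1} (w i) :: ennreal) = 1" by (intro prod.neutral) auto
      then show ?thesis using True by (simp add: open_domain_def indicator_def)
    next
      case False
      then obtain i where i: "i \<in> {k..m}" "w i \<notin> {0<..<1}" by auto
      then have "(\<Prod>i\<in>{k..m}. indicator {0<..<1} (w i) :: ennreal) = 0"
        by (intro prod_zero bexI[of _ i]) (auto simp: indicator_def)
      then show ?thesis using False by (auto simp: open_domain_def indicator_def)
    qed
  qed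
  ultimately show ?thesis by simp
qed

text \<open>For fixed other coordinates the coordinate \<open>s k\<close> is replaced by v = w k.
  Then the order of integration is interchanged, and for fixed v the other coordinates are rescaled
  and treated by the induction hypothesis with parameter x / v. The Jacobians of the single steps
  multiply up by \<open>coord_jacobian_step\<close>.\<close>

theorem affine_change_of_variables:
  assumes "k \<le> Suc m" "nodes m k x X" "f \<in> borel_measurable (lborel_prod {k..m})"
  shows "(\<integral>\<^sup>+s. (\<Prod>i\<in>{k..m}. indicator {0<..} (s i)) * f s \<partial>lborel_prod {k..m}) =
    (\<integral>\<^sup>+w. f (\<lambda>i\<in>{k..m}. affine_coord m k x X w i) *
      ennreal (coord_jacobian m k x X w / simplex_coord m k x X w (Suc m) ^ (Suc (Suc m) - k)) *
      indicator (open_domain m k x) w \<partial>lborel_prod {k..m})"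
  using assms
proof (induction k arbitrary: x f rule: inc_induct)
  case base
  note nd = nodesD[OF base(1)]
  have sc: "simplex_coord m (Suc m) x X w (Suc m) = 1" for w
    using nd by (simp add: simplex_coord_def wfull_def)
  have e: "{Suc m..m} = {}" by simp
  show ?case
  proof (rule nn_integral_cong)
    fix s assume "s \<in> space (lborel_prod {Suc m..m})"
    then have s: "s = (\<lambda>_. undefined)" by (simp add: space_PiM PiE_def extensional_def fun_eq_iff)
    have r: "(\<lambda>i\<in>{Suc m..m}. affine_coord m (Suc m) x X s i) = s" by (simp add: s restrict_def)
    have "s \<in> open_domain m (Suc m) x" using nd by (simp add: open_domain_def)
    then show "(\<Prod>i\<in>{Suc m..m}. indicator {0<..} (s i)) * f s = f (\<lambda>i\<in>{Suc m..m}. affine_coord m (Suc m) x X s i) *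
      ennreal (coord_jacobian m (Suc m) x X s / simplex_coord m (Suc m) x X s (Suc m) ^ (Suc (Suc m) - Suc m)) * indicator (open_domain m (Suc m) x) s"
      unfolding r by (simp add: sc coord_jacobian_def)
  qed
next
  case (step k)
  note n = step.prems(1)
  note nd = nodesD[OF n]
  have k: "k \<le> m" using step.hyps by simp
  define I where "I = {Suc k..m}"
  have ins: "{k..m} = insert k I" using k by (auto simp: I_def)
  have I: "finite I" "k \<notin> I" by (auto simp: I_def)
  note fm = step.prems(2)[unfolded ins]
  define g where "g = first_coord m k x X"
  define g' where "g' = first_coord' m k x X"
  define P where "P s = (\<Prod>i\<in>I. indicator {0<..} (s i) :: ennreal)" for s :: "nat => real"
  define F where "F s v = f ((restrict s I)(k := g s v)) * ennreal (- g' s v)" for s v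
  have g_cong: "g s v = g s' v" "g' s v = g' s' v" "P s = P s'" "restrict s I = restrict s' I" if "\<And>i. i \<in> I ==> s i = s' i" for s s' v
    using first_coord_cong[of k m s s' x X v] that by (auto simp: g_def g'_def I_def P_def intro!: prod.cong)
  have g_meas: "(\<lambda>u. g (G u) (h u)) \<in> borel_measurable N" "(\<lambda>u. g' (G u) (h u)) \<in> borel_measurable N"
    if [measurable]: "h \<in> borel_measurable N" and G: "\<And>i. i \<in> I ==> (\<lambda>u. G u i) \<in> borel_measurable N"
    for G h and N :: "(nat => real) measure"
  proof -
    have [measurable]: "(\<lambda>u. if j = Suc m then 1 else G u j) \<in> borel_measurable N" if "j \<in> {Suc k..Suc m}" for j
      using G[of j] that by (cases "j = Suc m") (auto simp: I_def)
    show "(\<lambda>u. g (G u) (h u)) \<in> borel_measurable N" unfolding g_def first_coord_def by measurable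
    show "(\<lambda>u. g' (G u) (h u)) \<in> borel_measurable N" unfolding g'_def first_coord'_def by measurable
  qed
  have F_meas: "(\<lambda>u. F (G u) (h u)) \<in> borel_measurable N"
    if [measurable]: "h \<in> borel_measurable N" and G: "\<And>i. i \<in> I ==> (\<lambda>u. G u i) \<in> borel_measurable N"
    for G h and N :: "(nat => real) measure"
  proof -
    note [measurable] = g_meas[OF that]
    have "(\<lambda>u. \<lambda>i\<in>insert k I. if i = k then g (G u) (h u) else G u i) \<in> measurable N (lborel_prod (insert k I))"
      using g_meas(1)[OF that] G by (intro measurable_restrict) auto
    moreover have "(\<lambda>i\<in>insert k I. if i = k then g (G u) (h u) else G u i) = (restrict (G u) I)(k := g (G u) (h u))" for u
      by (auto simp: restrict_def fun_eq_iff)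
    ultimately have "(\<lambda>u. (restrict (G u) I)(k := g (G u) (h u))) \<in> measurable N (lborel_prod (insert k I))" by simp
    from measurable_compose[OF this fm] have [measurable]: "(\<lambda>u. f ((restrict (G u) I)(k := g (G u) (h u)))) \<in> borel_measurable N" .
    show ?thesis unfolding F_def by measurable
  qed
  \<comment> \<open>A mixed stage: entry \<open>k\<close> of \<open>u\<close> already is the new
    variable v, while the entries in \<open>I\<close> still are affine coordinates.\<close>
  define H where "H u = P u * (F u (u k) * indicator {x<..<1} (u k))" for u
  have H_meas: "H \<in> borel_measurable (lborel_prod (insert k I))"
  proof -
    have [measurable]: "(\<lambda>u. F u (u k)) \<in> borel_measurable (lborel_prod (insert k I))"
      by (rule F_meas) auto
    show ?thesis unfolding H_def P_def by measurable
  qed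
  have Hupd: "H (s(k := v)) = P s * (F s v * indicator {x<..<1} v)" for s v
  proof -
    have ag: "(s(k := v)) i = s i" if "i \<in> I" for i using I that by auto
    have "F (s(k := v)) v = F s v" by (simp only: F_def g_cong(1,2,4)[OF ag])
    moreover have "P (s(k := v)) = P s" by (rule g_cong(3)[OF ag])
    ultimately show ?thesis by (simp only: H_def fun_upd_same)
  qed
  define \<Psi> where "\<Psi> w = f (\<lambda>i\<in>{k..m}. affine_coord m k x X w i) *
      ennreal (coord_jacobian m k x X w / simplex_coord m k x X w (Suc m) ^ (Suc (Suc m) - k)) * indicator (open_domain m k x) w" for w
  have Psi_meas: "\<Psi> \<in> borel_measurable (lborel_prod (insert k I))"
  proof -
    note [measurable] = step.prems(2)
    show ?thesis unfolding \<Psi>_def ins[symmetric] by measurable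
  qed
  have "(\<integral>\<^sup>+s. (\<Prod>i\<in>{k..m}. indicator {0<..} (s i)) * f s \<partial>lborel_prod {k..m}) =
     (\<integral>\<^sup>+s. (\<integral>\<^sup>+t. (\<Prod>i\<in>insert k I. indicator {0<..} ((s(k := t)) i)) * f (s(k := t)) \<partial>lborel) \<partial>lborel_prod I)"
    unfolding ins
  proof (rule lborel_prod_insert[OF I])
    note [measurable] = fm
    show "(\<lambda>s. (\<Prod>i\<in>insert k I. indicator {0<..} (s i)) * f s) \<in> borel_measurable (lborel_prod (insert k I))"
      by measurable
  qed
  also have "\<dots> = (\<integral>\<^sup>+s. (\<integral>\<^sup>+v. H (s(k := v)) \<partial>lborel) \<partial>lborel_prod I)"
  proof (rule nn_integral_cong)
    fix s assume s: "s \<in> space (lborel_prod I)"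
    have fs: "(\<lambda>t. f (s(k := t))) \<in> borel_measurable borel"
      using measurable_comp[OF measurable_component_update[OF s I(2)] fm] by (simp add: comp_def)
    have sI: "restrict s I = s" using s by (auto simp: space_PiM PiE_def extensional_def restrict_def fun_eq_iff)
    have "(\<integral>\<^sup>+t. (\<Prod>i\<in>insert k I. indicator {0<..} ((s(k := t)) i)) * f (s(k := t)) \<partial>lborel) =
      (\<integral>\<^sup>+t. P s * (f (s(k := t)) * indicator {0<..} t) \<partial>lborel)"
    proof (rule nn_integral_cong)
      fix t
      have "(\<Prod>i\<in>I. indicator {0<..} ((s(k := t)) i)) = P s" unfolding P_def using I by (intro prod.cong) auto
      then show "(\<Prod>i\<in>insert k I. indicator {0<..} ((s(k := t)) i)) * f (s(k := t)) = P s * (f (s(k := t)) * indicator {0<..} t)"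
        using I by (simp add: mult_ac)
    qed
    also have "\<dots> = P s * (\<integral>\<^sup>+t. f (s(k := t)) * indicator {0<..} t \<partial>lborel)"
    proof (rule nn_integral_cmult)
      note [measurable] = fs
      show "(\<lambda>t. f (s(k := t)) * indicator {0<..} t) \<in> borel_measurable lborel" by simp
    qed
    also have "\<dots> = P s * (\<integral>\<^sup>+v. f (s(k := g s v)) * ennreal (- g' s v) * indicator {x<..<1} v \<partial>lborel)"
    proof (cases "\<forall>i\<in>I. 0 < s i")
      case True
      then have pos: "\<And>i. i \<in> {Suc k..m} ==> 0 < s i" by (simp add: I_def)
      show ?thesis unfolding g_def g'_def using nn_integral_first_coord[OF n k pos fs] by simp
    next
      case False
      then obtain i where "i \<in> I" "\<not> 0 < s i" by auto
      then have "P s = 0" unfolding P_def using I by (intro prod_zero bexI[of _ i]) auto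
      then show ?thesis by simp
    qed
    also have "\<dots> = (\<integral>\<^sup>+v. P s * (F s v * indicator {x<..<1} v) \<partial>lborel)"
    proof -
      have [measurable]: "g s \<in> borel_measurable borel" "g' s \<in> borel_measurable borel"
        unfolding g_def g'_def by (rule first_coord_measurable[OF k])+
      have [measurable]: "(\<lambda>v. f (s(k := g s v))) \<in> borel_measurable borel"
        using measurable_compose[OF \<open>g s \<in> borel_measurable borel\<close> fs] .
      show ?thesis unfolding F_def sI by (subst nn_integral_cmult) auto
    qed
    also have "\<dots> = (\<integral>\<^sup>+v. H (s(k := v)) \<partial>lborel)" by (simp only: Hupd)
    finally show "(\<integral>\<^sup>+t. (\<Prod>i\<in>insert k I. indicator {0<..} ((s(k := t)) i)) * f (s(k := t)) \<partial>lborel) = (\<integral>\<^sup>+v. H (s(k := v)) \<partial>lborel)" .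
  qed
  also have "\<dots> = (\<integral>\<^sup>+u. H u \<partial>lborel_prod (insert k I))"
    by (rule lborel_prod_insert[symmetric]) (use I H_meas in auto)
  also have "\<dots> = (\<integral>\<^sup>+v. (\<integral>\<^sup>+s. H (s(k := v)) \<partial>lborel_prod I) \<partial>lborel)"
    by (rule lborel_prod_insert_rev) (use I H_meas in auto)
  also have "\<dots> = (\<integral>\<^sup>+v. (\<integral>\<^sup>+w. \<Psi> (w(k := v)) \<partial>lborel_prod I) \<partial>lborel)"
  proof (rule nn_integral_cong)
    fix v :: real
    show "(\<integral>\<^sup>+s. H (s(k := v)) \<partial>lborel_prod I) = (\<integral>\<^sup>+w. \<Psi> (w(k := v)) \<partial>lborel_prod I)"
    proof (cases "x < v \<and> v < 1")
      case False
      have "w(k := v) \<notin> open_domain m k x" for w using False open_domain_Suc[OF n k, of "w(k := v)"] by auto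
      then show ?thesis unfolding Hupd \<Psi>_def using False by simp
    next
      case True
      define \<gamma> where "\<gamma> = rescale k X v"
      have \<gamma>: "\<gamma> i > 0" if "i \<in> I" for i
      proof -
        have "X k > 0" "X k < 1" "X k < X i" using nd(4)[of k] nd(7)[of k] nd(6)[of k i] k that by (auto simp: I_def)
        moreover have "X k * v < X k * 1" using True \<open>X k > 0\<close> by (intro mult_strict_left_mono) auto
        ultimately show ?thesis unfolding \<gamma>_def rescale_def
          by (intro mult_pos_pos divide_pos_pos; linarith)
      qed
      define sc where "sc s = (\<lambda>i\<in>I. \<gamma> i * s i)" for s :: "nat => real"
      have Fm: "(\<lambda>s. F s v) \<in> borel_measurable (lborel_prod I)" by (rule F_meas) auto
      have Fm': "(\<lambda>s. F (sc s) v) \<in> borel_measurable (lborel_prod I)"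
        by (rule F_meas) (auto simp: sc_def)
      have nS: "nodes m (Suc k) (x / v) X" by (rule nodes_Suc[OF n]) (use True in auto)
      have "(\<integral>\<^sup>+s. H (s(k := v)) \<partial>lborel_prod I) = (\<integral>\<^sup>+s. P s * F s v \<partial>lborel_prod I)"
        unfolding Hupd using True by simp
      also have "\<dots> = ennreal (\<Prod>i\<in>I. \<gamma> i) * (\<integral>\<^sup>+s. P (sc s) * F (sc s) v \<partial>lborel_prod I)"
        unfolding sc_def
        by (rule nn_integral_lborel_prod_scale) (use I \<gamma> Fm in \<open>auto simp: P_def\<close>)
      also have "(\<integral>\<^sup>+s. P (sc s) * F (sc s) v \<partial>lborel_prod I) = (\<integral>\<^sup>+s. P s * F (sc s) v \<partial>lborel_prod I)"
      proof (rule nn_integral_cong)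
        fix s
        have "P (sc s) = P s" unfolding P_def
        proof (intro prod.cong refl)
          fix i assume i: "i \<in> I"
          have "0 < \<gamma> i * s i \<longleftrightarrow> 0 < s i" using \<gamma>[OF i] by (simp add: zero_less_mult_iff)
          then show "indicator {0<..} (sc s i) = (indicator {0<..} (s i) :: ennreal)" using i by (simp add: sc_def indicator_def)
        qed
        then show "P (sc s) * F (sc s) v = P s * F (sc s) v" by simp
      qed
      also have "\<dots> = (\<integral>\<^sup>+w. F (sc (\<lambda>i\<in>{Suc k..m}. affine_coord m (Suc k) (x / v) X w i)) v *
          ennreal (coord_jacobian m (Suc k) (x / v) X w / simplex_coord m (Suc k) (x / v) X w (Suc m) ^ (Suc (Suc m) - Suc k)) *
          indicator (open_domain m (Suc k) (x / v)) w \<partial>lborel_prod I)"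
        unfolding I_def P_def by (rule step.IH[OF nS Fm'[unfolded I_def]])
      also have "ennreal (\<Prod>i\<in>I. \<gamma> i) * \<dots> = (\<integral>\<^sup>+w. ennreal (\<Prod>i\<in>I. \<gamma> i) * (F (sc (\<lambda>i\<in>{Suc k..m}. affine_coord m (Suc k) (x / v) X w i)) v *
          ennreal (coord_jacobian m (Suc k) (x / v) X w / simplex_coord m (Suc k) (x / v) X w (Suc m) ^ (Suc (Suc m) - Suc k)) *
          indicator (open_domain m (Suc k) (x / v)) w) \<partial>lborel_prod I)"
      proof (rule nn_integral_cmult[symmetric])
        have [measurable]: "(\<lambda>w. F (sc (\<lambda>i\<in>{Suc k..m}. affine_coord m (Suc k) (x / v) X w i)) v) \<in> borel_measurable (lborel_prod {Suc k..m})"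
          by (rule F_meas) (auto simp: sc_def I_def)
        show "(\<lambda>w. F (sc (\<lambda>i\<in>{Suc k..m}. affine_coord m (Suc k) (x / v) X w i)) v *
          ennreal (coord_jacobian m (Suc k) (x / v) X w / simplex_coord m (Suc k) (x / v) X w (Suc m) ^ (Suc (Suc m) - Suc k)) *
          indicator (open_domain m (Suc k) (x / v)) w) \<in> borel_measurable (lborel_prod I)"
          unfolding I_def by measurable
      qed
      also have "\<dots> = (\<integral>\<^sup>+w. \<Psi> (w(k := v)) \<partial>lborel_prod I)"
      proof (rule nn_integral_cong)
        fix w0 assume w0: "w0 \<in> space (lborel_prod I)"
        define w where "w = w0(k := v)"
        have wk: "w k = v" by (simp add: w_def)
        have ag: "w0 i = w i" if "Suc k \<le> i" "i \<le> m" for i using that by (simp add: w_def)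
        have dom: "w0 \<in> open_domain m (Suc k) (x / v) \<longleftrightarrow> w \<in> open_domain m k x"
          using open_domain_Suc[OF n k, of w] open_domain_cong[of "Suc k" m w0 w "x / v"] ag True wk by auto
        show "ennreal (\<Prod>i\<in>I. \<gamma> i) * (F (sc (\<lambda>i\<in>{Suc k..m}. affine_coord m (Suc k) (x / v) X w0 i)) v *
          ennreal (coord_jacobian m (Suc k) (x / v) X w0 / simplex_coord m (Suc k) (x / v) X w0 (Suc m) ^ (Suc (Suc m) - Suc k)) *
          indicator (open_domain m (Suc k) (x / v)) w0) = \<Psi> (w0(k := v))"
        proof (cases "w \<in> open_domain m k x")
          case False
          then show ?thesis using dom by (simp add: \<Psi>_def w_def)
        next
          case wd: True
          define \<sigma> where "\<sigma> = affine_coord m k x X w"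
          have sig: "sc (\<lambda>i\<in>{Suc k..m}. affine_coord m (Suc k) (x / v) X w0 i) i = \<sigma> i" if i: "i \<in> I" for i
          proof -
            have "affine_coord m (Suc k) (x / v) X w0 i = affine_coord m (Suc k) (x / v) X w i"
              using simplex_coord_cong[of "Suc k" m w0 w] ag by (simp add: affine_coord_def)
            then show ?thesis using affine_coord_Suc[OF n k wd, of i] i unfolding wk by (simp add: sc_def I_def \<gamma>_def \<sigma>_def)
          qed
          have "g (sc (\<lambda>i\<in>{Suc k..m}. affine_coord m (Suc k) (x / v) X w0 i)) v = \<sigma> k"
            using g_cong(1)[OF sig] affine_coord_first[OF n k wd] by (simp add: g_def wk \<sigma>_def)
          moreover have "(restrict \<sigma> I)(k := \<sigma> k) = (\<lambda>i\<in>{k..m}. \<sigma> i)"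
            unfolding ins by (auto simp: restrict_def fun_eq_iff)
          ultimately have F: "F (sc (\<lambda>i\<in>{Suc k..m}. affine_coord m (Suc k) (x / v) X w0 i)) v = f (\<lambda>i\<in>{k..m}. \<sigma> i) * ennreal (- g' \<sigma> v)"
            unfolding F_def using g_cong(2,4)[OF sig] by simp
          have jc: "coord_jacobian m (Suc k) (x / v) X w0 = coord_jacobian m (Suc k) (x / v) X w"
            "simplex_coord m (Suc k) (x / v) X w0 (Suc m) = simplex_coord m (Suc k) (x / v) X w (Suc m)"
            using coord_jacobian_cong[of "Suc k" m w0 w] simplex_coord_cong[of "Suc k" m w0 w] ag by auto
          define Q where "Q = coord_jacobian m (Suc k) (x / v) X w / simplex_coord m (Suc k) (x / v) X w (Suc m) ^ (Suc m - k)"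
          have js: "(\<Prod>i\<in>I. \<gamma> i) * (- g' \<sigma> v) * Q = coord_jacobian m k x X w / simplex_coord m k x X w (Suc m) ^ (Suc (Suc m) - k)"
            using coord_jacobian_step[OF n k wd] unfolding wk by (simp add: I_def \<gamma>_def g'_def \<sigma>_def Q_def)
          \<comment> \<open>Signs have to be checked since the product of the factors is taken in
            \<open>ennreal\<close>, where a negative number would become 0.\<close>
          have neg: "- g' \<sigma> v \<ge> 0"
          proof -
            have xX: "X k < x * X j \<and> X k < X j" if "j \<in> {Suc k..Suc m}" for j
              using nd(5)[of k j] nd(6)[of k j] that by auto
            have "\<sigma> j > 0" if "j \<in> {Suc k..Suc m}" for j
              unfolding \<sigma>_def affine_coord_def by (intro divide_pos_pos simplex_coord_pos[OF n k wd]) (use that k in auto)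
            moreover have "X k * v\<^sup>2 \<le> X k"
              using True nd(1) nd(4)[of k] k by (intro mult_left_le) (auto simp: power_le_one)
            ultimately have "(\<Sum>j\<in>{Suc k..Suc m}. (if j = Suc m then 1 else \<sigma> j) * ((X j - X k) * (x * X j - X k * v\<^sup>2) / (X j - X k * v)\<^sup>2)) \<ge> 0"
              using xX by (intro sum_nonneg mult_nonneg_nonneg divide_nonneg_nonneg) (force intro: less_imp_le)+
            then show ?thesis unfolding g'_def first_coord'_def minus_minus using nd(2) by (intro mult_nonneg_nonneg) auto
          qed
          have gp: "(\<Prod>i\<in>I. \<gamma> i) \<ge> 0" using \<gamma> by (intro prod_nonneg) (auto intro: less_imp_le)
          have "ennreal (\<Prod>i\<in>I. \<gamma> i) * (f (\<lambda>i\<in>{k..m}. \<sigma> i) * ennreal (- g' \<sigma> v) * ennreal Q) = f (\<lambda>i\<in>{k..m}. \<sigma> i) *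
            ennreal (coord_jacobian m k x X w / simplex_coord m k x X w (Suc m) ^ (Suc (Suc m) - k))"
          proof -
            have "ennreal (a * b * Q) = ennreal a * ennreal b * ennreal Q" if "a \<ge> 0" "b \<ge> 0" for a b
              using ennreal_mult'[of "a * b" Q] ennreal_mult'[of a b] that by simp
            from this[OF gp neg] show ?thesis unfolding js[symmetric] by (simp only: mult_ac)
          qed
          then show ?thesis
            using wd dom by (simp add: F jc Q_def[symmetric] \<Psi>_def w_def[symmetric] \<sigma>_def[symmetric] del: of_nat_Suc)
        qed
      qed
      finally show ?thesis .
    qed
  qed
  also have "\<dots> = (\<integral>\<^sup>+w. \<Psi> w \<partial>lborel_prod (insert k I))"
    by (rule lborel_prod_insert_rev[symmetric]) (use I Psi_meas in auto)
  finally show ?case unfolding \<Psi>_def ins .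
qed

section \<open>Two parametric integrals\<close>

definition orthant_integral :: "nat set => ((nat => real) => real) => ennreal" where
  "orthant_integral I f = (\<integral>\<^sup>+s. (\<Prod>i\<in>I. indicator {0<..} (s i)) * ennreal (f s) \<partial>lborel_prod I)"

lemma orthant_indicator: "finite I ==> (\<Prod>i\<in>I. indicator {0<..} (s i)) = (indicator {s. \<forall>i\<in>I. 0 < s i} s :: ennreal)"
  by (induction I rule: finite_induct) (auto simp: indicator_def)

lemma orthant_weight_cong:
  assumes "\<And>s. (\<And>i. i \<in> I ==> 0 < s i) ==> f s = g s" "finite I"
  shows "(\<integral>\<^sup>+s. (\<Prod>i\<in>I. indicator {0<..} (s i)) * f s \<partial>lborel_prod I) = (\<integral>\<^sup>+s. (\<Prod>i\<in>I. indicator {0<..} (s i)) * g s \<partial>lborel_prod I)"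
proof (rule nn_integral_cong)
  fix s :: "nat => real"
  show "(\<Prod>i\<in>I. indicator {0<..} (s i)) * f s = (\<Prod>i\<in>I. indicator {0<..} (s i)) * g s"
    unfolding orthant_indicator[OF assms(2)] using assms(1) by (cases "\<forall>i\<in>I. 0 < s i") auto
qed

lemma orthant_integral_cong:
  assumes "finite I" "\<And>s. (\<And>i. i \<in> I ==> 0 < s i) ==> f s = g s"
  shows "orthant_integral I f = orthant_integral I g"
  unfolding orthant_integral_def by (rule orthant_weight_cong) (use assms in auto)

section \<open>Gamma integrals over the orthant\<close>

lemma nn_integral_gamma:
  assumes "a > 0" "L > 0"
  shows "(\<integral>\<^sup>+t. indicator {0<..} t * ennreal (t powr (a - 1) * exp (- L * t)) \<partial>lborel) = ennreal (Gamma a * L powr - a)"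
proof -
  have "(\<integral>\<^sup>+t. indicator {0<..} t * ennreal (t powr (a - 1) * exp (- L * t)) \<partial>lborel) =
     ennreal (1 / L) * (\<integral>\<^sup>+t. indicator {0<..} (0 + 1 / L * t) * ennreal ((0 + 1 / L * t) powr (a - 1) * exp (- L * (0 + 1 / L * t))) \<partial>lborel)"
    using assms by (subst nn_integral_real_affine[where c = "1 / L" and t = 0]) auto
  also have "(\<integral>\<^sup>+t. indicator {0<..} (0 + 1 / L * t) * ennreal ((0 + 1 / L * t) powr (a - 1) * exp (- L * (0 + 1 / L * t))) \<partial>lborel)
     = (\<integral>\<^sup>+t. ennreal (L powr (1 - a)) * ennreal (indicator {0..} t * t powr (a - 1) / exp t) \<partial>lborel)"
  proof (rule nn_integral_cong)
    fix t :: real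
    show "indicator {0<..} (0 + 1 / L * t) * ennreal ((0 + 1 / L * t) powr (a - 1) * exp (- L * (0 + 1 / L * t))) =
       ennreal (L powr (1 - a)) * ennreal (indicator {0..} t * t powr (a - 1) / exp t)"
    proof (cases "t > 0")
      case True
      have "(t / L) powr (a - 1) = L powr (1 - a) * t powr (a - 1)"
        using True assms by (simp add: powr_divide powr_diff field_simps)
      then show ?thesis using True assms
        by (simp add: ennreal_mult'[symmetric] exp_minus field_simps)
    next
      case False
      then show ?thesis using assms by (auto simp: indicator_def zero_less_divide_iff)
    qed
  qed
  also have "\<dots> = ennreal (L powr (1 - a)) * ennreal (Gamma a)"
    using Gamma_conv_nn_integral_real[OF assms(1)] by (subst nn_integral_cmult) auto
  also have "ennreal (1 / L) * (ennreal (L powr (1 - a)) * ennreal (Gamma a)) = ennreal (Gamma a * L powr - a)"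
    using assms by (simp add: ennreal_mult'[symmetric] powr_diff powr_minus field_simps Gamma_real_pos less_imp_le)
  finally show ?thesis .
qed

lemma orthant_integral_prod:
  assumes "finite I" "\<And>i. i \<in> I ==> g i \<in> borel_measurable borel" "\<And>i t. i \<in> I ==> 0 < t ==> 0 \<le> g i t"
  shows "orthant_integral I (\<lambda>s. \<Prod>i\<in>I. g i (s i)) = (\<Prod>i\<in>I. \<integral>\<^sup>+t. indicator {0<..} t * ennreal (g i t) \<partial>lborel)"
proof -
  have "orthant_integral I (\<lambda>s. \<Prod>i\<in>I. g i (s i)) = (\<integral>\<^sup>+s. (\<Prod>i\<in>I. indicator {0<..} (s i) * ennreal (g i (s i))) \<partial>lborel_prod I)"
    unfolding orthant_integral_def
  proof (rule nn_integral_cong)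
    fix s :: "nat => real"
    show "(\<Prod>i\<in>I. indicator {0<..} (s i)) * ennreal (\<Prod>i\<in>I. g i (s i)) = (\<Prod>i\<in>I. indicator {0<..} (s i) * ennreal (g i (s i)))"
    proof (cases "\<forall>i\<in>I. 0 < s i")
      case True then show ?thesis using assms by (simp add: prod_ennreal)
    next
      case False
      then obtain i where "i \<in> I" "\<not> 0 < s i" by blast
      then have "(\<Prod>i\<in>I. indicator {0<..} (s i)) = (0 :: ennreal)" "(\<Prod>i\<in>I. indicator {0<..} (s i) * ennreal (g i (s i))) = 0"
        using assms(1) by (auto intro!: prod_zero bexI[of _ i])
      then show ?thesis by (simp only: mult_zero_left)
    qed
  qed
  also have "\<dots> = (\<Prod>i\<in>I. \<integral>\<^sup>+t. indicator {0<..} t * ennreal (g i t) \<partial>lborel)"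
    using assms by (intro product_sigma_finite.product_nn_integral_prod[OF product_sigma_finite_lborel]) auto
  finally show ?thesis .
qed

lemma orthant_integral_gamma:
  assumes "finite I" "th > 0" "\<And>i. i \<in> I ==> 0 < L i"
  shows "orthant_integral I (\<lambda>s. (\<Prod>i\<in>I. s i powr (th - 1)) * exp (- (\<Sum>i\<in>I. s i * L i))) =
     ennreal (Gamma th ^ card I * (\<Prod>i\<in>I. L i powr - th))"
proof -
  have "orthant_integral I (\<lambda>s. (\<Prod>i\<in>I. s i powr (th - 1)) * exp (- (\<Sum>i\<in>I. s i * L i))) =
      orthant_integral I (\<lambda>s. \<Prod>i\<in>I. s i powr (th - 1) * exp (- L i * s i))"
    using assms(1) by (intro arg_cong[where f = "orthant_integral I"] ext) (simp add: prod.distrib exp_sum sum_negf[symmetric] mult.commute)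
  also have "\<dots> = (\<Prod>i\<in>I. ennreal (Gamma th * L i powr - th))"
    by (subst orthant_integral_prod[OF assms(1)]) (use assms nn_integral_gamma[of th] in \<open>auto intro!: prod.cong\<close>)
  also have "\<dots> = ennreal (Gamma th ^ card I * (\<Prod>i\<in>I. L i powr - th))"
    using assms by (subst prod_ennreal) (auto simp: prod.distrib Gamma_real_pos less_imp_le)
  finally show ?thesis .
qed

lemma orthant_integral_cmult:
  assumes "0 \<le> c" "f \<in> borel_measurable (lborel_prod I)" "finite I"
  shows "orthant_integral I (\<lambda>s. c * f s) = ennreal c * orthant_integral I f"
proof -
  note [measurable] = assms(2) lborel_product_component
  have "orthant_integral I (\<lambda>s. c * f s) = (\<integral>\<^sup>+s. ennreal c * ((\<Prod>i\<in>I. indicator {0<..} (s i)) * ennreal (f s)) \<partial>lborel_prod I)"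
    unfolding orthant_integral_def using assms(1) by (intro nn_integral_cong) (simp add: ennreal_mult' ac_simps)
  also have "\<dots> = ennreal c * orthant_integral I f"
    unfolding orthant_integral_def using assms(3) by (intro nn_integral_cmult) auto
  finally show ?thesis .
qed

lemma weighted_swap:
  fixes f :: "'a => 'b => ennreal"
  assumes "sigma_finite_measure M1" "sigma_finite_measure M2"
    and [measurable]: "a \<in> borel_measurable M1" "b \<in> borel_measurable M2" "case_prod f \<in> borel_measurable (M1 \<Otimes>\<^sub>M M2)"
  shows "(\<integral>\<^sup>+s. a s * (\<integral>\<^sup>+t. b t * f s t \<partial>M2) \<partial>M1) = (\<integral>\<^sup>+t. b t * (\<integral>\<^sup>+s. a s * f s t \<partial>M1) \<partial>M2)"
proof -
  interpret pair_sigma_finite M1 M2 by (rule pair_sigma_finite.intro[OF assms(1,2)])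
  have f1 [measurable]: "f s \<in> borel_measurable M2" if "s \<in> space M1" for s
    using measurable_compose[OF measurable_Pair1'[OF that] assms(5)] by simp
  have f2 [measurable]: "(\<lambda>s. f s t) \<in> borel_measurable M1" if "t \<in> space M2" for t
    using measurable_compose[OF measurable_Pair2'[OF that] assms(5)] by simp
  have "(\<integral>\<^sup>+s. a s * (\<integral>\<^sup>+t. b t * f s t \<partial>M2) \<partial>M1) = (\<integral>\<^sup>+s. (\<integral>\<^sup>+t. a s * (b t * f s t) \<partial>M2) \<partial>M1)"
    by (intro nn_integral_cong nn_integral_cmult[symmetric]) auto
  also have "\<dots> = (\<integral>\<^sup>+t. (\<integral>\<^sup>+s. a s * (b t * f s t) \<partial>M1) \<partial>M2)"
    by (rule Fubini'[symmetric]) measurable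
  also have "\<dots> = (\<integral>\<^sup>+t. b t * (\<integral>\<^sup>+s. a s * f s t \<partial>M1) \<partial>M2)"
    by (intro nn_integral_cong, subst nn_integral_cmult[symmetric]) (auto simp: mult.left_commute)
  finally show ?thesis .
qed

lemma sigma_finite_lborel_prod: "finite I ==> sigma_finite_measure (lborel_prod I)"
  by (rule product_sigma_finite.sigma_finite[OF product_sigma_finite_lborel])

lemma orthant_indicator_measurable [measurable]:
  "(\<lambda>s. \<Prod>i\<in>I. indicator {0<..} (s i) :: ennreal) \<in> borel_measurable (lborel_prod I)"
  by measurable

text \<open>Coordinate \<open>k\<close> serves as the radius: the others are written as multiples of
  it, with Jacobian t ^ card J.\<close>

lemma orthant_integral_insert:
  assumes "finite J" "k \<notin> J" and [measurable]: "f \<in> borel_measurable (lborel_prod (insert k J))"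
  shows "orthant_integral (insert k J) f =
    (\<integral>\<^sup>+t. indicator {0<..} t * (ennreal (t ^ card J) * orthant_integral J (\<lambda>s. f ((\<lambda>i\<in>J. t * s i)(k := t)))) \<partial>lborel)"
proof -
  let ?F = "\<lambda>s. (\<Prod>i\<in>insert k J. indicator {0<..} (s i)) * ennreal (f s)"
  have mF: "?F \<in> borel_measurable (lborel_prod (insert k J))" by measurable
  have "orthant_integral (insert k J) f = (\<integral>\<^sup>+t. (\<integral>\<^sup>+s. ?F (s(k := t)) \<partial>lborel_prod J) \<partial>lborel)"
    unfolding orthant_integral_def by (rule lborel_prod_insert_rev[OF assms(1,2) mF])
  also have "\<dots> = (\<integral>\<^sup>+t. indicator {0<..} t * (ennreal (t ^ card J) * orthant_integral J (\<lambda>s. f ((\<lambda>i\<in>J. t * s i)(k := t)))) \<partial>lborel)"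
  proof (rule nn_integral_cong)
    fix t :: real
    have ind: "(\<Prod>i\<in>insert k J. indicator {0<..} ((s(k := t)) i)) = (indicator {0<..} t * (\<Prod>i\<in>J. indicator {0<..} (s i)) :: ennreal)" for s
      using assms(1,2) by (auto simp: intro!: prod.cong arg_cong2[where f = "(*)"])
    have upd: "(\<lambda>s. s(k := t)) \<in> measurable (lborel_prod J) (lborel_prod (insert k J))"
      by (rule measurable_fun_upd[where J = J]) auto
    then have [measurable]: "(\<lambda>s. f (s(k := t))) \<in> borel_measurable (lborel_prod J)" by measurable
    show "(\<integral>\<^sup>+s. ?F (s(k := t)) \<partial>lborel_prod J) = indicator {0<..} t * (ennreal (t ^ card J) * orthant_integral J (\<lambda>s. f ((\<lambda>i\<in>J. t * s i)(k := t))))"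
    proof (cases "t > 0")
      case False
      then show ?thesis unfolding ind by simp
    next
      case True
      have "(\<integral>\<^sup>+s. ?F (s(k := t)) \<partial>lborel_prod J) = (\<integral>\<^sup>+s. (\<Prod>i\<in>J. indicator {0<..} (s i)) * ennreal (f (s(k := t))) \<partial>lborel_prod J)"
        unfolding ind using True by simp
      also have "\<dots> = ennreal (\<Prod>i\<in>J. t) * (\<integral>\<^sup>+s. (\<Prod>i\<in>J. indicator {0<..} ((\<lambda>i\<in>J. t * s i) i)) * ennreal (f ((\<lambda>i\<in>J. t * s i)(k := t))) \<partial>lborel_prod J)"
        by (rule nn_integral_lborel_prod_scale) (use True assms(1) in auto)
      also have "\<dots> = ennreal (t ^ card J) * orthant_integral J (\<lambda>s. f ((\<lambda>i\<in>J. t * s i)(k := t)))"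
        unfolding orthant_integral_def prod_constant
      proof (intro arg_cong2[where f = "(*)"] refl nn_integral_cong prod.cong)
        fix s :: "nat => real" and i assume "i \<in> J"
        then show "indicator {0<..} ((\<lambda>i\<in>J. t * s i) i) = (indicator {0<..} (s i) :: ennreal)"
          using True by (simp add: indicator_def zero_less_mult_iff)
      qed
      finally show ?thesis using True by simp
    qed
  qed
  finally show ?thesis .
qed

text \<open>Writing the powers as Gamma integrals makes the two sets of variables interchangeable.\<close>

lemma orthant_integral_duality:
  fixes c :: "nat => nat => real"
  assumes "th > 0" "m \<le> n" and c: "\<And>i j. 1 \<le> i ==> i \<le> Suc m ==> j \<le> n ==> 0 < c i j"
    and c0: "\<And>i. 1 \<le> i ==> i \<le> Suc m ==> c i 0 = 1"
  shows "ennreal (Gamma th ^ Suc n) * orthant_integral {1..m} (\<lambda>s. (\<Prod>i=1..m. s i powr (th - 1)) *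
       (\<Prod>j\<in>{0..n}. (c (Suc m) j + (\<Sum>i=1..m. s i * c i j)) powr - th)) =
     ennreal (Gamma th ^ m * Gamma (real (Suc n - m) * th)) * orthant_integral {1..n} (\<lambda>s. (\<Prod>j=1..n. s j powr (th - 1)) *
       ((\<Prod>i=1..m. (1 + (\<Sum>j=1..n. s j * c i j)) powr - th) * (1 + (\<Sum>j=1..n. s j * c (Suc m) j)) powr - (real (Suc n - m) * th)))"
proof -
  define \<beta> where "\<beta> = real (Suc n - m) * th"
  have \<beta>: "\<beta> > 0" using assms by (simp add: \<beta>_def)
  let ?L = "\<lambda>s j. c (Suc m) j + (\<Sum>i=1..m. s i * c i j)"
  \<comment> \<open>One variable \<open>t j\<close> for each linear form. Integrating over t first
    gives back the powers of the forms, integrating over s first gives the powers of the forms in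
    t.\<close>
  let ?e = "\<lambda>s t. (\<Prod>i=1..m. s i powr (th - 1)) * (\<Prod>j\<in>{0..n}. t j powr (th - 1)) * exp (- (\<Sum>j\<in>{0..n}. t j * ?L s j))"
  have "ennreal (Gamma th ^ Suc n) * orthant_integral {1..m} (\<lambda>s. (\<Prod>i=1..m. s i powr (th - 1)) * (\<Prod>j\<in>{0..n}. ?L s j powr - th)) =
     orthant_integral {1..m} (\<lambda>s. Gamma th ^ Suc n * ((\<Prod>i=1..m. s i powr (th - 1)) * (\<Prod>j\<in>{0..n}. ?L s j powr - th)))"
    using assms by (intro orthant_integral_cmult[symmetric]) (auto simp: Gamma_real_pos less_imp_le)
  also have "\<dots> = (\<integral>\<^sup>+s. (\<Prod>i\<in>{1..m}. indicator {0<..} (s i)) * (\<integral>\<^sup>+t. (\<Prod>j\<in>{0..n}. indicator {0<..} (t j)) * ennreal (?e s t) \<partial>lborel_prod {0..n}) \<partial>lborel_prod {1..m})"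
    unfolding orthant_integral_def
  proof (rule orthant_weight_cong)
    fix s :: "nat => real" assume pos: "\<And>i. i \<in> {1..m} ==> 0 < s i"
    have L: "0 < ?L s j" if "j \<le> n" for j
      using pos that by (intro add_pos_nonneg sum_nonneg mult_nonneg_nonneg c less_imp_le[OF c]) (auto intro: less_imp_le)
    have "(\<integral>\<^sup>+t. (\<Prod>j\<in>{0..n}. indicator {0<..} (t j)) * ennreal (?e s t) \<partial>lborel_prod {0..n}) =
        orthant_integral {0..n} (\<lambda>t. (\<Prod>i=1..m. s i powr (th - 1)) * ((\<Prod>j\<in>{0..n}. t j powr (th - 1)) * exp (- (\<Sum>j\<in>{0..n}. t j * ?L s j))))"
      unfolding orthant_integral_def by (simp only: mult.assoc)
    also have "\<dots> = ennreal (\<Prod>i=1..m. s i powr (th - 1)) * ennreal (Gamma th ^ card {0..n} * (\<Prod>j\<in>{0..n}. ?L s j powr - th))"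
      using L assms(1) by (subst orthant_integral_cmult, simp add: prod_nonneg, measurable, simp, subst orthant_integral_gamma) auto
    also have "\<dots> = ennreal (Gamma th ^ Suc n * ((\<Prod>i=1..m. s i powr (th - 1)) * (\<Prod>j\<in>{0..n}. ?L s j powr - th)))"
      by (subst ennreal_mult'[symmetric]) (auto simp: prod_nonneg mult_ac)
    finally show "ennreal (Gamma th ^ Suc n * ((\<Prod>i=1..m. s i powr (th - 1)) * (\<Prod>j\<in>{0..n}. ?L s j powr - th))) = (\<integral>\<^sup>+t. (\<Prod>j\<in>{0..n}. indicator {0<..} (t j)) * ennreal (?e s t) \<partial>lborel_prod {0..n})" by simp
  qed simp
  also have "\<dots> = (\<integral>\<^sup>+t. (\<Prod>j\<in>{0..n}. indicator {0<..} (t j)) * (\<integral>\<^sup>+s. (\<Prod>i\<in>{1..m}. indicator {0<..} (s i)) * ennreal (?e s t) \<partial>lborel_prod {1..m}) \<partial>lborel_prod {0..n})"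
    by (rule weighted_swap) (auto intro!: sigma_finite_lborel_prod)
  also have "\<dots> = orthant_integral {0..n} (\<lambda>t. Gamma th ^ m * ((\<Prod>j\<in>{0..n}. t j powr (th - 1)) * exp (- (\<Sum>j\<in>{0..n}. t j * c (Suc m) j)) * (\<Prod>i=1..m. (\<Sum>j\<in>{0..n}. t j * c i j) powr - th)))"
    unfolding orthant_integral_def
  proof (rule orthant_weight_cong)
    fix t :: "nat => real" assume pos: "\<And>i. i \<in> {0..n} ==> 0 < t i"
    have L: "0 < (\<Sum>j\<in>{0..n}. t j * c i j)" if "i \<in> {1..m}" for i
      using pos that by (intro sum_pos mult_pos_pos c) auto
    define K where "K = (\<Prod>j\<in>{0..n}. t j powr (th - 1)) * exp (- (\<Sum>j\<in>{0..n}. t j * c (Suc m) j))"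
    have K: "0 \<le> K" by (simp add: K_def prod_nonneg)
    have e: "?e s t = K * ((\<Prod>i\<in>{1..m}. s i powr (th - 1)) * exp (- (\<Sum>i\<in>{1..m}. s i * (\<Sum>j\<in>{0..n}. t j * c i j))))" for s
    proof -
      have "(\<Sum>j\<in>{0..n}. t j * ?L s j) = (\<Sum>j\<in>{0..n}. t j * c (Suc m) j) + (\<Sum>j\<in>{0..n}. \<Sum>i\<in>{1..m}. s i * (t j * c i j))"
        by (simp only: distrib_left sum.distrib sum_distrib_left mult.left_commute)
      also have "(\<Sum>j\<in>{0..n}. \<Sum>i\<in>{1..m}. s i * (t j * c i j)) = (\<Sum>i\<in>{1..m}. s i * (\<Sum>j\<in>{0..n}. t j * c i j))"
        by (subst sum.swap) (simp only: sum_distrib_left)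
      finally show ?thesis by (simp only: K_def minus_add_distrib exp_add ac_simps)
    qed
    have "(\<integral>\<^sup>+s. (\<Prod>i\<in>{1..m}. indicator {0<..} (s i)) * ennreal (?e s t) \<partial>lborel_prod {1..m}) =
      orthant_integral {1..m} (\<lambda>s. K * ((\<Prod>i\<in>{1..m}. s i powr (th - 1)) * exp (- (\<Sum>i\<in>{1..m}. s i * (\<Sum>j\<in>{0..n}. t j * c i j)))))"
      unfolding orthant_integral_def e ..
    also have "\<dots> = ennreal K * ennreal (Gamma th ^ card {1..m} * (\<Prod>i\<in>{1..m}. (\<Sum>j\<in>{0..n}. t j * c i j) powr - th))"
      by (subst orthant_integral_cmult[OF K], measurable, simp, subst orthant_integral_gamma) (use L assms in auto)
    also have "\<dots> = ennreal (Gamma th ^ m * (K * (\<Prod>i\<in>{1..m}. (\<Sum>j\<in>{0..n}. t j * c i j) powr - th)))"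
      by (subst ennreal_mult'[symmetric, OF K]) (simp add: mult_ac)
    finally show "(\<integral>\<^sup>+s. (\<Prod>i\<in>{1..m}. indicator {0<..} (s i)) * ennreal (?e s t) \<partial>lborel_prod {1..m}) = ennreal (Gamma th ^ m * ((\<Prod>j\<in>{0..n}. t j powr (th - 1)) * exp (- (\<Sum>j\<in>{0..n}. t j * c (Suc m) j)) * (\<Prod>i=1..m. (\<Sum>j\<in>{0..n}. t j * c i j) powr - th)))" unfolding K_def by simp
  qed simp
  also have "\<dots> = ennreal (Gamma th ^ m) * orthant_integral {0..n} (\<lambda>t. (\<Prod>j\<in>{0..n}. t j powr (th - 1)) * exp (- (\<Sum>j\<in>{0..n}. t j * c (Suc m) j)) * (\<Prod>i=1..m. (\<Sum>j\<in>{0..n}. t j * c i j) powr - th))"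
    using assms by (intro orthant_integral_cmult) (auto simp: Gamma_real_pos less_imp_le)
  \<comment> \<open>The forms are homogeneous in t, and \<open>c i 0 = 1\<close> lets t 0 act as the
    radius. The total degree n + (n + 1) (th - 1) - m th of the radial variable is \<beta> - 1, so
    the radial integral is a Gamma integral with parameter \<beta>.\<close>
  also have "orthant_integral {0..n} (\<lambda>t. (\<Prod>j\<in>{0..n}. t j powr (th - 1)) * exp (- (\<Sum>j\<in>{0..n}. t j * c (Suc m) j)) * (\<Prod>i=1..m. (\<Sum>j\<in>{0..n}. t j * c i j) powr - th)) =
     ennreal (Gamma \<beta>) * orthant_integral {1..n} (\<lambda>s. (\<Prod>j=1..n. s j powr (th - 1)) *
       ((\<Prod>i=1..m. (1 + (\<Sum>j=1..n. s j * c i j)) powr - th) * (1 + (\<Sum>j=1..n. s j * c (Suc m) j)) powr - \<beta>))"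
    (is "orthant_integral _ ?f = _")
  proof -
    let ?B = "\<lambda>s i. 1 + (\<Sum>j=1..n. s j * c i j)"
    let ?A = "\<lambda>s. (\<Prod>j=1..n. s j powr (th - 1)) * (\<Prod>i=1..m. ?B s i powr - th)"
    have ivl: "{0..n} = insert 0 {1..n}" by auto
    have "orthant_integral {0..n} ?f = orthant_integral (insert 0 {1..n}) ?f" by (simp only: ivl)
    also have "\<dots> = (\<integral>\<^sup>+t. indicator {0<..} t * (ennreal (t ^ card {1..n}) * orthant_integral {1..n} (\<lambda>s. ?f ((\<lambda>i\<in>{1..n}. t * s i)(0 := t)))) \<partial>lborel)"
    proof (rule orthant_integral_insert)
      show "?f \<in> borel_measurable (lborel_prod (insert 0 {1..n}))"
        unfolding ivl[symmetric] by measurable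
    qed auto
    also have "\<dots> = (\<integral>\<^sup>+t. indicator {0<..} t * (\<integral>\<^sup>+s. (\<Prod>i\<in>{1..n}. indicator {0<..} (s i)) * ennreal (?A s * (t powr (\<beta> - 1) * exp (- ?B s (Suc m) * t))) \<partial>lborel_prod {1..n}) \<partial>lborel)"
    proof (rule nn_integral_cong)
      fix t :: real
      show "indicator {0<..} t * (ennreal (t ^ card {1..n}) * orthant_integral {1..n} (\<lambda>s. ?f ((\<lambda>i\<in>{1..n}. t * s i)(0 := t)))) =
        indicator {0<..} t * (\<integral>\<^sup>+s. (\<Prod>i\<in>{1..n}. indicator {0<..} (s i)) * ennreal (?A s * (t powr (\<beta> - 1) * exp (- ?B s (Suc m) * t))) \<partial>lborel_prod {1..n})"
      proof (cases "t > 0")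
        case True
        have sum0: "(\<Sum>j\<in>{0..n}. ((\<lambda>i\<in>{1..n}. t * s i)(0 := t)) j * c i j) = t * ?B s i" if "1 \<le> i" "i \<le> Suc m" for s i
          unfolding ivl using that by (subst sum.insert) (auto simp: c0 sum_distrib_left distrib_left mult.assoc intro!: sum.cong)
        have prod0: "(\<Prod>j\<in>{0..n}. ((\<lambda>i\<in>{1..n}. t * s i)(0 := t)) j powr (th - 1)) = t powr (real (Suc n) * (th - 1)) * (\<Prod>j=1..n. s j powr (th - 1))"
          if "\<And>i. i \<in> {1..n} ==> 0 < s i" for s
        proof -
          have "(\<Prod>j\<in>{0..n}. ((\<lambda>i\<in>{1..n}. t * s i)(0 := t)) j powr (th - 1)) = t powr (th - 1) * (\<Prod>j=1..n. (t * s j) powr (th - 1))"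
            unfolding ivl by (subst prod.insert) (auto intro!: prod.cong)
          also have "(\<Prod>j=1..n. (t * s j) powr (th - 1)) = (t powr (th - 1)) ^ n * (\<Prod>j=1..n. s j powr (th - 1))"
            using True that by (simp add: powr_mult less_imp_le prod.distrib)
          also have "t powr (th - 1) * ((t powr (th - 1)) ^ n * (\<Prod>j=1..n. s j powr (th - 1))) = (t powr (th - 1)) ^ Suc n * (\<Prod>j=1..n. s j powr (th - 1))"
            by simp
          also have "(t powr (th - 1)) ^ Suc n = t powr (real (Suc n) * (th - 1))"
            using True by (simp only: powr_power mult.commute)
          finally show ?thesis .
        qed
        have B: "0 < ?B s i" if "\<And>i. i \<in> {1..n} ==> 0 < s i" "1 \<le> i" "i \<le> Suc m" for s i
          using that by (intro add_pos_nonneg sum_nonneg mult_nonneg_nonneg less_imp_le[OF c]) (auto intro: less_imp_le)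
        have "ennreal (t ^ card {1..n}) * orthant_integral {1..n} (\<lambda>s. ?f ((\<lambda>i\<in>{1..n}. t * s i)(0 := t))) =
           orthant_integral {1..n} (\<lambda>s. t ^ card {1..n} * ?f ((\<lambda>i\<in>{1..n}. t * s i)(0 := t)))"
        proof (rule orthant_integral_cmult[symmetric])
          have "(\<lambda>s. (\<lambda>i\<in>{1..n}. t * s i)(0 := t)) \<in> measurable (lborel_prod {1..n}) (lborel_prod {0..n})"
            unfolding ivl by (rule measurable_fun_upd[where J = "{1..n}"]) (auto intro!: measurable_restrict)
          then show "(\<lambda>s. ?f ((\<lambda>i\<in>{1..n}. t * s i)(0 := t))) \<in> borel_measurable (lborel_prod {1..n})"
            by (rule measurable_compose[where g = ?f]) measurable
        qed (use True in auto)
        also have "\<dots> = orthant_integral {1..n} (\<lambda>s. ?A s * (t powr (\<beta> - 1) * exp (- ?B s (Suc m) * t)))"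
        proof (rule orthant_integral_cong)
          fix s :: "nat => real" assume s: "\<And>i. i \<in> {1..n} ==> 0 < s i"
          have "(\<Prod>i=1..m. (\<Sum>j\<in>{0..n}. ((\<lambda>i\<in>{1..n}. t * s i)(0 := t)) j * c i j) powr - th) = (\<Prod>i=1..m. t powr - th * ?B s i powr - th)"
            using B[where s = s, OF s] True by (intro prod.cong refl) (simp only: sum0 atLeastAtMost_iff le_SucI, simp add: powr_mult less_imp_le)
          also have "\<dots> = t powr (- real m * th) * (\<Prod>i=1..m. ?B s i powr - th)"
            using True by (simp add: prod.distrib powr_power mult.commute)
          finally have P: "(\<Prod>i=1..m. (\<Sum>j\<in>{0..n}. ((\<lambda>i\<in>{1..n}. t * s i)(0 := t)) j * c i j) powr - th) = t powr (- real m * th) * (\<Prod>i=1..m. ?B s i powr - th)" .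
          have T: "t ^ card {1..n} * t powr (real (Suc n) * (th - 1)) * t powr (- real m * th) = t powr (\<beta> - 1)"
          proof -
            have "t ^ card {1..n} = t powr real n" using True by (simp add: powr_realpow)
            moreover have "real n + real (Suc n) * (th - 1) + (- real m * th) = \<beta> - 1"
              using assms(2) by (simp add: \<beta>_def of_nat_diff algebra_simps)
            ultimately show ?thesis by (simp only: powr_add[symmetric])
          qed
          have E: "exp (- (\<Sum>j\<in>{0..n}. ((\<lambda>i\<in>{1..n}. t * s i)(0 := t)) j * c (Suc m) j)) = exp (- ?B s (Suc m) * t)"
            by (subst sum0) (simp_all only: mult_minus_left mult.commute[of t] order_refl le_add1 plus_1_eq_Suc[symmetric])
          have Q: "(\<Prod>j\<in>{0..n}. ((\<lambda>i\<in>{1..n}. t * s i)(0 := t)) j powr (th - 1)) = t powr (real (Suc n) * (th - 1)) * (\<Prod>j=1..n. s j powr (th - 1))"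
            by (rule prod0) (rule s)
          show "t ^ card {1..n} * ?f ((\<lambda>i\<in>{1..n}. t * s i)(0 := t)) = ?A s * (t powr (\<beta> - 1) * exp (- ?B s (Suc m) * t))"
            unfolding P Q T[symmetric] E by (simp only: ac_simps)
        qed auto
        finally show ?thesis unfolding orthant_integral_def by simp
      qed auto
    qed
    also have "\<dots> = (\<integral>\<^sup>+s. (\<Prod>i\<in>{1..n}. indicator {0<..} (s i)) * (\<integral>\<^sup>+t. indicator {0<..} t * ennreal (?A s * (t powr (\<beta> - 1) * exp (- ?B s (Suc m) * t))) \<partial>lborel) \<partial>lborel_prod {1..n})"
      by (rule weighted_swap) (auto intro!: sigma_finite_lborel_prod sigma_finite_lborel)
    also have "\<dots> = (\<integral>\<^sup>+s. (\<Prod>i\<in>{1..n}. indicator {0<..} (s i)) * ennreal (Gamma \<beta> * ((\<Prod>j=1..n. s j powr (th - 1)) *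
       ((\<Prod>i=1..m. ?B s i powr - th) * ?B s (Suc m) powr - \<beta>))) \<partial>lborel_prod {1..n})"
    proof (rule orthant_weight_cong)
      fix s :: "nat => real" assume pos: "\<And>i. i \<in> {1..n} ==> 0 < s i"
      then have B: "0 < ?B s (Suc m)"
        by (intro add_pos_nonneg sum_nonneg mult_nonneg_nonneg less_imp_le[OF c]) (auto intro: less_imp_le)
      have A: "0 \<le> ?A s" by (simp add: prod_nonneg)
      have "(\<integral>\<^sup>+t. indicator {0<..} t * ennreal (?A s * (t powr (\<beta> - 1) * exp (- ?B s (Suc m) * t))) \<partial>lborel) =
        (\<integral>\<^sup>+t. ennreal (?A s) * (indicator {0<..} t * ennreal (t powr (\<beta> - 1) * exp (- ?B s (Suc m) * t))) \<partial>lborel)"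
        by (intro nn_integral_cong) (simp only: ennreal_mult'[OF A] mult.left_commute[of "indicator {0<..} _" "ennreal _"])
      also have "\<dots> = ennreal (?A s) * ennreal (Gamma \<beta> * ?B s (Suc m) powr - \<beta>)"
        by (subst nn_integral_cmult, simp) (simp only: nn_integral_gamma[OF \<beta> B])
      also have "\<dots> = ennreal (Gamma \<beta> * ((\<Prod>j=1..n. s j powr (th - 1)) * ((\<Prod>i=1..m. ?B s i powr - th) * ?B s (Suc m) powr - \<beta>)))"
        by (subst ennreal_mult'[OF A, symmetric]) (simp only: ac_simps)
      finally show "(\<integral>\<^sup>+t. indicator {0<..} t * ennreal (?A s * (t powr (\<beta> - 1) * exp (- ?B s (Suc m) * t))) \<partial>lborel) = ennreal (Gamma \<beta> * ((\<Prod>j=1..n. s j powr (th - 1)) * ((\<Prod>i=1..m. ?B s i powr - th) * ?B s (Suc m) powr - \<beta>)))" .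
    qed simp
    also have "\<dots> = orthant_integral {1..n} (\<lambda>s. Gamma \<beta> * ((\<Prod>j=1..n. s j powr (th - 1)) *
       ((\<Prod>i=1..m. ?B s i powr - th) * ?B s (Suc m) powr - \<beta>)))" by (simp only: orthant_integral_def)
    also have "\<dots> = ennreal (Gamma \<beta>) * orthant_integral {1..n} (\<lambda>s. (\<Prod>j=1..n. s j powr (th - 1)) *
       ((\<Prod>i=1..m. ?B s i powr - th) * ?B s (Suc m) powr - \<beta>))"
      using \<beta> by (intro orthant_integral_cmult) (auto simp: Gamma_real_pos less_imp_le)
    finally show ?thesis .
  qed
  finally show ?thesis
    using assms by (simp only: \<beta>_def[symmetric] mult.assoc[symmetric] ennreal_mult'[symmetric] Gamma_real_pos less_imp_le zero_le_power)
qed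

lemma nn_integral_half_line_scale:
  assumes "c > 0" and [measurable]: "h \<in> borel_measurable borel"
  shows "(\<integral>\<^sup>+t. indicator {0<..} t * h t \<partial>lborel) = ennreal c * (\<integral>\<^sup>+v. indicator {0<..} v * h (c * v) \<partial>lborel)"
proof -
  have "(\<integral>\<^sup>+t. indicator {0<..} t * h t \<partial>lborel) = ennreal \<bar>c\<bar> * (\<integral>\<^sup>+v. indicator {0<..} (0 + c * v) * h (0 + c * v) \<partial>lborel)"
    using assms by (intro nn_integral_real_affine) auto
  also have "(\<integral>\<^sup>+v. indicator {0<..} (0 + c * v) * h (0 + c * v) \<partial>lborel) = (\<integral>\<^sup>+v. indicator {0<..} v * h (c * v) \<partial>lborel)"
    using assms(1) by (intro nn_integral_cong) (auto simp: indicator_def zero_less_mult_iff)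
  finally show ?thesis using assms(1) by simp
qed

lemma powr_mult_prod_const:
  fixes a :: real
  assumes "0 \<le> a" "\<And>i. i \<in> I ==> 0 \<le> b i"
  shows "(\<Prod>i\<in>I. (a * b i) powr r) = (a powr r) ^ card I * (\<Prod>i\<in>I. b i powr r)"
  using assms by (simp add: powr_mult prod.distrib)

text \<open>
  The first step passes to polar coordinates \<open>\<tau> (s\<^sub>1, \<dots>, s\<^sub>n, 1)\<close>, the second one replaces
  the radius \<open>\<tau>\<close> by \<open>v = \<tau> (1 + s\<^sub>1 + \<dots> + s\<^sub>n)\<close>.
\<close>

lemma orthant_integral_mixture:
  fixes c :: "nat => nat => real"
  assumes "th > 0" and c: "\<And>i j. 1 \<le> i ==> i \<le> N ==> 1 \<le> j ==> j \<le> Suc n ==> 0 < c i j"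
  shows "orthant_integral {1..Suc n} (\<lambda>s. (\<Prod>j=1..Suc n. s j powr (th - 1)) * (\<Prod>i=1..N. (1 + (\<Sum>j=1..Suc n. s j * c i j)) powr - th)) =
    (\<integral>\<^sup>+v. indicator {0<..} v * orthant_integral {1..n} (\<lambda>s. v powr (real (Suc n) * th - 1) * (1 + v) powr - (real N * th) *
      ((\<Prod>j=1..n. s j powr (th - 1)) * (1 + (\<Sum>j=1..n. s j)) powr ((real N - real (Suc n)) * th) *
       (\<Prod>i=1..N. ((1 + v * c i (Suc n)) / (1 + v) + (\<Sum>j=1..n. s j * ((1 + v * c i j) / (1 + v)))) powr - th))) \<partial>lborel)"
    (is "orthant_integral _ ?f = _")
proof -
  let ?S = "\<lambda>s. 1 + (\<Sum>j=1..n. s j :: real)"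
  let ?A = "\<lambda>s i. c i (Suc n) + (\<Sum>j=1..n. s j * c i j)"
  let ?C = "\<lambda>v s i. (1 + v * c i (Suc n)) / (1 + v) + (\<Sum>j=1..n. s j * ((1 + v * c i j) / (1 + v)))"
  let ?h = "\<lambda>t s. t powr (real (Suc n) * th - 1) * (\<Prod>j=1..n. s j powr (th - 1)) * (\<Prod>i=1..N. (1 + t * ?A s i) powr - th)"
  let ?g = "\<lambda>v s. v powr (real (Suc n) * th - 1) * (1 + v) powr - (real N * th) *
      ((\<Prod>j=1..n. s j powr (th - 1)) * ?S s powr ((real N - real (Suc n)) * th) * (\<Prod>i=1..N. ?C v s i powr - th))"
  have ivl: "{1..Suc n} = insert (Suc n) {1..n}" by auto
  have A: "0 < ?A s i" if "\<And>j. j \<in> {1..n} ==> 0 < s j" "i \<in> {1..N}" for s i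
    using that by (intro add_pos_nonneg sum_nonneg mult_nonneg_nonneg c less_imp_le[OF c]) (auto intro: less_imp_le)
  have S: "0 < ?S s" if "\<And>j. j \<in> {1..n} ==> 0 < s j" for s
    using that by (intro add_pos_nonneg sum_nonneg) (auto intro: less_imp_le)
  have "orthant_integral {1..Suc n} ?f = orthant_integral (insert (Suc n) {1..n}) ?f" by (simp only: ivl)
  also have "\<dots> = (\<integral>\<^sup>+t. indicator {0<..} t * (ennreal (t ^ card {1..n}) * orthant_integral {1..n} (\<lambda>s. ?f ((\<lambda>i\<in>{1..n}. t * s i)(Suc n := t)))) \<partial>lborel)"
  proof (rule orthant_integral_insert)
    show "?f \<in> borel_measurable (lborel_prod (insert (Suc n) {1..n}))"
      unfolding ivl[symmetric] by measurable
  qed auto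
  also have "\<dots> = (\<integral>\<^sup>+t. indicator {0<..} t * (\<integral>\<^sup>+s. (\<Prod>i\<in>{1..n}. indicator {0<..} (s i)) * ennreal (?h t s) \<partial>lborel_prod {1..n}) \<partial>lborel)"
  proof (rule nn_integral_cong)
    fix t :: real
    show "indicator {0<..} t * (ennreal (t ^ card {1..n}) * orthant_integral {1..n} (\<lambda>s. ?f ((\<lambda>i\<in>{1..n}. t * s i)(Suc n := t)))) =
      indicator {0<..} t * (\<integral>\<^sup>+s. (\<Prod>i\<in>{1..n}. indicator {0<..} (s i)) * ennreal (?h t s) \<partial>lborel_prod {1..n})"
    proof (cases "t > 0")
      case True
      have "ennreal (t ^ card {1..n}) * orthant_integral {1..n} (\<lambda>s. ?f ((\<lambda>i\<in>{1..n}. t * s i)(Suc n := t))) =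
         orthant_integral {1..n} (\<lambda>s. t ^ card {1..n} * ?f ((\<lambda>i\<in>{1..n}. t * s i)(Suc n := t)))"
      proof (rule orthant_integral_cmult[symmetric])
        have "(\<lambda>s. (\<lambda>i\<in>{1..n}. t * s i)(Suc n := t)) \<in> measurable (lborel_prod {1..n}) (lborel_prod {1..Suc n})"
          unfolding ivl by (rule measurable_fun_upd[where J = "{1..n}"]) (auto intro!: measurable_restrict)
        then show "(\<lambda>s. ?f ((\<lambda>i\<in>{1..n}. t * s i)(Suc n := t))) \<in> borel_measurable (lborel_prod {1..n})"
          by (rule measurable_compose[where g = ?f]) measurable
      qed (use True in auto)
      also have "\<dots> = orthant_integral {1..n} (?h t)"
      proof (rule orthant_integral_cong)
        fix s :: "nat => real" assume s: "\<And>i. i \<in> {1..n} ==> 0 < s i"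
        let ?s = "(\<lambda>i\<in>{1..n}. t * s i)(Suc n := t)"
        have sum: "(\<Sum>j=1..Suc n. ?s j * c i j) = t * ?A s i" for i
          unfolding ivl by (subst sum.insert) (auto simp: sum_distrib_left distrib_left mult.assoc intro!: sum.cong)
        have "(\<Prod>j=1..Suc n. ?s j powr (th - 1)) = t powr (th - 1) * (\<Prod>j=1..n. (t * s j) powr (th - 1))"
          unfolding ivl by (subst prod.insert) (auto intro!: prod.cong)
        also have "(\<Prod>j=1..n. (t * s j) powr (th - 1)) = (t powr (th - 1)) ^ n * (\<Prod>j=1..n. s j powr (th - 1))"
          using True s by (subst powr_mult_prod_const) (auto intro: less_imp_le)
        finally have P: "(\<Prod>j=1..Suc n. ?s j powr (th - 1)) = (t powr (th - 1)) ^ Suc n * (\<Prod>j=1..n. s j powr (th - 1))"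
          by (simp only: power_Suc mult.assoc)
        have T: "t ^ card {1..n} * (t powr (th - 1)) ^ Suc n = t powr (real (Suc n) * th - 1)"
        proof -
          have "(t powr (th - 1)) ^ Suc n = t powr (real (Suc n) * (th - 1))"
            using True by (simp only: powr_power mult.commute)
          moreover have "t ^ card {1..n} = t powr real n" using True by (simp add: powr_realpow)
          moreover have "real n + real (Suc n) * (th - 1) = real (Suc n) * th - 1" by (simp add: algebra_simps)
          ultimately show ?thesis by (simp only: powr_add[symmetric])
        qed
        show "t ^ card {1..n} * ?f ?s = ?h t s"
          unfolding sum P T[symmetric] by (simp only: ac_simps)
      qed auto
      finally show ?thesis unfolding orthant_integral_def by simp
    qed auto
  qed
  also have "\<dots> = (\<integral>\<^sup>+s. (\<Prod>i\<in>{1..n}. indicator {0<..} (s i)) * (\<integral>\<^sup>+t. indicator {0<..} t * ennreal (?h t s) \<partial>lborel) \<partial>lborel_prod {1..n})"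
    by (rule weighted_swap) (auto intro!: sigma_finite_lborel_prod sigma_finite_lborel)
  also have "\<dots> = (\<integral>\<^sup>+s. (\<Prod>i\<in>{1..n}. indicator {0<..} (s i)) * (\<integral>\<^sup>+v. indicator {0<..} v * ennreal (?g v s) \<partial>lborel) \<partial>lborel_prod {1..n})"
  proof (rule orthant_weight_cong)
    fix s :: "nat => real" assume pos: "\<And>i. i \<in> {1..n} ==> 0 < s i"
    then have s: "0 < s j" if "j \<in> {1..n}" for j using that by blast
    define q where "q = 1 / ?S s"
    have q: "0 < q" using S[where s = s, OF s] by (simp add: q_def)
    have "(\<integral>\<^sup>+t. indicator {0<..} t * ennreal (?h t s) \<partial>lborel) = ennreal q * (\<integral>\<^sup>+v. indicator {0<..} v * ennreal (?h (q * v) s) \<partial>lborel)"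
      by (rule nn_integral_half_line_scale[OF q]) simp
    also have "\<dots> = (\<integral>\<^sup>+v. ennreal q * (indicator {0<..} v * ennreal (?h (q * v) s)) \<partial>lborel)"
      by (rule nn_integral_cmult[symmetric]) simp
    also have "\<dots> = (\<integral>\<^sup>+v. indicator {0<..} v * ennreal (?g v s) \<partial>lborel)"
    proof (rule nn_integral_cong)
      fix v :: real
      show "ennreal q * (indicator {0<..} v * ennreal (?h (q * v) s)) = indicator {0<..} v * ennreal (?g v s)"
      proof (cases "v > 0")
        case v: True
        \<comment> \<open>At radius q v the constant 1 is q times the sum of all s j, the last of
          them being 1. So each form becomes a combination of the numbers 1 + v c i j; the division
          by 1 + v makes these averages of 1 and c i j.\<close>
        have eq: "1 + q * v * ?A s i = q * (1 + v) * ?C v s i" for i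
        proof -
          have "(1 + v) * ?C v s i = (1 + v * c i (Suc n)) + (\<Sum>j=1..n. s j * (1 + v * c i j))"
          proof -
            have cancel: "(1 + v) * (a / (1 + v)) = a" for a using v by simp
            show ?thesis by (simp only: distrib_left[of "1 + v"] sum_distrib_left mult.left_commute[of "1 + v"] cancel)
          qed
          also have "\<dots> = ?S s + v * ?A s i"
            by (simp add: distrib_left sum.distrib sum_distrib_left mult_ac)
          finally have "q * (1 + v) * ?C v s i = q * (?S s + v * ?A s i)" by (simp only: mult.assoc)
          also have "\<dots> = 1 + q * v * ?A s i" using S[where s = s, OF s] by (simp add: q_def distrib_left add_divide_distrib[symmetric])
          finally show ?thesis by simp
        qed
        have C: "0 \<le> ?C v s i" if "i \<in> {1..N}" for i
        proof -
          have "0 < q * (1 + v) * ?C v s i" unfolding eq[symmetric] using mult_pos_pos[OF mult_pos_pos[OF q v] A[where s = s, OF s that]] by simp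
          moreover have "0 < q * (1 + v)" using q v by simp
          ultimately show ?thesis by (meson zero_less_mult_pos less_imp_le)
        qed
        have "(\<Prod>i=1..N. (1 + q * v * ?A s i) powr - th) = ((q * (1 + v)) powr - th) ^ card {1..N} * (\<Prod>i=1..N. ?C v s i powr - th)"
          unfolding eq using q v C by (intro powr_mult_prod_const) auto
        also have "((q * (1 + v)) powr - th) ^ card {1..N} = q powr - (real N * th) * (1 + v) powr - (real N * th)"
          using q v by (simp add: powr_power powr_mult power_mult_distrib mult.commute)
        finally have P: "(\<Prod>i=1..N. (1 + q * v * ?A s i) powr - th) = q powr - (real N * th) * (1 + v) powr - (real N * th) * (\<Prod>i=1..N. ?C v s i powr - th)" .
        have "q * (q powr (real (Suc n) * th - 1) * q powr - (real N * th)) = q powr 1 * q powr (real (Suc n) * th - 1) * q powr - (real N * th)"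
          using q by simp
        also have "\<dots> = q powr - ((real N - real (Suc n)) * th)"
          by (simp only: powr_add[symmetric]) (simp add: algebra_simps)
        also have "\<dots> = ?S s powr ((real N - real (Suc n)) * th)"
          using S[where s = s, OF s] by (simp add: q_def powr_minus powr_divide)
        finally have Q: "q * (q powr (real (Suc n) * th - 1) * q powr - (real N * th)) = ?S s powr ((real N - real (Suc n)) * th)" .
        have "q * ?h (q * v) s = ?g v s"
          unfolding P Q[symmetric] using q v by (simp only: powr_mult less_imp_le ac_simps)
        then show ?thesis by (simp only: ennreal_mult'[OF less_imp_le[OF q], symmetric] mult.left_commute[of "ennreal q"])
      qed simp
    qed
    finally show "(\<integral>\<^sup>+t. indicator {0<..} t * ennreal (?h t s) \<partial>lborel) = (\<integral>\<^sup>+v. indicator {0<..} v * ennreal (?g v s) \<partial>lborel)" by simp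
  qed simp
  also have "\<dots> = (\<integral>\<^sup>+v. indicator {0<..} v * (\<integral>\<^sup>+s. (\<Prod>i\<in>{1..n}. indicator {0<..} (s i)) * ennreal (?g v s) \<partial>lborel_prod {1..n}) \<partial>lborel)"
    by (rule weighted_swap[symmetric]) (auto intro!: sigma_finite_lborel_prod sigma_finite_lborel)
  finally show ?thesis unfolding orthant_integral_def .
qed

section \<open>The integral operator\<close>

definition shifted_point :: "nat => real => (nat => real) => (nat => real) => nat => real" where
  "shifted_point m x X w i = (if i \<le> Suc m then X i * wfull m 1 x w i else 1)"

text \<open>The Dirichlet density with m parameters th and one parameter (N - m) th, without its
  constant, written in the variables w.\<close>

definition jack_kernel :: "real => nat => nat => real => (nat => real) => (nat => real) => real" where
  "jack_kernel th N m x X w = (\<Prod>i=1..m. simplex_coord m 1 x X w i powr (th - 1)) *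
     simplex_coord m 1 x X w (Suc m) powr (real (N - m) * th - 1) * coord_jacobian m 1 x X w"

text \<open>The constant normalises the Dirichlet distribution, whose parameters add up to N th.
  Values in \<open>ennreal\<close> allow for series to be integrated term by term.\<close>

definition jack_transform :: "real => nat => nat => real => (nat => real) => ((nat => real) => real) => ennreal" where
  "jack_transform th N m x X f = ennreal (Gamma (real N * th) / (Gamma th ^ m * Gamma (real (N - m) * th))) *
     (\<integral>\<^sup>+w. ennreal (f (shifted_point m x X w)) * ennreal (jack_kernel th N m x X w) * indicator (open_domain m 1 x) w \<partial>lborel_prod {1..m})"

definition cauchy_product :: "real => nat => nat => real => (nat => real) => (nat => real) => real" where
  "cauchy_product th n M t u y = (\<Prod>i=1..n. \<Prod>j=1..M. (1 - t * u i * y j) powr - th)"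

definition one_ext :: "nat => (nat => real) => nat => real" where
  "one_ext m X i = (if i \<le> m then X i else 1)"

text \<open>The coefficient (z - x X i) / (z - X i) of \<open>simplex_coord_sum\<close> at z = 1 /
  (t u j). It depends on the product X i * u j only, so nodes and variables u may exchange their
  roles.\<close>

definition cauchy_ratio :: "real => real => (nat => real) => (nat => real) => nat => nat => real" where
  "cauchy_ratio t x X u i j = (1 - t * x * X i * u j) / (1 - t * X i * u j)"

lemma cauchy_product_commute: "cauchy_product th n M t u y = cauchy_product th M n t y u"
  unfolding cauchy_product_def by (subst prod.swap) (simp only: ac_simps)

lemma triple_product_less_one:
  fixes t a b :: real
  assumes "0 < t" "t < 1" "0 \<le> a" "a \<le> 1" "0 \<le> b" "b \<le> 1"
  shows "t * a * b < 1"
proof -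
  have "t * a * b \<le> t" using assms mult_le_one[of a b] by (simp add: mult.assoc mult_left_le)
  then show ?thesis using assms by linarith
qed

lemma cauchy_ratio_pos:
  assumes "0 < t" "t < 1" "0 < x" "x < 1" "0 \<le> X i" "X i \<le> 1" "0 \<le> u j" "u j \<le> 1"
  shows "0 < cauchy_ratio t x X u i j"
proof -
  have "t * X i * u j < 1" by (rule triple_product_less_one) (use assms in auto)
  moreover have "(t * x) * X i * u j < 1"
    by (rule triple_product_less_one) (use assms mult_le_one[of t x] mult_strict_mono[of t 1 x 1] in auto)
  ultimately show ?thesis by (simp add: cauchy_ratio_def)
qed

lemma simplex_coord_positive:
  assumes n: "nodes m 1 x X" and w: "w \<in> open_domain m 1 x" and i: "1 \<le> i" "i \<le> Suc m"
  shows "0 < simplex_coord m 1 x X w i"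
proof (cases "1 \<le> m")
  case True
  then show ?thesis by (rule simplex_coord_pos[OF n _ w i])
next
  case False
  then have "m = 0" "i = 1" using i by auto
  then show ?thesis using simplex_coord_sum(1)[OF n _ w] by simp
qed

lemma coord_jacobian_nonneg:
  assumes n: "nodes m 1 x X" and w: "w \<in> open_domain m 1 x"
  shows "0 \<le> coord_jacobian m 1 x X w"
proof -
  have "0 \<le> (X j * wfull m 1 x w j - X i * wfull m 1 x w i) / (X j - X i)" if "i \<in> {1..m}" "j \<in> {i<..Suc m}" for i j
    using domain_facts(8)[OF n _ w, of i j] nodesD(6)[OF n, of i j] that by (intro divide_nonneg_pos) auto
  moreover have "0 \<le> 1 / w i" if "i \<in> {1..m}" for i using w that by (auto simp: open_domain_def less_imp_le)
  ultimately have "0 \<le> (\<Prod>i\<in>{1..m}. 1 / w i * (\<Prod>j\<in>{i<..Suc m}. (X j * wfull m 1 x w j - X i * wfull m 1 x w i) / (X j - X i)))"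
    by (metis (no_types, lifting) mult_nonneg_nonneg prod_nonneg)
  then show ?thesis unfolding coord_jacobian_def using nodesD(2)[OF n] by simp
qed

lemma inverse_powr_power: "0 < P ==> ((1 / P) powr r) ^ k = P powr - (real k * r)" for P :: real
proof -
  assume P: "0 < P"
  have "((1 / P) powr r) ^ k = (1 / P) powr (r * real k)" using P by (simp add: powr_power mult.commute)
  then show ?thesis using P by (simp add: powr_divide powr_minus_divide mult.commute)
qed

text \<open>The quotient \<open>R j\<close> of the factors of the Cauchy product at the shifted
  points and at the nodes is the product in \<open>simplex_coord_sum\<close> at z = 1 / (t u j),
  hence a linear form in the simplex coordinates. The rest counts powers of the last coordinate
  \<open>P\<close>, which is the reciprocal of 1 plus the sum of the \<rho> i.\<close>

lemma cauchy_kernel_pointwise: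
  assumes th: "th > 0" and n: "nodes m 1 x X" and mN: "m < N" and w: "w \<in> open_domain m 1 x"
    and t: "0 < t" "t < 1" and u: "\<And>j. 1 \<le> j ==> j \<le> M ==> 0 < u j \<and> u j \<le> 1"
  defines "c \<equiv> cauchy_ratio t x X u" and "\<rho> \<equiv> (\<lambda>i\<in>{1..m}. affine_coord m 1 x X w i)"
  shows "cauchy_product th M N t u (shifted_point m x X w) * jack_kernel th N m x X w =
    cauchy_product th M N t u (one_ext m X) *
    ((\<Prod>i=1..m. \<rho> i powr (th - 1)) * (1 + (\<Sum>i=1..m. \<rho> i)) powr ((real M - real N) * th) *
      (\<Prod>j=1..M. (c (Suc m) j + (\<Sum>i=1..m. \<rho> i * c i j)) powr - th) *
      (coord_jacobian m 1 x X w / simplex_coord m 1 x X w (Suc m) ^ Suc m))"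
proof -
  define p where "p = simplex_coord m 1 x X w"
  define P where "P = p (Suc m)"
  note nd = nodesD[OF n]
  have k: "1 \<le> Suc m" by simp
  have p: "0 < p i" if "1 \<le> i" "i \<le> Suc m" for i unfolding p_def by (rule simplex_coord_positive[OF n w that])
  have P: "0 < P" unfolding P_def by (rule p) auto
  have \<rho>: "\<rho> i = p i / P" if "i \<in> {1..m}" for i using that by (simp add: \<rho>_def affine_coord_def p_def P_def)
  have sp: "(\<Sum>i=1..m. p i) + P = 1"
  proof -
    have "(\<Sum>i\<in>{1..Suc m}. p i) = 1" using simplex_coord_sum(1)[OF n k w] by (simp add: p_def)
    then show ?thesis by (simp only: sum.nat_ivl_Suc'[OF k] P_def add.commute)
  qed
  have S: "1 + (\<Sum>i=1..m. \<rho> i) = 1 / P"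
    using sp P by (simp add: \<rho> sum_divide_distrib[symmetric] field_simps)
  define y where "y = shifted_point m x X w"
  define R where "R j = (\<Prod>i\<in>{1..Suc m}. (1 - t * u j * y i) / (1 - t * u j * X i))" for j
  have X1: "0 < X i \<and> X i \<le> 1" if "1 \<le> i" "i \<le> Suc m" for i
    using nd(3) nd(4)[of i] nd(7)[of i] that by (cases "i = Suc m") auto
  have yX: "0 < y i \<and> y i \<le> 1" if "1 \<le> i" "i \<le> Suc m" for i
  proof -
    have W: "x \<le> wfull m 1 x w i" by (rule domain_facts(3)[OF n k w that])
    have "wfull m 1 x w i \<le> 1"
    proof (cases "1 \<le> m")
      case True then show ?thesis using domain_facts(5)[OF n k w that] by simp
    next
      case False then show ?thesis using that nd(2) by (simp add: wfull_def)
    qed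
    then show ?thesis using W X1[OF that] nd(1) that by (auto simp: y_def shifted_point_def mult_le_one)
  qed
  have L: "c (Suc m) j + (\<Sum>i=1..m. \<rho> i * c i j) = R j / P" if j: "j \<in> {1..M}" for j
  proof -
    define z where "z = 1 / (t * u j)"
    have tu: "0 < t * u j" using u[of j] t j by simp
    have "t * u j < 1" using triple_product_less_one[OF t, of "u j" 1] u[of j] j by auto
    then have "1 < z" using tu by (simp add: z_def)
    have zX: "z \<notin> X ` {1..Suc m}" using X1 \<open>1 < z\<close> by fastforce
    have rat: "(z - a) / (z - b) = (1 - t * u j * a) / (1 - t * u j * b)" for a b
    proof -
      have "z - a = (1 - t * u j * a) / (t * u j)" "z - b = (1 - t * u j * b) / (t * u j)"
        using tu by (auto simp: z_def diff_divide_distrib)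
      moreover have "t \<noteq> 0" "u j \<noteq> 0" using tu by auto
      ultimately show ?thesis by simp
    qed
    have "(\<Sum>i\<in>{1..Suc m}. p i * c i j) = R j"
      using simplex_coord_sum(2)[OF n k w zX] unfolding rat R_def p_def c_def cauchy_ratio_def y_def
      by (simp add: shifted_point_def mult_ac)
    then have "(\<Sum>i=1..m. p i * c i j) + P * c (Suc m) j = R j" by (simp only: sum.nat_ivl_Suc'[OF k] P_def add.commute)
    then show ?thesis using P by (simp add: \<rho> sum_divide_distrib[symmetric] field_simps)
  qed
  have Rpos: "0 < R j" if j: "j \<in> {1..M}" for j
    unfolding R_def using u[of j] j yX X1 t
    by (intro prod_pos ballI divide_pos_pos) (auto intro!: triple_product_less_one simp: less_imp_le)
  have CP: "cauchy_product th M N t u y = (\<Prod>j=1..M. R j powr - th) * cauchy_product th M N t u (one_ext m X)"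
    unfolding cauchy_product_def prod.distrib[symmetric]
  proof (rule prod.cong[OF refl])
    fix j assume j: "j \<in> {1..M}"
    have split: "(\<Prod>i=1..N. f i) = (\<Prod>i\<in>{1..Suc m}. f i) * (\<Prod>i\<in>{Suc (Suc m)..N}. f i)" for f :: "nat => real"
      by (subst prod.union_disjoint[symmetric]) (use mN in \<open>auto intro!: prod.cong\<close>)
    have A: "(\<Prod>i\<in>{Suc (Suc m)..N}. (1 - t * u j * y i) powr - th) = (\<Prod>i\<in>{Suc (Suc m)..N}. (1 - t * u j * one_ext m X i) powr - th)"
      by (intro prod.cong) (auto simp: y_def shifted_point_def one_ext_def)
    have nn: "0 \<le> 1 - t * u j * y i" "0 \<le> 1 - t * u j * X i" if "i \<in> {1..Suc m}" for i
      using triple_product_less_one[OF t, of "u j" "y i"] triple_product_less_one[OF t, of "u j" "X i"] u[of j] yX[of i] X1[of i] j that by auto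
    have "R j powr - th = (\<Prod>i\<in>{1..Suc m}. ((1 - t * u j * y i) / (1 - t * u j * X i)) powr - th)"
      unfolding R_def using nn by (intro prod_powr_distrib divide_nonneg_nonneg)
    also have "\<dots> = (\<Prod>i\<in>{1..Suc m}. (1 - t * u j * y i) powr - th / (1 - t * u j * X i) powr - th)"
      using nn by (intro prod.cong refl powr_divide)
    also have "\<dots> = (\<Prod>i\<in>{1..Suc m}. (1 - t * u j * y i) powr - th) / (\<Prod>i\<in>{1..Suc m}. (1 - t * u j * one_ext m X i) powr - th)"
      unfolding prod_dividef[symmetric] by (intro prod.cong refl) (auto simp: one_ext_def nd(3) le_Suc_eq)
    finally have B: "R j powr - th = (\<Prod>i\<in>{1..Suc m}. (1 - t * u j * y i) powr - th) / (\<Prod>i\<in>{1..Suc m}. (1 - t * u j * one_ext m X i) powr - th)" .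
    have "(\<Prod>i\<in>{1..Suc m}. (1 - t * u j * one_ext m X i) powr - th) > 0"
    proof (intro prod_pos ballI)
      fix i assume i: "i \<in> {1..Suc m}"
      have "t * u j * one_ext m X i < 1"
        by (rule triple_product_less_one[OF t]) (use u[of j] j X1[of i] i in \<open>auto simp: one_ext_def\<close>)
      then show "0 < (1 - t * u j * one_ext m X i) powr - th" by simp
    qed
    moreover have "a * q = a / D * (D * q)" if "0 < D" for a q D :: real using that by simp
    ultimately show "(\<Prod>i=1..N. (1 - t * u j * y i) powr - th) = R j powr - th * (\<Prod>i=1..N. (1 - t * u j * one_ext m X i) powr - th)"
      unfolding split A B by blast
  qed
  have p1: "(\<Prod>i=1..m. \<rho> i powr (th - 1)) = (\<Prod>i=1..m. p i powr (th - 1)) * P powr (- real m * (th - 1))"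
  proof -
    have "(\<Prod>i=1..m. \<rho> i powr (th - 1)) = (\<Prod>i=1..m. (1 / P * p i) powr (th - 1))" by (intro prod.cong) (auto simp: \<rho>)
    also have "\<dots> = ((1 / P) powr (th - 1)) ^ card {1..m} * (\<Prod>i=1..m. p i powr (th - 1))"
      by (rule powr_mult_prod_const) (use P p in \<open>auto intro: less_imp_le\<close>)
    also have "((1 / P) powr (th - 1)) ^ card {1..m} = P powr (- real m * (th - 1))"
      using inverse_powr_power[OF P] by (simp add: mult.commute)
    finally show ?thesis by (simp only: mult.commute)
  qed
  have p2: "(1 / P) powr ((real M - real N) * th) = P powr ((real N - real M) * th)"
    using P by (simp add: powr_divide powr_minus_divide[symmetric] algebra_simps)
  have p3: "(\<Prod>j=1..M. (c (Suc m) j + (\<Sum>i=1..m. \<rho> i * c i j)) powr - th) = (\<Prod>j=1..M. R j powr - th) * P powr (real M * th)"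
  proof -
    have "(\<Prod>j=1..M. (c (Suc m) j + (\<Sum>i=1..m. \<rho> i * c i j)) powr - th) = (\<Prod>j=1..M. (1 / P * R j) powr - th)"
      by (intro prod.cong refl) (simp only: L times_divide_eq_left mult_1_left)
    also have "\<dots> = ((1 / P) powr - th) ^ card {1..M} * (\<Prod>j=1..M. R j powr - th)"
      by (rule powr_mult_prod_const) (use P Rpos in \<open>auto intro: less_imp_le\<close>)
    also have "((1 / P) powr - th) ^ card {1..M} = P powr (real M * th)"
      using inverse_powr_power[OF P] by (simp add: mult.commute)
    finally show ?thesis by (simp only: mult.commute)
  qed
  \<comment> \<open>Both contributions of M cancel, so the exponent of the last coordinate is that
    of \<open>jack_kernel\<close> for every number of variables u.\<close>
  have pw: "P powr (- real m * (th - 1)) * P powr ((real N - real M) * th) * P powr (real M * th) / P ^ Suc m = P powr (real (N - m) * th - 1)"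
  proof -
    have "P ^ Suc m = P powr real (Suc m)" using P by (simp add: powr_realpow del: of_nat_Suc power_Suc)
    moreover have "- real m * (th - 1) + (real N - real M) * th + real M * th - real (Suc m) = real (N - m) * th - 1"
      using mN by (simp add: of_nat_diff algebra_simps)
    ultimately show ?thesis by (simp only: powr_add[symmetric] powr_diff[symmetric])
  qed
  show ?thesis
    unfolding y_def[symmetric] CP S p1 p2 p3 jack_kernel_def p_def[symmetric] P_def[symmetric] pw[symmetric]
    by (simp only: times_divide_eq_left times_divide_eq_right ac_simps)
qed

section \<open>The operator on Cauchy products\<close>

lemma jack_transform_cauchy:
  assumes th: "th > 0" and n: "nodes m 1 x X" and mN: "m < N"
    and t: "0 < t" "t < 1" and u: "\<And>j. 1 \<le> j ==> j \<le> M ==> 0 < u j \<and> u j \<le> 1"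
  defines "c \<equiv> cauchy_ratio t x X u"
  shows "jack_transform th N m x X (cauchy_product th M N t u) =
    ennreal (Gamma (real N * th) / (Gamma th ^ m * Gamma (real (N - m) * th))) *
    (ennreal (cauchy_product th M N t u (one_ext m X)) *
     orthant_integral {1..m} (\<lambda>s. (\<Prod>i=1..m. s i powr (th - 1)) * (1 + (\<Sum>i=1..m. s i)) powr ((real M - real N) * th) *
      (\<Prod>j=1..M. (c (Suc m) j + (\<Sum>i=1..m. s i * c i j)) powr - th)))"
proof -
  let ?f = "\<lambda>s. (\<Prod>i=1..m. s i powr (th - 1)) * (1 + (\<Sum>i=1..m. s i)) powr ((real M - real N) * th) *
      (\<Prod>j=1..M. (c (Suc m) j + (\<Sum>i=1..m. s i * c i j)) powr - th)"
  let ?K = "cauchy_product th M N t u (one_ext m X)"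
  have f0: "0 \<le> ?f s" for s by (intro mult_nonneg_nonneg prod_nonneg) auto
  have K0: "0 \<le> cauchy_product th M N t u y" for y unfolding cauchy_product_def by (intro prod_nonneg ballI) auto
  have mf: "?f \<in> borel_measurable (lborel_prod {1..m})" by measurable
  have "ennreal ?K * orthant_integral {1..m} ?f = orthant_integral {1..m} (\<lambda>s. ?K * ?f s)"
    by (rule orthant_integral_cmult[symmetric]) (use K0 mf in auto)
  also have "\<dots> = (\<integral>\<^sup>+w. ennreal (?K * ?f (\<lambda>i\<in>{1..m}. affine_coord m 1 x X w i)) * ennreal (coord_jacobian m 1 x X w / simplex_coord m 1 x X w (Suc m)^(Suc (Suc m)-1)) * indicator (open_domain m 1 x) w \<partial>lborel_prod {1..m})"
    unfolding orthant_integral_def by (rule affine_change_of_variables[OF _ n]) (use mf in auto)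
  also have "\<dots> = (\<integral>\<^sup>+w. ennreal (cauchy_product th M N t u (shifted_point m x X w)) * ennreal (jack_kernel th N m x X w) * indicator (open_domain m 1 x) w \<partial>lborel_prod {1..m})"
  proof (rule nn_integral_cong)
    fix w :: "nat => real"
    show "ennreal (?K * ?f (\<lambda>i\<in>{1..m}. affine_coord m 1 x X w i)) * ennreal (coord_jacobian m 1 x X w / simplex_coord m 1 x X w (Suc m)^(Suc (Suc m)-1)) * indicator (open_domain m 1 x) w =
      ennreal (cauchy_product th M N t u (shifted_point m x X w)) * ennreal (jack_kernel th N m x X w) * indicator (open_domain m 1 x) w"
    proof (cases "w \<in> open_domain m 1 x")
      case True
      let ?\<rho> = "\<lambda>i\<in>{1..m}. affine_coord m 1 x X w i"
      have "cauchy_product th M N t u (shifted_point m x X w) * jack_kernel th N m x X w =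
         (?K * ?f ?\<rho>) * (coord_jacobian m 1 x X w / simplex_coord m 1 x X w (Suc m)^(Suc (Suc m)-1))"
        using cauchy_kernel_pointwise[where u = u and M = M, OF th n mN True t u] by (simp only: c_def mult.assoc diff_Suc_1)
      then have "ennreal (cauchy_product th M N t u (shifted_point m x X w)) * ennreal (jack_kernel th N m x X w) =
        ennreal (?K * ?f ?\<rho>) * ennreal (coord_jacobian m 1 x X w / simplex_coord m 1 x X w (Suc m)^(Suc (Suc m)-1))"
        by (simp only: ennreal_mult'[symmetric] K0 f0 mult_nonneg_nonneg)
      then show ?thesis by simp
    qed simp
  qed
  finally show ?thesis unfolding jack_transform_def by simp
qed

text \<open>The duality produces one form for each node below 1 and the power -(N - m) th of the
  form for the node 1, where N = n + 1. Written as N - m equal factors, it completes a product over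
  N indices, in which m is visible only through \<open>one_ext m X\<close>.\<close>

lemma jack_transform_cauchy_dual:
  assumes th: "th > 0" and n: "nodes m 1 x X" and mn: "m \<le> n"
    and t: "0 < t" "t < 1" and u: "\<And>j. 1 \<le> j ==> j \<le> n ==> 0 < u j \<and> u j \<le> 1"
  shows "jack_transform th (Suc n) m x X (cauchy_product th n (Suc n) t u) =
    ennreal (Gamma (real (Suc n) * th) / Gamma th ^ Suc n) *
    (ennreal (cauchy_product th n (Suc n) t u (one_ext m X)) *
     orthant_integral {1..n} (\<lambda>s. (\<Prod>j=1..n. s j powr (th - 1)) *
       (\<Prod>i=1..Suc n. (1 + (\<Sum>j=1..n. s j * cauchy_ratio t x (one_ext m X) u i j)) powr - th)))"
proof -
  \<comment> \<open>A fictitious variable u 0 = 0 has all ratios equal to 1, so its linear form is 1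
    plus the sum of the s i. It absorbs the factor with exponent (n - (n + 1)) th.\<close>
  define U where "U = u(0 := 0)"
  define c where "c = cauchy_ratio t x X U"
  define d where "d = cauchy_ratio t x (one_ext m X) u"
  define \<beta> where "\<beta> = real (Suc n - m) * th"
  have \<beta>: "0 < \<beta>" using th mn by (simp add: \<beta>_def)
  note nd = nodesD[OF n]
  have X1: "0 < X i \<and> X i \<le> 1" if "1 \<le> i" "i \<le> Suc m" for i
    using nd(3) nd(4)[of i] nd(7)[of i] that by (cases "i = Suc m") auto
  have U1: "0 \<le> U j \<and> U j \<le> 1" if "j \<le> n" for j using u[of j] that by (cases "j = 0") (auto simp: U_def)
  have cU: "cauchy_ratio t x X u i j = c i j" if "1 \<le> j" for i j using that by (simp add: c_def cauchy_ratio_def U_def)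
  have c: "0 < c i j" if "1 \<le> i" "i \<le> Suc m" "j \<le> n" for i j
    unfolding c_def by (rule cauchy_ratio_pos) (use t nd X1[OF that(1,2)] U1[OF that(3)] in auto)
  have c0: "c i 0 = 1" for i by (simp add: c_def cauchy_ratio_def U_def)
  have cd: "d i j = c (min i (Suc m)) j" if "1 \<le> j" for i j
    using that by (auto simp: d_def c_def U_def cauchy_ratio_def one_ext_def min_def nd(3) le_Suc_eq)
  define I where "I = orthant_integral {1..m} (\<lambda>s. (\<Prod>i=1..m. s i powr (th - 1)) * (\<Prod>j\<in>{0..n}. (c (Suc m) j + (\<Sum>i=1..m. s i * c i j)) powr - th))"
  define J where "J = orthant_integral {1..n} (\<lambda>s. (\<Prod>j=1..n. s j powr (th - 1)) *
       ((\<Prod>i=1..m. (1 + (\<Sum>j=1..n. s j * c i j)) powr - th) * (1 + (\<Sum>j=1..n. s j * c (Suc m) j)) powr - \<beta>))"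
  have dual: "ennreal (Gamma th ^ Suc n) * I = ennreal (Gamma th ^ m * Gamma \<beta>) * J"
    unfolding I_def J_def \<beta>_def by (rule orthant_integral_duality[OF th mn]) (use c c0 in auto)
  have I': "orthant_integral {1..m} (\<lambda>s. (\<Prod>i=1..m. s i powr (th - 1)) * (1 + (\<Sum>i=1..m. s i)) powr ((real n - real (Suc n)) * th) *
      (\<Prod>j=1..n. (cauchy_ratio t x X u (Suc m) j + (\<Sum>i=1..m. s i * cauchy_ratio t x X u i j)) powr - th)) = I"
    unfolding I_def
  proof (rule orthant_integral_cong)
    fix s :: "nat => real"
    have "(\<Prod>j\<in>{0..n}. (c (Suc m) j + (\<Sum>i=1..m. s i * c i j)) powr - th) =
       (c (Suc m) 0 + (\<Sum>i=1..m. s i * c i 0)) powr - th * (\<Prod>j=1..n. (c (Suc m) j + (\<Sum>i=1..m. s i * c i j)) powr - th)"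
      by (subst prod.atLeast_Suc_atMost) auto
    moreover have "(\<Prod>j=1..n. (cauchy_ratio t x X u (Suc m) j + (\<Sum>i=1..m. s i * cauchy_ratio t x X u i j)) powr - th) =
       (\<Prod>j=1..n. (c (Suc m) j + (\<Sum>i=1..m. s i * c i j)) powr - th)"
      by (intro prod.cong) (auto simp: cU)
    ultimately show "(\<Prod>i=1..m. s i powr (th - 1)) * (1 + (\<Sum>i=1..m. s i)) powr ((real n - real (Suc n)) * th) *
      (\<Prod>j=1..n. (cauchy_ratio t x X u (Suc m) j + (\<Sum>i=1..m. s i * cauchy_ratio t x X u i j)) powr - th) =
      (\<Prod>i=1..m. s i powr (th - 1)) * (\<Prod>j\<in>{0..n}. (c (Suc m) j + (\<Sum>i=1..m. s i * c i j)) powr - th)"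
      by (simp add: c0)
  qed simp
  have J': "orthant_integral {1..n} (\<lambda>s. (\<Prod>j=1..n. s j powr (th - 1)) * (\<Prod>i=1..Suc n. (1 + (\<Sum>j=1..n. s j * d i j)) powr - th)) = J"
    unfolding J_def
  proof (rule orthant_integral_cong)
    fix s :: "nat => real" assume s: "\<And>i. i \<in> {1..n} ==> 0 < s i"
    have B: "0 < 1 + (\<Sum>j=1..n. s j * c (Suc m) j)"
      using s by (intro add_pos_nonneg sum_nonneg mult_nonneg_nonneg less_imp_le[OF c]) (auto intro: less_imp_le)
    have split: "(\<Prod>i=1..Suc n. f i) = (\<Prod>i\<in>{1..m}. f i) * (\<Prod>i\<in>{Suc m..Suc n}. f i)" for f :: "nat => real"
      by (subst prod.union_disjoint[symmetric]) (use mn in \<open>auto intro!: prod.cong simp del: prod.cl_ivl_Suc\<close>)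
    have "(\<Prod>i\<in>{1..m}. (1 + (\<Sum>j=1..n. s j * d i j)) powr - th) = (\<Prod>i=1..m. (1 + (\<Sum>j=1..n. s j * c i j)) powr - th)"
      by (intro prod.cong refl arg_cong2[where f = "(powr)"] arg_cong2[where f = "(+)"] sum.cong) (auto simp: cd)
    moreover have "(\<Prod>i\<in>{Suc m..Suc n}. (1 + (\<Sum>j=1..n. s j * d i j)) powr - th) = (\<Prod>i\<in>{Suc m..Suc n}. (1 + (\<Sum>j=1..n. s j * c (Suc m) j)) powr - th)"
      by (intro prod.cong refl arg_cong2[where f = "(powr)"] arg_cong2[where f = "(+)"] sum.cong) (auto simp: cd)
    moreover have "(\<Prod>i\<in>{Suc m..Suc n}. (1 + (\<Sum>j=1..n. s j * c (Suc m) j)) powr - th) = (1 + (\<Sum>j=1..n. s j * c (Suc m) j)) powr - \<beta>"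
      using B by (simp add: powr_power \<beta>_def mult.commute del: sum.cl_ivl_Suc)
    ultimately show "(\<Prod>j=1..n. s j powr (th - 1)) * (\<Prod>i=1..Suc n. (1 + (\<Sum>j=1..n. s j * d i j)) powr - th) =
      (\<Prod>j=1..n. s j powr (th - 1)) *
       ((\<Prod>i=1..m. (1 + (\<Sum>j=1..n. s j * c i j)) powr - th) * (1 + (\<Sum>j=1..n. s j * c (Suc m) j)) powr - \<beta>)"
      by (simp only: split)
  qed simp
  have g: "0 < Gamma th" "0 < Gamma \<beta>" "0 < Gamma (real (Suc n) * th)" using th \<beta> by (auto intro!: Gamma_real_pos mult_pos_pos)
  define A where "A = Gamma (real (Suc n) * th) / (Gamma th ^ m * Gamma \<beta>)"
  define B where "B = Gamma (real (Suc n) * th) / Gamma th ^ Suc n"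
  have A0: "0 \<le> A" and B0: "0 \<le> B" using g by (simp_all add: A_def B_def less_imp_le)
  have AB: "A = B / (Gamma th ^ m * Gamma \<beta>) * Gamma th ^ Suc n" using g by (simp add: A_def B_def)
  have "ennreal A * I = ennreal (B / (Gamma th ^ m * Gamma \<beta>)) * (ennreal (Gamma th ^ Suc n) * I)"
    unfolding AB using B0 g by (subst ennreal_mult') (auto simp: mult.assoc intro!: divide_nonneg_nonneg)
  also have "\<dots> = (ennreal (B / (Gamma th ^ m * Gamma \<beta>)) * ennreal (Gamma th ^ m * Gamma \<beta>)) * J"
    unfolding dual by (simp only: mult.assoc)
  also have "\<dots> = ennreal B * J"
    using B0 g by (subst ennreal_mult'[symmetric]) (auto intro!: divide_nonneg_nonneg)
  finally have AI: "ennreal A * I = ennreal B * J" .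
  have "jack_transform th (Suc n) m x X (cauchy_product th n (Suc n) t u) = ennreal A * (ennreal (cauchy_product th n (Suc n) t u (one_ext m X)) * I)"
    unfolding I'[symmetric] A_def \<beta>_def by (rule jack_transform_cauchy[OF th n _ t]) (use mn u in auto)
  also have "\<dots> = ennreal B * (ennreal (cauchy_product th n (Suc n) t u (one_ext m X)) * J)"
    using AI by (metis mult.left_commute)
  finally show ?thesis unfolding B_def J'[symmetric] d_def .
qed

lemma nodes_mono:
  assumes "nodes n k x u" "x \<le> x'" "x' < 1"
  shows "nodes n k x' u"
proof -
  have "u i < x' * u (Suc i)" if "k \<le> i" "i \<le> n" for i
  proof -
    have "u i < x * u (Suc i)" "0 < u (Suc i)" using nodesD(5)[OF assms(1), of i "Suc i"] nodesD(4)[OF assms(1), of "Suc i"] that by auto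
    moreover have "x * u (Suc i) \<le> x' * u (Suc i)" using assms(2) calculation(2) by (intro mult_right_mono) auto
    ultimately show ?thesis by linarith
  qed
  then show ?thesis using assms by (auto simp: nodes_def)
qed

text \<open>The average (1 + v c) / (1 + v) of 1 and a ratio c with parameter x is the ratio with
  parameter x' v, a number between x and 1. So the inner integral of
  \<open>orthant_integral_mixture\<close> is that of \<open>jack_transform_cauchy\<close> with nodes
  u. The weight in v, including its constant, is the beta prime density with parameters (n + 1) th
  and th.\<close>

lemma jack_transform_recursion:
  assumes th: "th > 0" and n: "nodes m 1 x X" and mn: "m \<le> Suc n"
    and t: "0 < t" "t < 1" and u: "nodes n 1 x u"
  defines "x' \<equiv> \<lambda>v. x + (1 - x) / (1 + v)"
  shows "jack_transform th (Suc (Suc n)) m x X (cauchy_product th (Suc n) (Suc (Suc n)) t u) =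
    (\<integral>\<^sup>+v. indicator {0<..} v * (ennreal (Gamma (real (Suc (Suc n)) * th) / (Gamma th * Gamma (real (Suc n) * th)) *
        (v powr (real (Suc n) * th - 1) * (1 + v) powr - (real (Suc (Suc n)) * th))) *
      jack_transform th (Suc n) n (x' v) u (cauchy_product th (Suc (Suc n)) (Suc n) t (one_ext m X))) \<partial>lborel)"
proof -
  define N where "N = Suc (Suc n)"
  define Y where "Y = one_ext m X"
  define C where "C = cauchy_product th (Suc n) N t u Y"
  define g where "g v s = v powr (real (Suc n) * th - 1) * (1 + v) powr - (real N * th) *
      ((\<Prod>j=1..n. s j powr (th - 1)) * (1 + (\<Sum>j=1..n. s j)) powr ((real N - real (Suc n)) * th) *
       (\<Prod>i=1..N. ((1 + v * cauchy_ratio t x Y u i (Suc n)) / (1 + v) + (\<Sum>j=1..n. s j * ((1 + v * cauchy_ratio t x Y u i j) / (1 + v)))) powr - th))" for v :: real and s :: "nat => real"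
  define h where "h v s = (\<Prod>j=1..n. s j powr (th - 1)) * (1 + (\<Sum>j=1..n. s j)) powr ((real N - real (Suc n)) * th) *
       (\<Prod>i=1..N. (cauchy_ratio t (x' v) u Y (Suc n) i + (\<Sum>j=1..n. s j * cauchy_ratio t (x' v) u Y j i)) powr - th)" for v :: real and s :: "nat => real"
  note nd = nodesD[OF n] and ud = nodesD[OF u]
  have Y1: "0 < Y i \<and> Y i \<le> 1" if "1 \<le> i" for i
    using nd(3) nd(4)[of i] nd(7)[of i] that by (auto simp: Y_def one_ext_def)
  have u1: "0 < u j \<and> u j \<le> 1" if "1 \<le> j" "j \<le> Suc n" for j
    using ud(3) ud(4)[of j] ud(7)[of j] that by (cases "j = Suc n") auto
  have gam: "0 < Gamma th" "0 < Gamma (real (Suc n) * th)" "0 < Gamma (real N * th)" using th by (auto intro!: Gamma_real_pos mult_pos_pos simp: N_def)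
  define B where "B = Gamma (real N * th) / Gamma th ^ N"
  define D where "D = Gamma (real (Suc n) * th) / (Gamma th ^ n * Gamma (real (Suc n - n) * th))"
  define K where "K = Gamma (real N * th) / (Gamma th * Gamma (real (Suc n) * th))"
  have "real (Suc n - n) * th = th" by simp
  then have D: "D = Gamma (real (Suc n) * th) / (Gamma th ^ n * Gamma th)" by (simp only: D_def)
  have BKD: "B = K * D" and pos: "0 \<le> B" "0 \<le> K" "0 \<le> D" using gam by (simp_all add: B_def K_def D N_def less_imp_le del: of_nat_Suc)
  have "jack_transform th N m x X (cauchy_product th (Suc n) N t u) = ennreal B * (ennreal C *
     orthant_integral {1..Suc n} (\<lambda>s. (\<Prod>j=1..Suc n. s j powr (th - 1)) * (\<Prod>i=1..N. (1 + (\<Sum>j=1..Suc n. s j * cauchy_ratio t x Y u i j)) powr - th)))"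
    unfolding B_def C_def N_def Y_def by (rule jack_transform_cauchy_dual[OF th n mn t]) (use u1 in auto)
  also have "orthant_integral {1..Suc n} (\<lambda>s. (\<Prod>j=1..Suc n. s j powr (th - 1)) * (\<Prod>i=1..N. (1 + (\<Sum>j=1..Suc n. s j * cauchy_ratio t x Y u i j)) powr - th)) =
     (\<integral>\<^sup>+v. indicator {0<..} v * orthant_integral {1..n} (g v) \<partial>lborel)"
    unfolding g_def by (rule orthant_integral_mixture[OF th], rule cauchy_ratio_pos) (use t nd Y1 u1 in \<open>auto simp: less_imp_le\<close>)
  also have "ennreal B * (ennreal C * (\<integral>\<^sup>+v. indicator {0<..} v * orthant_integral {1..n} (g v) \<partial>lborel)) =
     (\<integral>\<^sup>+v. ennreal B * (ennreal C * (indicator {0<..} v * orthant_integral {1..n} (g v))) \<partial>lborel)"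
  proof -
    have [measurable]: "(\<lambda>v. orthant_integral {1..n} (g v)) \<in> borel_measurable lborel"
    proof -
      interpret sigma_finite_measure "lborel_prod {1..n}" by (rule sigma_finite_lborel_prod) simp
      have "(\<lambda>(v, s). (\<Prod>i\<in>{1..n}. indicator {0<..} (s i)) * ennreal (g v s)) \<in> borel_measurable (lborel \<Otimes>\<^sub>M lborel_prod {1..n})"
        unfolding g_def by measurable
      then show ?thesis unfolding orthant_integral_def by (rule borel_measurable_nn_integral)
    qed
    define H where "H v = orthant_integral {1..n} (g v)" for v
    have "H \<in> borel_measurable lborel" unfolding H_def by fact
    then show ?thesis unfolding H_def[symmetric] by (simp add: nn_integral_cmult)
  qed
  also have "\<dots> = (\<integral>\<^sup>+v. indicator {0<..} v * (ennreal (K * (v powr (real (Suc n) * th - 1) * (1 + v) powr - (real N * th))) *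
      jack_transform th (Suc n) n (x' v) u (cauchy_product th N (Suc n) t Y)) \<partial>lborel)"
  proof (rule nn_integral_cong)
    fix v :: real
    show "ennreal B * (ennreal C * (indicator {0<..} v * orthant_integral {1..n} (g v))) = indicator {0<..} v * (ennreal (K * (v powr (real (Suc n) * th - 1) * (1 + v) powr - (real N * th))) *
      jack_transform th (Suc n) n (x' v) u (cauchy_product th N (Suc n) t Y))"
    proof (cases "v > 0")
      case v: True
      define E where "E = v powr (real (Suc n) * th - 1) * (1 + v) powr - (real N * th)"
      have E: "0 \<le> E" by (simp add: E_def)
      have xx: "x < x' v" "x' v < 1" using nd v by (simp_all add: x'_def field_simps)
      have u': "nodes n 1 (x' v) u" by (rule nodes_mono[OF u]) (use xx in auto)
      have ratio: "(1 + v * cauchy_ratio t x Y u i j) / (1 + v) = cauchy_ratio t (x' v) u Y j i" if "1 \<le> i" "1 \<le> j" "j \<le> Suc n" for i j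
      proof -
        have "t * Y i * u j < 1" by (rule triple_product_less_one[OF t]) (use Y1[of i] u1[of j] that in auto)
        then have ne: "1 - t * Y i * u j \<noteq> 0" "1 + v \<noteq> 0" using v by auto
        have "1 + v * cauchy_ratio t x Y u i j = ((1 - t * Y i * u j) + v * (1 - t * x * Y i * u j)) / (1 - t * Y i * u j)"
          using ne by (simp add: cauchy_ratio_def add_divide_distrib)
        also have "(1 - t * Y i * u j) + v * (1 - t * x * Y i * u j) = (1 + v) * (1 - t * x' v * u j * Y i)"
        proof -
          have "(1 + v) * x' v = 1 + v * x" using ne by (simp add: x'_def field_simps)
          moreover have "(1 + v) * (1 - t * x' v * u j * Y i) = (1 + v) - t * ((1 + v) * x' v) * u j * Y i"
            by (simp only: right_diff_distrib mult_1_right mult_1_left ac_simps)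
          ultimately show ?thesis by (simp add: algebra_simps)
        qed
        finally show ?thesis using ne by (simp add: cauchy_ratio_def mult_ac)
      qed
      have gh: "g v s = E * h v s" for s
      proof -
        have "(\<Prod>i=1..N. ((1 + v * cauchy_ratio t x Y u i (Suc n)) / (1 + v) + (\<Sum>j=1..n. s j * ((1 + v * cauchy_ratio t x Y u i j) / (1 + v)))) powr - th) =
          (\<Prod>i=1..N. (cauchy_ratio t (x' v) u Y (Suc n) i + (\<Sum>j=1..n. s j * cauchy_ratio t (x' v) u Y j i)) powr - th)"
          by (intro prod.cong refl arg_cong2[where f = "(powr)"] arg_cong2[where f = "(+)"] sum.cong arg_cong2[where f = "(*)"]) (auto intro!: ratio)
        then show ?thesis by (simp only: g_def h_def E_def)
      qed
      have oe: "one_ext n u i = u i" if "i \<in> {1..Suc n}" for i using that ud(3) by (auto simp: one_ext_def le_Suc_eq)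
      have C': "cauchy_product th N (Suc n) t Y (one_ext n u) = C"
        unfolding C_def cauchy_product_commute[of th "Suc n" N] by (simp only: cauchy_product_def) (intro prod.cong refl, simp only: oe)
      have jt: "jack_transform th (Suc n) n (x' v) u (cauchy_product th N (Suc n) t Y) = ennreal D * (ennreal C * orthant_integral {1..n} (h v))"
        unfolding D_def C'[symmetric] h_def by (rule jack_transform_cauchy[OF th u' _ t]) (use Y1 in auto)
      have "orthant_integral {1..n} (g v) = ennreal E * orthant_integral {1..n} (h v)"
        unfolding gh by (rule orthant_integral_cmult[OF E]) (auto simp: h_def)
      moreover have "ennreal (K * D) = ennreal K * ennreal D" "ennreal (K * E) = ennreal K * ennreal E"
        by (intro ennreal_mult pos E)+
      moreover have "indicator {0<..} v = (1 :: ennreal)" using v by simp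
      ultimately show ?thesis unfolding jt E_def[symmetric] BKD by (simp only: mult_1_left ac_simps)
    qed simp
  qed
  finally show ?thesis unfolding N_def K_def Y_def .
qed

section \<open>Expansion in power series\<close>

text \<open>The series agree for t in (0, 1) only. Once the lower coefficients are known to be
  equal, the common power of t is divided out, and the next coefficient is the limit from the right
  at 0.\<close>

lemma power_series_unique:
  fixes a b :: "nat => real"
  assumes "\<And>t. 0 < t ==> t < 1 ==> summable (\<lambda>k. a k * t ^ k)" "\<And>t. 0 < t ==> t < 1 ==> summable (\<lambda>k. b k * t ^ k)"
    and "\<And>t. 0 < t ==> t < 1 ==> (\<Sum>k. a k * t ^ k) = (\<Sum>k. b k * t ^ k)"
  shows "a k = b k"
proof (induction k rule: less_induct)
  case (less k)
  define d where "d i = a (i + k) - b (i + k)" for i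
  have zero: "summable (\<lambda>i. d i * t ^ i)" "(\<Sum>i. d i * t ^ i) = 0" if t: "0 < t" "t < 1" for t
  proof -
    define e where "e i = a i * t ^ i - b i * t ^ i" for i
    have e: "summable e" "(\<Sum>i. e i) = 0"
      using assms[OF t] by (auto simp: e_def[abs_def] suminf_diff[symmetric] intro: summable_diff)
    have "e i = 0" if "i < k" for i using less that by (simp add: e_def)
    then have "(\<Sum>i. e (i + k)) = 0" using e suminf_split_initial_segment[OF e(1), of k] by simp
    moreover have "e (i + k) = t ^ k * (d i * t ^ i)" for i by (simp add: e_def d_def power_add algebra_simps)
    moreover have "summable (\<lambda>i. e (i + k))" using e(1) by (rule summable_ignore_initial_segment)
    ultimately have "summable (\<lambda>i. t ^ k * (d i * t ^ i))" "(\<Sum>i. t ^ k * (d i * t ^ i)) = 0" by simp_all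
    then show "summable (\<lambda>i. d i * t ^ i)" "(\<Sum>i. d i * t ^ i) = 0"
      using t by (simp_all add: summable_cmult_iff suminf_mult)
  qed
  have "isCont (\<lambda>t. \<Sum>i. d i * t ^ i) 0"
    using zero(1)[of "1/2"] by (intro isCont_powser[of _ "1/2"]) auto
  then have "((\<lambda>t. \<Sum>i. d i * t ^ i) \<longlongrightarrow> d 0) (at 0)" by (simp only: isCont_def powser_zero)
  then have "((\<lambda>t. \<Sum>i. d i * t ^ i) \<longlongrightarrow> d 0) (at_right 0)" by (rule tendsto_mono[OF at_le[OF subset_UNIV]])
  moreover have "((\<lambda>t. \<Sum>i. d i * t ^ i) \<longlongrightarrow> 0) (at_right 0)"
    by (rule tendsto_eventually, rule eventually_at_rightI[of 0 1]) (use zero in auto)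
  ultimately have "d 0 = 0" by (rule tendsto_unique[OF trivial_limit_at_right_real])
  then show ?case by (simp add: d_def)
qed

lemma binomial_fps_sums:
  assumes "th > 0" "0 \<le> a" "0 \<le> t" "t * a < 1"
  shows "(\<lambda>k. fps_nth (binomial_fps th a) k * t ^ k) sums (1 - t * a) powr - th"
proof -
  have "(\<lambda>k. (- th gchoose k) * (- (t * a)) ^ k) sums (1 + - (t * a)) powr - th"
    using assms mult_nonneg_nonneg[of t a] by (intro gen_binomial_real) auto
  moreover have "(- th gchoose k) * (- (t * a)) ^ k = fps_nth (binomial_fps th a) k * t ^ k" for k
  proof -
    have "(- 1) ^ k * (- (t * a)) ^ k = a ^ k * t ^ k" unfolding power_mult_distrib[symmetric] by (simp add: mult.commute)
    then show ?thesis by (simp add: gbinomial_pochhammer binomial_fps_def)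
  qed
  ultimately show "(\<lambda>k. fps_nth (binomial_fps th a) k * t ^ k) sums (1 - t * a) powr - th" by simp
qed

lemma binomial_fps_nonneg: "th > 0 ==> 0 \<le> a ==> 0 \<le> fps_nth (binomial_fps th a) k"
  by (simp add: binomial_fps_def pochhammer_nonneg)

text \<open>Nonnegativity of the coefficients is carried through the induction because it provides
  the absolute convergence needed for the Cauchy product of two series.\<close>

lemma fps_prod_sums:
  fixes f :: "'a => real fps"
  assumes "finite S" "0 \<le> t" "\<And>p k. p \<in> S ==> 0 \<le> fps_nth (f p) k" "\<And>p. p \<in> S ==> (\<lambda>k. fps_nth (f p) k * t ^ k) sums F p"
  shows "(\<forall>k. 0 \<le> fps_nth (\<Prod>p\<in>S. f p) k) \<and> (\<lambda>k. fps_nth (\<Prod>p\<in>S. f p) k * t ^ k) sums (\<Prod>p\<in>S. F p)"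
  using assms(1,3,4)
proof (induction S rule: finite_induct)
  case empty
  have "(\<lambda>k. fps_nth (1 :: real fps) k * t ^ k) sums 1" using sums_single[of 0 "\<lambda>_. 1 :: real"] by (rule sums_cong[THEN iffD1, rotated]) auto
  then show ?case by simp
next
  case (insert p S)
  define g where "g = (\<Prod>p\<in>S. f p)"
  have g: "0 \<le> fps_nth g k" "(\<lambda>k. fps_nth g k * t ^ k) sums (\<Prod>p\<in>S. F p)" for k
    using insert unfolding g_def by auto
  have p: "0 \<le> fps_nth (f p) k" "(\<lambda>k. fps_nth (f p) k * t ^ k) sums F p" for k using insert by auto
  have "(\<lambda>k. \<Sum>i\<le>k. (fps_nth (f p) i * t ^ i) * (fps_nth g (k - i) * t ^ (k - i))) sums ((\<Sum>k. fps_nth (f p) k * t ^ k) * (\<Sum>k. fps_nth g k * t ^ k))"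
    using p g assms(2) by (intro Cauchy_product_sums) (auto simp: sums_iff)
  moreover have "(\<Sum>i\<le>k. (fps_nth (f p) i * t ^ i) * (fps_nth g (k - i) * t ^ (k - i))) = fps_nth (f p * g) k * t ^ k" for k
    unfolding fps_mult_nth sum_distrib_right atLeast0AtMost
    by (intro sum.cong refl) (simp add: power_add[symmetric] mult_ac)
  ultimately have "(\<lambda>k. fps_nth (f p * g) k * t ^ k) sums (F p * (\<Prod>p\<in>S. F p))" using p g by (simp add: sums_iff)
  moreover have "0 \<le> fps_nth (f p * g) k" for k unfolding fps_mult_nth using p g by (intro sum_nonneg mult_nonneg_nonneg) auto
  ultimately show ?case using insert.hyps by (simp add: g_def)
qed

text \<open>The Cauchy identity holds for formal coefficients; here its terms are nonnegative
  numbers and the series converges, so the identity holds in \<open>ennreal\<close> and may be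
  integrated term by term.\<close>

lemma cauchy_product_expansion:
  assumes th: "th > 0" and nM: "n \<le> M" and t: "0 < t" "t < 1"
    and u: "\<And>i. 1 \<le> i ==> i \<le> n ==> 0 < u i \<and> u i \<le> 1" and y: "\<And>j. 1 \<le> j ==> j \<le> M ==> 0 < y j \<and> y j \<le> 1"
  shows "ennreal (cauchy_product th n M t u y) =
    (\<Sum>k. \<Sum>nu\<in>partitions n k. ennreal (t ^ k * cauchy_coeff th n nu) * (ennreal (jack_nonneg th n nu u) * ennreal (jack_nonneg th M (zero_ext n nu) y)))"
proof -
  let ?S = "{1..n} \<times> {1..M}"
  have lt: "t * (u i * y j) < 1" if "(i, j) \<in> ?S" for i j
    using triple_product_less_one[OF t, of "u i" "y j"] u[of i] y[of j] that by (auto simp: mult.assoc)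
  have pos: "0 \<le> u i * y j" if "(i, j) \<in> ?S" for i j
    using u[of i] y[of j] that by auto
  have "(\<lambda>k. fps_nth (\<Prod>p\<in>?S. binomial_fps th (u (fst p) * y (snd p))) k * t ^ k) sums (\<Prod>p\<in>?S. (1 - t * (u (fst p) * y (snd p))) powr - th)"
    by (rule fps_prod_sums[THEN conjunct2]) (use th t lt pos in \<open>auto intro!: binomial_fps_sums binomial_fps_nonneg\<close>)
  then have sums: "(\<lambda>k. fps_nth (cauchy_fps th n M u y) k * t ^ k) sums cauchy_product th n M t u y"
    by (simp add: cauchy_fps_def cauchy_product_def prod.cartesian_product case_prod_unfold mult.assoc)
  have J: "0 < jack_nonneg th n nu u" "0 < jack_nonneg th M (zero_ext n nu) y" "0 < cauchy_coeff th n nu" if "nu \<in> partitions n k" for nu k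
    using jack_nonneg_pos[OF th partitionD(1)] partitionsD(2)[OF that] zero_ext_partition u y cauchy_coeff_pos[OF th] by blast+
  have eq: "fps_nth (cauchy_fps th n M u y) k * t ^ k = (\<Sum>nu\<in>partitions n k. t ^ k * cauchy_coeff th n nu * (jack_nonneg th n nu u * jack_nonneg th M (zero_ext n nu) y))" for k
    by (subst cauchy_identity[OF th nM]) (use y in \<open>auto simp: sum_distrib_left mult_ac\<close>)
  have eqe: "ennreal (fps_nth (cauchy_fps th n M u y) k * t ^ k) = (\<Sum>nu\<in>partitions n k. ennreal (t ^ k * cauchy_coeff th n nu) * (ennreal (jack_nonneg th n nu u) * ennreal (jack_nonneg th M (zero_ext n nu) y)))" for k
    unfolding eq using J t by (subst sum_ennreal[symmetric]) (auto simp: ennreal_mult less_imp_le intro!: sum.cong)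
  have nonneg: "0 \<le> fps_nth (cauchy_fps th n M u y) k * t ^ k" for k
    unfolding eq using J t by (intro sum_nonneg) (auto simp: less_imp_le)
  have "ennreal (cauchy_product th n M t u y) = (\<Sum>k. ennreal (fps_nth (cauchy_fps th n M u y) k * t ^ k))"
    using sums nonneg by (subst suminf_ennreal2) (auto simp: sums_iff)
  then show ?thesis by (simp only: eqe)
qed

section \<open>The operator applied to expansions in Jack polynomials\<close>

lemma jack_nonneg_measurable:
  "(\<And>i. 1 \<le> i ==> i \<le> n ==> (\<lambda>w. y w i) \<in> borel_measurable A) ==> (\<lambda>w. jack_nonneg th n nu (y w)) \<in> borel_measurable A"
proof (induction n arbitrary: nu)
  case (Suc n)
  have "(\<lambda>w. jack_nonneg th n mu (y w)) \<in> borel_measurable A" for mu using Suc by auto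
  moreover have "(\<lambda>w. y w (Suc n)) \<in> borel_measurable A" using Suc.prems by auto
  ultimately show ?case unfolding jack_nonneg.simps by (intro borel_measurable_sum borel_measurable_times borel_measurable_power borel_measurable_const)
qed simp

text \<open>A consequence of the positivity of the branching coefficients. It serves to bound the
  eigenvalues by 1.\<close>

lemma jack_nonneg_mono:
  assumes th: "th > 0"
  shows "antimono_on {1..n} nu ==> (\<And>i. 1 \<le> i ==> i \<le> n ==> 0 < x i \<and> x i \<le> y i) ==> jack_nonneg th n nu x \<le> jack_nonneg th n nu y"
proof (induction n arbitrary: nu)
  case (Suc n)
  have xy: "0 < x i" "x i \<le> y i" if "1 \<le> i" "i \<le> Suc n" for i using Suc.prems that by auto
  show ?case unfolding jack_nonneg.simps
  proof (rule sum_mono)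
    fix mu assume mu: "mu \<in> interlacing n nu"
    have am: "antimono_on {1..n} mu" by (rule interlacing_antimono[OF mu Suc.prems(1)])
    have "0 < jack_psi th n nu mu" by (rule jack_psi_pos[OF th Suc.prems(1) mu])
    moreover have "jack_nonneg th n mu x \<le> jack_nonneg th n mu y" by (rule Suc.IH[OF am]) (use xy in auto)
    moreover have "0 < jack_nonneg th n mu x" by (rule jack_nonneg_pos[OF th am]) (use xy in auto)
    moreover have "x (Suc n) ^ k \<le> y (Suc n) ^ k" "0 \<le> x (Suc n) ^ k" "0 \<le> y (Suc n) ^ k" for k
      using xy[of "Suc n"] by (auto intro!: power_mono simp: less_imp_le)
    ultimately show "jack_psi th n nu mu * x (Suc n) ^ nat (sig_size (Suc n) nu - sig_size n mu) * jack_nonneg th n mu x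
      \<le> jack_psi th n nu mu * y (Suc n) ^ nat (sig_size (Suc n) nu - sig_size n mu) * jack_nonneg th n mu y"
      by (intro mult_mono mult_nonneg_nonneg) (auto simp: less_imp_le)
  qed
qed simp

lemma jack_kernel_measurable: "(\<lambda>w. jack_kernel th N m x X w) \<in> borel_measurable (lborel_prod {1..m})"
  unfolding jack_kernel_def by measurable

lemma jack_shifted_measurable:
  "(\<lambda>w. jack_nonneg th N nu (shifted_point m x X w)) \<in> borel_measurable (lborel_prod {1..m})"
proof (rule jack_nonneg_measurable)
  fix i :: nat assume "1 \<le> i"
  then show "(\<lambda>w. shifted_point m x X w i) \<in> borel_measurable (lborel_prod {1..m})"
    unfolding shifted_point_def by (cases "i \<le> Suc m") (simp_all only: if_True if_False borel_measurable_times borel_measurable_const wfull_measurable)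
qed

lemma shifted_point_bounds:
  assumes n: "nodes m 1 x X" and w: "w \<in> open_domain m 1 x" and i: "1 \<le> (i :: nat)"
  shows "0 < shifted_point m x X w i" "shifted_point m x X w i \<le> 1"
proof -
  note nd = nodesD[OF n]
  have "0 < shifted_point m x X w i \<and> shifted_point m x X w i \<le> 1"
  proof (cases "i \<le> Suc m")
    case True
    have X1: "0 < X i \<and> X i \<le> 1" using nd(3) nd(4)[of i] nd(7)[of i] True i by (cases "i = Suc m") auto
    have k: "1 \<le> Suc m" by simp
    have W: "x \<le> wfull m 1 x w i" by (rule domain_facts(3)[OF n k w i True])
    have "wfull m 1 x w i \<le> 1"
    proof (cases "1 \<le> m")
      case m: True then show ?thesis using domain_facts(5)[OF n k w i True] by simp
    next
      case False then show ?thesis using True i nd(2) by (simp add: wfull_def)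
    qed
    then show ?thesis using W X1 nd(1) True by (auto simp: shifted_point_def mult_le_one)
  qed (simp add: shifted_point_def)
  then show "0 < shifted_point m x X w i" "shifted_point m x X w i \<le> 1" by auto
qed

text \<open>Monotone convergence. The index sets \<open>S k\<close> are arbitrary, so the lemma also
  covers a single term, that is, a constant factor.\<close>

lemma jack_transform_series:
  assumes "\<And>w. w \<in> open_domain m 1 x ==> ennreal (f (shifted_point m x X w)) =
      (\<Sum>k. \<Sum>nu\<in>S k. c k nu * ennreal (g nu (shifted_point m x X w)))"
    and g: "\<And>nu. (\<lambda>w. g nu (shifted_point m x X w)) \<in> borel_measurable (lborel_prod {1..m})"
  shows "jack_transform th N m x X f = (\<Sum>k. \<Sum>nu\<in>S k. c k nu * jack_transform th N m x X (g nu))"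
proof -
  define A where "A = lborel_prod {1..m}"
  define K where "K w = ennreal (jack_kernel th N m x X w) * indicator (open_domain m 1 x) w" for w
  have [measurable]: "K \<in> borel_measurable (A)"
    unfolding K_def[abs_def] using jack_kernel_measurable unfolding A_def by measurable
  define G where "G nu w = ennreal (g nu (shifted_point m x X w))" for nu w
  have [measurable]: "G nu \<in> borel_measurable (A)" for nu
    unfolding G_def[abs_def] using g[of nu] unfolding A_def by simp
  define C where "C = ennreal (Gamma (real N * th) / (Gamma th ^ m * Gamma (real (N - m) * th)))"
  have jt: "jack_transform th N m x X h = C * (\<integral>\<^sup>+w. ennreal (h (shifted_point m x X w)) * K w \<partial>A)" for h
    by (simp only: jack_transform_def C_def K_def A_def mult.assoc)
  have "(\<integral>\<^sup>+w. ennreal (f (shifted_point m x X w)) * K w \<partial>A) =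
     (\<integral>\<^sup>+w. (\<Sum>k. \<Sum>nu\<in>S k. c k nu * (G nu w * K w)) \<partial>A)"
  proof (rule nn_integral_cong)
    fix w :: "nat => real"
    show "ennreal (f (shifted_point m x X w)) * K w = (\<Sum>k. \<Sum>nu\<in>S k. c k nu * (G nu w * K w))"
    proof (cases "w \<in> open_domain m 1 x")
      case True
      then show ?thesis unfolding assms(1)[OF True] G_def
        by (simp only: ennreal_suminf_multc[symmetric] sum_distrib_right mult.assoc)
    qed (simp add: K_def)
  qed
  also have "\<dots> = (\<Sum>k. \<Sum>nu\<in>S k. c k nu * (\<integral>\<^sup>+w. G nu w * K w \<partial>A))"
    by (subst nn_integral_suminf) (auto simp: nn_integral_sum nn_integral_cmult)
  finally show ?thesis unfolding jt G_def
    by (simp only: ennreal_suminf_cmult[symmetric] sum_distrib_left mult.left_commute[of C])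
qed

text \<open>The expansion of a Cauchy product in which the value of J of \<open>nu\<close> at the
  second set of variables is replaced by an arbitrary number \<open>A nu\<close>.\<close>

definition jack_series :: "real => nat => ((nat => int) => ennreal) => real => (nat => real) => ennreal" where
  "jack_series th n A t u = (\<Sum>k. \<Sum>nu\<in>partitions n k. ennreal (t ^ k * cauchy_coeff th n nu) * (ennreal (jack_nonneg th n nu u) * A nu))"

text \<open>Finiteness of the series makes every coefficient finite, so the comparison takes place
  among real numbers: the powers of t separate the degrees, and
  \<open>jack_nonneg_independent\<close> separates the partitions of one degree. Homogeneity extends
  the equations from nodes with last entry 1 to the whole cone.\<close>

lemma jack_series_unique:
  fixes A B :: "(nat => int) => ennreal" and x :: real
  assumes th: "th > 0" and x: "0 < x" "x < 1"
    and eq: "\<And>t u. 0 < t ==> t < 1 ==> nodes n 1 x u ==> jack_series th (Suc n) A t u = jack_series th (Suc n) B t u"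
    and fin: "\<And>t u. 0 < t ==> t < 1 ==> nodes n 1 x u ==> jack_series th (Suc n) B t u < top"
    and nu: "nu \<in> partitions (Suc n) k"
  shows "A nu = B nu"
proof -
  let ?b = "cauchy_coeff th (Suc n)" and ?J = "jack_nonneg th (Suc n)"
  have bJ: "0 < ?b nu * ?J nu u" if "nodes n 1 x u" "nu \<in> partitions (Suc n) k" for nu u k
  proof -
    have "0 < ?J nu u" by (rule jack_nonneg_pos[OF th partitionD(1)[OF partitionsD(2)[OF that(2)]]]) (use nodesD(4)[OF that(1)] in auto)
    then show ?thesis using cauchy_coeff_pos[OF th partitionsD(2)[OF that(2)]] by simp
  qed
  have summand: "ennreal (t ^ k * ?b nu) * (ennreal (?J nu u) * a) = ennreal (t ^ k * (?b nu * ?J nu u)) * a"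
    if "nodes n 1 x u" "nu \<in> partitions (Suc n) k" "0 < t" for nu u k t a
    using bJ[OF that(1,2)] cauchy_coeff_pos[OF th partitionsD(2)[OF that(2)]] that(3)
    by (simp add: ennreal_mult''[symmetric] mult.assoc[symmetric] zero_less_mult_iff)
  \<comment> \<open>A geometric progression with ratio x / 2 is an explicit choice of admissible
    nodes; finiteness of the coefficients is read off at this point and t = 1/2.\<close>
  define u0 where "u0 i = (x / 2) ^ (Suc n - i)" for i
  have u0: "nodes n 1 x u0"
  proof -
    have "u0 i < x * u0 (Suc i)" if "i \<le> n" for i
    proof -
      have "u0 i = x / 2 * u0 (Suc i)" using that by (simp add: u0_def Suc_diff_le)
      moreover have "0 < x * u0 (Suc i)" using x by (simp add: u0_def)
      ultimately show ?thesis using x by simp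
    qed
    then show ?thesis using x by (auto simp: nodes_def u0_def)
  qed
  have finite_coeff: "a nu \<noteq> top" if "jack_series th (Suc n) a (1/2) u0 < top" "nu \<in> partitions (Suc n) k" for a nu k
  proof -
    have "(\<Sum>nu\<in>partitions (Suc n) k. ennreal ((1/2) ^ k * ?b nu) * (ennreal (?J nu u0) * a nu)) < top"
      using that(1) unfolding jack_series_def by (rule ennreal_suminf_lessD)
    then have "ennreal ((1/2) ^ k * ?b nu) * (ennreal (?J nu u0) * a nu) < top"
      using that(2) finite_partitions by (simp only: ennreal_sum_less_top)
    then have "ennreal ((1/2) ^ k * (?b nu * ?J nu u0)) * a nu < top" by (subst (asm) summand[OF u0 that(2)]) auto
    then show ?thesis using bJ[OF u0 that(2)] by (auto simp: ennreal_mult_less_top)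
  qed
  define \<alpha> \<beta> where "\<alpha> nu = enn2real (A nu)" and "\<beta> nu = enn2real (B nu)" for nu
  have A: "A nu = ennreal (\<alpha> nu)" if "nu \<in> partitions (Suc n) k" for nu k
    using finite_coeff[of A, OF _ that] eq[OF _ _ u0, of "1/2"] fin[OF _ _ u0, of "1/2"] by (simp add: \<alpha>_def less_top)
  have B: "B nu = ennreal (\<beta> nu)" if "nu \<in> partitions (Suc n) k" for nu k
    using finite_coeff[of B, OF _ that] fin[OF _ _ u0, of "1/2"] by (simp add: \<beta>_def less_top)
  have nonneg: "0 \<le> \<alpha> nu" "0 \<le> \<beta> nu" for nu by (simp_all add: \<alpha>_def \<beta>_def)
  have real_series: "jack_series th (Suc n) a t u = (\<Sum>k. ennreal ((\<Sum>nu\<in>partitions (Suc n) k. ?b nu * ?J nu u * c nu) * t ^ k))"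
      "0 \<le> (\<Sum>nu\<in>partitions (Suc n) k. ?b nu * ?J nu u * c nu)"
    if "\<And>nu k. nu \<in> partitions (Suc n) k ==> a nu = ennreal (c nu)" "\<And>nu. 0 \<le> c nu" "nodes n 1 x u" "0 < t" for a c u t k
  proof -
    have "(\<Sum>nu\<in>partitions (Suc n) k. ennreal (t ^ k * ?b nu) * (ennreal (?J nu u) * a nu)) =
      (\<Sum>nu\<in>partitions (Suc n) k. ennreal (?b nu * ?J nu u * c nu * t ^ k))" for k
    proof (rule sum.cong[OF refl])
      fix nu assume nu: "nu \<in> partitions (Suc n) k"
      show "ennreal (t ^ k * ?b nu) * (ennreal (?J nu u) * a nu) = ennreal (?b nu * ?J nu u * c nu * t ^ k)"
        unfolding summand[OF that(3) nu that(4)] that(1)[OF nu] by (subst ennreal_mult''[symmetric, OF that(2)]) (simp only: ac_simps)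
    qed
    also have "\<dots> k = ennreal (\<Sum>nu\<in>partitions (Suc n) k. ?b nu * ?J nu u * c nu * t ^ k)" for k
      using that(4) by (intro sum_ennreal mult_nonneg_nonneg[OF mult_nonneg_nonneg[OF less_imp_le[OF bJ[OF that(3)]] that(2)]]) auto
    finally show "jack_series th (Suc n) a t u = (\<Sum>k. ennreal ((\<Sum>nu\<in>partitions (Suc n) k. ?b nu * ?J nu u * c nu) * t ^ k))"
      unfolding jack_series_def sum_distrib_right by simp
    show "0 \<le> (\<Sum>nu\<in>partitions (Suc n) k. ?b nu * ?J nu u * c nu)"
      by (rule sum_nonneg, rule mult_nonneg_nonneg[OF less_imp_le[OF bJ[OF that(3)]] that(2)])
  qed
  have coeff: "(\<Sum>nu\<in>partitions (Suc n) k. ?b nu * ?J nu u * \<alpha> nu) = (\<Sum>nu\<in>partitions (Suc n) k. ?b nu * ?J nu u * \<beta> nu)" if u: "nodes n 1 x u" for u k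
  proof (rule power_series_unique)
    fix t :: real assume t: "0 < t" "t < 1"
    let ?a = "\<lambda>k. (\<Sum>nu\<in>partitions (Suc n) k. ?b nu * ?J nu u * \<alpha> nu) * t ^ k" and ?c = "\<lambda>k. (\<Sum>nu\<in>partitions (Suc n) k. ?b nu * ?J nu u * \<beta> nu) * t ^ k"
    have a: "jack_series th (Suc n) A t u = (\<Sum>k. ennreal (?a k))" "0 \<le> ?a k" for k
      using real_series[of A \<alpha>, OF A nonneg(1) u t(1)] t by auto
    have c: "jack_series th (Suc n) B t u = (\<Sum>k. ennreal (?c k))" "0 \<le> ?c k" for k
      using real_series[of B \<beta>, OF B nonneg(2) u t(1)] t by auto
    show sa: "summable ?a" using eq[OF t u] fin[OF t u] a by (intro summable_suminf_not_top) auto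
    show sc: "summable ?c" using fin[OF t u] c by (intro summable_suminf_not_top) auto
    have "ennreal (suminf ?a) = ennreal (suminf ?c)"
      using eq[OF t u] a c sa sc by (simp add: suminf_ennreal2)
    then show "suminf ?a = suminf ?c" using a c sa sc by (simp add: suminf_nonneg)
  qed
  have "?b nu * (\<alpha> nu - \<beta> nu) = 0"
  proof (rule jack_nonneg_independent[OF th x(1) finite_partitions[of "Suc n" k] _ _ nu])
    fix nu assume "nu \<in> partitions (Suc n) k"
    then show "nu \<in> extensional {1..Suc n} \<and> is_partition (Suc n) nu" using partitionsD by blast
  next
    fix u assume u: "u \<in> cone (Suc n) x"
    define c where "c = u (Suc n)"
    have c: "0 < c" using u by (simp add: cone_def c_def)
    define v where "v i = u i / c" for i
    have v: "nodes n 1 x v" using u c x by (auto simp: nodes_def v_def cone_def divide_strict_right_mono c_def[symmetric])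
    have uv: "u = (\<lambda>i. c * v i)" using c by (simp add: v_def)
    have J: "?J nu u = c ^ k * ?J nu v" if "nu \<in> partitions (Suc n) k" for nu
      unfolding uv using jack_nonneg_homogeneous[OF partitionsD(2)[OF that], of th c v] partitionsD(3)[OF that] by simp
    have "(\<Sum>nu\<in>partitions (Suc n) k. ?b nu * (\<alpha> nu - \<beta> nu) * ?J nu u) = c ^ k * ((\<Sum>nu\<in>partitions (Suc n) k. ?b nu * ?J nu v * \<alpha> nu) - (\<Sum>nu\<in>partitions (Suc n) k. ?b nu * ?J nu v * \<beta> nu))"
      unfolding sum_subtractf[symmetric] sum_distrib_left by (intro sum.cong refl) (simp only: J right_diff_distrib left_diff_distrib ac_simps)
    then show "(\<Sum>nu\<in>partitions (Suc n) k. ?b nu * (\<alpha> nu - \<beta> nu) * ?J nu u) = 0" using coeff[OF v] by simp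
  qed
  then have "\<alpha> nu = \<beta> nu" using cauchy_coeff_pos[OF th partitionsD(2)[OF nu]] by simp
  then show ?thesis using A[OF nu] B[OF nu] by simp
qed

section \<open>The eigenvalue equation\<close>

text \<open>For m = 0 the domain is a single point, the simplex is the point p = 1 and the kernel is
  1, so the operator evaluates at (x, 1, ..., 1).\<close>

lemma jack_transform_zero:
  assumes n: "nodes 0 1 x X" and th: "th > 0" and N: "0 < N"
  shows "jack_transform th N 0 x X (jack_nonneg th N nu) = ennreal (jack_nonneg th N nu (one_ext 1 (\<lambda>_. x)))"
proof -
  define w :: "nat => real" where "w = (\<lambda>_. undefined)"
  note nd = nodesD[OF n]
  have dom: "w \<in> open_domain 0 1 x" using nd by (simp add: open_domain_def)
  have J: "jack_nonneg th N nu (shifted_point 0 x X w) = jack_nonneg th N nu (one_ext 1 (\<lambda>_. x))"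
    using nd(3) by (intro jack_nonneg_cong) (auto simp: shifted_point_def one_ext_def wfull_def le_Suc_eq)
  have "simplex_coord 0 1 x X w (Suc 0) = 1" using simplex_coord_sum(1)[OF n _ dom] by simp
  then have K: "jack_kernel th N 0 x X w = 1" by (simp add: jack_kernel_def coord_jacobian_def)
  have "0 < Gamma (real N * th)" using th N by (intro Gamma_real_pos) simp
  then show ?thesis
    unfolding jack_transform_def using dom J K
    by (simp add: PiM_empty nn_integral_count_space_finite w_def)
qed

lemma jack_transform_expansion:
  assumes th: "th > 0" and n: "nodes m 1 x X" and t: "0 < t" "t < 1" and u: "nodes n 1 x u"
  shows "jack_transform th (Suc (Suc n)) m x X (cauchy_product th (Suc n) (Suc (Suc n)) t u) =
    jack_series th (Suc n) (\<lambda>nu. jack_transform th (Suc (Suc n)) m x X (jack_nonneg th (Suc (Suc n)) (zero_ext (Suc n) nu))) t u"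
proof -
  have u1: "0 < u j \<and> u j \<le> 1" if "1 \<le> j" "j \<le> Suc n" for j
    using nodesD(3)[OF u] nodesD(4)[OF u, of j] nodesD(7)[OF u, of j] that by (cases "j = Suc n") auto
  have "ennreal (cauchy_product th (Suc n) (Suc (Suc n)) t u (shifted_point m x X w)) =
     (\<Sum>k. \<Sum>nu\<in>partitions (Suc n) k. ennreal (t ^ k * cauchy_coeff th (Suc n) nu) * ennreal (jack_nonneg th (Suc n) nu u) *
       ennreal (jack_nonneg th (Suc (Suc n)) (zero_ext (Suc n) nu) (shifted_point m x X w)))"
    if "w \<in> open_domain m 1 x" for w
    using cauchy_product_expansion[where u = u and y = "shifted_point m x X w" and n = "Suc n" and M = "Suc (Suc n)", OF th _ t] u1 shifted_point_bounds[OF n that]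
    by (simp only: mult.assoc)
  from jack_transform_series[where g = "\<lambda>nu. jack_nonneg th (Suc (Suc n)) (zero_ext (Suc n) nu)", OF this jack_shifted_measurable]
  show ?thesis by (simp only: jack_series_def mult.assoc)
qed

text \<open>Here the operator of size n + 1 acts in the shorter set of variables, and its nodes u
  have n + 1 entries. So the values of its eigenfunctions are the polynomials J of \<open>nu\<close>
  at u, and the result is again a \<open>jack_series\<close> in u, ready to be compared with
  \<open>jack_transform_expansion\<close>.\<close>

lemma jack_transform_dual_expansion:
  assumes th: "th > 0" and t: "0 < t" "t < 1" and u: "nodes n 1 x u"
    and Y: "\<And>i. 1 \<le> i ==> i \<le> Suc (Suc n) ==> 0 < Y i \<and> Y i \<le> 1"
    and IH: "\<And>nu. is_partition (Suc n) nu ==> jack_transform th (Suc n) n x u (jack_nonneg th (Suc n) nu) = ennreal (c nu * jack_nonneg th (Suc n) nu (one_ext n u))"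
    and c: "\<And>nu. is_partition (Suc n) nu ==> 0 \<le> c nu"
  shows "jack_transform th (Suc n) n x u (cauchy_product th (Suc (Suc n)) (Suc n) t Y) =
    jack_series th (Suc n) (\<lambda>nu. ennreal (jack_nonneg th (Suc (Suc n)) (zero_ext (Suc n) nu) Y) * ennreal (c nu)) t u"
proof -
  have "ennreal (cauchy_product th (Suc (Suc n)) (Suc n) t Y (shifted_point n x u w)) =
     (\<Sum>k. \<Sum>nu\<in>partitions (Suc n) k. ennreal (t ^ k * cauchy_coeff th (Suc n) nu) * ennreal (jack_nonneg th (Suc (Suc n)) (zero_ext (Suc n) nu) Y) *
       ennreal (jack_nonneg th (Suc n) nu (shifted_point n x u w)))"
    if "w \<in> open_domain n 1 x" for w
    unfolding cauchy_product_commute[of th "Suc (Suc n)"]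
    by (subst cauchy_product_expansion[OF th _ t]) (use Y shifted_point_bounds[OF u that] in \<open>auto simp: mult_ac\<close>)
  from jack_transform_series[where g = "\<lambda>nu. jack_nonneg th (Suc n) nu", OF this jack_shifted_measurable]
  have "jack_transform th (Suc n) n x u (cauchy_product th (Suc (Suc n)) (Suc n) t Y) =
     (\<Sum>k. \<Sum>nu\<in>partitions (Suc n) k. ennreal (t ^ k * cauchy_coeff th (Suc n) nu) * ennreal (jack_nonneg th (Suc (Suc n)) (zero_ext (Suc n) nu) Y) *
       jack_transform th (Suc n) n x u (jack_nonneg th (Suc n) nu))" .
  also have "\<dots> = jack_series th (Suc n) (\<lambda>nu. ennreal (jack_nonneg th (Suc (Suc n)) (zero_ext (Suc n) nu) Y) * ennreal (c nu)) t u"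
    unfolding jack_series_def
  proof (intro suminf_cong sum.cong refl)
    fix k nu assume nu: "nu \<in> partitions (Suc n) k"
    have "jack_nonneg th (Suc n) nu (one_ext n u) = jack_nonneg th (Suc n) nu u"
      using nodesD(3)[OF u] by (intro jack_nonneg_cong) (auto simp: one_ext_def le_Suc_eq)
    then have "jack_transform th (Suc n) n x u (jack_nonneg th (Suc n) nu) = ennreal (c nu) * ennreal (jack_nonneg th (Suc n) nu u)"
      using IH[OF partitionsD(2)[OF nu]] c[OF partitionsD(2)[OF nu]] by (simp only: ennreal_mult')
    then show "ennreal (t ^ k * cauchy_coeff th (Suc n) nu) * ennreal (jack_nonneg th (Suc (Suc n)) (zero_ext (Suc n) nu) Y) *
       jack_transform th (Suc n) n x u (jack_nonneg th (Suc n) nu) =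
       ennreal (t ^ k * cauchy_coeff th (Suc n) nu) * (ennreal (jack_nonneg th (Suc n) nu u) * (ennreal (jack_nonneg th (Suc (Suc n)) (zero_ext (Suc n) nu) Y) * ennreal (c nu)))"
      by (simp only: ac_simps)
  qed
  finally show ?thesis .
qed

lemma nn_integral_jack_series:
  assumes K: "K \<in> borel_measurable lborel" and A: "\<And>nu. A nu \<in> borel_measurable lborel"
  shows "(\<integral>\<^sup>+v. K v * jack_series th n (\<lambda>nu. a nu * A nu v) t u \<partial>lborel) = jack_series th n (\<lambda>nu. a nu * (\<integral>\<^sup>+v. K v * A nu v \<partial>lborel)) t u"
proof -
  note [measurable] = K A
  have "(\<integral>\<^sup>+v. K v * jack_series th n (\<lambda>nu. a nu * A nu v) t u \<partial>lborel) =
    (\<integral>\<^sup>+v. (\<Sum>k. \<Sum>nu\<in>partitions n k. (ennreal (t ^ k * cauchy_coeff th n nu) * (ennreal (jack_nonneg th n nu u) * a nu)) * (K v * A nu v)) \<partial>lborel)"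
    unfolding jack_series_def ennreal_suminf_cmult[symmetric] sum_distrib_left
    by (intro nn_integral_cong suminf_cong sum.cong refl) (simp only: ac_simps)
  also have "\<dots> = jack_series th n (\<lambda>nu. a nu * (\<integral>\<^sup>+v. K v * A nu v \<partial>lborel)) t u"
    by (subst nn_integral_suminf) (auto simp: nn_integral_sum nn_integral_cmult jack_series_def mult.assoc)
  finally show ?thesis .
qed

text \<open>The induction hypothesis enters under the mixture integral, with the eigenvalue
  \<open>c nu (x' v)\<close> of the smaller operator. Its mean \<open>C nu\<close> involves neither
  m nor the nodes, so it need not be evaluated as an integral: the case m = 0 determines it.\<close>

lemma jack_transform_zero_ext:
  assumes th: "th > 0" and n: "nodes m 1 x X" and mn: "m \<le> Suc n" and nu: "nu \<in> partitions (Suc n) k"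
    and IH: "\<And>y u nu. nodes n 1 y u ==> is_partition (Suc n) nu ==> jack_transform th (Suc n) n y u (jack_nonneg th (Suc n) nu) =
      ennreal (jack_nonneg th (Suc n) nu (one_ext 1 (\<lambda>_. y)) / jack_nonneg th (Suc n) nu (\<lambda>_. 1) * jack_nonneg th (Suc n) nu (one_ext n u))"
  defines "J \<equiv> jack_nonneg th (Suc (Suc n)) (zero_ext (Suc n) nu)"
  shows "jack_transform th (Suc (Suc n)) m x X J = ennreal (J (one_ext 1 (\<lambda>_. x)) / J (\<lambda>_. 1) * J (one_ext m X))"
proof -
  define N where "N = Suc (Suc n)"
  define JN where "JN nu = jack_nonneg th N (zero_ext (Suc n) nu)" for nu
  define c where "c nu y = jack_nonneg th (Suc n) nu (one_ext 1 (\<lambda>_. y)) / jack_nonneg th (Suc n) nu (\<lambda>_. 1)" for nu y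
  define x' where "x' v = x + (1 - x) / (1 + v)" for v
  define K where "K v = indicator {0<..} v * ennreal (Gamma (real N * th) / (Gamma th * Gamma (real (Suc n) * th)) *
        (v powr (real (Suc n) * th - 1) * (1 + v) powr - (real N * th)))" for v
  define C where "C nu = (\<integral>\<^sup>+v. K v * ennreal (c nu (x' v)) \<partial>lborel)" for nu
  have x: "0 < x" "x < 1" using nodesD[OF n] by auto
  have JNpos: "0 < JN nu y" if "is_partition (Suc n) nu" "\<And>i. 1 \<le> i ==> 0 < y i" for nu y
    unfolding JN_def by (rule jack_nonneg_pos[OF th partitionD(1)[OF zero_ext_partition[OF that(1)]]]) (use that in auto)
  have JNmono: "JN nu y \<le> JN nu (\<lambda>_. 1)" if "is_partition (Suc n) nu" "\<And>i. 1 \<le> i ==> 0 < y i \<and> y i \<le> 1" for nu y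
    unfolding JN_def by (rule jack_nonneg_mono[OF th partitionD(1)[OF zero_ext_partition[OF that(1)]]]) (use that in auto)
  have c0: "0 \<le> c nu y" if "is_partition (Suc n) nu" "0 < y" for nu y
    unfolding c_def using that by (intro divide_nonneg_nonneg less_imp_le jack_nonneg_pos[OF th partitionD(1)]) (auto simp: one_ext_def)
  have Y: "0 < one_ext m' X' i \<and> one_ext m' X' i \<le> 1" if "nodes m' 1 x X'" "1 \<le> i" for m' X' and i :: nat
    using nodesD(4)[OF that(1), of i] nodesD(7)[OF that(1), of i] that(2) by (auto simp: one_ext_def)
  have x1: "0 < one_ext 1 (\<lambda>_. x) i \<and> one_ext 1 (\<lambda>_. x) i \<le> 1" for i using x by (simp add: one_ext_def)
  have series: "jack_series th (Suc n) (\<lambda>nu. jack_transform th N m' x X' (JN nu)) t u = jack_series th (Suc n) (\<lambda>nu. ennreal (JN nu (one_ext m' X')) * C nu) t u"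
    if n': "nodes m' 1 x X'" and m': "m' \<le> Suc n" and t: "0 < t" "t < 1" and u: "nodes n 1 x u" for m' X' t u
  proof -
    have "jack_series th (Suc n) (\<lambda>nu. jack_transform th N m' x X' (JN nu)) t u = jack_transform th N m' x X' (cauchy_product th (Suc n) N t u)"
      unfolding N_def JN_def by (rule jack_transform_expansion[OF th n' t u, symmetric])
    also have "\<dots> = (\<integral>\<^sup>+v. K v * jack_transform th (Suc n) n (x' v) u (cauchy_product th N (Suc n) t (one_ext m' X')) \<partial>lborel)"
      unfolding N_def K_def x'_def jack_transform_recursion[OF th n' m' t u] by (simp only: mult.assoc)
    also have "\<dots> = (\<integral>\<^sup>+v. K v * jack_series th (Suc n) (\<lambda>nu. ennreal (JN nu (one_ext m' X')) * ennreal (c nu (x' v))) t u \<partial>lborel)"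
    proof (rule nn_integral_cong)
      fix v :: real
      show "K v * jack_transform th (Suc n) n (x' v) u (cauchy_product th N (Suc n) t (one_ext m' X')) =
        K v * jack_series th (Suc n) (\<lambda>nu. ennreal (JN nu (one_ext m' X')) * ennreal (c nu (x' v))) t u"
      proof (cases "0 < v")
        case True
        have xx: "0 < x' v" "x \<le> x' v" "x' v < 1" using x True by (simp_all add: x'_def field_simps add_pos_pos)
        have u': "nodes n 1 (x' v) u" by (rule nodes_mono[OF u xx(2,3)])
        show ?thesis unfolding N_def JN_def
          by (subst jack_transform_dual_expansion[where c = "\<lambda>nu. c nu (x' v)", OF th t u']) (use Y[OF n'] IH[OF u'] c0 xx in \<open>auto simp: c_def\<close>)
      qed (simp add: K_def)
    qed
    also have "\<dots> = jack_series th (Suc n) (\<lambda>nu. ennreal (JN nu (one_ext m' X')) * C nu) t u"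
      unfolding C_def
    proof (rule nn_integral_jack_series)
      show "K \<in> borel_measurable lborel" unfolding K_def[abs_def] by simp
      fix nu
      have "(\<lambda>v. jack_nonneg th (Suc n) nu (one_ext 1 (\<lambda>_. x' v))) \<in> borel_measurable borel"
        by (rule jack_nonneg_measurable) (auto simp: one_ext_def x'_def)
      then show "(\<lambda>v. ennreal (c nu (x' v))) \<in> borel_measurable lborel" unfolding c_def by simp
    qed
    finally show ?thesis .
  qed
  have bounded: "jack_series th (Suc n) (\<lambda>nu. ennreal (JN nu y)) t u < top"
    if t: "0 < t" "t < 1" and u: "nodes n 1 x u" and y: "\<And>i. 1 \<le> i ==> 0 < y i \<and> y i \<le> 1" for t u y
  proof -
    have u1: "0 < u j \<and> u j \<le> 1" if "1 \<le> j" "j \<le> Suc n" for j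
      using nodesD(3)[OF u] nodesD(4)[OF u, of j] nodesD(7)[OF u, of j] that by (cases "j = Suc n") auto
    have "jack_series th (Suc n) (\<lambda>nu. ennreal (JN nu y)) t u = ennreal (cauchy_product th (Suc n) N t u y)"
      unfolding jack_series_def JN_def N_def
      by (rule cauchy_product_expansion[symmetric, OF th _ t]) (use u1 y in auto)
    then show ?thesis by simp
  qed
  have n0: "nodes 0 1 x (\<lambda>_. 1)" using x by (simp add: nodes_def)
  have T0: "jack_transform th N 0 x (\<lambda>_. 1) (JN nu) = ennreal (JN nu (one_ext 1 (\<lambda>_. x)))" for nu
    unfolding JN_def by (rule jack_transform_zero[OF n0 th]) (simp add: N_def)
  have C: "C nu = ennreal (JN nu (one_ext 1 (\<lambda>_. x)) / JN nu (\<lambda>_. 1))" if nu: "nu \<in> partitions (Suc n) k" for nu k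
  proof -
    \<comment> \<open>For m = 0 the two sides are known: the operator gives the value at (x, 1, ...,
      1), and \<open>one_ext 0\<close> is constantly 1, so \<open>C nu\<close> is multiplied by the
      value at (1, ..., 1).\<close>
    have "ennreal (JN nu (one_ext 0 (\<lambda>_. 1))) * C nu = ennreal (JN nu (one_ext 1 (\<lambda>_. x)))"
    proof (rule jack_series_unique[OF th x _ _ nu])
      fix t :: real and u :: "nat => real" assume tu: "0 < t" "t < 1" "nodes n 1 x u"
      show "jack_series th (Suc n) (\<lambda>nu. ennreal (JN nu (one_ext 0 (\<lambda>_. 1))) * C nu) t u = jack_series th (Suc n) (\<lambda>nu. ennreal (JN nu (one_ext 1 (\<lambda>_. x)))) t u"
        using series[OF n0 _ tu] by (simp only: T0)
      show "jack_series th (Suc n) (\<lambda>nu. ennreal (JN nu (one_ext 1 (\<lambda>_. x)))) t u < top"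
        by (rule bounded[OF tu]) (use x1 in auto)
    qed
    moreover have "one_ext 0 (\<lambda>_. 1) = (\<lambda>_. 1 :: real)" by (simp add: one_ext_def fun_eq_iff)
    ultimately have eq: "ennreal (JN nu (\<lambda>_. 1)) * C nu = ennreal (JN nu (one_ext 1 (\<lambda>_. x)))" by simp
    have p: "0 < JN nu (\<lambda>_. 1)" using partitionsD(2)[OF nu] by (rule JNpos) auto
    have "C nu = ennreal (1 / JN nu (\<lambda>_. 1)) * (ennreal (JN nu (\<lambda>_. 1)) * C nu)"
      using p by (simp add: mult.assoc[symmetric] ennreal_mult'[symmetric])
    also have "\<dots> = ennreal (JN nu (one_ext 1 (\<lambda>_. x)) / JN nu (\<lambda>_. 1))"
      unfolding eq using p by (simp add: ennreal_mult'[symmetric])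
    finally show ?thesis .
  qed
  have "jack_transform th N m x X (JN nu) = ennreal (JN nu (one_ext m X)) * C nu"
  proof (rule jack_series_unique[OF th x _ _ nu])
    fix t :: real and u :: "nat => real" assume tu: "0 < t" "t < 1" "nodes n 1 x u"
    show "jack_series th (Suc n) (\<lambda>nu. jack_transform th N m x X (JN nu)) t u = jack_series th (Suc n) (\<lambda>nu. ennreal (JN nu (one_ext m X)) * C nu) t u"
      by (rule series[OF n mn tu])
    \<comment> \<open>By monotonicity of J the eigenvalue is at most 1, so the finiteness required
      for the uniqueness is inherited from the Cauchy product.\<close>
    have "jack_series th (Suc n) (\<lambda>nu. ennreal (JN nu (one_ext m X)) * C nu) t u \<le> jack_series th (Suc n) (\<lambda>nu. ennreal (JN nu (one_ext m X))) t u"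
      unfolding jack_series_def
    proof (intro suminf_le summableI sum_mono mult_left_mono zero_le)
      fix k nu assume nu: "nu \<in> partitions (Suc n) k"
      have "JN nu (one_ext 1 (\<lambda>_. x)) / JN nu (\<lambda>_. 1) \<le> 1"
        using JNmono[OF partitionsD(2)[OF nu], of "one_ext 1 (\<lambda>_. x)"] JNpos[OF partitionsD(2)[OF nu], of "\<lambda>_. 1"] x1 by simp
      then have "C nu \<le> 1" by (simp add: C[OF nu] ennreal_le_1)
      then show "ennreal (JN nu (one_ext m X)) * C nu \<le> ennreal (JN nu (one_ext m X))" using mult_left_mono[of "C nu" 1 "ennreal (JN nu (one_ext m X))"] by simp
    qed
    also have "\<dots> < top" by (rule bounded[OF tu]) (use Y[OF n] in auto)
    finally show "jack_series th (Suc n) (\<lambda>nu. ennreal (JN nu (one_ext m X)) * C nu) t u < top" .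
  qed
  also have "\<dots> = ennreal (JN nu (one_ext 1 (\<lambda>_. x)) / JN nu (\<lambda>_. 1) * JN nu (one_ext m X))"
  proof -
    have "0 \<le> JN nu (one_ext m X)" by (rule less_imp_le, rule JNpos[OF partitionsD(2)[OF nu]]) (use Y[OF n] in auto)
    then show ?thesis unfolding C[OF nu] by (simp only: ennreal_mult'[symmetric] mult.commute)
  qed
  finally show ?thesis unfolding J_def JN_def N_def .
qed

theorem jack_transform_eigen:
  assumes th: "th > 0"
  shows "m < N ==> nodes m 1 x X ==> is_partition N nu ==> jack_transform th N m x X (jack_nonneg th N nu) =
    ennreal (jack_nonneg th N nu (one_ext 1 (\<lambda>_. x)) / jack_nonneg th N nu (\<lambda>_. 1) * jack_nonneg th N nu (one_ext m X))"
proof (induction N arbitrary: m x X nu)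
  case (Suc n)
  show ?case
  proof (cases n)
    case 0
    then have m: "m = 0" using Suc.prems by simp
    have "0 < jack_nonneg th (Suc n) nu (\<lambda>_. 1)" by (rule jack_nonneg_pos[OF th partitionD(1)[OF Suc.prems(3)]]) simp
    moreover have "jack_nonneg th (Suc n) nu (one_ext 0 X) = jack_nonneg th (Suc n) nu (\<lambda>_. 1)"
      by (intro jack_nonneg_cong) (auto simp: one_ext_def)
    ultimately show ?thesis using jack_transform_zero[of x X th "Suc n" nu] Suc.prems(2) th
      unfolding m by (simp only: zero_less_Suc) simp
  next
    case (Suc n')
    note n' = this
    define N where "N = Suc n"
    \<comment> \<open>Removing the columns of full height N leaves a partition with at most n rows,
      the case treated by \<open>jack_transform_zero_ext\<close>.\<close>
    define k where "k = nu N"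
    define mu where "mu = (\<lambda>i\<in>{1..n}. nu i - k)"
    define J where "J = jack_nonneg th N (zero_ext n mu)"
    note part = Suc.prems(3)[folded N_def]
    have k0: "0 \<le> k" unfolding k_def by (rule partitionD(2)[OF part]) (auto simp: N_def)
    have mu: "is_partition n mu"
    proof (rule partitionI)
      fix i assume "1 \<le> i" "i < n"
      then show "mu (Suc i) \<le> mu i" using partitionD(3)[OF part, of i "Suc i"] by (auto simp: mu_def N_def)
    next
      assume "1 \<le> n"
      then show "0 \<le> mu n" using partitionD(3)[OF part, of n N] by (auto simp: mu_def N_def k_def)
    qed
    have Jk: "jack_nonneg th N nu y = (\<Prod>i=1..N. y i) ^ nat k * J y" for y
    proof -
      have "jack_nonneg th N nu y = jack_nonneg th N (\<lambda>i. zero_ext n mu i + k) y"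
        by (rule jack_nonneg_cong) (auto simp: zero_ext_def mu_def k_def N_def le_Suc_eq)
      also have "\<dots> = (\<Prod>i=1..N. y i) ^ nat k * J y"
        unfolding J_def by (rule jack_nonneg_shift[OF zero_ext_partition[OF mu] k0])
      finally show ?thesis .
    qed
    have mu': "mu \<in> partitions n (nat (sig_size n mu))"
    proof (rule partitionsI)
      have "0 \<le> sig_size n mu" unfolding sig_size_def by (intro sum_nonneg) (use partitionD(2)[OF mu] in auto)
      then show "sig_size n mu = int (nat (sig_size n mu))" by simp
    qed (use mu in \<open>auto simp: mu_def\<close>)
    have T: "jack_transform th N m x X J = ennreal (J (one_ext 1 (\<lambda>_. x)) / J (\<lambda>_. 1) * J (one_ext m X))"
      unfolding J_def N_def n'
      by (rule jack_transform_zero_ext[OF th Suc.prems(2) _ mu'[unfolded n'] Suc.IH[unfolded n', OF lessI]]) (use Suc.prems(1) n' in auto)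
    \<comment> \<open>The W i multiply to x, so the product of all arguments is the same at every
      point of the domain, and its power can be taken out of the integral.\<close>
    have prod: "(\<Prod>i=1..N. shifted_point m x X w i) = x * (\<Prod>i=1..N. one_ext m X i)" if w: "w \<in> open_domain m 1 x" for w
    proof -
      have split: "(\<Prod>i=1..N. f i) = (\<Prod>i\<in>{1..Suc m}. f i)" if "\<And>i. Suc m < i ==> f i = 1" for f :: "nat => real"
        by (rule prod.mono_neutral_right) (use Suc.prems(1) that in \<open>auto simp: N_def\<close>)
      have "(\<Prod>i=1..N. shifted_point m x X w i) = (\<Prod>i\<in>{1..Suc m}. X i * wfull m 1 x w i)"
        by (subst split) (auto simp: shifted_point_def intro!: prod.cong simp del: prod.cl_ivl_Suc)
      also have "\<dots> = (\<Prod>i\<in>{1..Suc m}. X i) * x"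
        using domain_facts(2)[OF Suc.prems(2) _ w] by (simp only: prod.distrib le_add1 plus_1_eq_Suc[symmetric])
      also have "(\<Prod>i\<in>{1..Suc m}. X i) = (\<Prod>i\<in>{1..Suc m}. one_ext m X i)"
        using nodesD(3)[OF Suc.prems(2)] by (intro prod.cong) (auto simp: one_ext_def le_Suc_eq)
      also have "\<dots> = (\<Prod>i=1..N. one_ext m X i)" by (rule split[symmetric]) (auto simp: one_ext_def)
      finally show ?thesis by (simp only: mult.commute)
    qed
    define A where "A = (x * (\<Prod>i=1..N. one_ext m X i)) ^ nat k"
    have "0 \<le> one_ext m X i" if "i \<in> {1..N}" for i
      using nodesD(4)[OF Suc.prems(2), of i] that by (auto simp: one_ext_def)
    then have A: "0 \<le> A" unfolding A_def using nodesD(1)[OF Suc.prems(2)] by (intro zero_le_power mult_nonneg_nonneg prod_nonneg) auto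
    \<comment> \<open>A series with one nonzero term: this use of
      \<open>jack_transform_series\<close> moves the constant \<open>A\<close> out of the
      operator.\<close>
    have "jack_transform th N m x X (jack_nonneg th N nu) = (\<Sum>l. \<Sum>_\<in>(if l = (0 :: nat) then {0} else {} :: nat set). ennreal A * jack_transform th N m x X J)"
    proof (rule jack_transform_series)
      fix w assume w: "w \<in> open_domain m 1 x"
      have "jack_nonneg th N nu (shifted_point m x X w) = A * J (shifted_point m x X w)"
        unfolding Jk prod[OF w] A_def ..
      then show "ennreal (jack_nonneg th N nu (shifted_point m x X w)) = (\<Sum>l. \<Sum>_\<in>(if l = (0 :: nat) then {0} else {} :: nat set). ennreal A * ennreal (J (shifted_point m x X w)))"
        using A by (subst suminf_finite[of "{0}"]) (auto simp: ennreal_mult')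
    qed (unfold J_def, rule jack_shifted_measurable)
    also have "\<dots> = ennreal A * jack_transform th N m x X J" by (subst suminf_finite[of "{0}"]) auto
    also have "\<dots> = ennreal (A * (J (one_ext 1 (\<lambda>_. x)) / J (\<lambda>_. 1) * J (one_ext m X)))"
      unfolding T using A by (simp only: ennreal_mult')
    also have "A * (J (one_ext 1 (\<lambda>_. x)) / J (\<lambda>_. 1) * J (one_ext m X)) =
      jack_nonneg th N nu (one_ext 1 (\<lambda>_. x)) / jack_nonneg th N nu (\<lambda>_. 1) * jack_nonneg th N nu (one_ext m X)"
    proof -
      have "(\<Prod>i=1..N. one_ext 1 (\<lambda>_. x) i) = (\<Prod>i\<in>{1}. one_ext 1 (\<lambda>_. x) i)"
        by (rule prod.mono_neutral_right) (auto simp: N_def one_ext_def)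
      then have "(\<Prod>i=1..N. one_ext 1 (\<lambda>_. x) i) = x" by (simp add: one_ext_def)
      then show ?thesis unfolding Jk A_def by (simp only: power_mult_distrib) simp
    qed
    finally show ?thesis unfolding N_def .
  qed
qed simp

section \<open>The kernel of the product formula\<close>

text \<open>The origin of the exponents in the product formula: \<open>D\<close> occurs twice in the
  denominator of the simplex coordinates, with exponent th - 1, and once in that of the Jacobian,
  which gives 1 - 2 th. \<open>E\<close> and \<open>q\<close> occur once in each and give -th, and
  \<open>V\<close> in the numerators gives th.\<close>

lemma kernel_powers:
  fixes U A B C D E V q th :: real
  assumes "0 < U" "0 < A" "0 < B" "0 < D" "0 < E" "0 < V" "0 < q"
  shows "(U / q * (A / D) * (V * B / (D * E))) powr (th - 1) * (V * C / (D * E) / q) =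
    V powr th * (U powr (th - 1) * A powr (th - 1) * B powr (th - 1) * C * D powr (1 - 2 * th)) / (q powr th * E powr th)"
proof -
  have s: "z powr (th - 1) = z powr th / z" if "0 < z" for z :: real using that by (simp add: powr_diff)
  have d: "D powr (1 - 2 * th) = D / (D powr th * D powr th)"
    using assms by (simp add: powr_diff powr_add[symmetric])
  have "(U / q * (A / D) * (V * B / (D * E))) powr (th - 1) = U powr (th - 1) / q powr (th - 1) * (A powr (th - 1) / D powr (th - 1)) * (V powr (th - 1) * B powr (th - 1) / (D powr (th - 1) * E powr (th - 1)))"
    using assms by (simp add: powr_mult powr_divide less_imp_le)
  then show ?thesis unfolding d using assms by (simp add: s field_simps)
qed

lemma triangle_prod_swap:
  fixes h :: "nat => nat => real"
  shows "(\<Prod>i=1..m. \<Prod>j\<in>{1..<i}. h j i) = (\<Prod>j=1..m. \<Prod>i\<in>{j<..m}. h j i)"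
proof -
  have "(\<Prod>i=1..m. \<Prod>j\<in>{1..<i}. h j i) = (\<Prod>i\<in>{1..m}. \<Prod>j\<in>{j \<in> {1..m}. j < i}. h j i)"
    by (intro prod.cong refl) auto
  also have "\<dots> = (\<Prod>j\<in>{1..m}. \<Prod>i\<in>{i \<in> {1..m}. j < i}. h j i)"
    by (rule prod.swap_restrict) auto
  also have "\<dots> = (\<Prod>j=1..m. \<Prod>i\<in>{j<..m}. h j i)" by (intro prod.cong refl) auto
  finally show ?thesis .
qed

text \<open>On the left W j occurs j - 1 times, namely once for each i < j. This is m minus the
  exponent m + 1 - j for j \<le> m, and m for j = m + 1.\<close>

lemma triangle_weights:
  fixes W :: "nat => real"
  assumes "\<And>i. 1 \<le> i ==> i \<le> m ==> W i \<noteq> 0"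
  shows "(\<Prod>i=1..m. \<Prod>j\<in>{i<..Suc m}. W j) = (\<Prod>i\<in>{1..Suc m}. W i) ^ m / (\<Prod>i=1..m. W i ^ (Suc m - i))"
proof -
  have "(\<Prod>i=1..m. \<Prod>j\<in>{i<..Suc m}. W j) * (\<Prod>i=1..m. \<Prod>j\<in>{1..i}. W j) = (\<Prod>i=1..m. \<Prod>j\<in>{1..Suc m}. W j)"
    unfolding prod.distrib[symmetric]
  proof (rule prod.cong[OF refl])
    fix i assume i: "i \<in> {1..m}"
    have "{1..Suc m} = {i<..Suc m} \<union> {1..i}" using i by auto
    then show "(\<Prod>j\<in>{i<..Suc m}. W j) * (\<Prod>j\<in>{1..i}. W j) = (\<Prod>j\<in>{1..Suc m}. W j)"
      by (simp only:) (rule prod.union_disjoint[symmetric], auto)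
  qed
  moreover have "(\<Prod>i=1..m. \<Prod>j\<in>{1..i}. W j) = (\<Prod>j=1..m. W j ^ (Suc m - j))"
  proof -
    have "(\<Prod>i=1..m. \<Prod>j\<in>{1..i}. W j) = (\<Prod>i\<in>{1..m}. \<Prod>j\<in>{j \<in> {1..m}. j \<le> i}. W j)"
      by (intro prod.cong refl) auto
    also have "\<dots> = (\<Prod>j\<in>{1..m}. \<Prod>i\<in>{i \<in> {1..m}. j \<le> i}. W j)"
      by (rule prod.swap_restrict) auto
    also have "\<dots> = (\<Prod>j\<in>{1..m}. \<Prod>i\<in>{j..m}. W j)" by (intro prod.cong refl) auto
    also have "\<dots> = (\<Prod>j=1..m. W j ^ (Suc m - j))" by simp
    finally show ?thesis .
  qed
  moreover have "(\<Prod>j=1..m. W j ^ (Suc m - j)) \<noteq> 0" using assms by auto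
  ultimately show ?thesis by (simp only: prod_constant card_atLeastAtMost) (simp add: eq_divide_eq)
qed

lemma F_fun_simplex_coord: "F_fun m xs x w = simplex_coord m 1 x (x_ext m xs) w (Suc m)"
proof -
  have "{1..Suc m} - {Suc m} = {1..m}" by auto
  then have "(\<Prod>j\<in>{1..Suc m} - {Suc m}. x_ext m xs (Suc m) - x_ext m xs j) = (\<Prod>j=1..m. 1 - xs j)"
    by (simp only:) (auto intro!: prod.cong simp: x_ext_def)
  moreover have "(\<Prod>j\<in>{1..Suc m}. x_ext m xs (Suc m) - x_ext m xs j * wfull m 1 x w j) = (\<Prod>i=1..Suc m. 1 - x_ext m xs i * w_ext m x w i)"
    by (rule prod.cong[OF refl]) (auto simp: x_ext_def wfull_def w_ext_def)
  moreover have "(\<Prod>j=1..m. inverse (1 - xs j)) = inverse (\<Prod>j=1..m. 1 - xs j)"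
    using prod_inversef[of "\<lambda>j. 1 - xs j" "{1..m}"] by (simp add: comp_def)
  ultimately show ?thesis unfolding F_fun_def simplex_coord_def
    by (simp add: x_ext_def divide_inverse inverse_mult_distrib mult_ac del: prod.cl_ivl_Suc)
qed

text \<open>In the simplex coordinate p i the pairs j < i contribute to \<open>A / D\<close> and the
  pairs j > i to \<open>V * B / (D * E)\<close>; the Jacobian contributes
  \<open>V * C / (D * E)\<close>. As the W i multiply to x, the power \<open>V powr th\<close>
  supplies both the constant x powr (m th) and the first factor of \<open>G_fun\<close>.\<close>

lemma product_kernel:
  assumes n: "nodes m 1 x (x_ext m xs)" and m: "1 \<le> m" and mN: "m < N" and w: "w \<in> open_domain m 1 x"
  shows "x powr (real m * th) / ((1 - x) powr (real m * th) * (\<Prod>i=1..m. (1 - xs i) powr th)) *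
    (G_fun th m xs x w * F_fun m xs x w powr (th * (real N - real m) - 1) * (\<Prod>i=1..m. (1 - w i) powr (th - 1)) * (\<Prod>i=1..m. 1 / w i)) =
    jack_kernel th N m x (x_ext m xs) w"
proof -
  define X where "X = x_ext m xs"
  define W where "W = wfull m 1 x w"
  have Wx: "w_ext m x w = W" by (auto simp: W_def wfull_def w_ext_def)
  define y where "y j = X j * W j" for j
  define p where "p = simplex_coord m 1 x X w"
  note nd = nodesD[OF n[folded X_def]] and df = domain_facts[OF n[folded X_def] _ w, folded W_def]
  have Ww: "W i = w i" if "i \<in> {1..m}" for i using that by (simp add: W_def wfull_def)
  have Xx: "X i = xs i" if "i \<in> {1..m}" for i using that by (simp add: X_def x_ext_def)
  have X0: "0 < X i" if "1 \<le> i" "i \<le> Suc m" for i using nd(4)[OF that] .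
  have XX: "X i < X j" if "1 \<le> i" "i < j" "j \<le> Suc m" for i j using nd(6)[OF that] .
  have W0: "0 < W i" "W i < 1" if "1 \<le> i" "i \<le> Suc m" for i using df(3)[of i] df(5)[of i] nd(1) that m by auto
  have y0: "0 < y i" if "1 \<le> i" "i \<le> Suc m" for i using X0[OF that] W0[OF that] by (simp add: y_def)
  have Xy: "X i < y j" if "1 \<le> i" "i < j" "j \<le> Suc m" for i j using df(7)[of i j] that by (simp add: y_def)
  have yX: "y i < X j" if "1 \<le> i" "i \<le> j" "j \<le> Suc m" for i j using df(6)[of i j] that m by (simp add: y_def)
  have yy: "y i < y j" if "1 \<le> i" "i < j" "j \<le> Suc m" for i j using df(8)[of i j] that m by (simp add: y_def)
  define U where "U = (\<Prod>i=1..m. 1 - w i)"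
  define A where "A = (\<Prod>i=1..m. \<Prod>j\<in>{i<..m}. 1 - X i / X j * W i)"
  define B where "B = (\<Prod>i=1..m. \<Prod>j\<in>{i<..Suc m}. 1 - X i / (X j * W j))"
  define C where "C = (\<Prod>i=1..m. \<Prod>j\<in>{i<..Suc m}. 1 - X i * W i / (X j * W j))"
  define D where "D = (\<Prod>i=1..m. \<Prod>j\<in>{i<..m}. 1 - X i / X j)"
  define E where "E = (\<Prod>i=1..m. 1 - X i)"
  define V where "V = (\<Prod>i=1..m. \<Prod>j\<in>{i<..Suc m}. W j)"
  have fU: "0 < 1 - w i" if "i \<in> {1..m}" for i using W0[of i] Ww[OF that] that by auto
  have fA: "0 < 1 - X i / X j * W i" if "i \<in> {1..m}" "j \<in> {i<..m}" for i j
    using yX[of i j] X0[of j] that by (simp add: y_def field_simps)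
  have fB: "0 < 1 - X i / (X j * W j)" if "i \<in> {1..m}" "j \<in> {i<..Suc m}" for i j
  proof -
    have "X i / y j < 1" using Xy[of i j] y0[of j] that by simp
    then show ?thesis by (simp add: y_def)
  qed
  have fD: "0 < 1 - X i / X j" if "i \<in> {1..m}" "j \<in> {i<..m}" for i j
    using XX[of i j] X0[of j] that by (simp add: field_simps)
  have fE: "0 < 1 - X i" if "i \<in> {1..m}" for i using nd(7)[of i] that by auto
  have fV: "0 < W j" if "i \<in> {1..m}" "j \<in> {i<..Suc m}" for i j using W0[of j] that by auto
  have pos: "0 < U" "0 < A" "0 < B" "0 < D" "0 < E" "0 < V"
    unfolding U_def A_def B_def D_def E_def V_def by (intro prod_pos ballI fU fA fB fD fE fV; assumption)+
  have q: "0 < (1 - x) ^ m" using nd(2) by simp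
  have row: "(\<Prod>j\<in>{i<..Suc m}. 1 - X i / X j) = (\<Prod>j\<in>{i<..m}. 1 - X i / X j) * (1 - X i)" if "i \<in> {1..m}" for i
  proof -
    have "{i<..Suc m} = insert (Suc m) {i<..m}" using that by auto
    then show ?thesis using nd(3) by (simp add: mult.commute)
  qed
  have pi: "p i = (1 - w i) / (1 - x) * (\<Prod>j\<in>{1..<i}. (1 - X j / X i * W j) / (1 - X j / X i)) *
     (\<Prod>j\<in>{i<..Suc m}. W j * (1 - X i / (X j * W j)) / (1 - X i / X j))" if i: "i \<in> {1..m}" for i
  proof -
    have S: "{1..Suc m} = insert i ({1..<i} \<union> {i<..Suc m})" "{1..Suc m} - {i} = {1..<i} \<union> {i<..Suc m}" using i by auto
    have "p i = (X i - y i) * (\<Prod>j\<in>{1..Suc m} - {i}. X i - y j) / ((1 - x) * X i * (\<Prod>j\<in>{1..Suc m} - {i}. X i - X j))"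
      unfolding p_def simplex_coord_def y_def W_def using i by (subst prod.remove[of _ i]) auto
    also have "\<dots> = (X i - y i) / ((1 - x) * X i) * (\<Prod>j\<in>{1..Suc m} - {i}. (X i - y j) / (X i - X j))"
      by (simp add: prod_dividef)
    also have "(X i - y i) / ((1 - x) * X i) = (1 - w i) / (1 - x)"
      using X0[of i] i nd(2) by (simp add: y_def Ww field_simps)
    also have "(\<Prod>j\<in>{1..Suc m} - {i}. (X i - y j) / (X i - X j)) = (\<Prod>j\<in>{1..<i}. (X i - y j) / (X i - X j)) * (\<Prod>j\<in>{i<..Suc m}. (X i - y j) / (X i - X j))"
      unfolding S(2) by (rule prod.union_disjoint) auto
    also have "(\<Prod>j\<in>{1..<i}. (X i - y j) / (X i - X j)) = (\<Prod>j\<in>{1..<i}. (1 - X j / X i * W j) / (1 - X j / X i))"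
    proof (rule prod.cong[OF refl])
      fix j assume j: "j \<in> {1..<i}"
      have "1 - X j / X i * W j = (X i - y j) / X i" "1 - X j / X i = (X i - X j) / X i" using X0[of i] i by (simp_all add: y_def diff_divide_distrib)
      then show "(X i - y j) / (X i - X j) = (1 - X j / X i * W j) / (1 - X j / X i)" using X0[of i] i by simp
    qed
    also have "(\<Prod>j\<in>{i<..Suc m}. (X i - y j) / (X i - X j)) = (\<Prod>j\<in>{i<..Suc m}. W j * (1 - X i / (X j * W j)) / (1 - X i / X j))"
    proof (rule prod.cong[OF refl])
      fix j assume j: "j \<in> {i<..Suc m}"
      have "W j * (1 - X i / (X j * W j)) = (y j - X i) / X j" "1 - X i / X j = (X j - X i) / X j"
        using X0[of j] W0[of j] j by (simp_all add: y_def diff_divide_distrib right_diff_distrib)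
      then have "W j * (1 - X i / (X j * W j)) / (1 - X i / X j) = (y j - X i) / (X j - X i)" using X0[of j] j by simp
      then show "(X i - y j) / (X i - X j) = W j * (1 - X i / (X j * W j)) / (1 - X i / X j)" by (metis minus_diff_eq minus_divide_divide)
    qed
    finally show ?thesis by (simp only: mult.assoc)
  qed
  have prow: "(\<Prod>i=1..m. p i) = U / (1 - x) ^ m * (A / D) * (V * B / (D * E))"
  proof -
    have "(\<Prod>i=1..m. p i) = (\<Prod>i=1..m. (1 - w i) / (1 - x) * (\<Prod>j\<in>{1..<i}. (1 - X j / X i * W j) / (1 - X j / X i)) *
       (\<Prod>j\<in>{i<..Suc m}. W j * (1 - X i / (X j * W j)) / (1 - X i / X j)))"
      by (rule prod.cong[OF refl]) (rule pi)
    also have "\<dots> = (\<Prod>i=1..m. (1 - w i) / (1 - x)) * (\<Prod>i=1..m. \<Prod>j\<in>{1..<i}. (1 - X j / X i * W j) / (1 - X j / X i)) *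
       (\<Prod>i=1..m. \<Prod>j\<in>{i<..Suc m}. W j * (1 - X i / (X j * W j)) / (1 - X i / X j))"
      by (simp only: prod.distrib)
    also have "(\<Prod>i=1..m. (1 - w i) / (1 - x)) = U / (1 - x) ^ m" by (simp add: U_def prod_dividef)
    also have "(\<Prod>i=1..m. \<Prod>j\<in>{1..<i}. (1 - X j / X i * W j) / (1 - X j / X i)) = A / D"
      unfolding triangle_prod_swap A_def D_def by (simp only: prod_dividef)
    also have "(\<Prod>i=1..m. \<Prod>j\<in>{i<..Suc m}. W j * (1 - X i / (X j * W j)) / (1 - X i / X j)) = V * B / (D * E)"
    proof -
      have "(\<Prod>i=1..m. \<Prod>j\<in>{i<..Suc m}. 1 - X i / X j) = D * E"
        unfolding D_def E_def prod.distrib[symmetric] by (rule prod.cong[OF refl]) (rule row)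
      then show ?thesis unfolding V_def B_def by (simp only: prod_dividef prod.distrib)
    qed
    finally show ?thesis .
  qed
  have jac: "coord_jacobian m 1 x X w = (\<Prod>i=1..m. 1 / w i) * (V * C / (D * E) / (1 - x) ^ m)"
  proof -
    have "(\<Prod>i=1..m. \<Prod>j\<in>{i<..Suc m}. (X j * W j - X i * W i) / (X j - X i)) = (\<Prod>i=1..m. \<Prod>j\<in>{i<..Suc m}. W j * (1 - X i * W i / (X j * W j)) / (1 - X i / X j))"
    proof (intro prod.cong refl)
      fix i j assume ij: "i \<in> {1..m}" "j \<in> {i<..Suc m}"
      have "W j * (1 - X i * W i / (X j * W j)) = (X j * W j - X i * W i) / X j" "1 - X i / X j = (X j - X i) / X j"
        using X0[of j] W0[of j] ij by (simp_all add: diff_divide_distrib right_diff_distrib)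
      then show "(X j * W j - X i * W i) / (X j - X i) = W j * (1 - X i * W i / (X j * W j)) / (1 - X i / X j)" using X0[of j] ij by simp
    qed
    also have "\<dots> = V * C / (D * E)"
    proof -
      have "(\<Prod>i=1..m. \<Prod>j\<in>{i<..Suc m}. 1 - X i / X j) = D * E"
        unfolding D_def E_def prod.distrib[symmetric] by (rule prod.cong[OF refl]) (rule row)
      then show ?thesis unfolding V_def C_def by (simp only: prod_dividef prod.distrib)
    qed
    finally show ?thesis unfolding coord_jacobian_def W_def[symmetric] prod.distrib by (simp only: diff_Suc_Suc diff_zero times_divide_eq_right One_nat_def)
  qed
  define Z where "Z = (\<Prod>i=1..m. W i ^ (Suc m - i))"
  have Z: "0 < Z" unfolding Z_def using W0 by (intro prod_pos) auto
  have VZ: "V powr th = x powr (real m * th) * Z powr - th"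
  proof -
    have ne: "W i \<noteq> 0" if "1 \<le> i" "i \<le> m" for i using W0[of i] that by auto
    have "(\<Prod>i\<in>{1..Suc m}. W i) = x" by (rule df(2)) simp
    then have "V = x ^ m / Z" using triangle_weights[where W = W and m = m, OF ne] by (simp only: V_def Z_def)
    then show ?thesis using nd(1) Z by (simp add: powr_divide powr_minus_divide powr_realpow[symmetric] powr_powr)
  qed
  have G: "G_fun th m xs x w = Z powr - th * A powr (th - 1) * (C * B powr (th - 1)) * D powr (1 - 2 * th)"
  proof -
    have pw: "(\<Prod>i\<in>{1..m}. \<Prod>j\<in>S i. h i j powr r) = (\<Prod>i\<in>{1..m}. \<Prod>j\<in>S i. h i j) powr r" if "\<And>i j. i \<in> {1..m} ==> j \<in> S i ==> 0 < h i j" for S and h :: "nat => nat => real" and r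
      using that by (subst prod_powr_distrib) (auto intro!: prod_nonneg prod.cong prod_powr_distrib[symmetric] simp: less_imp_le)
    have last: "(\<Prod>i\<in>{1..Suc m}. \<Prod>j\<in>{i<..Suc m}. h i j) = (\<Prod>i\<in>{1..m}. \<Prod>j\<in>{i<..Suc m}. h i j)" for h :: "nat => nat => real"
      by (subst prod.nat_ivl_Suc') auto
    show ?thesis
      unfolding G_fun_def Let_def Wx X_def[symmetric] Z_def[symmetric] last prod.distrib
      by (simp only: pw[OF fA] pw[OF fB] pw[OF fD] A_def B_def C_def D_def)
  qed
  have ppow: "(\<Prod>i=1..m. p i powr (th - 1)) = (\<Prod>i=1..m. p i) powr (th - 1)"
    by (rule prod_powr_distrib[symmetric])
  have Upow: "(\<Prod>i=1..m. (1 - w i) powr (th - 1)) = U powr (th - 1)"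
    unfolding U_def by (rule prod_powr_distrib[symmetric])
  have Epow: "(\<Prod>i=1..m. (1 - xs i) powr th) = E powr th"
  proof -
    have "(\<Prod>i=1..m. (1 - xs i) powr th) = (\<Prod>i=1..m. (1 - X i) powr th)" by (intro prod.cong) (auto simp: Xx)
    then show ?thesis by (simp only: E_def prod_powr_distrib)
  qed
  have qpow: "((1 - x) ^ m) powr th = (1 - x) powr (real m * th)" using nd(2) by (simp add: powr_realpow[symmetric] powr_powr)
  have F: "F_fun m xs x w powr (th * (real N - real m) - 1) = p (Suc m) powr (real (N - m) * th - 1)"
    using mN by (simp add: F_fun_simplex_coord p_def X_def of_nat_diff mult.commute)
  have "jack_kernel th N m x X w = p (Suc m) powr (real (N - m) * th - 1) * (\<Prod>i=1..m. 1 / w i) *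
     ((U / (1 - x) ^ m * (A / D) * (V * B / (D * E))) powr (th - 1) * (V * C / (D * E) / (1 - x) ^ m))"
    unfolding jack_kernel_def p_def[symmetric] ppow prow jac by (simp only: ac_simps)
  also have "\<dots> = p (Suc m) powr (real (N - m) * th - 1) * (\<Prod>i=1..m. 1 / w i) *
     (x powr (real m * th) * Z powr - th * (U powr (th - 1) * A powr (th - 1) * B powr (th - 1) * C * D powr (1 - 2 * th)) / ((1 - x) powr (real m * th) * E powr th))"
    unfolding kernel_powers[OF pos q] VZ qpow ..
  also have "\<dots> = x powr (real m * th) / ((1 - x) powr (real m * th) * (\<Prod>i=1..m. (1 - xs i) powr th)) *
    (G_fun th m xs x w * F_fun m xs x w powr (th * (real N - real m) - 1) * (\<Prod>i=1..m. (1 - w i) powr (th - 1)) * (\<Prod>i=1..m. 1 / w i))"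
    unfolding G F Upow Epow by (simp only: times_divide_eq_left times_divide_eq_right ac_simps)
  finally show ?thesis unfolding X_def ..
qed

text \<open>A point of \<open>U_dom\<close> outside the open domain has some w i = 1 or w (m + 1) =
  1, since w i = 0 is excluded by the positive lower bound on the product. Some base of a power is
  then 0, and by the convention \<open>0 powr a = 0\<close> the integrand vanishes for every
  exponent, so the two domains need no comparison of measures.\<close>

lemma product_kernel_boundary:
  assumes n: "nodes m 1 x (x_ext m xs)" and w: "w \<in> U_dom m x" "w \<notin> open_domain m 1 x"
  shows "F_fun m xs x w powr a * (\<Prod>i=1..m. (1 - w i) powr b) = 0"
proof -
  note nd = nodesD[OF n]
  have P: "x \<le> (\<Prod>i=1..m. w i)" using w(1) by (simp add: U_dom_def)
  have w01: "0 \<le> w i" "w i \<le> 1" if "i \<in> {1..m}" for i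
    using w(1) that by (auto simp: U_dom_def PiE_iff)
  have ne: "w i \<noteq> 0" if "i \<in> {1..m}" for i
  proof
    assume "w i = 0"
    then have "(\<Prod>i=1..m. w i) = 0" using that by (intro prod_zero bexI[of _ i]) auto
    then show False using P nd(1) by linarith
  qed
  show ?thesis
  proof (cases "\<exists>i\<in>{1..m}. w i = 1")
    case True
    then obtain i where "i \<in> {1..m}" "w i = 1" by blast
    then have "(\<Prod>i=1..m. (1 - w i) powr b) = 0" by (intro prod_zero bexI[of _ i]) auto
    then show ?thesis by simp
  next
    case False
    have "0 < w i \<and> w i < 1" if "i \<in> {1..m}" for i using w01[OF that] ne[OF that] False that by (auto simp: less_le)
    then have "\<not> x < (\<Prod>i=1..m. w i)" using w(2) by (auto simp: open_domain_def)
    then have "(\<Prod>i=1..m. w i) = x" using w(1) by (auto simp: U_dom_def)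
    then have "w_ext m x w (Suc m) = 1" using nd(1) by (simp add: w_ext_def)
    then have "(\<Prod>i\<in>{1..Suc m}. 1 - x_ext m xs i * w_ext m x w i) = 0"
      by (intro prod_zero bexI[of _ "Suc m"]) (auto simp: x_ext_def)
    then have "F_fun m xs x w = 0" by (simp add: F_fun_def del: prod.cl_ivl_Suc)
    then show ?thesis by simp
  qed
qed

theorem theorem3p1:
  fixes \<theta> x :: real and m N :: nat and \<nu> :: "nat \<Rightarrow> int" and xs :: "nat \<Rightarrow> real"
  assumes "\<theta> > 0"
    and "1 \<le> m" and "m + 1 \<le> N"
    and "\<nu> \<in> signatures N"
    and "0 < xs 1" and "strict_mono_on {1..m} xs" and "xs m < x" and "x < 1"
    and "\<forall>i\<in>{1..<m}. xs i / xs (Suc i) < x"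
  shows "jack_char \<theta> N \<nu> m xs * jack_char \<theta> N \<nu> 1 (\<lambda>_. x) =
    Gamma (real N * \<theta>) * x powr (real m * \<theta>) /
      (Gamma ((real N - real m) * \<theta>) * Gamma \<theta> ^ m * (1 - x) powr (real m * \<theta>)
        * (\<Prod>i = 1..m. (1 - xs i) powr \<theta>)) *
    (LINT w:U_dom m x | (\<Pi>\<^sub>M i\<in>{1..m}. lborel).
      G_fun \<theta> m xs x w * F_fun m xs x w powr (\<theta> * (real N - real m) - 1)
      * (\<Prod>i = 1..m. (1 - w i) powr (\<theta> - 1))
      * jack_char \<theta> N \<nu> (Suc m) (\<lambda>i. x_ext m xs i * w_ext m x w i)
      * (\<Prod>i = 1..m. 1 / w i))"
proof -
  define X where "X = x_ext m xs"
  \<comment> \<open>The shift used by \<open>jack\<close>. The product of the arguments is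
    \<open>P\<close> and \<open>x\<close> for the two characters on the left and
    \<open>P * x\<close> everywhere on the open domain, so the powers with exponent - K agree on
    both sides.\<close>
  define K where "K = max 0 (- \<nu> N)"
  define \<kappa> where "\<kappa> i = \<nu> i + K" for i
  define J where "J = jack_nonneg \<theta> N \<kappa>"
  define P where "P = (\<Prod>i=1..m. xs i)"
  have mN: "m < N" using assms(3) by simp
  have xs0: "0 < xs i" if "i \<in> {1..m}" for i
    using strict_mono_onD[OF assms(6), of 1 i] assms(2,5) that by (cases "i = 1") auto
  have nodes: "nodes m 1 x X"
  proof -
    have "xs i < x * xs (Suc i)" if "i \<in> {1..<m}" for i
      using assms(9) that xs0[of "Suc i"] by (auto simp: divide_less_eq)
    moreover have "0 < x" using xs0[of m] assms(2,7) by auto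
    ultimately show ?thesis using assms(7,8) xs0 by (auto simp: nodes_def X_def x_ext_def less_Suc_eq_le)
  qed
  note nd = nodesD[OF nodes]
  have part: "is_partition N \<kappa>"
    unfolding is_partition_def
  proof (intro conjI ballI)
    show "antimono_on {1..N} \<kappa>" using assms(4) by (auto simp: signatures_def monotone_on_def \<kappa>_def)
    fix i assume i: "i \<in> {1..N}"
    then have "\<nu> N \<le> \<nu> i" using assms(4) by (auto simp: signatures_def monotone_on_def)
    then show "0 \<le> \<kappa> i" by (simp add: \<kappa>_def K_def)
  qed
  have Jpos: "0 < J y" if "\<And>i. 1 \<le> i \<Longrightarrow> 0 < y i" for y
    unfolding J_def by (rule jack_nonneg_pos[OF assms(1) partitionD(1)[OF part]]) (use that in auto)
  have J1: "0 < J (\<lambda>_. 1)" by (rule Jpos) simp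
  have jack: "jack \<theta> N \<nu> y = (\<Prod>i=1..N. y i) powi (- K) * J y" for y
    by (simp only: jack_def Let_def K_def J_def \<kappa>_def[abs_def])
  have char: "jack_char \<theta> N \<nu> k y = (\<Prod>i=1..N. one_ext k y i) powi (- K) * J (one_ext k y) / J (\<lambda>_. 1)" for k y
    unfolding jack_char_def jack one_ext_def[abs_def] by simp
  have prod_one_ext: "(\<Prod>i=1..N. one_ext k y i) = (\<Prod>i=1..k. y i)" if "k \<le> N" for k y
  proof -
    have "(\<Prod>i=1..N. one_ext k y i) = (\<Prod>i=1..k. one_ext k y i)"
      by (rule prod.mono_neutral_right) (use that in \<open>auto simp: one_ext_def\<close>)
    also have "\<dots> = (\<Prod>i=1..k. y i)" by (rule prod.cong) (auto simp: one_ext_def)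
    finally show ?thesis .
  qed
  have oX: "one_ext m X = one_ext m xs" by (auto simp: one_ext_def X_def x_ext_def)
  have charm: "jack_char \<theta> N \<nu> m xs = P powi (- K) * J (one_ext m X) / J (\<lambda>_. 1)"
    unfolding char oX P_def prod_one_ext[OF less_imp_le[OF mN]] ..
  have charx: "jack_char \<theta> N \<nu> 1 (\<lambda>_. x) = x powi (- K) * J (one_ext 1 (\<lambda>_. x)) / J (\<lambda>_. 1)"
    unfolding char using mN prod_one_ext[of 1 "\<lambda>_. x"] by simp
  have chary: "jack_char \<theta> N \<nu> (Suc m) (\<lambda>i. x_ext m xs i * w_ext m x w i) = (P * x) powi (- K) * J (shifted_point m x X w) / J (\<lambda>_. 1)"
    if w: "w \<in> open_domain m 1 x" for w
  proof -
    have W: "w_ext m x w = wfull m 1 x w" by (auto simp: wfull_def w_ext_def)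
    have e: "one_ext (Suc m) (\<lambda>i. x_ext m xs i * w_ext m x w i) = shifted_point m x X w"
      by (auto simp: one_ext_def shifted_point_def X_def W)
    have "(\<Prod>i\<in>{1..Suc m}. x_ext m xs i * w_ext m x w i) = P * x"
    proof -
      have "(\<Prod>i\<in>{1..Suc m}. x_ext m xs i) = (\<Prod>i\<in>{1..m}. x_ext m xs i)" by (simp add: x_ext_def)
      also have "\<dots> = P" unfolding P_def by (rule prod.cong) (auto simp: x_ext_def)
      finally show ?thesis unfolding prod.distrib W using domain_facts(2)[OF nodes _ w] by simp
    qed
    then have "(\<Prod>i=1..N. shifted_point m x X w i) = P * x"
      using prod_one_ext[of "Suc m" "\<lambda>i. x_ext m xs i * w_ext m x w i"] mN unfolding e by simp
    then show ?thesis unfolding char e by simp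
  qed
  \<comment> \<open>The integrand without its constants, cut off to the open domain. Being
    nonnegative, it lets the Lebesgue integral of the statement be computed from the integral in
    \<open>ennreal\<close>.\<close>
  define h where "h w = J (shifted_point m x X w) * jack_kernel \<theta> N m x X w * indicator (open_domain m 1 x) w" for w
  define g where "g = Gamma (real N * \<theta>) / (Gamma \<theta> ^ m * Gamma (real (N - m) * \<theta>))"
  define R where "R = x powr (real m * \<theta>) / ((1 - x) powr (real m * \<theta>) * (\<Prod>i=1..m. (1 - xs i) powr \<theta>))"
  define Q where "Q = (P * x) powi (- K) / J (\<lambda>_. 1)"
  have g: "0 < g" using assms(1) mN by (auto simp: g_def intro!: divide_pos_pos mult_pos_pos Gamma_real_pos)
  have R: "0 < R"
  proof -
    have "0 < (\<Prod>i=1..m. (1 - xs i) powr \<theta>)"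
    proof (intro prod_pos ballI)
      fix i assume i: "i \<in> {1..m}"
      then have "xs i < 1" using nd(7)[of i] by (auto simp: X_def x_ext_def)
      then show "0 < (1 - xs i) powr \<theta>" by simp
    qed
    then show ?thesis using nd(1,2) by (simp add: R_def)
  qed
  have h0: "0 \<le> h w" for w
  proof (cases "w \<in> open_domain m 1 x")
    case True
    have "0 < J (shifted_point m x X w)" by (rule Jpos) (rule shifted_point_bounds(1)[OF nodes True])
    moreover have "0 \<le> jack_kernel \<theta> N m x X w"
      unfolding jack_kernel_def using coord_jacobian_nonneg[OF nodes True] by (intro mult_nonneg_nonneg prod_nonneg) auto
    ultimately show ?thesis by (simp add: h_def)
  qed (simp add: h_def)
  have hm: "h \<in> borel_measurable (lborel_prod {1..m})"
  proof -
    have "(\<lambda>w. J (shifted_point m x X w) * jack_kernel \<theta> N m x X w * enn2real (indicator (open_domain m 1 x) w)) \<in> borel_measurable (lborel_prod {1..m})"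
      using jack_shifted_measurable[of \<theta> N \<kappa> m x X] jack_kernel_measurable[of \<theta> N m x X] open_domain_measurable[of m 1 x]
      unfolding J_def by (intro borel_measurable_times borel_measurable_enn2real)
    moreover have "enn2real (indicator A w) = indicator A w" for A and w :: "nat \<Rightarrow> real" by (simp add: indicator_def)
    ultimately show ?thesis unfolding h_def[abs_def] by simp
  qed
  have transform: "ennreal g * (\<integral>\<^sup>+w. ennreal (h w) \<partial>lborel_prod {1..m}) = ennreal (J (one_ext 1 (\<lambda>_. x)) / J (\<lambda>_. 1) * J (one_ext m X))"
  proof -
    have "(\<integral>\<^sup>+w. ennreal (h w) \<partial>lborel_prod {1..m}) =
      (\<integral>\<^sup>+w. ennreal (J (shifted_point m x X w)) * ennreal (jack_kernel \<theta> N m x X w) * indicator (open_domain m 1 x) w \<partial>lborel_prod {1..m})"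
    proof (rule nn_integral_cong)
      fix w
      show "ennreal (h w) = ennreal (J (shifted_point m x X w)) * ennreal (jack_kernel \<theta> N m x X w) * indicator (open_domain m 1 x) w"
      proof (cases "w \<in> open_domain m 1 x")
        case True
        have "0 < J (shifted_point m x X w)" by (rule Jpos) (rule shifted_point_bounds(1)[OF nodes True])
        then show ?thesis using True by (simp add: h_def ennreal_mult')
      qed (simp add: h_def)
    qed
    then show ?thesis using jack_transform_eigen[OF assms(1) mN nodes part] by (simp only: jack_transform_def g_def J_def)
  qed
  define V where "V = J (one_ext 1 (\<lambda>_. x)) / J (\<lambda>_. 1) * J (one_ext m X)"
  have V: "0 \<le> V"
  proof -
    have "0 < J (one_ext 1 (\<lambda>_. x))" by (rule Jpos) (use nd(1) in \<open>auto simp: one_ext_def\<close>)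
    moreover have "0 < J (one_ext m X)" by (rule Jpos) (use nd(4) in \<open>auto simp: one_ext_def\<close>)
    ultimately show ?thesis using J1 by (simp add: V_def)
  qed
  have LINT: "(LINT w|lborel_prod {1..m}. h w) = V / g"
  proof -
    have "(\<integral>\<^sup>+w. ennreal (h w) \<partial>lborel_prod {1..m}) = ennreal (1 / g) * (ennreal g * (\<integral>\<^sup>+w. ennreal (h w) \<partial>lborel_prod {1..m}))"
      using g by (simp add: mult.assoc[symmetric] ennreal_mult'[symmetric])
    also have "\<dots> = ennreal (V / g)" unfolding transform V_def[symmetric] using g V by (simp add: ennreal_mult'[symmetric])
    finally have "(\<integral>\<^sup>+w. ennreal (h w) \<partial>lborel_prod {1..m}) = ennreal (V / g)" .
    then show ?thesis using h0 hm g V by (subst integral_eq_nn_integral) auto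
  qed
  \<comment> \<open>\<open>R\<close> collects the constants of the formula other than Gamma values,
    and \<open>Q\<close> the constants of the character under the integral.\<close>
  have integrand: "indicator (U_dom m x) w *\<^sub>R (G_fun \<theta> m xs x w * F_fun m xs x w powr (\<theta> * (real N - real m) - 1)
      * (\<Prod>i = 1..m. (1 - w i) powr (\<theta> - 1)) * jack_char \<theta> N \<nu> (Suc m) (\<lambda>i. x_ext m xs i * w_ext m x w i)
      * (\<Prod>i = 1..m. 1 / w i)) = Q / R * h w" if "w \<in> space (lborel_prod {1..m})" for w
  proof (cases "w \<in> open_domain m 1 x")
    case True
    then have wU: "w \<in> U_dom m x" using that by (auto simp: U_dom_def open_domain_def space_PiM PiE_iff less_imp_le)
    have "R * (G_fun \<theta> m xs x w * F_fun m xs x w powr (\<theta> * (real N - real m) - 1) * (\<Prod>i=1..m. (1 - w i) powr (\<theta> - 1)) * (\<Prod>i=1..m. 1 / w i)) = jack_kernel \<theta> N m x X w"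
      using product_kernel[OF nodes[unfolded X_def] assms(2) mN True, of \<theta>] by (simp only: R_def X_def)
    moreover have "a * b * u * (q * c / d) * v = q / d / R * (c * (R * (a * b * u * v)) * 1)" for a b c d u v q :: real
      using R by simp
    ultimately show ?thesis unfolding chary[OF True] Q_def h_def using True wU by (simp only: indicator_simps scaleR_one)
  next
    case False
    show ?thesis
    proof (cases "w \<in> U_dom m x")
      case True
      have "F_fun m xs x w powr (\<theta> * (real N - real m) - 1) * (\<Prod>i = 1..m. (1 - w i) powr (\<theta> - 1)) = 0"
        by (rule product_kernel_boundary[OF nodes[unfolded X_def] True False])
      then show ?thesis using False by (auto simp: h_def)
    qed (use False in \<open>simp add: h_def\<close>)
  qed
  have "(LINT w:U_dom m x | (\<Pi>\<^sub>M i\<in>{1..m}. lborel).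
      G_fun \<theta> m xs x w * F_fun m xs x w powr (\<theta> * (real N - real m) - 1)
      * (\<Prod>i = 1..m. (1 - w i) powr (\<theta> - 1))
      * jack_char \<theta> N \<nu> (Suc m) (\<lambda>i. x_ext m xs i * w_ext m x w i)
      * (\<Prod>i = 1..m. 1 / w i)) = (LINT w|lborel_prod {1..m}. Q / R * h w)"
    unfolding set_lebesgue_integral_def by (rule Bochner_Integration.integral_cong[OF refl integrand])
  also have "\<dots> = Q / R * (V / g)" by (simp only: integral_mult_right_zero LINT)
  finally have rhs: "(LINT w:U_dom m x | (\<Pi>\<^sub>M i\<in>{1..m}. lborel).
      G_fun \<theta> m xs x w * F_fun m xs x w powr (\<theta> * (real N - real m) - 1)
      * (\<Prod>i = 1..m. (1 - w i) powr (\<theta> - 1))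
      * jack_char \<theta> N \<nu> (Suc m) (\<lambda>i. x_ext m xs i * w_ext m x w i)
      * (\<Prod>i = 1..m. 1 / w i)) = Q / R * (V / g)" .
  have const: "Gamma (real N * \<theta>) * x powr (real m * \<theta>) /
      (Gamma ((real N - real m) * \<theta>) * Gamma \<theta> ^ m * (1 - x) powr (real m * \<theta>)
        * (\<Prod>i = 1..m. (1 - xs i) powr \<theta>)) = g * R"
    using mN by (simp add: g_def R_def of_nat_diff mult_ac)
  have "g * R * (Q / R * (V / g)) = Q * V" using g R by simp
  moreover have "jack_char \<theta> N \<nu> m xs * jack_char \<theta> N \<nu> 1 (\<lambda>_. x) = Q * V"
    unfolding charm charx Q_def V_def by (simp add: power_int_mult_distrib)
  ultimately show ?thesis unfolding rhs const by simp
qed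

end
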